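(* Let $D_0>0$, let $(T,g_T)$ be a fixed flat $3$-torus and let $M_i\in\mathcal M^{D_0}$, $i\in\mathbb N$, be graph tori such that $M_i$ arises from $(T,f_i)$ with $f_i\in\mathcal G$, $f_i:T\to\mathbb R$. Assume that the scalar curvatures satisfy $R(M_i)\to 0$ uniformly, i.e. $\sup_{M_i}|R(M_i)|\to 0$ as $i\to\infty$. Then there is a subsequence of $\{M_i\}$, denoted in the same way, which converges in the flat sense in $T\times\mathbb R$ to $T\times\{0\}$, i.e. $d_F^{T\times\mathbb R}([M_i],[T\times\{0\}])\to 0$, where $M_i$ is regarded as the submanifold $\mathrm{graph}(f_i)\subset T\times\mathbb R$, and moreover $\mathrm{vol}(M_i)\to\mathrm{vol}(T)$.
   Context: Flat tori. A flat $3$-torus is $(T,g_T)=(\mathbb R^3,g_{eucl})/\Gamma$, where $\Gamma\cong\mathbb Z^3$ is a subgroup of $(\mathbb R^3,+)$ (a lattice) acting by translations; $p:\mathbb R^3\to T$ is the quotient (Riemannian covering) map. For a set of generators $a^1,a^2,a^3$ of $\Gamma$ (positively oriented), $D=\{\sum_{i=1}^3\lambda_ia^i:\lambda_i\in[0,1]\}$ is the (closed) fundamental domain. A flat torus $T$ is considered together with such $p$ and $D$. Graph tori. For $f\in C^4(T)$, the graph torus $(M,g_M)$ arising from $(T,f)$ is $M=T$ with $g_M=g_T+df\otimes df$; via $x\mapsto(x,f(x))$ it is isometric to $\mathrm{graph}(f)\subset T\times\mathbb R$ with the metric induced from $g_T+dt\otimes dt$, and $M$ is identified with this submanifold. $R(M)$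 is the scalar curvature of $g_M$; $\mathrm{vol}(M)$ and $\mathrm{diam}(M)$ are taken with respect to $g_M$. Outer minimizing. For $E\subset\mathbb R^3$, $P(E)=\sup\{\int_E\mathrm{div}\,\varphi\,d\mathcal L^3:\varphi\in C_c^1(\mathbb R^3,\mathbb R^3),\ \|\varphi\|_\infty\le1\}$ is the perimeter; if $P(E)<\infty$ it equals $\mathcal H^2(\partial^*E)$, $\partial^*E$ the reduced boundary. For a bounded set $E$ of finite perimeter, $\partial^*E$ is outer minimizing if $\mathcal H^2(\partial^*E)\le P(F)$ for every bounded $F\subset\mathbb R^3$ containing $E$. Class $\mathcal G$. It is the set of functions $f\in C^4(T)$, $T$ a flat $3$-torus, such that: (i) $\max_Tf=0$ and $f\circ p\equiv0$ on $\partial D$; (ii) for almost every $h\in f(T)$ the level set $\Sigma_h=f^{-1}(h)$ is strictly mean convex with respect to $-Df/|Df|$, i.e. $\mathbf H_{\Sigma_h}\cdot(-Df/|Df|)>0$, where $\mathbf H_{\Sigma_h}$ is the mean curvature vector of $\Sigma_h$ in $(T,g_T)$ (convention: round spheres have positive mean curvature with respect to the inner normal); (iii) for almost every $h\in f(T)$ the level set $\tilde\Sigma_h=(f\circ p|_D)^{-1}(h)$, viewed as the boundary of $\tilde\Omega_h=\{x\in D:f(p(x))<h\}$, is outer minimizing in $\mathbb R^3$. $\mathcal M$ is the class of graph tori arising from functions in $\mathcal G$, and $\mathcal M^{D_0}=\{M\in\mathcal M:\mathrm{diam}(M)\le D_0\}$. Flat distance. For an open set $O\subset T\times\mathbb R$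 and integral $3$-currents $S_1,S_2$, $d_F^O(S_1,S_2)=\inf\{\mathbf M(A)+\mathbf M(B): S_1-S_2=A+\partial B\text{ in }O\}$, the infimum over integral $3$-currents $A$ and integral $4$-currents $B$ in $O$, with $\mathbf M$ the mass. $[S]$ denotes the integration current of an oriented submanifold $S$. $T\times\{0\}$ has the orientation induced from $T\times\mathbb R$ (upward), and $\mathrm{graph}(f_i)$ is oriented correspondingly as a graph over $T$. *)

theory Defs
  imports "HOL-Analysis.Analysis"
begin

abbreviation dir_deriv ::
  "('a::real_normed_vector \<Rightarrow> 'b::real_normed_vector) \<Rightarrow> 'a \<Rightarrow> 'a \<Rightarrow> 'b" where
  "dir_deriv f v x \<equiv> frechet_derivative f (at x) v"

text \<open>On a finite-dimensional space a function is \<open>C\<^sup>1\<close> iff it is differentiable and all its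
  directional derivatives are continuous; this is iterated below.\<close>

primrec Ck :: "nat \<Rightarrow> ('a::real_normed_vector \<Rightarrow> 'b::real_normed_vector) \<Rightarrow> bool" where
  "Ck 0 f = continuous_on UNIV f"
| "Ck (Suc k) f = ((\<forall>x. f differentiable (at x)) \<and> (\<forall>v. Ck k (\<lambda>x. dir_deriv f v x)))"

definition partial :: "3 \<Rightarrow> (real^3 \<Rightarrow> real) \<Rightarrow> real^3 \<Rightarrow> real" where
  "partial i u x = dir_deriv u (axis i 1) x"

definition grad :: "(real^3 \<Rightarrow> real) \<Rightarrow> real^3 \<Rightarrow> real^3" where
  "grad u x = (\<chi> i. partial i u x)"

definition divergence :: "(real^3 \<Rightarrow> real^3) \<Rightarrow> real^3 \<Rightarrow> real" where
  "divergence X x = (\<Sum>i\<in>UNIV. dir_deriv X (axis i 1) x $ i)"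

text \<open>A flat torus, together with \<open>p\<close> and \<open>D\<close>, is given by a positively oriented system of
  generators of the lattice: the generators are the rows of \<open>a\<close>. The points of the torus are the
  cosets of the lattice.\<close>

definition flat_torus :: "real^3^3 \<Rightarrow> bool" where
  "flat_torus a \<longleftrightarrow> det a > 0"

definition lattice :: "real^3^3 \<Rightarrow> (real^3) set" where
  "lattice a = {(\<Sum>i\<in>UNIV. of_int (n i) *\<^sub>R (a $ i)) | n :: 3 \<Rightarrow> int. True}"

definition proj :: "real^3^3 \<Rightarrow> real^3 \<Rightarrow> (real^3) set" where
  "proj a x = {x + v | v. v \<in> lattice a}"

definition torus :: "real^3^3 \<Rightarrow> (real^3) set set" where
  "torus a = range (proj a)"

definition fund_domain :: "real^3^3 \<Rightarrow> (real^3) set" where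
  "fund_domain a =
     {(\<Sum>i\<in>UNIV. l i *\<^sub>R (a $ i)) | l :: 3 \<Rightarrow> real. \<forall>i. 0 \<le> l i \<and> l i \<le> 1}"

text \<open>Since \<open>p\<close> is a covering, a metric on the torus is described by its (periodic) lift to
  \<open>\<real>\<^sup>3\<close>, given as a matrix field in the standard coordinates.\<close>

definition flat_metric :: "real^3 \<Rightarrow> real^3^3" where
  "flat_metric x = mat 1"

definition graph_metric ::
  "real^3^3 \<Rightarrow> ((real^3) set \<Rightarrow> real) \<Rightarrow> real^3 \<Rightarrow> real^3^3" where
  "graph_metric a f x =
     (\<chi> i j. flat_metric x $ i $ j + partial i (f \<circ> proj a) x * partial j (f \<circ> proj a) x)"

definition christoffel :: "(real^3 \<Rightarrow> real^3^3) \<Rightarrow> 3 \<Rightarrow> 3 \<Rightarrow> 3 \<Rightarrow> real^3 \<Rightarrow> real" where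
  "christoffel g k i j x = (\<Sum>l\<in>UNIV. matrix_inv (g x) $ k $ l *
     (partial i (\<lambda>y. g y $ j $ l) x + partial j (\<lambda>y. g y $ i $ l) x
       - partial l (\<lambda>y. g y $ i $ j) x)) / 2"

definition ricci :: "(real^3 \<Rightarrow> real^3^3) \<Rightarrow> 3 \<Rightarrow> 3 \<Rightarrow> real^3 \<Rightarrow> real" where
  "ricci g j k x = (\<Sum>i\<in>UNIV.
     partial i (christoffel g i j k) x - partial j (christoffel g i i k) x
     + (\<Sum>m\<in>UNIV. christoffel g i i m x * christoffel g m j k x
                 - christoffel g i j m x * christoffel g m i k x))"

definition scalar_curvature :: "(real^3 \<Rightarrow> real^3^3) \<Rightarrow> real^3 \<Rightarrow> real" where
  "scalar_curvature g x =
     (\<Sum>j\<in>UNIV. \<Sum>k\<in>UNIV. matrix_inv (g x) $ j $ k * ricci g j k x)"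

text \<open>The boundary of the fundamental domain is a null set, so integrating over the closed domain
  is integrating over the torus.\<close>

definition riem_vol :: "real^3^3 \<Rightarrow> (real^3 \<Rightarrow> real^3^3) \<Rightarrow> real" where
  "riem_vol a g = (LINT x:fund_domain a|lebesgue. sqrt (det (g x)))"

definition riem_length :: "(real^3 \<Rightarrow> real^3^3) \<Rightarrow> (real \<Rightarrow> real^3) \<Rightarrow> real" where
  "riem_length g c = integral {0..1} (\<lambda>t. sqrt
     (vector_derivative c (at t) \<bullet> (g (c t) *v vector_derivative c (at t))))"

text \<open>Curves in the torus are the projections of curves in \<open>\<real>\<^sup>3\<close>.\<close>

definition riem_dist ::
  "real^3^3 \<Rightarrow> (real^3 \<Rightarrow> real^3^3) \<Rightarrow> (real^3) set \<Rightarrow> (real^3) set \<Rightarrow> real" where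
  "riem_dist a g q q' = Inf {riem_length g c | c.
     c piecewise_C1_differentiable_on {0..1} \<and> proj a (c 0) = q \<and> proj a (c 1) = q'}"

definition riem_diam :: "real^3^3 \<Rightarrow> (real^3 \<Rightarrow> real^3^3) \<Rightarrow> real" where
  "riem_diam a g = (SUP (q, q') \<in> torus a \<times> torus a. riem_dist a g q q')"

definition tangent_vectors :: "(real^3) set \<Rightarrow> real^3 \<Rightarrow> (real^3) set" where
  "tangent_vectors S x = {v. \<exists>c. c 0 = x \<and> (\<forall>\<^sub>F t in nhds 0. c t \<in> S)
     \<and> (c has_vector_derivative v) (at (0::real))}"

text \<open>The mean curvature vector is \<open>H = -(div\<^sub>S N) N\<close>, where \<open>N\<close> is a local differentiable unit
  normal field, extended to a neighbourhood of \<open>x\<close>, and the tangential divergence is the trace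
  of \<open>DN\<close> over an orthonormal basis \<open>e\<^sub>1, e\<^sub>2\<close> of the tangent plane. It depends neither on
  the extension nor on the sign of \<open>N\<close>, and points inwards for round spheres.\<close>

definition has_mean_curvature_vector :: "(real^3) set \<Rightarrow> real^3 \<Rightarrow> real^3 \<Rightarrow> bool" where
  "has_mean_curvature_vector S x H \<longleftrightarrow> x \<in> S \<and> (\<exists>U N e1 e2.
     open U \<and> x \<in> U \<and> N differentiable_on U
     \<and> (\<forall>y\<in>S \<inter> U. norm (N y) = 1 \<and> (\<forall>v\<in>tangent_vectors S y. N y \<bullet> v = 0))
     \<and> e1 \<in> tangent_vectors S x \<and> e2 \<in> tangent_vectors S x
     \<and> norm e1 = 1 \<and> norm e2 = 1 \<and> e1 \<bullet> e2 = 0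
     \<and> H = - (dir_deriv N e1 x \<bullet> e1 + dir_deriv N e2 x \<bullet> e2) *\<^sub>R N x)"

definition hausdorff_pre :: "nat \<Rightarrow> real \<Rightarrow> 'a::euclidean_space set \<Rightarrow> ennreal" where
  "hausdorff_pre k \<delta> A =
     (INF C \<in> {C :: nat \<Rightarrow> 'a set. A \<subseteq> (\<Union>j. C j) \<and> (\<forall>j. bounded (C j) \<and> diameter (C j) \<le> \<delta>)}.
        \<Sum>j. if C j = {} then 0
             else ennreal (unit_ball_vol (real k) * (diameter (C j) / 2) ^ k))"

definition hausdorff_outer :: "nat \<Rightarrow> 'a::euclidean_space set \<Rightarrow> ennreal" where
  "hausdorff_outer k A = (SUP \<delta>\<in>{0<..}. hausdorff_pre k \<delta> A)"

text \<open>By Caratheodory's criterion the outer measure is countably additive on Borel sets, so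
  \<open>hausdorff_measure\<close> has the values of \<open>hausdorff_outer\<close> on Borel sets.\<close>

definition hausdorff_measure :: "nat \<Rightarrow> 'a::euclidean_space measure" where
  "hausdorff_measure k = measure_of UNIV (sets borel) (hausdorff_outer k)"

definition C1c_fields :: "(real^3 \<Rightarrow> real^3) set" where
  "C1c_fields = {\<phi>. Ck 1 \<phi> \<and> (\<exists>K. compact K \<and> (\<forall>x. x \<notin> K \<longrightarrow> \<phi> x = 0))}"

text \<open>Only meaningful for Lebesgue measurable sets.\<close>

definition perimeter :: "(real^3) set \<Rightarrow> ennreal" where
  "perimeter E = (SUP \<phi> \<in> {\<phi> \<in> C1c_fields. \<forall>x. norm (\<phi> x) \<le> 1}.
     ennreal (LINT x:E|lebesgue. divergence \<phi> x))"

text \<open>Up to sign, \<open>\<nu> \<mu>\<close> is the polar decomposition of the distributional gradient of the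
  indicator function of \<open>E\<close>; \<open>\<mu>\<close> is unique and \<open>\<nu>\<close> is unique up to \<open>\<mu>\<close>-null sets.\<close>

definition gauss_green_pair ::
  "(real^3) set \<Rightarrow> (real^3) measure \<Rightarrow> (real^3 \<Rightarrow> real^3) \<Rightarrow> bool" where
  "gauss_green_pair E \<mu> \<nu> \<longleftrightarrow>
     sets \<mu> = sets borel \<and> (\<forall>K. compact K \<longrightarrow> emeasure \<mu> K < \<infinity>)
     \<and> \<nu> \<in> borel_measurable borel \<and> (\<forall>x. norm (\<nu> x) = 1)
     \<and> (\<forall>\<phi>\<in>C1c_fields. (LINT x:E|lebesgue. divergence \<phi> x) = (LINT x|\<mu>. \<phi> x \<bullet> \<nu> x))"

definition reduced_boundary :: "(real^3) set \<Rightarrow> (real^3) set" where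
  "reduced_boundary E = {x. \<exists>\<mu> \<nu> n. gauss_green_pair E \<mu> \<nu>
     \<and> (\<forall>r>0. 0 < measure \<mu> (ball x r)) \<and> norm n = 1
     \<and> ((\<lambda>r. (1 / measure \<mu> (ball x r)) *\<^sub>R (LINT y:ball x r|\<mu>. \<nu> y)) \<longlongrightarrow> n) (at_right 0)}"

text \<open>\<open>E\<close> is the set whose reduced boundary is outer minimizing.\<close>

definition outer_minimizing :: "(real^3) set \<Rightarrow> bool" where
  "outer_minimizing E \<longleftrightarrow> bounded E \<and> E \<in> sets lebesgue \<and> perimeter E < \<infinity>
     \<and> (\<forall>F. bounded F \<and> F \<in> sets lebesgue \<and> E \<subseteq> F
            \<longrightarrow> hausdorff_outer 2 (reduced_boundary E) \<le> perimeter F)"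

text \<open>The mean curvature is computed in \<open>\<real>\<^sup>3\<close> through the local isometry \<open>p\<close>. At critical
  points the vector \<open>-Df/|Df|\<close> is \<open>0\<close> by the convention for division by zero, so the strict
  inequality forces the level set to be regular.\<close>

definition class_G :: "real^3^3 \<Rightarrow> ((real^3) set \<Rightarrow> real) set" where
  "class_G a = {f. let u = f \<circ> proj a in
     Ck 4 u
     \<and> (\<exists>q\<in>torus a. f q = 0) \<and> (\<forall>q\<in>torus a. f q \<le> 0)
     \<and> (\<forall>x\<in>frontier (fund_domain a). u x = 0)
     \<and> (AE h in lborel. h \<in> f ` torus a \<longrightarrow>
          (\<forall>x. u x = h \<longrightarrow> (\<exists>H. has_mean_curvature_vector {y. u y = h} x H
              \<and> H \<bullet> (- (1 / norm (grad u x)) *\<^sub>R grad u x) > 0)))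
     \<and> (AE h in lborel. h \<in> f ` torus a \<longrightarrow>
          outer_minimizing {x \<in> fund_domain a. u x < h})}"

type_synonym pt = "(real^3) set \<times> real"
type_synonym vec4 = "(real^3) \<times> real"
type_synonym form = "pt \<Rightarrow> vec4 list \<Rightarrow> real"
type_synonym current = "form \<Rightarrow> real"

definition cover :: "real^3^3 \<Rightarrow> vec4 \<Rightarrow> pt" where
  "cover a z = (proj a (fst z), snd z)"

text \<open>The tangent bundle is trivialized by the covering; a \<open>k\<close>-covector takes lists of \<open>k\<close>
  tangent vectors as arguments.\<close>

definition alternating :: "nat \<Rightarrow> (vec4 list \<Rightarrow> real) \<Rightarrow> bool" where
  "alternating k \<alpha> \<longleftrightarrow>
     (\<forall>vs i. length vs = k \<and> i < k \<longrightarrow> linear (\<lambda>v. \<alpha> (vs[i := v])))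
     \<and> (\<forall>vs i j. length vs = k \<and> i < j \<and> j < k \<and> vs ! i = vs ! j \<longrightarrow> \<alpha> vs = 0)
     \<and> (\<forall>vs. length vs \<noteq> k \<longrightarrow> \<alpha> vs = 0)"

text \<open>The set \<open>W\<close> is meant to be open in the quotient; the compact subsets of the
  quotient are the images of compact sets.\<close>

definition test_forms :: "real^3^3 \<Rightarrow> pt set \<Rightarrow> nat \<Rightarrow> form set" where
  "test_forms a W k = {\<omega>.
     (\<forall>z. alternating k (\<omega> (cover a z)))
     \<and> (\<forall>n vs. length vs = k \<longrightarrow> Ck n (\<lambda>z. \<omega> (cover a z) vs))
     \<and> (\<exists>K. compact K \<and> cover a ` K \<subseteq> W
          \<and> (\<forall>z vs. cover a z \<notin> cover a ` K \<longrightarrow> \<omega> (cover a z) vs = 0))}"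

text \<open>The derivative at a point of the product is computed at any of its preimages in the
  covering; by periodicity the choice does not matter.\<close>

definition ext_deriv :: "real^3^3 \<Rightarrow> form \<Rightarrow> form" where
  "ext_deriv a \<omega> q vs = (\<Sum>i<length vs. (-1) ^ i *
     dir_deriv (\<lambda>z. \<omega> (cover a z) (take i vs @ drop (Suc i) vs)) (vs ! i) (inv (cover a) q))"

definition boundary :: "real^3^3 \<Rightarrow> current \<Rightarrow> current" where
  "boundary a S = (\<lambda>\<omega>. S (ext_deriv a \<omega>))"

definition orthonormal_list :: "vec4 list \<Rightarrow> bool" where
  "orthonormal_list vs \<longleftrightarrow> (\<forall>i<length vs. \<forall>j<length vs.
     vs ! i \<bullet> vs ! j = (if i = j then 1 else 0))"

definition comass_le_1 :: "real^3^3 \<Rightarrow> nat \<Rightarrow> form \<Rightarrow> bool" where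
  "comass_le_1 a k \<omega> \<longleftrightarrow>
     (\<forall>z vs. length vs = k \<and> orthonormal_list vs \<longrightarrow> \<bar>\<omega> (cover a z) vs\<bar> \<le> 1)"

definition mass :: "real^3^3 \<Rightarrow> pt set \<Rightarrow> nat \<Rightarrow> current \<Rightarrow> ennreal" where
  "mass a W k S = (SUP \<omega> \<in> {\<omega> \<in> test_forms a W k. comass_le_1 a k \<omega>}. ennreal \<bar>S \<omega>\<bar>)"

text \<open>A \<open>k\<close>-dimensional subspace of the ambient space serves as \<open>\<real>\<^sup>k\<close>, \<open>k \<le> 4\<close>.\<close>

definition countably_rectifiable :: "nat \<Rightarrow> vec4 set \<Rightarrow> bool" where
  "countably_rectifiable k M \<longleftrightarrow>
     (\<exists>V N F. subspace V \<and> dim V = k \<and> hausdorff_outer k N = 0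
        \<and> (\<forall>j::nat. \<exists>L. L-lipschitz_on V (F j :: vec4 \<Rightarrow> vec4))
        \<and> M \<subseteq> N \<union> (\<Union>j. F j ` V))"

definition has_approx_tangent :: "nat \<Rightarrow> vec4 set \<Rightarrow> vec4 \<Rightarrow> vec4 set \<Rightarrow> bool" where
  "has_approx_tangent k M x V \<longleftrightarrow> subspace V \<and> dim V = k
     \<and> (\<forall>\<phi> :: vec4 \<Rightarrow> real.
          continuous_on UNIV \<phi> \<and> (\<exists>K. compact K \<and> (\<forall>y. y \<notin> K \<longrightarrow> \<phi> y = 0)) \<longrightarrow>
          ((\<lambda>r. (LINT y:M|hausdorff_measure k. \<phi> ((1 / r) *\<^sub>R (y - x))) / r ^ k)
             \<longlongrightarrow> (LINT y:V|hausdorff_measure k. \<phi> y)) (at_right 0))"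

text \<open>Integer multiplicity rectifiable \<open>k\<close>-currents in \<open>W\<close> of finite mass: integration of forms
  over a countably rectifiable set with positive integer multiplicity \<open>\<theta>\<close>, oriented by
  \<open>\<tau>\<^sub>0 \<and> \<dots> \<and> \<tau>\<^sub>k\<^sub>-\<^sub>1\<close> for an orthonormal basis of the approximate tangent space. The
  rectifiable subset of \<open>W\<close> is represented by a set \<open>M\<close> in the covering space that is
  mapped injectively (for instance one that lies over a half-open fundamental domain).\<close>

definition rectifiable_current :: "real^3^3 \<Rightarrow> pt set \<Rightarrow> nat \<Rightarrow> current \<Rightarrow> bool" where
  "rectifiable_current a W k S \<longleftrightarrow>
     (\<exists>(M :: vec4 set) (\<theta> :: vec4 \<Rightarrow> nat) (\<tau> :: nat \<Rightarrow> vec4 \<Rightarrow> vec4).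
        M \<in> sets borel \<and> cover a ` M \<subseteq> W \<and> inj_on (cover a) M
        \<and> countably_rectifiable k M
        \<and> (\<forall>z\<in>M. 1 \<le> \<theta> z) \<and> set_integrable (hausdorff_measure k) M (\<lambda>z. real (\<theta> z))
        \<and> (\<forall>i<k. \<tau> i \<in> borel_measurable borel)
        \<and> (AE z in hausdorff_measure k. z \<in> M \<longrightarrow>
             (\<exists>V. has_approx_tangent k M z V \<and> (\<forall>i<k. \<tau> i z \<in> V)
                \<and> orthonormal_list (map (\<lambda>i. \<tau> i z) [0..<k])))
        \<and> (\<forall>\<omega>\<in>test_forms a W k. S \<omega> = (LINT z:M|hausdorff_measure k.
             real (\<theta> z) * \<omega> (cover a z) (map (\<lambda>i. \<tau> i z) [0..<k]))))"

text \<open>Used for \<open>k \<ge> 1\<close> only.\<close>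

definition integral_current :: "real^3^3 \<Rightarrow> pt set \<Rightarrow> nat \<Rightarrow> current \<Rightarrow> bool" where
  "integral_current a W k S \<longleftrightarrow>
     rectifiable_current a W k S \<and> mass a W k S < \<infinity> \<and> mass a W (k - 1) (boundary a S) < \<infinity>"

definition flat_distance :: "real^3^3 \<Rightarrow> pt set \<Rightarrow> current \<Rightarrow> current \<Rightarrow> ennreal" where
  "flat_distance a W S1 S2 =
     (INF (A, B) \<in> {(A, B). integral_current a W 3 A \<and> integral_current a W 4 B
         \<and> (\<forall>\<omega>\<in>test_forms a W 3. S1 \<omega> - S2 \<omega> = A \<omega> + boundary a B \<omega>)}.
        mass a W 3 A + mass a W 4 B)"

text \<open>Integration over \<open>graph(f)\<close>, in the parametrization \<open>x \<mapsto> (x, f(x))\<close> by the torus with its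
  standard orientation.\<close>

definition graph_current :: "real^3^3 \<Rightarrow> ((real^3) set \<Rightarrow> real) \<Rightarrow> current" where
  "graph_current a f = (\<lambda>\<omega>. LINT x:fund_domain a|lebesgue.
     \<omega> (proj a x, f (proj a x))
       (map (\<lambda>i. (axis i 1, partial i (f \<circ> proj a) x)) [1, 2, 3]))"

end

theory Submission
  imports Defs
begin

text \<open>Let \<open>u \<le> 0\<close> be the lift of \<open>f\<close> to the fundamental domain \<open>D\<close>, \<open>s = |Du|\<close>, \<open>N = Du/s\<close>, and let \<open>H\<close> be
  the mean curvature of the level sets of \<open>u\<close>. The scalar curvature of the graph is the divergence
  of the field \<open>X = (\<Delta>u Du - D\<^sup>2u Du) / (1 + s\<^sup>2)\<close>, and \<open>X \<bullet> Du = H s\<^sup>3 / (1 + s\<^sup>2)\<close>. Integrating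
  against \<open>-u\<close> shows that \<open>\<integral> H s\<^sup>3 / (1 + s\<^sup>2)\<close> is at most \<open>sup |R|\<close> times \<open>\<integral> |u|\<close>, hence at most a
  constant times \<open>sup |R| \<integral> s\<close>. Minkowski's identity \<open>div ((N \<bullet> Du) x - (x \<bullet> Du) N) = 2 s - H (x \<bullet> Du)\<close>
  bounds \<open>2 \<integral> s\<close> by a constant times \<open>\<integral> H s\<close>, and \<open>H s \<le> \<tau> H + (1 + 1/\<tau>\<^sup>2) H s\<^sup>3 / (1 + s\<^sup>2)\<close> for every
  \<open>\<tau> > 0\<close>. The outer minimizing property enters through \<open>\<integral> H \<le> P(D)\<close>: the area of the level sets is
  non-decreasing in the height and at most \<open>P(D)\<close>, and its increment between two heights is the
  integral of \<open>H\<close> over the region in between. Together, \<open>\<integral> s\<close> is bounded by a constant times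
  \<open>\<tau> P(D)\<close> as soon as \<open>sup |R|\<close> is small enough in terms of \<open>\<tau>\<close>. Critical levels are cut off by a
  profile \<open>\<psi>(u)\<close>; since almost every level is regular, this costs nothing in the limit.

  Finally, the flat distance to \<open>T \<times> {0}\<close> is at most the volume \<open>\<integral> |u|\<close> of the region between the
  two hypersurfaces, and \<open>\<surd>(1 + s\<^sup>2) - 1 \<le> s\<close> controls the volume.\<close>

section \<open>Calculus and the divergence theorem on convex bodies\<close>

text \<open>Two obstacles shape the proof. Outer minimality speaks of the Hausdorff measure of a
  reduced boundary, whereas the integral identities see a level set only through the divergence
  theorem. The bridge consists of two inequalities: the surface measure of a regular level set is a
  weak limit of measures spread over thin layers of heights just below it; Gauss-Green bounds the
  perimeter of the sublevel set by its total mass, and the isodiametric inequality bounds this mass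
  by the Hausdorff measure of the level set. Applied at two heights, they give the monotonicity of
  the area. The second obstacle is that regularity is known only at almost every height. The
  profiles therefore vanish near the closed set of critical values, and what they remove is
  estimated by slicing in height. The constants depend on the torus alone: \<open>\<rho>\<close> is
  the radius of a ball about 0 that contains the fundamental domain, and \<open>C0\<close> bounds
  its perimeter. The estimate closes because the curvature term returns as a multiple of the
  gradient integral, with the factor
  \<open>\<rho>\<^sup>2 * (1 + 1 / \<tau>\<^sup>2) * \<epsilon> / 3\<close>, and is absorbed once
  this factor is at most 1.\<close>

declare Ck.simps(2) [simp del] One_nat_def [simp del]

lemma Ck1_iff:
  "Ck 1 f \<longleftrightarrow> (\<forall>x. f differentiable (at x)) \<and> (\<forall>v. continuous_on UNIV (\<lambda>x. dir_deriv f v x))"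
  by (simp add: Ck.simps(2) One_nat_def)

lemma Ck1I:
  assumes "\<And>x. (f has_derivative f' x) (at x)" "\<And>v. continuous_on UNIV (\<lambda>x. f' x v)"
  shows "Ck 1 f"
proof -
  have "dir_deriv f v x = f' x v" for v x
    using frechet_derivative_at[OF assms(1)[of x]] by metis
  with assms show ?thesis unfolding Ck1_iff differentiable_def by auto
qed

lemma dir_deriv_eqI: "(f has_derivative f') (at x) \<Longrightarrow> dir_deriv f v x = f' v"
  using frechet_derivative_at by metis

lemma Ck1_has_derivative: "Ck 1 f \<Longrightarrow> (f has_derivative (\<lambda>v. dir_deriv f v x)) (at x)"
  using frechet_derivative_works by (auto simp: Ck1_iff)

lemma Ck1_continuous_dir_deriv: "Ck 1 f \<Longrightarrow> continuous_on S (\<lambda>x. dir_deriv f v x)"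
  by (auto simp: Ck1_iff intro: continuous_on_subset)

lemma Ck1_continuous: "Ck 1 f \<Longrightarrow> continuous_on S f"
  by (metis Ck1_has_derivative has_derivative_continuous continuous_at_imp_continuous_on)

text \<open>\<open>Ck (Suc k)\<close> records differentiability and postpones continuity to level 0.
  The induction recovers it: every directional derivative is itself \<open>Ck 1\<close>, hence
  continuous.\<close>

lemma Ck_Suc_imp_Ck1: "Ck (Suc k) f \<Longrightarrow> Ck 1 f"
proof (induction k arbitrary: f)
  case (Suc k)
  then have "Ck 1 (\<lambda>x. dir_deriv f v x)" for v by (simp add: Ck.simps(2))
  with Suc.prems show ?case by (auto simp: Ck.simps(2)[of "Suc k"] Ck1_iff[of f] intro!: Ck1_continuous)
qed (simp add: One_nat_def)

lemma Ck1_const: "Ck 1 (\<lambda>x. c)"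
  by (rule Ck1I[where f'="\<lambda>x v. 0"]) auto

lemma Ck1_bounded_linear: "bounded_linear f \<Longrightarrow> Ck 1 f"
  by (rule Ck1I[where f'="\<lambda>x. f"]) (auto intro: bounded_linear_imp_has_derivative)

lemma Ck1_ident: "Ck 1 (\<lambda>x. x)"
  by (rule Ck1_bounded_linear) (rule bounded_linear_ident)

lemma Ck1_add:
  assumes "Ck 1 f" "Ck 1 g" shows "Ck 1 (\<lambda>x. f x + g x)"
  by (rule Ck1I[where f'="\<lambda>x v. dir_deriv f v x + dir_deriv g v x"])
    (intro has_derivative_add Ck1_has_derivative continuous_on_add Ck1_continuous_dir_deriv assms)+

lemma Ck1_minus:
  assumes "Ck 1 f" shows "Ck 1 (\<lambda>x. - f x)"
  by (rule Ck1I[where f'="\<lambda>x v. - dir_deriv f v x"])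
    (intro has_derivative_minus Ck1_has_derivative continuous_on_minus Ck1_continuous_dir_deriv assms)+

lemma Ck1_diff:
  assumes "Ck 1 f" "Ck 1 g" shows "Ck 1 (\<lambda>x. f x - g x)"
  using Ck1_add[OF assms(1) Ck1_minus[OF assms(2)]] by simp

lemma Ck1_sum:
  assumes "\<And>i. i \<in> I \<Longrightarrow> Ck 1 (f i)" shows "Ck 1 (\<lambda>x. \<Sum>i\<in>I. f i x)"
  using assms
proof (induction I rule: infinite_finite_induct)
  case (insert i I)
  then show ?case using Ck1_add[of "f i" "\<lambda>x. \<Sum>i\<in>I. f i x"] by simp
qed (simp_all add: Ck1_const)

lemma Ck1_bilinear:
  assumes p: "bounded_bilinear b" and "Ck 1 f" "Ck 1 g"
  shows "Ck 1 (\<lambda>x. b (f x) (g x))"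
proof (rule Ck1I[where f'="\<lambda>x v. b (f x) (dir_deriv g v x) + b (dir_deriv f v x) (g x)"])
  show "((\<lambda>x. b (f x) (g x)) has_derivative
      (\<lambda>v. b (f x) (dir_deriv g v x) + b (dir_deriv f v x) (g x))) (at x)" for x
    by (intro bounded_bilinear.FDERIV[OF p] Ck1_has_derivative assms)
  show "continuous_on UNIV (\<lambda>x. b (f x) (dir_deriv g v x) + b (dir_deriv f v x) (g x))" for v
    by (intro continuous_on_add bounded_bilinear.continuous_on[OF p]
        Ck1_continuous_dir_deriv Ck1_continuous[OF assms(2)] Ck1_continuous[OF assms(3)] assms)
qed

lemmas Ck1_mult = Ck1_bilinear[OF bounded_bilinear_mult]
lemmas Ck1_scaleR = Ck1_bilinear[OF bounded_bilinear_scaleR]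
lemmas Ck1_inner = Ck1_bilinear[OF bounded_bilinear_inner]

lemma Ck1_comp_real:
  fixes g :: "'a::real_normed_vector \<Rightarrow> real"
  assumes "\<And>t. (\<phi> has_real_derivative \<phi>' t) (at t)" "continuous_on UNIV \<phi>'" "Ck 1 g"
  shows "Ck 1 (\<lambda>x. \<phi> (g x))"
proof (rule Ck1I[where f'="\<lambda>x v. \<phi>' (g x) * dir_deriv g v x"])
  show "((\<lambda>x. \<phi> (g x)) has_derivative (\<lambda>v. \<phi>' (g x) * dir_deriv g v x)) (at x)" for x
    using has_derivative_compose[OF Ck1_has_derivative[OF assms(3)]
        assms(1)[of "g x", unfolded has_field_derivative_def]] .
  show "continuous_on UNIV (\<lambda>x. \<phi>' (g x) * dir_deriv g v x)" for v
    by (intro continuous_intros Ck1_continuous_dir_deriv assms(3)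
        continuous_on_compose2[OF assms(2)] Ck1_continuous) auto
qed

lemma Ck1_inverse:
  fixes g :: "'a::real_normed_vector \<Rightarrow> real"
  assumes "Ck 1 g" "\<And>x. g x \<noteq> 0"
  shows "Ck 1 (\<lambda>x. inverse (g x))"
proof (rule Ck1I[where f'="\<lambda>x v. - (inverse (g x) * dir_deriv g v x * inverse (g x))"])
  show "((\<lambda>x. inverse (g x)) has_derivative
      (\<lambda>v. - (inverse (g x) * dir_deriv g v x * inverse (g x)))) (at x)" for x
    by (intro Deriv.has_derivative_inverse Ck1_has_derivative assms)
  show "continuous_on UNIV (\<lambda>x. - (inverse (g x) * dir_deriv g v x * inverse (g x)))" for v
    by (intro continuous_intros Ck1_continuous_dir_deriv Ck1_continuous[OF assms(1)] assms ballI)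
qed

lemma vec_eq_sum_axis: "(x :: real^'n) = (\<Sum>i\<in>UNIV. (x $ i) *\<^sub>R axis i 1)"
  using basis_expansion[of x] by (simp only: scalar_mult_eq_scaleR)

lemma Ck1_vecI:
  fixes f :: "'a::real_normed_vector \<Rightarrow> real^'n"
  assumes "\<And>i. Ck 1 (\<lambda>x. f x $ i)"
  shows "Ck 1 f"
proof -
  have "Ck 1 (\<lambda>x. \<Sum>i\<in>UNIV. (f x $ i) *\<^sub>R (axis i 1 :: real^'n))"
    by (intro Ck1_sum Ck1_scaleR Ck1_const assms)
  also have "(\<lambda>x. \<Sum>i\<in>UNIV. (f x $ i) *\<^sub>R (axis i 1 :: real^'n)) = f"
    by (rule ext) (rule vec_eq_sum_axis[symmetric])
  finally show ?thesis .
qed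

lemma Ck1_vec_nth:
  fixes f :: "'a::real_normed_vector \<Rightarrow> real^'n"
  assumes "Ck 1 f"
  shows "Ck 1 (\<lambda>x. f x $ i)"
  using Ck1_inner[OF assms Ck1_const[of "axis i 1"]] by (simp add: inner_axis)

section \<open>Symmetry of second derivatives\<close>

lemma has_derivative_line:
  assumes "(f has_derivative f') (at (x + t *\<^sub>R v))"
  shows "((\<lambda>t. f (x + t *\<^sub>R v)) has_vector_derivative f' v) (at t)"
proof -
  have "((\<lambda>t. x + t *\<^sub>R v) has_derivative (\<lambda>t. t *\<^sub>R v)) (at t)"
    by (auto intro!: derivative_eq_intros)
  from has_derivative_compose[OF this assms]
  have "((\<lambda>t. f (x + t *\<^sub>R v)) has_derivative (\<lambda>t. f' (t *\<^sub>R v))) (at t)" .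
  moreover have "f' (t *\<^sub>R v) = t *\<^sub>R f' v" for t
    using has_derivative_linear[OF assms] by (simp add: linear_cmul)
  ultimately show ?thesis by (simp add: has_vector_derivative_def)
qed

lemma has_real_derivative_line:
  fixes f :: "'a::real_normed_vector \<Rightarrow> real"
  assumes "(f has_derivative f') (at (x + t *\<^sub>R v))"
  shows "((\<lambda>t. f (x + t *\<^sub>R v)) has_real_derivative f' v) (at t)"
  using has_derivative_line[OF assms] by (simp add: has_real_derivative_iff_has_vector_derivative)

text \<open>Mean value theorem twice: in direction \<open>v\<close> for the increment along
  \<open>w\<close>, then in direction \<open>w\<close> for the derivative
  \<open>dir_deriv f v\<close>.\<close>

lemma second_difference:
  fixes f :: "'a::real_normed_vector \<Rightarrow> real"
  assumes f: "Ck 1 f" and fv: "Ck 1 (dir_deriv f v)" and t: "t > 0"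
  shows "\<exists>y. dist y x \<le> t * (norm v + norm w) \<and>
    f (x + t *\<^sub>R v + t *\<^sub>R w) - f (x + t *\<^sub>R v) - f (x + t *\<^sub>R w) + f x
      = t\<^sup>2 * dir_deriv (dir_deriv f v) w y"
proof -
  define g where "g r = f ((x + t *\<^sub>R w) + r *\<^sub>R v) - f (x + r *\<^sub>R v)" for r
  have "(g has_real_derivative
      (dir_deriv f v ((x + t *\<^sub>R w) + r *\<^sub>R v) - dir_deriv f v (x + r *\<^sub>R v))) (at r)" for r
    unfolding g_def by (intro DERIV_diff has_real_derivative_line Ck1_has_derivative f)
  from MVT2[OF t this] obtain a where a: "0 < a" "a < t" and
    1: "g t - g 0 = t * (dir_deriv f v ((x + t *\<^sub>R w) + a *\<^sub>R v) - dir_deriv f v (x + a *\<^sub>R v))"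
    by auto
  define k where "k r = dir_deriv f v ((x + a *\<^sub>R v) + r *\<^sub>R w)" for r
  have "(k has_real_derivative dir_deriv (dir_deriv f v) w ((x + a *\<^sub>R v) + r *\<^sub>R w)) (at r)" for r
    unfolding k_def by (intro has_real_derivative_line Ck1_has_derivative fv)
  from MVT2[OF t this] obtain b where b: "0 < b" "b < t" and
    2: "k t - k 0 = t * dir_deriv (dir_deriv f v) w ((x + a *\<^sub>R v) + b *\<^sub>R w)" by auto
  have "g t - g 0 = t * (k t - k 0)"
    unfolding 1 k_def by (simp add: add.assoc add.left_commute add.commute)
  then have "f (x + t *\<^sub>R w + t *\<^sub>R v) - f (x + t *\<^sub>R v) - (f (x + t *\<^sub>R w) - f x)
      = t\<^sup>2 * dir_deriv (dir_deriv f v) w ((x + a *\<^sub>R v) + b *\<^sub>R w)"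
    unfolding 2 g_def by (simp add: power2_eq_square)
  moreover have "x + t *\<^sub>R w + t *\<^sub>R v = x + t *\<^sub>R v + t *\<^sub>R w" by simp
  ultimately have "f (x + t *\<^sub>R v + t *\<^sub>R w) - f (x + t *\<^sub>R v) - f (x + t *\<^sub>R w) + f x
      = t\<^sup>2 * dir_deriv (dir_deriv f v) w (x + a *\<^sub>R v + b *\<^sub>R w)" by simp
  moreover have "dist (x + a *\<^sub>R v + b *\<^sub>R w) x \<le> t * (norm v + norm w)"
  proof -
    have "norm (a *\<^sub>R v + b *\<^sub>R w) \<le> a * norm v + b * norm w"
      using norm_triangle_ineq[of "a *\<^sub>R v" "b *\<^sub>R w"] a b by simp
    also have "\<dots> \<le> t * norm v + t * norm w"
      using a b by (intro add_mono mult_right_mono) auto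
    finally show ?thesis by (simp add: dist_norm add.assoc distrib_left)
  qed
  ultimately show ?thesis by blast
qed

text \<open>The second difference is symmetric in \<open>v\<close> and \<open>w\<close>; divided by
  the square of the step it tends to either mixed derivative.\<close>

lemma dir_deriv_commute:
  fixes f :: "'a::real_normed_vector \<Rightarrow> real"
  assumes f: "Ck 1 f" and fv: "Ck 1 (dir_deriv f v)" and fw: "Ck 1 (dir_deriv f w)"
  shows "dir_deriv (dir_deriv f v) w x = dir_deriv (dir_deriv f w) v x"
proof -
  define T where "T n = inverse (real (Suc n))" for n
  have T: "T n > 0" "T \<longlonglongrightarrow> 0" for n
    unfolding T_def using LIMSEQ_inverse_real_of_nat by (auto simp: inverse_le_1_iff)
  have lim: "\<exists>y. (\<forall>n. f (x + T n *\<^sub>R p + T n *\<^sub>R q) - f (x + T n *\<^sub>R p) - f (x + T n *\<^sub>R q) + f x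
      = (T n)\<^sup>2 * dir_deriv (dir_deriv f p) q (y n))
    \<and> (\<lambda>n. dir_deriv (dir_deriv f p) q (y n)) \<longlonglongrightarrow> dir_deriv (dir_deriv f p) q x"
    if fp: "Ck 1 (dir_deriv f p)" for p q
  proof -
    have "\<forall>n. \<exists>y. dist y x \<le> T n * (norm p + norm q) \<and>
      f (x + T n *\<^sub>R p + T n *\<^sub>R q) - f (x + T n *\<^sub>R p) - f (x + T n *\<^sub>R q) + f x
        = (T n)\<^sup>2 * dir_deriv (dir_deriv f p) q y"
      using second_difference[OF f fp T(1)] by blast
    from choice[OF this] obtain y where y: "\<forall>n. dist (y n) x \<le> T n * (norm p + norm q) \<and>
      f (x + T n *\<^sub>R p + T n *\<^sub>R q) - f (x + T n *\<^sub>R p) - f (x + T n *\<^sub>R q) + f x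
        = (T n)\<^sup>2 * dir_deriv (dir_deriv f p) q (y n)" by blast
    have "(\<lambda>n. T n * (norm p + norm q)) \<longlonglongrightarrow> 0 * (norm p + norm q)"
      by (intro tendsto_intros T)
    then have "(\<lambda>n. dist (y n) x) \<longlonglongrightarrow> 0"
      by (intro Lim_null_comparison[of "\<lambda>n. dist (y n) x" "\<lambda>n. T n * (norm p + norm q)"])
        (use y in simp_all)
    then have "y \<longlonglongrightarrow> x" by (rule tendsto_dist_iff[THEN iffD2])
    moreover have "isCont (dir_deriv (dir_deriv f p) q) x"
      using Ck1_continuous_dir_deriv[OF fp, of UNIV q] by (simp add: continuous_on_eq_continuous_at)
    ultimately have "(\<lambda>n. dir_deriv (dir_deriv f p) q (y n)) \<longlonglongrightarrow> dir_deriv (dir_deriv f p) q x"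
      by (rule isCont_tendsto_compose[rotated])
    with y show ?thesis by blast
  qed
  obtain y where y: "\<And>n. f (x + T n *\<^sub>R v + T n *\<^sub>R w) - f (x + T n *\<^sub>R v) - f (x + T n *\<^sub>R w) + f x
      = (T n)\<^sup>2 * dir_deriv (dir_deriv f v) w (y n)"
    and ylim: "(\<lambda>n. dir_deriv (dir_deriv f v) w (y n)) \<longlonglongrightarrow> dir_deriv (dir_deriv f v) w x"
    using lim[OF fv, of w] by blast
  obtain z where z: "\<And>n. f (x + T n *\<^sub>R w + T n *\<^sub>R v) - f (x + T n *\<^sub>R w) - f (x + T n *\<^sub>R v) + f x
      = (T n)\<^sup>2 * dir_deriv (dir_deriv f w) v (z n)"
    and zlim: "(\<lambda>n. dir_deriv (dir_deriv f w) v (z n)) \<longlonglongrightarrow> dir_deriv (dir_deriv f w) v x"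
    using lim[OF fw, of v] by blast
  have "dir_deriv (dir_deriv f v) w (y n) = dir_deriv (dir_deriv f w) v (z n)" for n
  proof -
    have p: "x + T n *\<^sub>R w + T n *\<^sub>R v = x + T n *\<^sub>R v + T n *\<^sub>R w"
      by (simp add: add_ac)
    have "(T n)\<^sup>2 * dir_deriv (dir_deriv f v) w (y n)
      = (T n)\<^sup>2 * dir_deriv (dir_deriv f w) v (z n)"
      using y[of n] z[of n] unfolding p by linarith
    with T(1)[of n] show ?thesis by simp
  qed
  then show ?thesis
    using LIMSEQ_unique[OF ylim] zlim by simp
qed

section \<open>Divergence theorem for fields that vanish on the frontier\<close>

lemma continuous_on_compact_integrable:
  fixes g :: "'a::euclidean_space \<Rightarrow> real"
  assumes "compact D" "continuous_on D g"
  shows "set_integrable lebesgue D g"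
  unfolding set_integrable_def
  using borel_integrable_compact[OF assms] borel_measurable_integrable[OF borel_integrable_compact[OF assms]]
  by (subst integrable_completion) auto

lemma LINT_lebesgue_lborel:
  fixes g :: "'a::euclidean_space \<Rightarrow> real"
  assumes "compact D" "continuous_on D g"
  shows "(LINT x:D|lebesgue. g x) = (LINT x:D|lborel. g x)"
  unfolding set_lebesgue_integral_def
  by (rule integral_completion) (use borel_integrable_compact[OF assms] in auto)

text \<open>Translation invariance makes every difference quotient integrate to 0. The Lipschitz
  bound and the bounded support dominate the quotients, so their almost everywhere limit inherits
  the value 0.\<close>

lemma integral_difference_quotient_zero:
  fixes g G :: "'a::euclidean_space \<Rightarrow> real"
  assumes lip: "\<And>x y. \<bar>g x - g y\<bar> \<le> L * dist x y" and L: "L \<ge> 0"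
    and supp: "\<And>x. norm x > r \<Longrightarrow> g x = 0"
    and G: "G \<in> borel_measurable borel"
    and lim: "AE x in lborel. ((\<lambda>t. (g (x + t *\<^sub>R e) - g x) / t) \<longlongrightarrow> G x) (at 0)"
  shows "integral\<^sup>L lborel G = 0"
proof -
  define T where "T n = inverse (real (Suc n))" for n
  have T: "T n > 0" "T \<longlonglongrightarrow> 0" "T n \<le> 1" for n
    unfolding T_def using LIMSEQ_inverse_real_of_nat by (auto simp: inverse_le_1_iff)
  define q where "q n x = (g (x + T n *\<^sub>R e) - g x) / T n" for n x
  have "continuous_on UNIV g"
    by (rule lipschitz_on_continuous_on[OF lipschitz_onI[of _ _ L]]) (use lip L in \<open>auto simp: dist_real_def\<close>)
  then have gm: "g \<in> borel_measurable borel" by (rule borel_measurable_continuous_onI)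
  have gm2: "(\<lambda>x. g (x + c)) \<in> borel_measurable borel" for c
    using gm by measurable
  \<comment> \<open>Comparison with a point of norm \<open>\<bar>r\<bar> + 1\<close>, where
    \<open>g\<close> vanishes.\<close>
  have gbd: "\<bar>g x\<bar> \<le> L * (2 * \<bar>r\<bar> + 2)" for x
  proof (cases "norm x > r")
    case True
    then show ?thesis using supp L by auto
  next
    case False
    obtain b :: 'a where b: "b \<in> Basis" using nonempty_Basis by blast
    have n: "norm ((\<bar>r\<bar> + 1) *\<^sub>R b) = \<bar>r\<bar> + 1" using b by simp
    have "g ((\<bar>r\<bar> + 1) *\<^sub>R b) = 0" using n by (intro supp) linarith
    then have "\<bar>g x\<bar> \<le> L * dist x ((\<bar>r\<bar> + 1) *\<^sub>R b)" using lip[of x "(\<bar>r\<bar> + 1) *\<^sub>R b"] by simp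
    also have "dist x ((\<bar>r\<bar> + 1) *\<^sub>R b) \<le> norm x + (\<bar>r\<bar> + 1)"
      using norm_triangle_ineq4[of x "(\<bar>r\<bar> + 1) *\<^sub>R b"] unfolding n dist_norm .
    then have "L * dist x ((\<bar>r\<bar> + 1) *\<^sub>R b) \<le> L * (2 * \<bar>r\<bar> + 2)"
      using False L by (intro mult_left_mono) auto
    finally show ?thesis .
  qed
  have ic: "integrable lborel (\<lambda>x. indicator (cball 0 R) x * c)" for R :: real and c :: real
    using emeasure_lborel_cball_finite[of 0 R]
    by (intro integrable_mult_left integrable_real_indicator) (auto simp: infinity_ennreal_def)
  have gint: "integrable lborel (\<lambda>x. g (x + c))" for c
  proof (rule Bochner_Integration.integrable_bound[OF ic[of "\<bar>r\<bar> + norm c" "L * (2 * \<bar>r\<bar> + 2)"]])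
    show "AE x in lborel. norm (g (x + c)) \<le> norm (indicator (cball 0 (\<bar>r\<bar> + norm c)) x * (L * (2 * \<bar>r\<bar> + 2)))"
    proof (intro AE_I2)
      fix x
      have "norm (x + c) > r" if "norm x > \<bar>r\<bar> + norm c"
        using that norm_triangle_ineq4[of "x + c" c] by simp
      then show "norm (g (x + c)) \<le> norm (indicator (cball 0 (\<bar>r\<bar> + norm c)) x * (L * (2 * \<bar>r\<bar> + 2)))"
        using gbd[of "x + c"] supp[of "x + c"] by (auto simp: indicator_def)
    qed
  qed (use gm2 in auto)
  have tr: "integral\<^sup>L lborel (\<lambda>x. g (x + c)) = integral\<^sup>L lborel g" for c
  proof -
    have "integral\<^sup>L (distr lborel borel ((+) c)) g = integral\<^sup>L lborel (\<lambda>x. g (c + x))"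
      by (rule integral_distr) (use gm in auto)
    then show ?thesis by (simp add: lborel_distr_plus add.commute)
  qed
  have q0: "integral\<^sup>L lborel (q n) = 0" for n
  proof -
    have "integral\<^sup>L lborel (q n) = (integral\<^sup>L lborel (\<lambda>x. g (x + T n *\<^sub>R e)) - integral\<^sup>L lborel (\<lambda>x. g (x + 0))) / T n"
      unfolding q_def by (subst Bochner_Integration.integral_diff[symmetric]) (auto intro: gint gint[of 0, simplified])
    then show ?thesis using tr by simp
  qed
  have "(\<lambda>n. integral\<^sup>L lborel (q n)) \<longlonglongrightarrow> integral\<^sup>L lborel G"
  proof (rule integral_dominated_convergence[where w="\<lambda>x. indicator (cball 0 (\<bar>r\<bar> + norm e)) x * (L * norm e)"])
    show "AE x in lborel. (\<lambda>n. q n x) \<longlonglongrightarrow> G x"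
      using lim
    proof eventually_elim
      case (elim x)
      have "filterlim T (at 0) sequentially"
        using T by (auto simp: filterlim_at intro!: always_eventually simp: less_imp_neq[symmetric])
      from filterlim_compose[OF elim this] show ?case unfolding q_def .
    qed
    show "AE x in lborel. norm (q n x) \<le> indicator (cball 0 (\<bar>r\<bar> + norm e)) x * (L * norm e)" for n
    proof (intro AE_I2)
      fix x
      have 1: "\<bar>g (x + T n *\<^sub>R e) - g x\<bar> \<le> L * norm e * T n"
        using lip[of "x + T n *\<^sub>R e" x] T(1)[of n] by (simp add: dist_norm mult_ac)
      have "norm (T n *\<^sub>R e) \<le> norm e" using T(1)[of n] T(3)[of n] by (simp add: mult_left_le_one_le)
      then have 2: "q n x = 0" if "norm x > \<bar>r\<bar> + norm e"
      proof -
        have "norm x \<le> norm (x + T n *\<^sub>R e) + norm (T n *\<^sub>R e)"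
          using norm_triangle_ineq4[of "x + T n *\<^sub>R e" "T n *\<^sub>R e"] by simp
        then have "r < norm x" "r < norm (x + T n *\<^sub>R e)"
          using that \<open>norm (T n *\<^sub>R e) \<le> norm e\<close> norm_ge_zero[of e] by linarith+
        then show ?thesis using supp by (simp add: q_def)
      qed
      show "norm (q n x) \<le> indicator (cball 0 (\<bar>r\<bar> + norm e)) x * (L * norm e)"
        using 1 2 T(1)[of n] by (cases "norm x \<le> \<bar>r\<bar> + norm e") (auto simp: q_def divide_simps)
    qed
    show "q n \<in> borel_measurable lborel" for n
      unfolding q_def using gm gm2[of "T n *\<^sub>R e"] by simp
  qed (use G ic in auto)
  then show ?thesis using q0 by (simp add: LIMSEQ_const_iff)
qed

lemma Ck1_lipschitz_on_compact_convex:
  fixes g :: "'a::euclidean_space \<Rightarrow> real"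
  assumes g: "Ck 1 g" and D: "compact D" "convex D"
  obtains L where "L \<ge> 0" "\<And>x y. x \<in> D \<Longrightarrow> y \<in> D \<Longrightarrow> \<bar>g x - g y\<bar> \<le> L * dist x y"
proof -
  have "\<exists>B. \<forall>x\<in>D. \<bar>dir_deriv g b x\<bar> \<le> B" for b
    using compact_imp_bounded[OF compact_continuous_image[OF Ck1_continuous_dir_deriv[OF g] D(1)], of b]
    by (auto simp: bounded_iff)
  then obtain B where B: "\<And>b x. x \<in> D \<Longrightarrow> \<bar>dir_deriv g b x\<bar> \<le> B b" by metis
  define L where "L = (\<Sum>b\<in>Basis. \<bar>B b\<bar>)"
  have "norm (dir_deriv g v x) \<le> L * norm v" if "x \<in> D" for v x
  proof -
    have lin: "linear (\<lambda>v. dir_deriv g v x)" using has_derivative_linear[OF Ck1_has_derivative[OF g]] .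
    have "dir_deriv g v x = dir_deriv g (\<Sum>b\<in>Basis. (v \<bullet> b) *\<^sub>R b) x" by (simp add: euclidean_representation)
    also have "\<dots> = (\<Sum>b\<in>Basis. (v \<bullet> b) * dir_deriv g b x)"
      by (simp only: linear_sum[OF lin] linear_cmul[OF lin] real_scaleR_def)
    finally have "norm (dir_deriv g v x) \<le> (\<Sum>b\<in>Basis. \<bar>v \<bullet> b\<bar> * \<bar>dir_deriv g b x\<bar>)"
      using sum_abs[of "\<lambda>b. (v \<bullet> b) * dir_deriv g b x" Basis] by (simp add: abs_mult)
    also have "\<dots> \<le> (\<Sum>b\<in>Basis. norm v * \<bar>B b\<bar>)"
      using B[OF that] by (intro sum_mono mult_mono) (auto simp: Basis_le_norm intro: order_trans[OF _ abs_ge_self])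
    finally show ?thesis by (simp add: L_def sum_distrib_left mult.commute)
  qed
  then have "onorm (\<lambda>v. dir_deriv g v x) \<le> L" if "x \<in> D" for x
    using that by (intro onorm_le) auto
  then have "norm (g x - g y) \<le> L * norm (x - y)" if "x \<in> D" "y \<in> D" for x y
    using that by (intro differentiable_bound[OF D(2)])
      (auto intro: has_derivative_at_withinI Ck1_has_derivative g)
  moreover have "L \<ge> 0" unfolding L_def by (simp add: sum_nonneg)
  ultimately show thesis using that by (simp add: dist_norm)
qed

text \<open>A segment from a point of \<open>D\<close> to a point outside meets the frontier, where
  \<open>g\<close> vanishes, and the crossing point is no farther away than the other end.\<close>

lemma extend_by_zero_lipschitz:
  fixes g :: "'a::euclidean_space \<Rightarrow> real"
  assumes L: "L \<ge> 0" "\<And>x y. x \<in> D \<Longrightarrow> y \<in> D \<Longrightarrow> \<bar>g x - g y\<bar> \<le> L * dist x y"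
    and D: "closed D" and z: "\<And>x. x \<in> frontier D \<Longrightarrow> g x = 0"
  shows "\<bar>indicator D x * g x - indicator D y * g y\<bar> \<le> L * dist x y"
proof -
  have *: "\<bar>g x\<bar> \<le> L * dist x y" if "x \<in> D" "y \<notin> D" for x y
  proof -
    have "closed_segment x y \<inter> frontier D \<noteq> {}"
      by (rule connected_Int_frontier) (use that in auto)
    then obtain c where c: "c \<in> closed_segment x y" "c \<in> frontier D" by auto
    have cD: "c \<in> D" using c D frontier_subset_closed by blast
    have "\<bar>g x\<bar> \<le> L * dist x c" using L(2)[OF that(1) cD] z[OF c(2)] by simp
    also have "\<dots> \<le> L * dist x y"
      using segment_bound(1)[OF c(1)] by (intro mult_left_mono L) (auto simp: dist_norm norm_minus_commute)
    finally show ?thesis .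
  qed
  show ?thesis
    using L(2)[of x y] *[of x y] *[of y x] L(1)
    by (cases "x \<in> D"; cases "y \<in> D") (auto simp: dist_commute)
qed

lemma AE_not_in_frontier_convex:
  fixes D :: "'a::euclidean_space set"
  assumes "convex D" shows "AE x in lborel. x \<notin> frontier D"
proof (rule AE_not_in)
  have "emeasure lebesgue (frontier D) = 0"
    using negligible_convex_frontier[OF assms] negligible_iff_emeasure0 by (metis negligible_imp_sets)
  moreover have "frontier D \<in> sets borel" by (simp add: borel_closed)
  ultimately show "frontier D \<in> null_sets lborel"
    by (simp add: null_sets_def)
qed

text \<open>Extended by zero, \<open>g\<close> is Lipschitz on the whole space, and its difference
  quotients converge off the frontier, which is a null set because \<open>D\<close> is
  convex.\<close>

lemma integral_dir_deriv_zero: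
  fixes g :: "'a::euclidean_space \<Rightarrow> real"
  assumes g: "Ck 1 g" and D: "compact D" "convex D" and z: "\<And>x. x \<in> frontier D \<Longrightarrow> g x = 0"
  shows "(LINT x:D|lebesgue. dir_deriv g e x) = 0"
proof -
  obtain L where L: "L \<ge> 0" "\<And>x y. x \<in> D \<Longrightarrow> y \<in> D \<Longrightarrow> \<bar>g x - g y\<bar> \<le> L * dist x y"
    using Ck1_lipschitz_on_compact_convex[OF g D] by blast
  obtain r where r: "\<And>x. x \<in> D \<Longrightarrow> norm x \<le> r" using compact_imp_bounded[OF D(1)] by (auto simp: bounded_iff)
  have cl: "closed D" using D compact_imp_closed by blast
  have "integral\<^sup>L lborel (\<lambda>x. indicator D x *\<^sub>R dir_deriv g e x) = 0"
  proof (rule integral_difference_quotient_zero[OF extend_by_zero_lipschitz[OF L cl z] L(1)])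
    show "indicator D x * g x = 0" if "norm x > r" for x using r[of x] that by (auto simp: indicator_def)
    show "(\<lambda>x. indicator D x *\<^sub>R dir_deriv g e x) \<in> borel_measurable borel"
      using borel_measurable_integrable[OF borel_integrable_compact[OF D(1) Ck1_continuous_dir_deriv[OF g, of D e]]]
      by simp
    show "AE x in lborel. ((\<lambda>t. (indicator D (x + t *\<^sub>R e) * g (x + t *\<^sub>R e) - indicator D x * g x) / t) \<longlongrightarrow>
               indicator D x *\<^sub>R dir_deriv g e x) (at 0)"
      using AE_not_in_frontier_convex[OF D(2)]
    proof eventually_elim
      case (elim x)
      have lim0: "((\<lambda>t. x + t *\<^sub>R e) \<longlongrightarrow> x + 0 *\<^sub>R e) (at 0)" by (intro tendsto_intros)
      show ?case
      proof (cases "x \<in> D")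
        case True
        then have int: "x \<in> interior D" using elim cl by (auto simp: frontier_def)
        have ev: "\<forall>\<^sub>F t in at 0. x + t *\<^sub>R e \<in> interior D"
          by (rule topological_tendstoD[OF lim0]) (use int in auto)
        have "((\<lambda>t. g (x + t *\<^sub>R e)) has_real_derivative dir_deriv g e x) (at 0)"
          by (rule has_real_derivative_line) (simp add: Ck1_has_derivative[OF g, simplified])
        then have "((\<lambda>t. (g (x + t *\<^sub>R e) - g x) / t) \<longlongrightarrow> dir_deriv g e x) (at 0)"
          by (simp add: DERIV_def)
        moreover have "\<forall>\<^sub>F t in at 0. (g (x + t *\<^sub>R e) - g x) / t
            = (indicator D (x + t *\<^sub>R e) * g (x + t *\<^sub>R e) - indicator D x * g x) / t"
          using ev
        proof eventually_elim
          case (elim t)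
          then have "x + t *\<^sub>R e \<in> D" using interior_subset by blast
          with True show ?case by simp
        qed
        ultimately show ?thesis using True by (simp add: Lim_transform_eventually)
      next
        case False
        have ev: "\<forall>\<^sub>F t in at 0. x + t *\<^sub>R e \<in> - D"
          by (rule topological_tendstoD[OF lim0]) (use False cl in auto)
        show ?thesis
          by (rule tendsto_eventually) (use ev False in \<open>auto elim!: eventually_mono simp: indicator_def\<close>)
      qed
    qed
  qed
  then show ?thesis
    using LINT_lebesgue_lborel[OF D(1) Ck1_continuous_dir_deriv[OF g]] by (simp add: set_lebesgue_integral_def)
qed

lemma divergence_eqI:
  "(X has_derivative X') (at x) \<Longrightarrow> divergence X x = (\<Sum>i\<in>UNIV. X' (axis i 1) $ i)"
  unfolding divergence_def by (simp add: dir_deriv_eqI)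

lemma dir_deriv_vec_nth:
  fixes X :: "'a::real_normed_vector \<Rightarrow> real^'n"
  assumes "Ck 1 X" shows "dir_deriv (\<lambda>x. X x $ i) v x = dir_deriv X v x $ i"
  by (rule dir_deriv_eqI)
    (rule bounded_linear.has_derivative[OF bounded_linear_vec_nth Ck1_has_derivative[OF assms]])

lemma continuous_divergence: "Ck 1 X \<Longrightarrow> continuous_on S (divergence X)"
  unfolding divergence_def
  by (intro continuous_intros continuous_on_component Ck1_continuous_dir_deriv)

theorem divergence_theorem_zero:
  assumes X: "Ck 1 X" and D: "compact D" "convex D" and z: "\<And>x. x \<in> frontier D \<Longrightarrow> X x = 0"
  shows "(LINT x:D|lebesgue. divergence X x) = 0"
proof -
  have "(LINT x:D|lebesgue. divergence X x) = (\<Sum>i\<in>UNIV. LINT x:D|lebesgue. dir_deriv (\<lambda>x. X x $ i) (axis i 1) x)"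
    unfolding divergence_def set_lebesgue_integral_def dir_deriv_vec_nth[OF X] scaleR_sum_right
    by (rule Bochner_Integration.integral_sum)
      (use continuous_on_compact_integrable[OF D(1) continuous_on_component[OF Ck1_continuous_dir_deriv[OF X]]]
        in \<open>auto simp: set_integrable_def\<close>)
  also have "\<dots> = 0"
    by (intro sum.neutral ballI integral_dir_deriv_zero Ck1_vec_nth X D) (simp add: z)
  finally show ?thesis .
qed

lemma divergence_scaleR:
  assumes "(\<alpha> has_derivative \<alpha>') (at x)" "(X has_derivative X') (at x)"
  shows "divergence (\<lambda>x. \<alpha> x *\<^sub>R X x) x = \<alpha>' (X x) + \<alpha> x * divergence X x"
proof -
  have lin: "linear \<alpha>'" using has_derivative_linear[OF assms(1)] .
  have "\<alpha>' (X x) = \<alpha>' (\<Sum>i\<in>UNIV. (X x $ i) *\<^sub>R axis i 1)" by (subst vec_eq_sum_axis[of "X x"]) simp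
  also have "\<dots> = (\<Sum>i\<in>UNIV. (X x $ i) * \<alpha>' (axis i 1))"
    by (simp only: linear_sum[OF lin] linear_cmul[OF lin] real_scaleR_def)
  finally show ?thesis
    by (subst divergence_eqI[OF has_derivative_scaleR[OF assms]])
      (simp add: divergence_eqI[OF assms(2)] sum.distrib sum_distrib_left mult.commute add.commute)
qed

lemma divergence_ident: "divergence (\<lambda>x. x) x = 3"
  by (subst divergence_eqI[OF has_derivative_ident]) simp

lemma divergence_diff:
  assumes "(X has_derivative X') (at x)" "(Y has_derivative Y') (at x)"
  shows "divergence (\<lambda>x. X x - Y x) x = divergence X x - divergence Y x"
  by (simp add: divergence_eqI[OF has_derivative_diff[OF assms]] divergence_eqI[OF assms(1)]
      divergence_eqI[OF assms(2)] sum_subtractf)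

section \<open>Steiner symmetrization and the isodiametric inequality\<close>

lemma nn_integral_lborel_translation:
  fixes g :: "'a::euclidean_space \<Rightarrow> ennreal"
  assumes [measurable]: "g \<in> borel_measurable borel"
  shows "(\<integral>\<^sup>+x. g (x + c) \<partial>lborel) = (\<integral>\<^sup>+x. g x \<partial>lborel)"
proof -
  have "(\<integral>\<^sup>+x. g x \<partial>distr lborel borel ((+) c)) = (\<integral>\<^sup>+x. g (c + x) \<partial>lborel)"
    by (rule nn_integral_distr) auto
  then show ?thesis by (simp add: lborel_distr_plus add.commute)
qed

text \<open>Integration over the lines in direction \<open>e\<close>; the lines are parametrized, with a
  redundant coordinate along \<open>e\<close>, by the points of a slab of width \<open>1\<close>.\<close>

lemma nn_integral_slab:
  fixes g :: "'a::euclidean_space \<Rightarrow> ennreal"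
  assumes e: "norm e = 1" and g[measurable]: "g \<in> borel_measurable borel"
  shows "(\<integral>\<^sup>+x. indicator {x. 0 \<le> x \<bullet> e \<and> x \<bullet> e < 1} x * (\<integral>\<^sup>+t. g (x + t *\<^sub>R e) \<partial>lborel) \<partial>lborel)
    = (\<integral>\<^sup>+x. g x \<partial>lborel)"
proof -
  define S where "S = {x. 0 \<le> x \<bullet> e \<and> x \<bullet> e < 1}"
  have [measurable]: "S \<in> sets borel" unfolding S_def by measurable
  have ee: "e \<bullet> e = 1" using e by (simp add: dot_square_norm)
  have "(\<integral>\<^sup>+x. indicator S x * (\<integral>\<^sup>+t. g (x + t *\<^sub>R e) \<partial>lborel) \<partial>lborel)
      = (\<integral>\<^sup>+x. \<integral>\<^sup>+t. indicator S x * g (x + t *\<^sub>R e) \<partial>lborel \<partial>lborel)"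
    by (simp add: nn_integral_cmult)
  also have "\<dots> = (\<integral>\<^sup>+t. \<integral>\<^sup>+x. indicator S x * g (x + t *\<^sub>R e) \<partial>lborel \<partial>lborel)"
    by (rule lborel_pair.Fubini') measurable
  also have "\<dots> = (\<integral>\<^sup>+t. \<integral>\<^sup>+x. indicator S (x - t *\<^sub>R e) * g x \<partial>lborel \<partial>lborel)"
  proof (rule nn_integral_cong)
    fix t :: real
    show "(\<integral>\<^sup>+x. indicator S x * g (x + t *\<^sub>R e) \<partial>lborel) = (\<integral>\<^sup>+x. indicator S (x - t *\<^sub>R e) * g x \<partial>lborel)"
      using nn_integral_lborel_translation[of "\<lambda>x. indicator S (x - t *\<^sub>R e) * g x" "t *\<^sub>R e"] by simp
  qed
  also have "\<dots> = (\<integral>\<^sup>+x. \<integral>\<^sup>+t. indicator S (x - t *\<^sub>R e) * g x \<partial>lborel \<partial>lborel)"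
    by (rule lborel_pair.Fubini'[symmetric]) measurable
  also have "\<dots> = (\<integral>\<^sup>+x. g x \<partial>lborel)"
  proof (intro nn_integral_cong)
    fix x
    have "(\<integral>\<^sup>+t. indicator S (x - t *\<^sub>R e) * g x \<partial>lborel) = (\<integral>\<^sup>+t. indicator S (x - t *\<^sub>R e) \<partial>lborel) * g x"
      by (rule nn_integral_multc) measurable
    also have "(\<integral>\<^sup>+t. indicator S (x - t *\<^sub>R e) \<partial>lborel) = (\<integral>\<^sup>+t. indicator {x \<bullet> e - 1<..x \<bullet> e} t \<partial>lborel)"
      by (intro nn_integral_cong) (auto simp: S_def indicator_def inner_diff_left ee)
    also have "\<dots> = 1" by simp
    finally show "(\<integral>\<^sup>+t. indicator S (x - t *\<^sub>R e) * g x \<partial>lborel) = g x" by simp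
  qed
  finally show ?thesis unfolding S_def .
qed

text \<open>The integrals are exchanged twice, once before and once after a translation along
  \<open>e\<close>; \<open>i1\<close> and \<open>i2\<close> are the two integrability
  claims.\<close>

lemma integral_slab:
  fixes g :: "'a::euclidean_space \<Rightarrow> real"
  assumes e: "norm e = 1" and g: "integrable lborel g"
  shows "(\<integral>x. indicator {x. 0 \<le> x \<bullet> e \<and> x \<bullet> e < 1} x * (\<integral>t. g (x + t *\<^sub>R e) \<partial>lborel) \<partial>lborel)
    = (\<integral>x. g x \<partial>lborel)"
proof -
  define S where "S = {x. 0 \<le> x \<bullet> e \<and> x \<bullet> e < 1}"
  have [measurable]: "S \<in> sets borel" unfolding S_def by measurable
  have gm[measurable]: "g \<in> borel_measurable borel" using borel_measurable_integrable[OF g] by simp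
  have ee: "e \<bullet> e = 1" using e by (simp add: dot_square_norm)
  have fin: "(\<integral>\<^sup>+x. ennreal \<bar>g x\<bar> \<partial>lborel) < \<infinity>" using g by (simp add: integrable_iff_bounded)
  have nn: "(\<integral>\<^sup>+x. \<integral>\<^sup>+t. ennreal \<bar>indicator S x * g (x + t *\<^sub>R e)\<bar> \<partial>lborel \<partial>lborel)
     = (\<integral>\<^sup>+x. ennreal \<bar>g x\<bar> \<partial>lborel)"
  proof -
    have "(\<integral>\<^sup>+t. ennreal \<bar>indicator S x * g (x + t *\<^sub>R e)\<bar> \<partial>lborel)
        = indicator S x * (\<integral>\<^sup>+t. ennreal \<bar>g (x + t *\<^sub>R e)\<bar> \<partial>lborel)" for x
      by (cases "x \<in> S") auto
    then show ?thesis
      using nn_integral_slab[OF e, of "\<lambda>x. ennreal \<bar>g x\<bar>"] by (simp add: S_def)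
  qed
  have i1: "integrable (lborel \<Otimes>\<^sub>M lborel) (\<lambda>(x, t). indicator S x * g (x + t *\<^sub>R e))"
    unfolding case_prod_beta'
  proof (rule integrableI_bounded)
    show "(\<lambda>z. indicator S (fst z) * g (fst z + snd z *\<^sub>R e)) \<in> borel_measurable (lborel \<Otimes>\<^sub>M lborel)" by measurable
    have "(\<integral>\<^sup>+ z. ennreal (norm (indicator S (fst z) * g (fst z + snd z *\<^sub>R e))) \<partial>(lborel \<Otimes>\<^sub>M lborel))
       = (\<integral>\<^sup>+x. \<integral>\<^sup>+t. ennreal (norm (indicator S (fst (x, t)) * g (fst (x, t) + snd (x, t) *\<^sub>R e))) \<partial>lborel \<partial>lborel)"
      by (rule lborel.nn_integral_fst[symmetric]) measurable
    then show "(\<integral>\<^sup>+ z. ennreal (norm (indicator S (fst z) * g (fst z + snd z *\<^sub>R e))) \<partial>(lborel \<Otimes>\<^sub>M lborel)) < \<infinity>"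
      using nn fin by simp
  qed
  \<comment> \<open>For fixed \<open>x\<close> the admissible \<open>t\<close> fill a half-open
    interval of length 1, so the redundant coordinate integrates out.\<close>
  have slab1: "(\<integral>\<^sup>+t. indicator S (x - t *\<^sub>R e) \<partial>lborel) = (1::ennreal)"
    and slab2: "(\<integral>t. indicator S (x - t *\<^sub>R e) \<partial>lborel) = (1::real)" for x
  proof -
    have i: "indicator S (x - t *\<^sub>R e) = (indicator {x \<bullet> e - 1<..x \<bullet> e} t :: real)" for t
      by (auto simp: S_def indicator_def inner_diff_left ee)
    have j: "indicator S (x - t *\<^sub>R e) = (indicator {x \<bullet> e - 1<..x \<bullet> e} t :: ennreal)" for t
      by (auto simp: S_def indicator_def inner_diff_left ee)
    show "(\<integral>\<^sup>+t. indicator S (x - t *\<^sub>R e) \<partial>lborel) = (1::ennreal)" unfolding j by simp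
    show "(\<integral>t. indicator S (x - t *\<^sub>R e) \<partial>lborel) = (1::real)" unfolding i by simp
  qed
  have i2: "integrable (lborel \<Otimes>\<^sub>M lborel) (\<lambda>(x, t). indicator S (x - t *\<^sub>R e) * g x)"
    unfolding case_prod_beta'
  proof (rule integrableI_bounded)
    show "(\<lambda>z. indicator S (fst z - snd z *\<^sub>R e) * g (fst z)) \<in> borel_measurable (lborel \<Otimes>\<^sub>M lborel)" by measurable
    have "(\<integral>\<^sup>+ z. ennreal (norm (indicator S (fst z - snd z *\<^sub>R e) * g (fst z))) \<partial>(lborel \<Otimes>\<^sub>M lborel))
       = (\<integral>\<^sup>+x. \<integral>\<^sup>+t. ennreal (norm (indicator S (fst (x, t) - snd (x, t) *\<^sub>R e) * g (fst (x, t)))) \<partial>lborel \<partial>lborel)"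
      by (rule lborel.nn_integral_fst[symmetric]) measurable
    also have "\<dots> = (\<integral>\<^sup>+x. \<integral>\<^sup>+t. indicator S (x - t *\<^sub>R e) * ennreal \<bar>g x\<bar> \<partial>lborel \<partial>lborel)"
      by (intro nn_integral_cong) (simp add: abs_mult indicator_def)
    also have "\<dots> = (\<integral>\<^sup>+x. ennreal \<bar>g x\<bar> \<partial>lborel)"
    proof (rule nn_integral_cong)
      fix x
      have "(\<integral>\<^sup>+t. indicator S (x - t *\<^sub>R e) * ennreal \<bar>g x\<bar> \<partial>lborel)
          = (\<integral>\<^sup>+t. indicator S (x - t *\<^sub>R e) \<partial>lborel) * ennreal \<bar>g x\<bar>"
        by (rule nn_integral_multc) measurable
      then show "(\<integral>\<^sup>+t. indicator S (x - t *\<^sub>R e) * ennreal \<bar>g x\<bar> \<partial>lborel) = ennreal \<bar>g x\<bar>"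
        by (simp add: slab1)
    qed
    finally show "(\<integral>\<^sup>+ z. ennreal (norm (indicator S (fst z - snd z *\<^sub>R e) * g (fst z))) \<partial>(lborel \<Otimes>\<^sub>M lborel)) < \<infinity>"
      using fin by simp
  qed
  have "(\<integral>x. indicator S x * (\<integral>t. g (x + t *\<^sub>R e) \<partial>lborel) \<partial>lborel)
      = (\<integral>x. \<integral>t. indicator S x * g (x + t *\<^sub>R e) \<partial>lborel \<partial>lborel)"
    by simp
  also have "\<dots> = (\<integral>t. \<integral>x. indicator S x * g (x + t *\<^sub>R e) \<partial>lborel \<partial>lborel)"
    by (rule lborel_pair.Fubini_integral[OF i1, symmetric])
  also have "\<dots> = (\<integral>t. \<integral>x. indicator S (x - t *\<^sub>R e) * g x \<partial>lborel \<partial>lborel)"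
  proof (rule Bochner_Integration.integral_cong[OF refl])
    fix t :: real
    have "integral\<^sup>L (distr lborel borel ((+) (t *\<^sub>R e))) (\<lambda>x. indicator S (x - t *\<^sub>R e) * g x)
       = (\<integral>x. indicator S (t *\<^sub>R e + x - t *\<^sub>R e) * g (t *\<^sub>R e + x) \<partial>lborel)"
      by (rule integral_distr) measurable
    then show "(\<integral>x. indicator S x * g (x + t *\<^sub>R e) \<partial>lborel) = (\<integral>x. indicator S (x - t *\<^sub>R e) * g x \<partial>lborel)"
      by (simp add: lborel_distr_plus add.commute)
  qed
  also have "\<dots> = (\<integral>x. \<integral>t. indicator S (x - t *\<^sub>R e) * g x \<partial>lborel \<partial>lborel)"
    by (rule lborel_pair.Fubini_integral[OF i2])
  also have "\<dots> = (\<integral>x. g x \<partial>lborel)"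
    by (simp add: slab2)
  finally show ?thesis unfolding S_def .
qed

section \<open>Steiner symmetrization\<close>

definition fiber_length :: "'a::euclidean_space set \<Rightarrow> 'a \<Rightarrow> 'a \<Rightarrow> ennreal" where
  "fiber_length A b x = emeasure lborel {t. x + t *\<^sub>R b \<in> A}"

text \<open>For a unit vector \<open>b\<close>, each fibre is replaced by the open interval of the
  same length centred on the hyperplane orthogonal to \<open>b\<close>. The strict inequality drops
  the fibres of length 0.\<close>

definition steiner :: "'a::euclidean_space \<Rightarrow> 'a set \<Rightarrow> 'a set" where
  "steiner b A = {x. ennreal (2 * \<bar>x \<bullet> b\<bar>) < fiber_length A b x}"

lemma fiber_measurable:
  fixes A :: "'a::euclidean_space set"
  assumes "A \<in> sets borel" shows "{t. x + t *\<^sub>R b \<in> A} \<in> sets borel"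
proof -
  have "(\<lambda>t. x + t *\<^sub>R b) \<in> borel_measurable borel" by measurable
  from measurable_sets[OF this assms] show ?thesis by (simp add: vimage_def)
qed

lemma fiber_length_measurable:
  fixes A :: "'a::euclidean_space set"
  assumes A[measurable]: "A \<in> sets borel"
  shows "fiber_length A b \<in> borel_measurable borel"
proof -
  have m: "(\<lambda>z. fst z + snd z *\<^sub>R b) \<in> borel_measurable (borel \<Otimes>\<^sub>M (lborel :: real measure))"
    by measurable
  have "{z \<in> space (borel \<Otimes>\<^sub>M lborel). fst z + snd z *\<^sub>R b \<in> A} \<in> sets (borel \<Otimes>\<^sub>M (lborel :: real measure))"
    using measurable_sets[OF m A] by (simp add: vimage_def space_pair_measure)
  from lborel.measurable_emeasure_Pair[OF this] show ?thesis
    by (simp add: fiber_length_def space_pair_measure vimage_def cong: measurable_cong)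
qed

lemma fiber_length_shift:
  fixes A :: "'a::euclidean_space set"
  assumes "A \<in> sets borel"
  shows "fiber_length A b (x + s *\<^sub>R b) = fiber_length A b x"
proof -
  define B where "B = {t. x + t *\<^sub>R b \<in> A}"
  have B: "B \<in> sets borel" unfolding B_def by (rule fiber_measurable[OF assms])
  have "emeasure lborel B = emeasure (distr lborel borel ((+) s)) B" by (simp add: lborel_distr_plus)
  also have "\<dots> = emeasure lborel {t. x + s *\<^sub>R b + t *\<^sub>R b \<in> A}"
    by (subst emeasure_distr) (use B in \<open>auto simp: B_def algebra_simps vimage_def\<close>)
  finally show ?thesis by (simp add: fiber_length_def B_def)
qed

lemma steiner_measurable:
  fixes A :: "'a::euclidean_space set"
  assumes "A \<in> sets borel" shows "steiner b A \<in> sets borel"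
  unfolding steiner_def using fiber_length_measurable[OF assms, of b] by measurable

lemma emeasure_slab:
  fixes A :: "'a::euclidean_space set"
  assumes "norm b = 1" and A[measurable]: "A \<in> sets borel"
  shows "emeasure lborel A = (\<integral>\<^sup>+x. indicator {x. 0 \<le> x \<bullet> b \<and> x \<bullet> b < 1} x * fiber_length A b x \<partial>lborel)"
proof -
  have "(\<integral>\<^sup>+t. indicator A (x + t *\<^sub>R b) \<partial>lborel) = fiber_length A b x" for x
  proof -
    have "indicator A (x + t *\<^sub>R b) = (indicator {t. x + t *\<^sub>R b \<in> A} t :: ennreal)" for t
      by (auto simp: indicator_def)
    then show ?thesis using fiber_measurable[OF A, of x b] by (simp add: fiber_length_def)
  qed
  then show ?thesis
    using nn_integral_slab[OF assms(1), of "indicator A"] by simp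
qed

lemma fiber_length_finite:
  fixes A :: "'a::euclidean_space set"
  assumes "norm b = 1" "bounded A"
  shows "fiber_length A b x < \<infinity>"
proof -
  obtain r where r: "\<And>y. y \<in> A \<Longrightarrow> norm y \<le> r" using assms(2) by (auto simp: bounded_iff)
  have "{t. x + t *\<^sub>R b \<in> A} \<subseteq> {-(r + norm x)..r + norm x}"
  proof
    fix t assume "t \<in> {t. x + t *\<^sub>R b \<in> A}"
    then have "norm (x + t *\<^sub>R b) \<le> r" using r by simp
    moreover have "norm (t *\<^sub>R b) \<le> norm (x + t *\<^sub>R b) + norm x"
      using norm_triangle_ineq4[of "x + t *\<^sub>R b" x] by simp
    ultimately show "t \<in> {-(r + norm x)..r + norm x}" using assms(1) by auto
  qed
  then have "fiber_length A b x \<le> emeasure lborel {-(r + norm x)..r + norm x}"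
    unfolding fiber_length_def by (intro emeasure_mono) auto
  also have "\<dots> < \<infinity>" by (simp add: emeasure_lborel_Icc_eq)
  finally show ?thesis .
qed

text \<open>Cavalieri: symmetrization keeps the length of every fibre, and the measure is the
  integral of these lengths over the slab.\<close>

lemma emeasure_steiner:
  fixes A :: "'a::euclidean_space set"
  assumes b: "norm b = 1" and A: "A \<in> sets borel" "bounded A"
  shows "emeasure lborel (steiner b A) = emeasure lborel A"
proof -
  have bb: "b \<bullet> b = 1" using b by (simp add: dot_square_norm)
  have "fiber_length (steiner b A) b x = fiber_length A b x" for x
  proof -
    obtain m where m: "fiber_length A b x = ennreal m" "m \<ge> 0"
      using fiber_length_finite[OF b A(2), of x] by (metis ennreal_cases infinity_ennreal_def less_irrefl)
    have "{t. x + t *\<^sub>R b \<in> steiner b A} = {-(x \<bullet> b) - m / 2 <..< -(x \<bullet> b) + m / 2}"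
      unfolding steiner_def using m fiber_length_shift[OF A(1)]
      by (auto simp: inner_add_left bb ennreal_less_iff abs_less_iff field_simps abs_if split: if_splits)
    then show ?thesis using m by (simp add: fiber_length_def[of "steiner b A"])
  qed
  then show ?thesis
    using emeasure_slab[OF b A(1)] emeasure_slab[OF b steiner_measurable[OF A(1)], of b] by simp
qed

text \<open>If all differences were at most \<open>c\<close>, the fibre over \<open>y\<close> would
  lie in an interval \<open>{l..h}\<close> and the one over \<open>x\<close> in
  \<open>{h - c..l + c}\<close>; the two lengths add up to only \<open>2 * c\<close>.\<close>

lemma steiner_spread:
  fixes A :: "'a::euclidean_space set"
  assumes lt: "ennreal (2 * c) < fiber_length A b x + fiber_length A b y" "c \<ge> 0"
    and pos: "0 < fiber_length A b x" "0 < fiber_length A b y"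
  shows "\<exists>t s. x + t *\<^sub>R b \<in> A \<and> y + s *\<^sub>R b \<in> A \<and> c < \<bar>t - s\<bar>"
proof (rule ccontr)
  assume neg: "\<not> ?thesis"
  define X where "X = {t. x + t *\<^sub>R b \<in> A}"
  define Y where "Y = {t. y + t *\<^sub>R b \<in> A}"
  have n: "t \<le> s + c" "s \<le> t + c" if "t \<in> X" "s \<in> Y" for t s
    using neg that by (force simp: X_def Y_def not_less)+
  have "X \<noteq> {}" "Y \<noteq> {}"
    using pos unfolding fiber_length_def X_def[symmetric] Y_def[symmetric] by auto
  then obtain t0 s0 where ts: "t0 \<in> X" "s0 \<in> Y" by auto
  have "bdd_below Y" "bdd_above Y"
    using n[OF ts(1)] by (auto intro!: bdd_belowI[of _ "t0 - c"] bdd_aboveI[of _ "t0 + c"] simp: diff_le_eq)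
  note bY = this
  define l where "l = Inf Y"
  define h where "h = Sup Y"
  have "Inf Y \<le> s0" "s0 \<le> Sup Y" using ts(2) bY by (auto intro: cInf_lower cSup_upper)
  then have lh: "l \<le> h" by (simp add: l_def h_def)
  have Y: "Y \<subseteq> {l..h}" unfolding l_def h_def using bY by (auto intro: cInf_lower cSup_upper)
  have X: "X \<subseteq> {h - c..l + c}"
  proof
    fix t assume t: "t \<in> X"
    have "h \<le> t + c" unfolding h_def by (rule cSup_least) (use ts n(2)[OF t] in auto)
    moreover have "t - c \<le> l"
      unfolding l_def by (rule cInf_greatest) (use ts n(1)[OF t] in \<open>auto simp: algebra_simps\<close>)
    ultimately show "t \<in> {h - c..l + c}" by auto
  qed
  have hc: "h - c \<le> l + c" using subsetD[OF X ts(1)] by auto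
  have "fiber_length A b x + fiber_length A b y \<le> ennreal (l + c - (h - c)) + ennreal (h - l)"
    unfolding fiber_length_def X_def[symmetric] Y_def[symmetric]
    using emeasure_mono[OF Y, of lborel] emeasure_mono[OF X, of lborel] lh hc
    by (intro add_mono) auto
  also have "\<dots> = ennreal (2 * c)"
    using lh hc by (subst ennreal_plus[symmetric]) auto
  finally show False using lt by simp
qed

text \<open>The distance splits into a part orthogonal to \<open>b\<close>, which depends on the two
  lines alone, and the difference of the coordinates along \<open>b\<close>. The latter is at most
  \<open>\<bar>p\<bar> + \<bar>r\<bar>\<close>, and \<open>steiner_spread\<close> finds points of
  \<open>A\<close> on the same lines that are farther apart along \<open>b\<close>.\<close>

lemma steiner_diameter:
  fixes A :: "'a::euclidean_space set"
  assumes A: "A \<in> sets borel" and b: "norm b = 1" and d: "\<And>x y. x \<in> A \<Longrightarrow> y \<in> A \<Longrightarrow> dist x y \<le> d"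
    and xy: "x \<in> steiner b A" "y \<in> steiner b A"
  shows "dist x y \<le> d"
proof -
  have bb: "b \<bullet> b = 1" using b by (simp add: dot_square_norm)
  define p where "p = x \<bullet> b"
  define r where "r = y \<bullet> b"
  define x' where "x' = x - p *\<^sub>R b"
  define y' where "y' = y - r *\<^sub>R b"
  have orth: "(x' - y') \<bullet> b = 0" by (simp add: x'_def y'_def p_def r_def inner_diff_left bb)
  have pyth: "(dist (x' + t *\<^sub>R b) (y' + s *\<^sub>R b))\<^sup>2 = (norm (x' - y'))\<^sup>2 + (t - s)\<^sup>2" for t s
  proof -
    have e: "x' + t *\<^sub>R b - (y' + s *\<^sub>R b) = (x' - y') + (t - s) *\<^sub>R b" by (simp add: algebra_simps)
    show ?thesis
      unfolding dist_norm e power2_norm_eq_inner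
      by (simp add: inner_add_left inner_add_right orth bb power2_eq_square inner_commute[of b "x' - y'"])
  qed
  have fx: "fiber_length A b x' = fiber_length A b x" "fiber_length A b y' = fiber_length A b y"
    using fiber_length_shift[OF A, of b x "- p"] fiber_length_shift[OF A, of b y "- r"]
    by (simp_all add: x'_def y'_def)
  have px: "ennreal (2 * \<bar>p\<bar>) < fiber_length A b x'" "ennreal (2 * \<bar>r\<bar>) < fiber_length A b y'"
    using xy unfolding fx p_def r_def steiner_def by auto
  have "ennreal (2 * (\<bar>p\<bar> + \<bar>r\<bar>)) = ennreal (2 * \<bar>p\<bar>) + ennreal (2 * \<bar>r\<bar>)"
    by (subst ennreal_plus[symmetric]) auto
  also have "\<dots> < fiber_length A b x' + fiber_length A b y'"
    using px by (rule add_strict_mono)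
  finally have "ennreal (2 * (\<bar>p\<bar> + \<bar>r\<bar>)) < fiber_length A b x' + fiber_length A b y'" .
  then obtain t s where ts: "x' + t *\<^sub>R b \<in> A" "y' + s *\<^sub>R b \<in> A" "\<bar>p\<bar> + \<bar>r\<bar> < \<bar>t - s\<bar>"
    using steiner_spread[of "\<bar>p\<bar> + \<bar>r\<bar>" A b x' y'] px by (auto intro: le_less_trans[OF zero_le])
  have "(p - r)\<^sup>2 \<le> (t - s)\<^sup>2"
    using ts(3) by (intro abs_le_square_iff[THEN iffD1]) auto
  then have "(dist (x' + p *\<^sub>R b) (y' + r *\<^sub>R b))\<^sup>2 \<le> (dist (x' + t *\<^sub>R b) (y' + s *\<^sub>R b))\<^sup>2"
    unfolding pyth by simp
  then have "dist (x' + p *\<^sub>R b) (y' + r *\<^sub>R b) \<le> dist (x' + t *\<^sub>R b) (y' + s *\<^sub>R b)"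
    by (rule power2_le_imp_le) simp
  also have "\<dots> \<le> d" using d ts by blast
  finally show ?thesis by (simp add: x'_def y'_def)
qed

text \<open>For a unit vector \<open>b\<close>, the reflection in the hyperplane orthogonal to
  it.\<close>

definition reflect :: "'a::euclidean_space \<Rightarrow> 'a \<Rightarrow> 'a" where
  "reflect b x = x - (2 * (x \<bullet> b)) *\<^sub>R b"

lemma steiner_reflect:
  fixes A :: "'a::euclidean_space set"
  assumes A: "A \<in> sets borel" and b: "norm b = 1" and x: "x \<in> steiner b A"
  shows "reflect b x \<in> steiner b A"
proof -
  have bb: "b \<bullet> b = 1" using b by (simp add: dot_square_norm)
  have "fiber_length A b (reflect b x) = fiber_length A b x"
    using fiber_length_shift[OF A, of b x "- (2 * (x \<bullet> b))"] by (simp add: reflect_def)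
  then show ?thesis
    using x by (simp add: steiner_def reflect_def inner_diff_left bb)
qed

text \<open>Reflection in a direction orthogonal to \<open>b\<close> permutes the lines along
  \<open>b\<close> and preserves the coordinate along them, so it preserves fibre lengths. Hence
  later symmetrizations keep the symmetries gained before.\<close>

lemma steiner_reflect_orthogonal:
  fixes A :: "'a::euclidean_space set"
  assumes c: "b \<bullet> c = 0" "norm c = 1" and sym: "\<And>x. x \<in> A \<Longrightarrow> reflect c x \<in> A" and x: "x \<in> steiner b A"
  shows "reflect c x \<in> steiner b A"
proof -
  have cc: "c \<bullet> c = 1" using c by (simp add: dot_square_norm)
  have inv: "reflect c (reflect c y) = y" for y
    by (simp add: reflect_def inner_diff_left cc)
  have "reflect c y \<in> A \<longleftrightarrow> y \<in> A" for y
    using sym[of y] sym[of "reflect c y"] inv by metis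
  moreover have "reflect c x + t *\<^sub>R b = reflect c (x + t *\<^sub>R b)" for t
    by (simp add: reflect_def inner_add_left c)
  ultimately have "fiber_length A b (reflect c x) = fiber_length A b x"
    by (simp add: fiber_length_def)
  moreover have "reflect c x \<bullet> b = x \<bullet> b"
    using c by (simp add: reflect_def inner_diff_left inner_commute[of c b])
  ultimately show ?thesis using x by (simp add: steiner_def)
qed

text \<open>Successive symmetrizations in the directions of \<open>B\<close>; each gains one
  reflection symmetry and loses none.\<close>

lemma steiner_symmetrization:
  fixes A :: "'a::euclidean_space set"
  assumes A: "A \<in> sets borel" "bounded A" and d: "\<And>x y. x \<in> A \<Longrightarrow> y \<in> A \<Longrightarrow> dist x y \<le> d"
    and B: "B \<subseteq> Basis"
  shows "\<exists>A' :: 'a set. A' \<in> sets borel \<and> bounded A' \<and> emeasure lborel A' = emeasure lborel A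
    \<and> (\<forall>x\<in>A'. \<forall>y\<in>A'. dist x y \<le> d) \<and> (\<forall>b\<in>B. \<forall>x\<in>A'. reflect b x \<in> A')"
  using finite_subset[OF B finite_Basis] B
proof (induction B rule: finite_induct)
  case empty
  show ?case using A d by (intro exI[of _ A]) auto
next
  case (insert b B)
  then obtain A' where A': "A' \<in> sets borel" "bounded A'" "emeasure lborel A' = emeasure lborel A"
    "\<And>x y. x \<in> A' \<Longrightarrow> y \<in> A' \<Longrightarrow> dist x y \<le> d" "\<And>c x. c \<in> B \<Longrightarrow> x \<in> A' \<Longrightarrow> reflect c x \<in> A'"
    by auto
  have b: "norm b = 1" using insert.prems by auto
  let ?S = "steiner b A'"
  have 1: "dist x y \<le> d" if "x \<in> ?S" "y \<in> ?S" for x y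
    using steiner_diameter[OF A'(1) b A'(4)] that by blast
  have "reflect c x \<in> ?S" if "c \<in> insert b B" "x \<in> ?S" for c x
  proof (cases "c = b")
    case True
    then show ?thesis using steiner_reflect[OF A'(1) b that(2)] by simp
  next
    case False
    then have "b \<bullet> c = 0" "norm c = 1" "c \<in> B"
      using that insert.prems by (auto simp: inner_Basis)
    then show ?thesis using steiner_reflect_orthogonal[OF _ _ A'(5) that(2)] by blast
  qed
  moreover have "bounded ?S"
    unfolding bounded_def using 1 by blast
  ultimately show ?case
    using steiner_measurable[OF A'(1), of b] emeasure_steiner[OF b A'(1,2)] A'(3) 1
    by (intro exI[of _ ?S]) auto
qed

text \<open>After symmetrization in all coordinate directions the set is invariant under
  \<open>x \<mapsto> - x\<close>. Opposite points are at distance at most \<open>d\<close>, so the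
  set lies in the ball of radius \<open>d / 2\<close> about the origin.\<close>

theorem isodiametric_inequality:
  fixes A :: "'a::euclidean_space set"
  assumes A: "A \<in> sets borel" "bounded A" and d: "\<And>x y. x \<in> A \<Longrightarrow> y \<in> A \<Longrightarrow> dist x y \<le> d"
    and "d \<ge> 0"
  shows "emeasure lborel A \<le> ennreal (unit_ball_vol (real DIM('a)) * (d / 2) ^ DIM('a))"
proof -
  obtain A' :: "'a set" where A': "A' \<in> sets borel" "emeasure lborel A' = emeasure lborel A"
    "\<And>x y. x \<in> A' \<Longrightarrow> y \<in> A' \<Longrightarrow> dist x y \<le> d" "\<And>b x. b \<in> Basis \<Longrightarrow> x \<in> A' \<Longrightarrow> reflect b x \<in> A'"
    using steiner_symmetrization[OF A d order_refl] by blast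
  \<comment> \<open>Composing the reflections of \<open>B\<close> flips exactly these coordinates;
    \<open>B = Basis\<close> gives \<open>- x\<close>.\<close>
  have refl: "x - (\<Sum>b\<in>B. (2 * (x \<bullet> b)) *\<^sub>R b) \<in> A'" if "x \<in> A'" "B \<subseteq> Basis" for x B
    using finite_subset[OF that(2) finite_Basis] that(2)
  proof (induction B rule: finite_induct)
    case (insert b B)
    let ?y = "x - (\<Sum>b\<in>B. (2 * (x \<bullet> b)) *\<^sub>R b)"
    have "(\<Sum>c\<in>B. (2 * (x \<bullet> c)) *\<^sub>R c) \<bullet> b = 0"
      using insert by (auto simp: inner_sum_left inner_Basis intro!: sum.neutral)
    then have "?y \<bullet> b = x \<bullet> b" by (simp add: inner_diff_left)
    then have "reflect b ?y = x - (\<Sum>b\<in>insert b B. (2 * (x \<bullet> b)) *\<^sub>R b)"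
      using insert by (simp add: reflect_def algebra_simps)
    moreover have "reflect b ?y \<in> A'" using insert A'(4) by auto
    ultimately show ?case by simp
  qed (use that in simp)
  have "A' \<subseteq> cball 0 (d / 2)"
  proof
    fix x assume x: "x \<in> A'"
    have "(\<Sum>b\<in>Basis. (2 * (x \<bullet> b)) *\<^sub>R b) = 2 *\<^sub>R x"
      by (subst (2) euclidean_representation[of x, symmetric]) (simp add: scaleR_sum_right)
    then have "- x \<in> A'" using refl[OF x order_refl] by (simp add: scaleR_2)
    then have "dist x (- x) \<le> d" using A'(3) x by blast
    moreover have "x - (- x) = 2 *\<^sub>R x" by (simp add: scaleR_2)
    ultimately show "x \<in> cball 0 (d / 2)" by (simp add: dist_norm)
  qed
  then have "emeasure lborel A' \<le> emeasure lborel (cball 0 (d / 2) :: 'a set)"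
    by (rule emeasure_mono) simp
  then show ?thesis using A'(2) emeasure_cball[of "d / 2" "0::'a"] \<open>d \<ge> 0\<close> by simp
qed

section \<open>The scalar curvature of a graph as a divergence\<close>

lemma partial_eqI: "(h has_derivative h') (at x) \<Longrightarrow> partial i h x = h' (axis i 1)"
  unfolding partial_def by (rule dir_deriv_eqI)

lemma Ck_partial: "Ck (Suc k) h \<Longrightarrow> Ck k (partial i h)"
  unfolding partial_def by (simp add: Ck.simps(2))

lemma Ck1_dir_deriv_eq_partial:
  assumes "Ck 1 h"
  shows "dir_deriv h v x = (\<Sum>i\<in>UNIV. (v $ i) * partial i h x)"
proof -
  have lin: "linear (\<lambda>v. dir_deriv h v x)"
    using has_derivative_linear[OF Ck1_has_derivative[OF assms]] .
  have "dir_deriv h v x = dir_deriv h (\<Sum>i\<in>UNIV. (v $ i) *\<^sub>R axis i 1) x"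
    by (subst vec_eq_sum_axis[of v]) simp
  also have "\<dots> = (\<Sum>i\<in>UNIV. (v $ i) * partial i h x)"
    unfolding partial_def by (simp only: linear_sum[OF lin] linear_cmul[OF lin] real_scaleR_def)
  finally show ?thesis .
qed

lemma Ck1_has_derivative_grad:
  assumes "Ck 1 h" shows "(h has_derivative (\<lambda>v. grad h x \<bullet> v)) (at x)"
proof -
  have "(\<lambda>v. dir_deriv h v x) = (\<lambda>v. grad h x \<bullet> v)"
    by (rule ext) (simp add: Ck1_dir_deriv_eq_partial[OF assms] grad_def inner_vec_def mult.commute)
  with Ck1_has_derivative[OF assms, of x] show ?thesis by simp
qed

lemma partial_const: "partial i (\<lambda>x. c) x = 0"
  by (subst partial_eqI[OF has_derivative_const]) simp

lemma partial_add:
  "Ck 1 f \<Longrightarrow> Ck 1 g \<Longrightarrow> partial i (\<lambda>x. f x + g x) x = partial i f x + partial i g x"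
  by (subst partial_eqI[OF has_derivative_add[OF Ck1_has_derivative Ck1_has_derivative]])
    (auto simp: partial_def)

lemma partial_diff:
  "Ck 1 f \<Longrightarrow> Ck 1 g \<Longrightarrow> partial i (\<lambda>x. f x - g x) x = partial i f x - partial i g x"
  by (subst partial_eqI[OF has_derivative_diff[OF Ck1_has_derivative Ck1_has_derivative]])
    (auto simp: partial_def)

lemma partial_mult:
  "Ck 1 f \<Longrightarrow> Ck 1 g \<Longrightarrow> partial i (\<lambda>x. f x * g x) x = partial i f x * g x + f x * partial i g x"
  by (subst partial_eqI[OF has_derivative_mult[OF Ck1_has_derivative Ck1_has_derivative]])
    (auto simp: partial_def)

lemma partial_sum:
  assumes "\<And>i. i \<in> I \<Longrightarrow> Ck 1 (f i)"
  shows "partial j (\<lambda>x. \<Sum>i\<in>I. f i x) x = (\<Sum>i\<in>I. partial j (f i) x)"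
  by (subst partial_eqI[OF has_derivative_sum[OF Ck1_has_derivative[OF assms]]])
    (auto simp: partial_def)

lemma partial_inverse:
  "Ck 1 f \<Longrightarrow> f x \<noteq> 0 \<Longrightarrow> partial i (\<lambda>x. inverse (f x)) x = - (inverse (f x))\<^sup>2 * partial i f x"
  by (subst partial_eqI[OF Deriv.has_derivative_inverse[OF _ Ck1_has_derivative]])
    (auto simp: partial_def power2_eq_square)

text \<open>\<open>matrix_inv\<close> is a choice among two-sided inverses, so uniqueness of the
  inverse is what identifies it.\<close>

lemma matrix_inv_eqI:
  fixes A B :: "real^'n^'n"
  assumes "A ** B = mat 1" "B ** A = mat 1"
  shows "matrix_inv A = B"
proof -
  have "invertible A" using assms by (auto simp: invertible_def)
  then have "A ** matrix_inv A = mat 1" "matrix_inv A ** A = mat 1"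
    unfolding invertible_def matrix_inv_def
    by (metis (mono_tags, lifting) someI_ex)+
  then have "matrix_inv A = (B ** A) ** matrix_inv A" using assms by simp
  also have "\<dots> = B" using \<open>A ** matrix_inv A = mat 1\<close> by (simp add: matrix_mul_assoc[symmetric])
  finally show ?thesis .
qed

lemma UNIV_3_distinct: "(1::3) \<noteq> 2" "(1::3) \<noteq> 3" "(2::3) \<noteq> 3" "(2::3) \<noteq> 1" "(3::3) \<noteq> 1" "(3::3) \<noteq> 2"
  by simp_all

locale C4_function =
  fixes u :: "real^3 \<Rightarrow> real"
  assumes C4: "Ck 4 u"
begin

definition d1 where "d1 i = partial i u"
definition d2 where "d2 i j = partial i (d1 j)"
definition d3 where "d3 i j k = partial i (d2 j k)"
definition slope2 where "slope2 x = (\<Sum>i\<in>UNIV. (d1 i x)\<^sup>2)"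
definition lap where "lap x = (\<Sum>i\<in>UNIV. d2 i i x)"
definition hessgrad where "hessgrad i x = (\<Sum>j\<in>UNIV. d2 i j x * d1 j x)"
definition hessgrad2 where "hessgrad2 x = (\<Sum>i\<in>UNIV. hessgrad i x * d1 i x)"
definition q where "q x = inverse (1 + slope2 x)"
text \<open>\<open>mcnum / norm (grad u) ^ 3\<close> is the mean curvature of the level sets.\<close>
definition mcnum where "mcnum x = lap x * slope2 x - hessgrad2 x"
text \<open>The Gauss equation of the graph in a flat ambient space: squared trace minus squared
  norm of the second fundamental form \<open>sqrt q * d2\<close>, both taken with the inverse
  metric.\<close>

definition scal where
  "scal x = q x * ((lap x)\<^sup>2 - (\<Sum>i\<in>UNIV. \<Sum>j\<in>UNIV. (d2 i j x)\<^sup>2))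
     - 2 * (q x)\<^sup>2 * (lap x * hessgrad2 x - (\<Sum>i\<in>UNIV. (hessgrad i x)\<^sup>2))"
definition flux :: "real^3 \<Rightarrow> real^3" where
  "flux x = (\<chi> i. q x * (lap x * d1 i x - hessgrad i x))"

lemma C1_u: "Ck 1 u"
proof -
  have "Ck (Suc 3) u" using C4 by simp
  then show ?thesis by (rule Ck_Suc_imp_Ck1)
qed

lemma C3_d1: "Ck 3 (d1 i)"
proof -
  have "Ck (Suc 3) u" using C4 by simp
  then show ?thesis unfolding d1_def by (rule Ck_partial)
qed

lemma C1_d1: "Ck 1 (d1 i)"
proof -
  have "Ck (Suc 2) (d1 i)" using C3_d1 by simp
  then show ?thesis by (rule Ck_Suc_imp_Ck1)
qed

lemma C1_d2: "Ck 1 (d2 i j)"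
proof -
  have "Ck (Suc 2) (d1 j)" using C3_d1 by simp
  then have "Ck 2 (d2 i j)" unfolding d2_def by (rule Ck_partial)
  then have "Ck (Suc 1) (d2 i j)" by simp
  then show ?thesis by (rule Ck_Suc_imp_Ck1)
qed

lemma C1_slope2: "Ck 1 slope2"
  unfolding slope2_def power2_eq_square by (intro Ck1_sum Ck1_mult C1_d1)

lemma C1_lap: "Ck 1 lap"
  unfolding lap_def by (intro Ck1_sum C1_d2)

lemma C1_hessgrad: "Ck 1 (hessgrad i)"
  unfolding hessgrad_def by (intro Ck1_sum Ck1_mult C1_d1 C1_d2)

lemma slope2_nonneg: "slope2 x \<ge> 0"
  by (simp add: slope2_def sum_nonneg)

lemma W_pos: "1 + slope2 x > 0"
  using slope2_nonneg[of x] by simp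

lemma C1_q: "Ck 1 q"
  unfolding q_def using W_pos by (intro Ck1_inverse Ck1_add Ck1_const C1_slope2) (metis less_irrefl)

lemma C1_flux: "Ck 1 flux"
  unfolding flux_def by (intro Ck1_vecI) (simp, intro Ck1_mult Ck1_diff C1_q C1_lap C1_d1 C1_hessgrad)

lemma q_pos: "q x > 0" "q x \<le> 1"
  using slope2_nonneg[of x] W_pos[of x] by (auto simp: q_def inverse_le_1_iff)

lemma q_W: "q x * (1 + slope2 x) = 1"
  using W_pos[of x] by (simp add: q_def)

lemma d2_sym: "d2 i j x = d2 j i x"
  using dir_deriv_commute[OF C1_u, of "axis i 1" "axis j 1" x] C1_d1
  by (simp add: d2_def d1_def partial_def[abs_def])

lemma d3_sym: "d3 i j k x = d3 j i k x"
  using dir_deriv_commute[OF C1_d1[of k], of "axis i 1" "axis j 1" x] C1_d2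
  by (simp add: d3_def d2_def partial_def[abs_def])

lemma d3_sym2: "d3 i j k x = d3 i k j x"
proof -
  have "d2 j k = d2 k j" using d2_sym by blast
  then show ?thesis by (simp add: d3_def)
qed

lemma partial_slope2: "partial i slope2 x = 2 * hessgrad i x"
proof -
  have "partial i slope2 x = (\<Sum>j\<in>UNIV. partial i (\<lambda>x. d1 j x * d1 j x) x)"
    unfolding slope2_def[abs_def] power2_eq_square by (rule partial_sum) (intro Ck1_mult C1_d1)
  then show ?thesis
    by (simp add: partial_mult C1_d1 d2_def[symmetric] hessgrad_def sum_distrib_left sum.distrib mult.commute)
qed

lemma partial_q: "partial i q x = - 2 * (q x)\<^sup>2 * hessgrad i x"
proof -
  have "partial i q x = - (q x)\<^sup>2 * partial i (\<lambda>x. 1 + slope2 x) x"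
    unfolding q_def[abs_def] using W_pos[of x]
    by (subst partial_inverse) (auto intro!: Ck1_add Ck1_const C1_slope2)
  then show ?thesis
    by (simp add: partial_add Ck1_const C1_slope2 partial_const partial_slope2)
qed

lemma partial_lap: "partial i lap x = (\<Sum>j\<in>UNIV. d3 i j j x)"
  unfolding lap_def[abs_def] d3_def by (rule partial_sum) (rule C1_d2)

lemma partial_hessgrad: "partial k (hessgrad i) x = (\<Sum>j\<in>UNIV. d3 k i j x * d1 j x + d2 i j x * d2 k j x)"
  unfolding hessgrad_def[abs_def]
  by (subst partial_sum) (auto intro!: Ck1_mult C1_d1 C1_d2 simp: partial_mult C1_d1 C1_d2 d3_def d2_def[symmetric])

text \<open>The third derivatives cancel: the gradient of the Laplacian paired with
  \<open>Du\<close> occurs with both signs, by symmetry of \<open>d3\<close>. What remains is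
  quadratic in the Hessian.\<close>

lemma divergence_flux: "divergence flux x = scal x"
proof -
  have "divergence flux x = (\<Sum>i\<in>UNIV. partial i (\<lambda>x. q x * (lap x * d1 i x - hessgrad i x)) x)"
    unfolding divergence_def partial_def dir_deriv_vec_nth[OF C1_flux, symmetric] by (simp add: flux_def)
  also have "\<dots> = (\<Sum>i\<in>UNIV. - 2 * (q x)\<^sup>2 * hessgrad i x * (lap x * d1 i x - hessgrad i x)
     + q x * ((\<Sum>j\<in>UNIV. d3 i j j x) * d1 i x + lap x * d2 i i x - (\<Sum>j\<in>UNIV. d3 i i j x * d1 j x + d2 i j x * d2 i j x)))"
    by (simp add: partial_mult partial_diff C1_q C1_lap C1_d1 C1_hessgrad Ck1_diff Ck1_mult
        partial_q partial_lap partial_hessgrad d2_def[symmetric])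
  also have "\<dots> = scal x"
  proof -
    have "(\<Sum>i\<in>UNIV. (\<Sum>j\<in>UNIV. d3 i j j x) * d1 i x) = (\<Sum>i\<in>UNIV. \<Sum>j\<in>UNIV. d3 i i j x * d1 j x)"
    proof -
      have "(\<Sum>i\<in>UNIV. (\<Sum>j\<in>UNIV. d3 i j j x) * d1 i x) = (\<Sum>i\<in>UNIV. \<Sum>j\<in>UNIV. d3 i j j x * d1 i x)"
        by (simp add: sum_distrib_right)
      also have "\<dots> = (\<Sum>i\<in>UNIV. \<Sum>j\<in>UNIV. d3 j j i x * d1 i x)"
      proof (intro sum.cong refl)
        fix i j
        show "d3 i j j x * d1 i x = d3 j j i x * d1 i x" using d3_sym[of i j j x] d3_sym2[of j i j x] by simp
      qed
      also have "\<dots> = (\<Sum>i\<in>UNIV. \<Sum>j\<in>UNIV. d3 i i j x * d1 j x)" by (rule sum.swap)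
      finally show ?thesis .
    qed
    moreover define A where "A i = (\<Sum>j\<in>UNIV. d3 i j j x)" for i
    moreover define B where "B i = (\<Sum>j\<in>UNIV. d3 i i j x * d1 j x)" for i
    moreover define C where "C i = (\<Sum>j\<in>UNIV. (d2 i j x)\<^sup>2)" for i
    ultimately have AB: "(\<Sum>i\<in>UNIV. A i * d1 i x) = (\<Sum>i\<in>UNIV. B i)" by simp
    have "(\<Sum>i\<in>UNIV. - 2 * (q x)\<^sup>2 * hessgrad i x * (lap x * d1 i x - hessgrad i x)
        + q x * (A i * d1 i x + lap x * d2 i i x - (B i + C i)))
      = - 2 * (q x)\<^sup>2 * (lap x * hessgrad2 x - (\<Sum>i\<in>UNIV. (hessgrad i x)\<^sup>2))
        + q x * ((\<Sum>i\<in>UNIV. A i * d1 i x) + lap x * (\<Sum>i\<in>UNIV. d2 i i x) - ((\<Sum>i\<in>UNIV. B i) + (\<Sum>i\<in>UNIV. C i)))"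
      unfolding hessgrad2_def by (simp add: sum_3 algebra_simps power2_eq_square)
    also have "\<dots> = scal x"
      unfolding AB by (simp add: scal_def lap_def[symmetric] C_def power2_eq_square)
    finally show ?thesis
      by (simp add: A_def B_def C_def sum.distrib power2_eq_square)
  qed
  finally show ?thesis .
qed

lemma flux_inner_grad: "flux x \<bullet> grad u x = q x * mcnum x"
  by (simp add: flux_def grad_def d1_def[symmetric] inner_vec_def mcnum_def hessgrad2_def slope2_def
      sum_distrib_left sum_subtractf[symmetric] power2_eq_square algebra_simps)

end

text \<open>The metric is a rank one perturbation of the identity, so its inverse and its
  Christoffel symbols have closed forms in \<open>q\<close>; third derivatives enter the Ricci
  tensor only through a difference that vanishes by symmetry.\<close>

lemma scalar_curvature_graph_metric:
  assumes "Ck 4 (f \<circ> proj a)"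
  shows "scalar_curvature (graph_metric a f) x = C4_function.scal (f \<circ> proj a) x"
proof -
  define u where "u = f \<circ> proj a"
  interpret C4_function u by standard (use assms in \<open>simp add: u_def\<close>)
  define g where "g = graph_metric a f"
  have g: "g x $ i $ j = (if i = j then 1 else 0) + d1 i x * d1 j x" for x i j
    by (simp add: g_def graph_metric_def flat_metric_def mat_def d1_def flip: u_def)
  \<comment> \<open>The Sherman-Morrison formula.\<close>
  have inv: "matrix_inv (g x) = (\<chi> i j. (if i = j then 1 else 0) - q x * d1 i x * d1 j x)" for x
  proof (rule matrix_inv_eqI)
    have *: "d1 i x * d1 j x = q x * (d1 i x * d1 j x) + q x * (d1 i x * d1 j x) * slope2 x" for i j
    proof -
      have "d1 i x * d1 j x = (d1 i x * d1 j x) * (q x * (1 + slope2 x))" unfolding q_W by simp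
      then show ?thesis by (simp add: algebra_simps)
    qed
    have 1: "(\<Sum>k\<in>UNIV. ((if i = k then 1 else 0) + d1 i x * d1 k x) * ((if k = j then 1 else 0) - q x * d1 k x * d1 j x))
        = (if i = j then 1 else 0) + d1 i x * d1 j x - (q x * (d1 i x * d1 j x) + q x * (d1 i x * d1 j x) * slope2 x)" for i j
      using exhaust_3[of i] exhaust_3[of j]
      by (elim disjE) (simp_all add: sum_3 slope2_def UNIV_3_distinct algebra_simps power2_eq_square)
    have 2: "(\<Sum>k\<in>UNIV. ((if i = k then 1 else 0) - q x * d1 i x * d1 k x) * ((if k = j then 1 else 0) + d1 k x * d1 j x))
        = (if i = j then 1 else 0) + d1 i x * d1 j x - (q x * (d1 i x * d1 j x) + q x * (d1 i x * d1 j x) * slope2 x)" for i j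
      using exhaust_3[of i] exhaust_3[of j]
      by (elim disjE) (simp_all add: sum_3 slope2_def UNIV_3_distinct algebra_simps power2_eq_square)
    show "g x ** (\<chi> i j. (if i = j then 1 else 0) - q x * d1 i x * d1 j x) = mat 1"
      unfolding vec_eq_iff matrix_matrix_mult_def vec_lambda_beta g 1 *[symmetric] by (simp add: mat_def)
    show "(\<chi> i j. (if i = j then 1 else 0) - q x * d1 i x * d1 j x) ** g x = mat 1"
      unfolding vec_eq_iff matrix_matrix_mult_def vec_lambda_beta g 2 *[symmetric] by (simp add: mat_def)
  qed
  have dg: "partial k (\<lambda>y. g y $ i $ j) x = d2 k i x * d1 j x + d1 i x * d2 k j x" for i j k x
    by (simp add: g partial_add partial_mult partial_const Ck1_const Ck1_mult C1_d1 d2_def)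
  \<comment> \<open>Only the terms with \<open>d2 i j\<close> survive in the bracket
    \<open>br\<close>; contraction with the inverse metric turns \<open>d1\<close> into
    \<open>q * d1\<close>.\<close>
  have chr: "christoffel g k i j = (\<lambda>x. q x * (d1 k x * d2 i j x))" for k i j
  proof
    fix x
    have br: "partial i (\<lambda>y. g y $ j $ l) x + partial j (\<lambda>y. g y $ i $ l) x - partial l (\<lambda>y. g y $ i $ j) x
       = 2 * (d2 i j x * d1 l x)" for l
      unfolding dg using d2_sym[of j i x] d2_sym[of l i x] d2_sym[of l j x] by (simp add: algebra_simps)
    have "christoffel g k i j x = (\<Sum>l\<in>UNIV. ((if k = l then 1 else 0) - q x * d1 k x * d1 l x) * (d2 i j x * d1 l x))"
      unfolding christoffel_def br inv by (simp add: sum_divide_distrib)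
    also have "\<dots> = d2 i j x * d1 k x - q x * d1 k x * d2 i j x * slope2 x"
      using exhaust_3[of k]
      by (elim disjE) (simp_all add: sum_3 slope2_def UNIV_3_distinct algebra_simps power2_eq_square)
    also have "\<dots> = q x * (d1 k x * d2 i j x)"
    proof -
      have "d2 i j x * d1 k x * (q x * (1 + slope2 x)) = d2 i j x * d1 k x" unfolding q_W by simp
      then show ?thesis by (simp add: algebra_simps)
    qed
    finally show "christoffel g k i j x = q x * (d1 k x * d2 i j x)" .
  qed
  have dchr: "partial l (christoffel g k i j) x
      = - 2 * (q x)\<^sup>2 * hessgrad l x * (d1 k x * d2 i j x) + q x * (d2 l k x * d2 i j x + d1 k x * d3 l i j x)" for l k i j x
    unfolding chr by (simp add: partial_mult C1_q C1_d1 C1_d2 Ck1_mult partial_q d2_def[symmetric] d3_def[symmetric])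
  \<comment> \<open>The terms with \<open>d3\<close> cancel here, by \<open>d3_sym\<close>.\<close>
  have ric: "ricci g j k x = q x * (lap x * d2 j k x - (\<Sum>i\<in>UNIV. d2 i j x * d2 i k x))
      - (q x)\<^sup>2 * hessgrad2 x * d2 j k x + (q x)\<^sup>2 * hessgrad j x * hessgrad k x" for j k x
  proof -
    have s: "d3 j i k x = d3 i j k x" for i using d3_sym by blast
    have t: "d2 j 1 x = d2 1 j x" "d2 j 2 x = d2 2 j x" "d2 j 3 x = d2 3 j x"
      "d2 k 1 x = d2 1 k x" "d2 k 2 x = d2 2 k x" "d2 k 3 x = d2 3 k x" using d2_sym by blast+
    have "ricci g j k x = (\<Sum>i\<in>UNIV.
       - 2 * (q x)\<^sup>2 * hessgrad i x * (d1 i x * d2 j k x) + q x * (d2 i i x * d2 j k x)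
       - (- 2 * (q x)\<^sup>2 * hessgrad j x * (d1 i x * d2 i k x) + q x * (d2 i j x * d2 i k x))
       + (\<Sum>m\<in>UNIV. (q x * (d1 i x * d2 i m x)) * (q x * (d1 m x * d2 j k x))
            - (q x * (d1 i x * d2 m j x)) * (q x * (d1 m x * d2 i k x))))"
      unfolding ricci_def dchr unfolding chr
    proof (rule sum.cong[OF refl])
      fix i
      have "d2 j m x = d2 m j x" for m using d2_sym by blast
      then show "- 2 * (q x)\<^sup>2 * hessgrad i x * (d1 i x * d2 j k x) + q x * (d2 i i x * d2 j k x + d1 i x * d3 i j k x)
         - (- 2 * (q x)\<^sup>2 * hessgrad j x * (d1 i x * d2 i k x) + q x * (d2 j i x * d2 i k x + d1 i x * d3 j i k x))
         + (\<Sum>m\<in>UNIV. q x * (d1 i x * d2 i m x) * (q x * (d1 m x * d2 j k x)) - q x * (d1 i x * d2 j m x) * (q x * (d1 m x * d2 i k x)))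
        = - 2 * (q x)\<^sup>2 * hessgrad i x * (d1 i x * d2 j k x) + q x * (d2 i i x * d2 j k x)
       - (- 2 * (q x)\<^sup>2 * hessgrad j x * (d1 i x * d2 i k x) + q x * (d2 i j x * d2 i k x))
       + (\<Sum>m\<in>UNIV. (q x * (d1 i x * d2 i m x)) * (q x * (d1 m x * d2 j k x))
            - (q x * (d1 i x * d2 m j x)) * (q x * (d1 m x * d2 i k x)))"
        by (simp add: s algebra_simps)
    qed
    also have "\<dots> = - 2 * (q x)\<^sup>2 * (\<Sum>i\<in>UNIV. hessgrad i x * d1 i x) * d2 j k x + q x * (\<Sum>i\<in>UNIV. d2 i i x) * d2 j k x
       + 2 * (q x)\<^sup>2 * hessgrad j x * (\<Sum>i\<in>UNIV. d2 k i x * d1 i x) - q x * (\<Sum>i\<in>UNIV. d2 i j x * d2 i k x)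
       + (q x)\<^sup>2 * (\<Sum>i\<in>UNIV. (\<Sum>m\<in>UNIV. d2 i m x * d1 m x) * d1 i x) * d2 j k x
       - (q x)\<^sup>2 * (\<Sum>m\<in>UNIV. d2 j m x * d1 m x) * (\<Sum>i\<in>UNIV. d2 k i x * d1 i x)"
      unfolding sum_3 t by (simp add: algebra_simps power2_eq_square)
    finally show ?thesis
      unfolding hessgrad_def[symmetric] hessgrad2_def[symmetric] lap_def[symmetric]
      by (simp add: algebra_simps)
  qed
  define M where "M j k = (\<Sum>i\<in>UNIV. d2 i j x * d2 i k x)" for j k
  have M: "(\<Sum>j\<in>UNIV. \<Sum>k\<in>UNIV. d1 j x * d1 k x * M j k) = (\<Sum>i\<in>UNIV. (hessgrad i x)\<^sup>2)"
    unfolding M_def hessgrad_def by (simp add: sum_3 algebra_simps power2_eq_square)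
  have M1: "(\<Sum>j\<in>UNIV. M j j) = (\<Sum>i\<in>UNIV. \<Sum>j\<in>UNIV. (d2 i j x)\<^sup>2)"
    unfolding M_def by (simp add: sum_3 power2_eq_square)
  have a: "(\<Sum>j\<in>UNIV. \<Sum>k\<in>UNIV. d1 j x * d1 k x * d2 j k x) = hessgrad2 x"
    unfolding hessgrad2_def hessgrad_def by (simp add: sum_3 algebra_simps)
  have h: "(\<Sum>j\<in>UNIV. \<Sum>k\<in>UNIV. d1 j x * d1 k x * (hessgrad j x * hessgrad k x)) = (hessgrad2 x)\<^sup>2"
    unfolding hessgrad2_def by (simp add: sum_3 algebra_simps power2_eq_square)
  define r where "r j k = q x * (lap x * d2 j k x - M j k)
      - (q x)\<^sup>2 * hessgrad2 x * d2 j k x + (q x)\<^sup>2 * (hessgrad j x * hessgrad k x)" for j k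
  have "scalar_curvature g x
      = (\<Sum>j\<in>UNIV. \<Sum>k\<in>UNIV. ((if j = k then 1 else 0) - q x * d1 j x * d1 k x) * r j k)"
    unfolding scalar_curvature_def ric inv r_def M_def by (simp add: mult.assoc)
  also have "\<dots> = (\<Sum>j\<in>UNIV. r j j) - q x * (\<Sum>j\<in>UNIV. \<Sum>k\<in>UNIV. d1 j x * d1 k x * r j k)"
    by (simp add: sum_3 UNIV_3_distinct algebra_simps)
  also have "(\<Sum>j\<in>UNIV. r j j) = q x * (lap x * lap x - (\<Sum>j\<in>UNIV. M j j))
      - (q x)\<^sup>2 * hessgrad2 x * lap x + (q x)\<^sup>2 * (\<Sum>j\<in>UNIV. (hessgrad j x)\<^sup>2)"
    unfolding r_def lap_def by (simp add: sum_3 algebra_simps power2_eq_square)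
  also have "(\<Sum>j\<in>UNIV. \<Sum>k\<in>UNIV. d1 j x * d1 k x * r j k)
      = q x * (lap x * (\<Sum>j\<in>UNIV. \<Sum>k\<in>UNIV. d1 j x * d1 k x * d2 j k x) - (\<Sum>j\<in>UNIV. \<Sum>k\<in>UNIV. d1 j x * d1 k x * M j k))
      - (q x)\<^sup>2 * hessgrad2 x * (\<Sum>j\<in>UNIV. \<Sum>k\<in>UNIV. d1 j x * d1 k x * d2 j k x)
      + (q x)\<^sup>2 * (\<Sum>j\<in>UNIV. \<Sum>k\<in>UNIV. d1 j x * d1 k x * (hessgrad j x * hessgrad k x))"
    unfolding r_def by (simp add: sum_3 algebra_simps)
  finally have "scalar_curvature g x = scal x"
    unfolding M M1 a h scal_def by (simp add: algebra_simps power2_eq_square)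
  then show ?thesis by (simp add: g_def u_def)
qed

section \<open>Hausdorff measure of full dimension\<close>

text \<open>The term of a cover in \<open>hausdorff_pre\<close>. The empty set is set apart because
  for \<open>k = 0\<close> the formula would give it weight 1.\<close>

definition hausdorff_weight :: "nat \<Rightarrow> 'a::euclidean_space set \<Rightarrow> ennreal" where
  "hausdorff_weight k S =
     (if S = {} then 0 else ennreal (unit_ball_vol (real k) * (diameter S / 2) ^ k))"

lemma hausdorff_pre_eq:
  "hausdorff_pre k \<delta> A =
     (INF C \<in> {C :: nat \<Rightarrow> 'a::euclidean_space set. A \<subseteq> (\<Union>j. C j) \<and> (\<forall>j. bounded (C j) \<and> diameter (C j) \<le> \<delta>)}.
        \<Sum>j. hausdorff_weight k (C j))"
  unfolding hausdorff_pre_def hausdorff_weight_def ..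

text \<open>The index set is enumerated and the sequence is padded with empty sets, which weigh
  0.\<close>

lemma hausdorff_pre_le_countable:
  fixes S :: "'i \<Rightarrow> 'a::euclidean_space set"
  assumes I: "countable I" and cov: "A \<subseteq> (\<Union>i\<in>I. S i)" and \<delta>: "\<delta> \<ge> 0"
    and S: "\<And>i. i \<in> I \<Longrightarrow> bounded (S i) \<and> diameter (S i) \<le> \<delta>"
  shows "hausdorff_pre k \<delta> A \<le> (\<integral>\<^sup>+i. hausdorff_weight k (S i) \<partial>count_space I)"
proof -
  define J where "J = to_nat_on I ` I"
  define C where "C j = (if j \<in> J then S (from_nat_into I j) else {})" for j
  have bij: "bij_betw (to_nat_on I) I J"
    using I unfolding J_def by (intro inj_on_imp_bij_betw inj_on_to_nat_on)
  have into: "from_nat_into I (to_nat_on I i) = i" if "i \<in> I" for i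
    using that I by simp
  have "A \<subseteq> (\<Union>j. C j)"
  proof
    fix x assume "x \<in> A"
    then obtain i where i: "i \<in> I" "x \<in> S i" using cov by auto
    then have "x \<in> C (to_nat_on I i)" by (simp add: C_def J_def into)
    then show "x \<in> (\<Union>j. C j)" by blast
  qed
  moreover have "bounded (C j) \<and> diameter (C j) \<le> \<delta>" for j
    using S \<delta> by (auto simp: C_def J_def into)
  ultimately have "hausdorff_pre k \<delta> A \<le> (\<Sum>j. hausdorff_weight k (C j))"
    unfolding hausdorff_pre_eq by (intro INF_lower) auto
  also have "\<dots> = (\<integral>\<^sup>+j. hausdorff_weight k (C j) \<partial>count_space UNIV)"
    by (rule nn_integral_count_space_nat[symmetric])
  also have "\<dots> = (\<integral>\<^sup>+j. hausdorff_weight k (C j) \<partial>count_space J)"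
    by (rule nn_integral_count_space_eq) (auto simp: C_def hausdorff_weight_def)
  also have "\<dots> = (\<integral>\<^sup>+i. hausdorff_weight k (C (to_nat_on I i)) \<partial>count_space I)"
    by (rule nn_integral_bij_count_space[OF bij, symmetric])
  also have "\<dots> = (\<integral>\<^sup>+i. hausdorff_weight k (S i) \<partial>count_space I)"
    by (intro nn_integral_cong) (auto simp: C_def J_def into)
  finally show ?thesis .
qed

text \<open>Serves to join the two covers of the Vitali argument below.\<close>

lemma nn_integral_count_space_Plus:
  fixes f :: "'a + 'b \<Rightarrow> ennreal"
  shows "(\<integral>\<^sup>+z. f z \<partial>count_space (A <+> B))
     = (\<integral>\<^sup>+x. f (Inl x) \<partial>count_space A) + (\<integral>\<^sup>+y. f (Inr y) \<partial>count_space B)"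
proof -
  have "(\<integral>\<^sup>+z. f z \<partial>count_space (A <+> B)) = (\<integral>\<^sup>+z. f z * indicator (A <+> B) z \<partial>count_space UNIV)"
    by (rule nn_integral_count_space_indicator) simp
  also have "\<dots> = (\<integral>\<^sup>+z. f z * indicator (Inl ` A) z + f z * indicator (Inr ` B) z \<partial>count_space UNIV)"
    by (intro nn_integral_cong) (auto simp: indicator_def Plus_def)
  also have "\<dots> = (\<integral>\<^sup>+z. f z * indicator (Inl ` A) z \<partial>count_space UNIV)
      + (\<integral>\<^sup>+z. f z * indicator (Inr ` B) z \<partial>count_space UNIV)"
    by (rule nn_integral_add) auto
  also have "\<dots> = (\<integral>\<^sup>+z. f z \<partial>count_space (Inl ` A)) + (\<integral>\<^sup>+z. f z \<partial>count_space (Inr ` B))"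
    by (simp add: nn_integral_count_space_indicator)
  also have "\<dots> = (\<integral>\<^sup>+x. f (Inl x) \<partial>count_space A) + (\<integral>\<^sup>+y. f (Inr y) \<partial>count_space B)"
    by (simp add: nn_integral_bij_count_space[symmetric, of Inl A] nn_integral_bij_count_space[symmetric, of Inr B] inj_on_imp_bij_betw)
  finally show ?thesis .
qed

text \<open>The isodiametric inequality. Passing to the closure provides a Borel set without
  changing the diameter.\<close>

lemma emeasure_le_hausdorff_weight:
  fixes S :: "'a::euclidean_space set"
  assumes "bounded S"
  shows "emeasure lborel (closure S) \<le> hausdorff_weight DIM('a) S"
proof (cases "S = {}")
  case False
  have "emeasure lborel (closure S) \<le> ennreal (unit_ball_vol (real DIM('a)) * (diameter S / 2) ^ DIM('a))"
  proof (rule isodiametric_inequality)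
    show "dist x y \<le> diameter S" if "x \<in> closure S" "y \<in> closure S" for x y
      using diameter_bounded_bound[OF bounded_closure[OF assms]] that assms by (simp add: diameter_closure)
  qed (use assms diameter_ge_0[OF assms] in auto)
  then show ?thesis using False by (simp add: hausdorff_weight_def)
qed (simp add: hausdorff_weight_def)

lemma hausdorff_pre_le_outer: "\<delta> > 0 \<Longrightarrow> hausdorff_pre k \<delta> A \<le> hausdorff_outer k A"
  unfolding hausdorff_outer_def by (intro SUP_upper) simp

lemma hausdorff_pre_mono: "A \<subseteq> B \<Longrightarrow> hausdorff_pre k \<delta> A \<le> hausdorff_pre k \<delta> B"
  unfolding hausdorff_pre_eq by (intro INF_superset_mono) auto

lemma hausdorff_outer_mono: "A \<subseteq> B \<Longrightarrow> hausdorff_outer k A \<le> hausdorff_outer k B"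
  unfolding hausdorff_outer_def by (intro SUP_mono) (blast intro: hausdorff_pre_mono)

text \<open>A single scale yields the lower bound, as \<open>hausdorff_outer\<close> is a supremum
  over scales.\<close>

lemma emeasure_le_hausdorff_outer:
  fixes A :: "'a::euclidean_space set"
  shows "emeasure lborel A \<le> hausdorff_outer DIM('a) A"
proof -
  have "emeasure lborel A \<le> hausdorff_pre DIM('a) 1 A"
    unfolding hausdorff_pre_eq
  proof (rule INF_greatest, clarify)
    fix C :: "nat \<Rightarrow> 'a set" assume C: "A \<subseteq> (\<Union>j. C j)" "\<forall>j. bounded (C j) \<and> diameter (C j) \<le> 1"
    have "emeasure lborel A \<le> emeasure lborel (\<Union>j. closure (C j))"
      using C(1) closure_subset by (intro emeasure_mono) (auto, blast)
    also have "\<dots> \<le> (\<Sum>j. emeasure lborel (closure (C j)))"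
      by (rule emeasure_subadditive_countably) auto
    also have "\<dots> \<le> (\<Sum>j. hausdorff_weight DIM('a) (C j))"
      using C(2) by (intro suminf_le emeasure_le_hausdorff_weight) auto
    finally show "emeasure lborel A \<le> (\<Sum>j. hausdorff_weight DIM('a) (C j))" .
  qed
  also have "\<dots> \<le> hausdorff_outer DIM('a) A" by (rule hausdorff_pre_le_outer) simp
  finally show ?thesis .
qed

lemma hausdorff_weight_cball:
  fixes c :: "'a::euclidean_space"
  assumes "r \<ge> 0" shows "hausdorff_weight DIM('a) (cball c r) = emeasure lborel (cball c r)"
  using assms by (simp add: hausdorff_weight_def emeasure_cball)

lemma sum_emeasure_disjoint_cballs:
  fixes a :: "'i \<Rightarrow> 'a::euclidean_space"
  assumes C: "countable C" "pairwise (\<lambda>i j. disjnt (cball (a i) (r i)) (cball (a j) (r j))) C"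
    and U: "open U" "\<And>i. i \<in> C \<Longrightarrow> cball (a i) (r i) \<subseteq> U"
  shows "(\<integral>\<^sup>+i. emeasure lborel (cball (a i) (r i)) \<partial>count_space C) \<le> emeasure lborel U"
proof -
  have "disjoint_family_on (\<lambda>i. cball (a i) (r i)) C"
    using C(2) by (auto simp: disjoint_family_on_def pairwise_def disjnt_def)
  then have "(\<integral>\<^sup>+i. emeasure lborel (cball (a i) (r i)) \<partial>count_space C) = emeasure lborel (\<Union>i\<in>C. cball (a i) (r i))"
    using C(1) by (intro emeasure_UN_countable[symmetric]) auto
  also have "\<dots> \<le> emeasure lborel U" using U by (intro emeasure_mono) auto
  finally show ?thesis .
qed

lemma small_cball_inside:
  fixes x :: "'a::euclidean_space"
  assumes "open U" "x \<in> U" "\<eta> > 0"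
  shows "\<exists>r. 0 < r \<and> r < \<eta> \<and> cball x r \<subseteq> U"
proof -
  obtain e where e: "e > 0" "cball x e \<subseteq> U" using assms open_contains_cball by blast
  then show ?thesis using assms(3)
    by (intro exI[of _ "min e (\<eta> / 2)"]) auto
qed

text \<open>Vitali: disjoint small balls exhaust \<open>A\<close> up to a null set \<open>N\<close>,
  and the weight of a ball is its volume. The null set is covered by further balls of arbitrarily
  small total weight.\<close>

lemma hausdorff_outer_open_le:
  fixes A :: "'a::euclidean_space set"
  assumes A: "open A"
  shows "hausdorff_outer DIM('a) A \<le> emeasure lborel A"
  unfolding hausdorff_outer_def
proof (rule SUP_least)
  fix \<delta> :: real assume "\<delta> \<in> {0<..}"
  then have \<delta>: "\<delta> > 0" by simp
  define K where "K = {(x, r). x \<in> A \<and> 0 < r \<and> r < \<delta> / 2 \<and> cball x r \<subseteq> A}"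
  obtain C where C: "countable C" "C \<subseteq> K"
     "pairwise (\<lambda>i j. disjnt (cball (fst i) (snd i)) (cball (fst j) (snd j))) C"
     "negligible (A - (\<Union>i\<in>C. cball (fst i) (snd i)))"
  proof (rule Vitali_covering_theorem_cballs[of K snd A fst])
    show "0 < snd i" if "i \<in> K" for i using that by (auto simp: K_def)
    fix x d assume x: "x \<in> A" "0 < (d::real)"
    obtain r where "0 < r" "r < min d (\<delta> / 2)" "cball x r \<subseteq> A"
      using small_cball_inside[OF A x(1), of "min d (\<delta> / 2)"] x(2) \<delta> by auto
    then show "\<exists>i. i \<in> K \<and> x \<in> cball (fst i) (snd i) \<and> snd i < d"
      using x by (intro exI[of _ "(x, r)"]) (auto simp: K_def)
  qed blast
  define N where "N = A - (\<Union>i\<in>C. cball (fst i) (snd i))"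
  have Nb: "N \<in> sets borel" unfolding N_def using C(1) A
    by (intro sets.Diff sets.countable_UN'') auto
  have N0: "emeasure lborel N = 0"
    using C(4) Nb unfolding N_def[symmetric] negligible_iff_emeasure0[OF negligible_imp_sets[OF C(4)[folded N_def]]] by simp
  show "hausdorff_pre DIM('a) \<delta> A \<le> emeasure lborel A"
  proof (rule ennreal_le_epsilon)
    fix e :: real assume e: "0 < e"
    \<comment> \<open>Compensates for enlarging the balls of the second cover by the factor
      5.\<close>
    define e' where "e' = e / 5 ^ DIM('a)"
    have e': "e' > 0" using e by (simp add: e'_def)
    obtain U where U: "open U" "N \<subseteq> U" "emeasure lborel (U - N) < ennreal e'"
      using outer_regular_lborel[OF Nb e'] by blast
    have "emeasure lborel U \<le> emeasure lborel (U - N) + emeasure lborel N"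
      using emeasure_subadditive[of "U - N" lborel N] U Nb by (simp add: Un_absorb2)
    then have Ue: "emeasure lborel U \<le> ennreal e'" using U(3) N0 by simp
    \<comment> \<open>The radii are below \<open>\<delta> / 10\<close>, so that the fivefold balls
      have diameter below \<open>\<delta>\<close>.\<close>
    define K' where "K' = {(x, r). x \<in> U \<and> 0 < r \<and> r < \<delta> / 10 \<and> cball x r \<subseteq> U}"
    obtain C' where C': "countable C'" "C' \<subseteq> K'"
     "pairwise (\<lambda>i j. disjnt (cball (fst i) (snd i)) (cball (fst j) (snd j))) C'"
     "U \<subseteq> (\<Union>i\<in>C'. cball (fst i) (5 * snd i))"
    proof (rule Vitali_covering_lemma_cballs[of U fst snd K' "\<delta> / 10"])
      show "U \<subseteq> (\<Union>i\<in>K'. cball (fst i) (snd i))"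
      proof
        fix x assume x: "x \<in> U"
        obtain r where "0 < r" "r < \<delta> / 10" "cball x r \<subseteq> U"
          using small_cball_inside[OF U(1) x, of "\<delta> / 10"] \<delta> by auto
        then show "x \<in> (\<Union>i\<in>K'. cball (fst i) (snd i))"
          using x by (intro UN_I[of "(x, r)"]) (auto simp: K'_def)
      qed
      show "0 < snd i \<and> snd i \<le> \<delta> / 10" if "i \<in> K'" for i using that by (auto simp: K'_def)
    qed blast
    define S where "S = case_sum (\<lambda>i. cball (fst i) (snd i)) (\<lambda>i::'a \<times> real. cball (fst i) (5 * snd i))"
    have "hausdorff_pre DIM('a) \<delta> A \<le> (\<integral>\<^sup>+z. hausdorff_weight DIM('a) (S z) \<partial>count_space (C <+> C'))"
    proof (rule hausdorff_pre_le_countable)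
      show "countable (C <+> C')" using C(1) C'(1) by auto
      show "A \<subseteq> (\<Union>z\<in>C <+> C'. S z)"
      proof
        fix x assume x: "x \<in> A"
        show "x \<in> (\<Union>z\<in>C <+> C'. S z)"
        proof (cases "x \<in> N")
          case True
          then obtain i where "i \<in> C'" "x \<in> cball (fst i) (5 * snd i)" using U(2) C'(4) by blast
          then show ?thesis by (intro UN_I[of "Inr i"]) (auto simp: S_def)
        next
          case False
          then obtain i where "i \<in> C" "x \<in> cball (fst i) (snd i)" using x by (auto simp: N_def)
          then show ?thesis by (intro UN_I[of "Inl i"]) (auto simp: S_def)
        qed
      qed
      show "bounded (S z) \<and> diameter (S z) \<le> \<delta>" if z: "z \<in> C <+> C'" for z
        using z
      proof (cases z)
        case (Inl i)
        then have "0 < snd i" "snd i < \<delta> / 2" using z C(2) by (auto simp: K_def)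
        then show ?thesis using Inl by (simp add: S_def)
      next
        case (Inr i)
        then have "0 < snd i" "snd i < \<delta> / 10" using z C'(2) by (auto simp: K'_def)
        then show ?thesis using Inr by (simp add: S_def)
      qed
    qed (use \<delta> in simp)
    also have "\<dots> = (\<integral>\<^sup>+i. hausdorff_weight DIM('a) (cball (fst i) (snd i)) \<partial>count_space C)
        + (\<integral>\<^sup>+i. hausdorff_weight DIM('a) (cball (fst i) (5 * snd i)) \<partial>count_space C')"
      by (simp add: nn_integral_count_space_Plus S_def)
    also have "(\<integral>\<^sup>+i. hausdorff_weight DIM('a) (cball (fst i) (snd i)) \<partial>count_space C)
        = (\<integral>\<^sup>+i. emeasure lborel (cball (fst i) (snd i)) \<partial>count_space C)"
      using C(2) by (intro nn_integral_cong hausdorff_weight_cball) (auto simp: K_def)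
    also have "\<dots> \<le> emeasure lborel A"
      by (rule sum_emeasure_disjoint_cballs[OF C(1,3) A]) (use C(2) in \<open>force simp: K_def\<close>)
    also have "(\<integral>\<^sup>+i. hausdorff_weight DIM('a) (cball (fst i) (5 * snd i)) \<partial>count_space C')
        = (\<integral>\<^sup>+i. ennreal (5 ^ DIM('a)) * emeasure lborel (cball (fst i) (snd i)) \<partial>count_space C')"
    proof (intro nn_integral_cong)
      fix i assume "i \<in> space (count_space C')"
      then have i: "0 < snd i" using C'(2) by (auto simp: K'_def)
      then show "hausdorff_weight DIM('a) (cball (fst i) (5 * snd i)) = ennreal (5 ^ DIM('a)) * emeasure lborel (cball (fst i) (snd i))"
        by (subst hausdorff_weight_cball)
          (auto simp: emeasure_cball power_mult_distrib ennreal_mult'[symmetric] mult_ac)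
    qed
    also have "\<dots> = ennreal (5 ^ DIM('a)) * (\<integral>\<^sup>+i. emeasure lborel (cball (fst i) (snd i)) \<partial>count_space C')"
      by (rule nn_integral_cmult) simp
    also have "\<dots> \<le> ennreal (5 ^ DIM('a)) * ennreal e'"
      by (rule mult_left_mono[OF order_trans[OF sum_emeasure_disjoint_cballs[OF C'(1,3) U(1)] Ue]])
        (use C'(2) in \<open>force simp: K'_def\<close>, simp)
    also have "\<dots> = ennreal e"
      using e by (simp add: e'_def ennreal_mult'[symmetric])
    finally show "hausdorff_pre DIM('a) \<delta> A \<le> emeasure lborel A + ennreal e"
      by (simp add: add_mono)
  qed
qed

text \<open>Outer regularity reduces the upper bound to open sets.\<close>

theorem hausdorff_outer_eq_emeasure:
  fixes A :: "'a::euclidean_space set"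
  assumes A: "A \<in> sets borel"
  shows "hausdorff_outer DIM('a) A = emeasure lborel A"
proof (rule antisym)
  show "hausdorff_outer DIM('a) A \<le> emeasure lborel A"
  proof (rule ennreal_le_epsilon)
    fix e :: real assume e: "0 < e"
    obtain U where U: "open U" "A \<subseteq> U" "emeasure lborel (U - A) < ennreal e"
      using outer_regular_lborel[OF A e] by blast
    have "hausdorff_outer DIM('a) A \<le> emeasure lborel U"
      using hausdorff_outer_mono[OF U(2)] hausdorff_outer_open_le[OF U(1)] order_trans by blast
    also have "\<dots> \<le> emeasure lborel A + emeasure lborel (U - A)"
      using emeasure_subadditive[of A lborel "U - A"] U A by (simp add: Un_absorb1)
    also have "\<dots> \<le> emeasure lborel A + ennreal e"
      using U(3) by (intro add_left_mono) simp
    finally show "hausdorff_outer DIM('a) A \<le> emeasure lborel A + ennreal e" .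
  qed
qed (rule emeasure_le_hausdorff_outer)

text \<open>Applied in dimension 4, where it turns the integrals in the definition of a rectifiable
  4-current into Lebesgue integrals.\<close>

theorem hausdorff_measure_eq_lborel: "hausdorff_measure DIM('a) = (lborel :: 'a::euclidean_space measure)"
proof -
  have "hausdorff_measure DIM('a) = measure_of (space (lborel :: 'a measure)) (sets (lborel :: 'a measure)) (emeasure lborel)"
    unfolding hausdorff_measure_def space_lborel sets_lborel space_borel
    by (rule measure_of_eq) (auto simp: hausdorff_outer_eq_emeasure sets.space_closed sets.sigma_sets_eq[of borel, simplified])
  then show ?thesis by (simp only: measure_of_of_measure)
qed

section \<open>The mean curvature of level sets\<close>

text \<open>\<open>u\<close> is constant along a curve in the level set.\<close>

lemma tangent_vector_orthogonal:
  fixes u :: "real^3 \<Rightarrow> real"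
  assumes u: "(u has_derivative (\<lambda>v. g \<bullet> v)) (at x)" and v: "v \<in> tangent_vectors {y. u y = h} x"
  shows "g \<bullet> v = 0"
proof -
  obtain c where c: "c 0 = x" "\<forall>\<^sub>F t in nhds 0. u (c t) = h" "(c has_vector_derivative v) (at 0)"
    using v by (auto simp: tangent_vectors_def)
  have "((\<lambda>t. u (c t)) has_derivative (\<lambda>t. g \<bullet> (t *\<^sub>R v))) (at 0)"
    by (rule has_derivative_compose[OF c(3)[unfolded has_vector_derivative_def], of u "\<lambda>v. g \<bullet> v", unfolded c(1), OF u])
  then have "((\<lambda>t. u (c t)) has_real_derivative g \<bullet> v) (at 0)"
    unfolding has_field_derivative_def
    by (rule has_derivative_eq_rhs) (auto simp: mult.commute)
  moreover have "((\<lambda>t. u (c t)) has_real_derivative 0) (at 0)"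
    by (subst DERIV_cong_ev[OF refl _ refl, of "\<lambda>t. u (c t)" "\<lambda>t. h"]) (use c(2) in auto)
  ultimately show ?thesis by (rule DERIV_unique)
qed

text \<open>The curve is \<open>t \<mapsto> x + t v + \<gamma>(t) g\<close>, where \<open>\<gamma>(t)\<close> is a root of smallest modulus given by
  the intermediate value theorem; differentiability of \<open>u\<close> at \<open>x\<close> forces \<open>\<gamma>(t) = o(t)\<close>.\<close>

lemma orthogonal_imp_tangent_vector:
  fixes u :: "real^3 \<Rightarrow> real"
  assumes u: "(u has_derivative (\<lambda>v. g \<bullet> v)) (at x)" and cont: "continuous_on UNIV u"
    and g: "g \<noteq> 0" and v: "g \<bullet> v = 0" and h: "u x = h"
  shows "v \<in> tangent_vectors {y. u y = h} x"
proof -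
  define R where "R t = {\<gamma>. u (x + t *\<^sub>R v + \<gamma> *\<^sub>R g) = h}" for t
  have closed: "closed (R t)" for t
    unfolding R_def
    by (intro closed_Collect_eq continuous_on_compose2[OF cont] continuous_intros) auto
  define \<gamma> where "\<gamma> t = (SOME \<gamma>. \<gamma> \<in> R t \<and> (\<forall>\<gamma>'\<in>R t. \<bar>\<gamma>\<bar> \<le> \<bar>\<gamma>'\<bar>))" for t
  have \<gamma>: "\<gamma> t \<in> R t" "\<And>\<gamma>'. \<gamma>' \<in> R t \<Longrightarrow> \<bar>\<gamma> t\<bar> \<le> \<bar>\<gamma>'\<bar>" if ne: "R t \<noteq> {}" for t
  proof -
    obtain z where z: "z \<in> R t" "\<And>y. y \<in> R t \<Longrightarrow> dist 0 z \<le> dist 0 y"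
      using distance_attains_inf[OF closed ne, of 0] by metis
    then have "z \<in> R t \<and> (\<forall>\<gamma>'\<in>R t. \<bar>z\<bar> \<le> \<bar>\<gamma>'\<bar>)" by (simp add: dist_norm)
    then have "\<exists>\<gamma>. \<gamma> \<in> R t \<and> (\<forall>\<gamma>'\<in>R t. \<bar>\<gamma>\<bar> \<le> \<bar>\<gamma>'\<bar>)" by (rule exI)
    from someI_ex[OF this] show "\<gamma> t \<in> R t" "\<And>\<gamma>'. \<gamma>' \<in> R t \<Longrightarrow> \<bar>\<gamma> t\<bar> \<le> \<bar>\<gamma>'\<bar>"
      unfolding \<gamma>_def by blast+
  qed
  have gg: "g \<bullet> g > 0" using g by simp
  have root: "\<exists>d>0. \<forall>t. \<bar>t\<bar> < d \<longrightarrow> R t \<noteq> {} \<and> \<bar>\<gamma> t\<bar> \<le> \<epsilon> * \<bar>t\<bar>" if \<epsilon>: "\<epsilon> > 0" for \<epsilon>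
  proof -
    \<comment> \<open>Chosen such that the linearization error, at distances up to
      \<open>\<bar>t\<bar> * (norm v + \<epsilon> * norm g + 1)\<close>, is at most the change
      \<open>\<epsilon> * \<bar>t\<bar> * (g \<bullet> g)\<close> of the linear part. So
      \<open>u - h\<close> changes sign between the two ends.\<close>
    define e where "e = \<epsilon> * (g \<bullet> g) / (norm v + \<epsilon> * norm g + 1)"
    have den: "norm v + \<epsilon> * norm g + 1 > 0" using \<epsilon> by (simp add: add_nonneg_pos)
    have e: "e > 0" unfolding e_def using \<epsilon> gg den by simp
    obtain d0 where d0: "d0 > 0" and lin: "\<And>y. norm (y - x) < d0 \<Longrightarrow> \<bar>u y - u x - g \<bullet> (y - x)\<bar> \<le> e * norm (y - x)"
      using u e unfolding has_derivative_at_alt by (metis real_norm_def)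
    define d where "d = d0 / (norm v + \<epsilon> * norm g + 1)"
    have d: "d > 0" unfolding d_def using d0 den by simp
    have "R t \<noteq> {} \<and> \<bar>\<gamma> t\<bar> \<le> \<epsilon> * \<bar>t\<bar>" if t: "\<bar>t\<bar> < d" for t
    proof -
      have est: "\<bar>u (x + t *\<^sub>R v + s *\<^sub>R g) - h - s * (g \<bullet> g)\<bar> \<le> \<epsilon> * \<bar>t\<bar> * (g \<bullet> g)" if s: "\<bar>s\<bar> \<le> \<epsilon> * \<bar>t\<bar>" for s
      proof -
        have "norm (t *\<^sub>R v + s *\<^sub>R g) \<le> \<bar>t\<bar> * norm v + \<bar>s\<bar> * norm g"
          using norm_triangle_ineq[of "t *\<^sub>R v" "s *\<^sub>R g"] by simp
        also have "\<dots> \<le> \<bar>t\<bar> * norm v + (\<epsilon> * \<bar>t\<bar>) * norm g"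
          using s by (intro add_left_mono mult_right_mono) auto
        also have "\<dots> \<le> \<bar>t\<bar> * (norm v + \<epsilon> * norm g + 1)"
          by (simp add: algebra_simps)
        finally have n: "norm (t *\<^sub>R v + s *\<^sub>R g) \<le> \<bar>t\<bar> * (norm v + \<epsilon> * norm g + 1)" .
        also have "\<dots> < d0" using t den by (simp add: d_def field_simps)
        finally have "\<bar>u (x + t *\<^sub>R v + s *\<^sub>R g) - u x - g \<bullet> (t *\<^sub>R v + s *\<^sub>R g)\<bar> \<le> e * norm (t *\<^sub>R v + s *\<^sub>R g)"
          using lin[of "x + t *\<^sub>R v + s *\<^sub>R g"] by (simp add: add.assoc)
        also have "\<dots> \<le> e * (\<bar>t\<bar> * (norm v + \<epsilon> * norm g + 1))"
          using n e by (intro mult_left_mono) auto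
        also have "\<dots> = \<epsilon> * \<bar>t\<bar> * (g \<bullet> g)"
          using den by (simp add: e_def)
        finally show ?thesis using h v by (simp add: inner_add_right)
      qed
      let ?f = "\<lambda>s. u (x + t *\<^sub>R v + s *\<^sub>R g)"
      have "?f (- (\<epsilon> * \<bar>t\<bar>)) \<le> h" "h \<le> ?f (\<epsilon> * \<bar>t\<bar>)"
        using est[of "- (\<epsilon> * \<bar>t\<bar>)"] est[of "\<epsilon> * \<bar>t\<bar>"] \<epsilon> by (auto simp: abs_le_iff)
      moreover have "continuous_on {- (\<epsilon> * \<bar>t\<bar>)..\<epsilon> * \<bar>t\<bar>} ?f"
        by (intro continuous_on_compose2[OF cont] continuous_intros) auto
      moreover have "- (\<epsilon> * \<bar>t\<bar>) \<le> \<epsilon> * \<bar>t\<bar>" using \<epsilon> by (simp add: minus_le_iff)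
      ultimately obtain s where s: "- (\<epsilon> * \<bar>t\<bar>) \<le> s" "s \<le> \<epsilon> * \<bar>t\<bar>" "?f s = h"
        using IVT'[of ?f "- (\<epsilon> * \<bar>t\<bar>)" h "\<epsilon> * \<bar>t\<bar>"] by blast
      then have sR: "s \<in> R t" by (simp add: R_def)
      then have ne: "R t \<noteq> {}" by blast
      have "\<bar>\<gamma> t\<bar> \<le> \<bar>s\<bar>" by (rule \<gamma>(2)[OF ne sR])
      with s ne show ?thesis by auto
    qed
    with d show ?thesis by blast
  qed
  have "0 \<in> R 0" using h by (simp add: R_def)
  then have \<gamma>0: "\<gamma> 0 = 0" using \<gamma>(2)[of 0 0] by force
  have "((\<lambda>t. \<gamma> t) has_derivative (\<lambda>t. 0)) (at 0)"
    unfolding has_derivative_at_alt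
  proof (intro conjI allI impI)
    fix e :: real assume "0 < e"
    from root[OF this] obtain d where "d > 0" "\<And>t. \<bar>t\<bar> < d \<Longrightarrow> \<bar>\<gamma> t\<bar> \<le> e * \<bar>t\<bar>" by blast
    then show "\<exists>d>0. \<forall>y. norm (y - 0) < d \<longrightarrow> norm (\<gamma> y - \<gamma> 0 - 0) \<le> e * norm (y - 0)"
      by (intro exI[of _ d]) (simp add: \<gamma>0)
  qed simp
  then have "((\<lambda>t. x + t *\<^sub>R v + \<gamma> t *\<^sub>R g) has_derivative (\<lambda>t. 0 + t *\<^sub>R v + 0 *\<^sub>R g)) (at 0)"
    by (intro has_derivative_add has_derivative_const has_derivative_scaleR_left has_derivative_ident)
  then have "((\<lambda>t. x + t *\<^sub>R v + \<gamma> t *\<^sub>R g) has_vector_derivative v) (at 0)"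
    by (simp add: has_vector_derivative_def)
  moreover have "\<forall>\<^sub>F t in nhds 0. u (x + t *\<^sub>R v + \<gamma> t *\<^sub>R g) = h"
  proof -
    obtain d where "d > 0" "\<And>t. \<bar>t\<bar> < d \<Longrightarrow> R t \<noteq> {}" using root[of 1] by auto
    then show ?thesis
      using \<gamma>(1) unfolding eventually_nhds_metric
      by (intro exI[of _ d]) (auto simp: R_def dist_norm)
  qed
  ultimately show ?thesis
    using \<gamma>0 unfolding tangent_vectors_def
    by (intro CollectI exI[of _ "\<lambda>t. x + t *\<^sub>R v + \<gamma> t *\<^sub>R g"]) simp
qed

text \<open>The three vectors are the rows of an orthogonal matrix \<open>A\<close>, and the bracket
  is an entry of \<open>transpose A ** A\<close>, the identity.\<close>

lemma orthonormal_trace: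
  fixes e1 e2 n :: "real^3" and B :: "3 \<Rightarrow> 3 \<Rightarrow> real"
  assumes "norm e1 = 1" "norm e2 = 1" "norm n = 1" "e1 \<bullet> e2 = 0" "e1 \<bullet> n = 0" "e2 \<bullet> n = 0"
  shows "(\<Sum>i\<in>UNIV. \<Sum>j\<in>UNIV. B i j * (e1 $ i * e1 $ j + e2 $ i * e2 $ j + n $ i * n $ j))
    = (\<Sum>i\<in>UNIV. B i i)"
proof -
  define A :: "real^3^3" where "A = vector [e1, e2, n]"
  have r: "A $ 1 = e1" "A $ 2 = e2" "A $ 3 = n" by (simp_all add: A_def vector_3)
  have sq: "e1 \<bullet> e1 = 1" "e2 \<bullet> e2 = 1" "n \<bullet> n = 1" using assms by (simp_all add: dot_square_norm)
  have row: "A $ i \<bullet> A $ j = (if i = j then 1 else 0)" for i j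
    using exhaust_3[of i] exhaust_3[of j] assms sq r
    by (auto simp: inner_commute UNIV_3_distinct)
  have "A ** transpose A = mat 1"
    by (simp add: vec_eq_iff matrix_matrix_mult_def transpose_def mat_def row[unfolded inner_vec_def, simplified])
  then have "transpose A ** A = mat 1" by (simp add: matrix_left_right_inverse)
  then have "(transpose A ** A) $ i $ j = (if i = j then 1 else 0)" for i j
    by (simp add: mat_def)
  then have "e1 $ i * e1 $ j + e2 $ i * e2 $ j + n $ i * n $ j = (if i = j then 1 else 0)" for i j
    by (simp add: matrix_matrix_mult_def transpose_def sum_3 r)
  then show ?thesis by (simp add: if_distrib[where f="\<lambda>t. _ * t"] cong: if_cong)
qed

context C4_function begin

definition hess :: "real^3 \<Rightarrow> real^3 \<Rightarrow> real^3" where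
  "hess x v = (\<chi> i. \<Sum>j\<in>UNIV. v $ j * d2 j i x)"

lemma grad_eq: "grad u x = (\<chi> i. d1 i x)"
  by (simp add: grad_def d1_def)

lemma C1_grad: "Ck 1 (grad u)"
  by (rule Ck1_vecI) (simp add: grad_eq C1_d1)

lemma dir_deriv_grad: "dir_deriv (grad u) v x = hess x v"
proof -
  have "dir_deriv (grad u) v x $ i = hess x v $ i" for i
  proof -
    have "dir_deriv (grad u) v x $ i = dir_deriv (d1 i) v x"
      unfolding dir_deriv_vec_nth[OF C1_grad, symmetric] by (simp add: grad_eq)
    then show ?thesis
      by (simp add: Ck1_dir_deriv_eq_partial[OF C1_d1] hess_def d2_def)
  qed
  then show ?thesis by (simp add: vec_eq_iff)
qed

lemma grad_has_derivative: "(grad u has_derivative hess x) (at x)"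
  using Ck1_has_derivative[OF C1_grad, of x] unfolding dir_deriv_grad by simp

lemma u_has_derivative: "(u has_derivative (\<lambda>v. grad u x \<bullet> v)) (at x)"
  by (rule Ck1_has_derivative_grad[OF C1_u])

lemma slope2_eq: "slope2 x = (norm (grad u x))\<^sup>2"
  unfolding power2_norm_eq_inner by (simp add: slope2_def grad_eq inner_vec_def power2_eq_square)

lemma hess_inner_grad: "hess x (grad u x) \<bullet> grad u x = hessgrad2 x"
  by (simp add: hess_def grad_eq inner_vec_def hessgrad2_def hessgrad_def d2_sym mult.commute)

lemma hess_inner_eq: "hess x v \<bullet> w = (\<Sum>i\<in>UNIV. \<Sum>j\<in>UNIV. d2 i j x * (v $ i * w $ j))"
  by (simp add: hess_def inner_vec_def sum_3 algebra_simps)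

lemma hess_sym: "hess x v \<bullet> w = hess x w \<bullet> v"
  unfolding hess_inner_eq sum_3 using d2_sym[of 1 2 x] d2_sym[of 1 3 x] d2_sym[of 2 3 x]
  by (simp add: algebra_simps)

text \<open>On the level set near \<open>x\<close>, every admissible normal field is the normalized
  gradient up to a constant sign. The sign enters squared into the inner product of \<open>H\<close>
  with the descent direction, which is therefore the trace of the Hessian over the tangent plane
  divided by the gradient norm, that is, \<open>mcnum x\<close> divided by the cube of this
  norm.\<close>

lemma mean_curvature_pos:
  assumes H: "has_mean_curvature_vector {y. u y = h} x H"
    and pos: "H \<bullet> (- (1 / norm (grad u x)) *\<^sub>R grad u x) > 0"
  shows "grad u x \<noteq> 0" "mcnum x > 0"
proof -
  show nz: "grad u x \<noteq> 0" using pos by auto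
  define S where "S = {y. u y = h}"
  obtain U N e1 e2 where xS: "u x = h" and U: "open U" "x \<in> U" and N: "N differentiable_on U"
     "\<And>y. y \<in> S \<inter> U \<Longrightarrow> norm (N y) = 1" "\<And>y v. y \<in> S \<inter> U \<Longrightarrow> v \<in> tangent_vectors S y \<Longrightarrow> N y \<bullet> v = 0"
    and e: "e1 \<in> tangent_vectors S x" "e2 \<in> tangent_vectors S x" "norm e1 = 1" "norm e2 = 1" "e1 \<bullet> e2 = 0"
    and Heq: "H = - (dir_deriv N e1 x \<bullet> e1 + dir_deriv N e2 x \<bullet> e2) *\<^sub>R N x"
    using H unfolding has_mean_curvature_vector_def S_def by blast
  define \<nu> where "\<nu> y = inverse (norm (grad u y)) *\<^sub>R grad u y" for y
  have s: "norm (grad u x) > 0" using nz by simp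
  have dN: "(N has_derivative (\<lambda>v. dir_deriv N v x)) (at x)"
    using N(1) U by (metis differentiable_on_eq_differentiable_at frechet_derivative_works)
  have N_nu: "N y = (N y \<bullet> \<nu> y) *\<^sub>R \<nu> y" "\<bar>N y \<bullet> \<nu> y\<bar> = 1" if y: "y \<in> S \<inter> U" "grad u y \<noteq> 0" for y
  proof -
    have nn: "\<nu> y \<bullet> \<nu> y = 1" using y(2) by (simp add: \<nu>_def dot_square_norm power2_eq_square)
    \<comment> \<open>The component of \<open>N y\<close> orthogonal to \<open>\<nu> y\<close> is
      itself a tangent vector, hence orthogonal to \<open>N y\<close>, hence zero.\<close>
    define v where "v = N y - (N y \<bullet> \<nu> y) *\<^sub>R \<nu> y"
    have "\<nu> y \<bullet> v = 0" by (simp add: v_def inner_diff_right nn inner_commute)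
    then have "grad u y \<bullet> v = 0" using y(2) by (simp add: \<nu>_def)
    then have "v \<in> tangent_vectors S y"
      unfolding S_def using orthogonal_imp_tangent_vector[OF u_has_derivative Ck1_continuous[OF C1_u] y(2)] y(1)
      by (auto simp: S_def)
    then have "N y \<bullet> v = 0" using N(3) y(1) by blast
    then have "v \<bullet> v = 0" using \<open>\<nu> y \<bullet> v = 0\<close> by (simp add: v_def[of] inner_diff_left)
    then show eq: "N y = (N y \<bullet> \<nu> y) *\<^sub>R \<nu> y" by (simp add: v_def)
    have "norm (\<nu> y) = 1" using nn by (simp add: norm_eq_1)
    then show "\<bar>N y \<bullet> \<nu> y\<bar> = 1" using N(2)[OF y(1)] arg_cong[OF eq, of norm] by simp
  qed
  define \<sigma> where "\<sigma> = N x \<bullet> \<nu> x"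
  have xSU: "x \<in> S \<inter> U" using xS U by (simp add: S_def)
  have Nx: "N x = \<sigma> *\<^sub>R \<nu> x" "\<bar>\<sigma>\<bar> = 1" using N_nu[OF xSU nz] by (simp_all add: \<sigma>_def)
  have ngrad: "((\<lambda>y. norm (grad u y)) has_derivative (\<lambda>v. hess x v \<bullet> \<nu> x)) (at x)"
    using has_derivative_compose[OF grad_has_derivative has_derivative_norm[OF nz]] by (simp add: \<nu>_def sgn_div_norm)
  have d\<nu>: "(\<nu> has_derivative (\<lambda>v. inverse (norm (grad u x)) *\<^sub>R hess x v
      + (- (inverse (norm (grad u x)) * (hess x v \<bullet> \<nu> x) * inverse (norm (grad u x)))) *\<^sub>R grad u x)) (at x)"
    unfolding \<nu>_def[abs_def]
    by (rule has_derivative_scaleR[OF Deriv.has_derivative_inverse[OF _ ngrad] grad_has_derivative, unfolded \<nu>_def]) (use s in simp)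
  have cont: "isCont N x" "isCont \<nu> x" "isCont (grad u) x"
    using dN d\<nu> grad_has_derivative has_derivative_continuous by blast+
  \<comment> \<open>A continuous function whose values on \<open>S\<close> are \<open>1\<close> or
    \<open>- 1\<close> is constant on \<open>S\<close> near \<open>x\<close>.\<close>
  have ev: "\<forall>\<^sub>F y in nhds x. y \<in> S \<longrightarrow> N y = \<sigma> *\<^sub>R \<nu> y"
  proof -
    have "isCont (\<lambda>y. N y \<bullet> \<nu> y) x" by (intro continuous_intros cont)
    then have "\<forall>\<^sub>F y in nhds x. dist (N y \<bullet> \<nu> y) \<sigma> < 1"
      unfolding \<sigma>_def by (intro tendstoD[OF tendsto_at_iff_tendsto_nhds[THEN iffD1]]) (auto simp: isCont_def)
    moreover have "\<forall>\<^sub>F y in nhds x. grad u y \<noteq> 0"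
      using tendsto_imp_eventually_ne[OF tendsto_at_iff_tendsto_nhds[THEN iffD1, OF cont(3)[unfolded isCont_def]] nz] .
    moreover have "\<forall>\<^sub>F y in nhds x. y \<in> U" using U by (rule eventually_nhds_in_open)
    ultimately show ?thesis
    proof eventually_elim
      case (elim y)
      show ?case
      proof
        assume "y \<in> S"
        with N_nu[of y] elim have *: "N y = (N y \<bullet> \<nu> y) *\<^sub>R \<nu> y" "\<bar>N y \<bullet> \<nu> y\<bar> = 1" by auto
        have "N y \<bullet> \<nu> y = \<sigma>" using *(2) Nx(2) elim(1) by (auto simp: dist_real_def abs_if split: if_splits)
        then show "N y = \<sigma> *\<^sub>R \<nu> y" using *(1) by simp
      qed
    qed
  qed
  \<comment> \<open>\<open>N\<close> and \<open>\<sigma> *\<^sub>R \<nu>\<close> agree only on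
    \<open>S\<close>, so their derivatives are compared along a curve in \<open>S\<close>. The part
    of the derivative of \<open>\<nu>\<close> that is parallel to \<open>grad u x\<close> drops out
    against \<open>v\<close>.\<close>
  have DN: "dir_deriv N v x \<bullet> v = \<sigma> * ((hess x v \<bullet> v) / norm (grad u x))" if v: "v \<in> tangent_vectors S x" for v
  proof -
    obtain c where c: "c 0 = x" "\<forall>\<^sub>F t in nhds 0. c t \<in> S" "(c has_vector_derivative v) (at 0)"
      using v by (auto simp: tangent_vectors_def)
    have orth: "grad u x \<bullet> v = 0" using tangent_vector_orthogonal[OF u_has_derivative] v by (simp add: S_def)
    have cd: "(c has_derivative (\<lambda>t. t *\<^sub>R v)) (at 0)" using c(3) by (simp add: has_vector_derivative_def)
    have cc: "(c \<longlongrightarrow> x) (nhds 0)"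
      using has_derivative_continuous[OF cd] c(1) tendsto_at_iff_tendsto_nhds[of c 0] by (simp add: isCont_def)
    have A: "((\<lambda>t. N (c t)) has_derivative (\<lambda>t. dir_deriv N (t *\<^sub>R v) x)) (at 0)"
      by (rule has_derivative_compose[OF cd, of N "\<lambda>v. dir_deriv N v x", unfolded c(1), OF dN])
    let ?D = "\<lambda>v. inverse (norm (grad u x)) *\<^sub>R hess x v
      + (- (inverse (norm (grad u x)) * (hess x v \<bullet> \<nu> x) * inverse (norm (grad u x)))) *\<^sub>R grad u x"
    have B: "((\<lambda>t. \<sigma> *\<^sub>R \<nu> (c t)) has_derivative (\<lambda>t. \<sigma> *\<^sub>R ?D (t *\<^sub>R v))) (at 0)"
      by (intro has_derivative_scaleR_right has_derivative_compose[OF cd, of \<nu> ?D, unfolded c(1), OF d\<nu>])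
    have "\<forall>\<^sub>F t in nhds 0. N (c t) = \<sigma> *\<^sub>R \<nu> (c t)"
      using c(2) filterlim_iff[THEN iffD1, OF cc, rule_format, OF ev] by eventually_elim simp
    then have "((\<lambda>t. N (c t)) has_derivative (\<lambda>t. \<sigma> *\<^sub>R ?D (t *\<^sub>R v))) (at 0)"
      by (intro has_derivative_transform_eventually[OF B])
        (auto simp: eventually_at_filter dest: eventually_nhds_x_imp_x elim: eventually_mono)
    from fun_cong[OF has_derivative_unique[OF A this], of 1]
    have "dir_deriv N v x = \<sigma> *\<^sub>R ?D v" unfolding scaleR_one .
    then show ?thesis using orth by (simp add: inner_add_left inner_diff_left divide_inverse mult.commute)
  qed
  have sum: "hess x e1 \<bullet> e1 + hess x e2 \<bullet> e2 + hess x (\<nu> x) \<bullet> \<nu> x = lap x"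
  proof -
    have o: "e1 \<bullet> \<nu> x = 0" "e2 \<bullet> \<nu> x = 0"
      using tangent_vector_orthogonal[OF u_has_derivative] e by (simp_all add: S_def \<nu>_def inner_commute)
    have "norm (\<nu> x) = 1" using s by (simp add: \<nu>_def)
    from orthonormal_trace[OF e(3,4) this e(5) o, of "\<lambda>i j. d2 i j x"] show ?thesis
      unfolding hess_inner_eq lap_def by (simp add: distrib_left sum.distrib)
  qed
  have "0 < H \<bullet> (- (1 / norm (grad u x)) *\<^sub>R grad u x)" by (rule pos)
  also have "\<dots> = (dir_deriv N e1 x \<bullet> e1 + dir_deriv N e2 x \<bullet> e2) * (N x \<bullet> \<nu> x)"
    by (simp add: Heq \<nu>_def divide_inverse algebra_simps)
  also have "\<dots> = (\<sigma> * \<sigma>) * ((hess x e1 \<bullet> e1 + hess x e2 \<bullet> e2) / norm (grad u x))"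
    using e by (simp add: DN \<sigma>_def[symmetric] add_divide_distrib algebra_simps)
  also have "\<sigma> * \<sigma> = 1" using Nx(2) by (auto simp: abs_if split: if_splits)
  finally have "0 < hess x e1 \<bullet> e1 + hess x e2 \<bullet> e2" using s by (simp add: zero_less_divide_iff)
  then have "0 < lap x - hess x (\<nu> x) \<bullet> \<nu> x" using sum by simp
  moreover have "hess x (\<nu> x) \<bullet> \<nu> x = hessgrad2 x / slope2 x"
    using linear_cmul[OF has_derivative_linear[OF grad_has_derivative]]
    by (simp add: \<nu>_def hess_inner_grad slope2_eq power2_eq_square divide_inverse)
  moreover have "slope2 x > 0" using s by (simp add: slope2_eq)
  ultimately show "mcnum x > 0" by (simp add: mcnum_def field_simps)
qed

end

section \<open>Measures on regular level sets\<close>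

lemma antiderivative_exists:
  fixes f :: "real \<Rightarrow> real"
  assumes f: "continuous_on UNIV f"
  shows "\<exists>F. F 0 = 0 \<and> (\<forall>t. (F has_real_derivative f t) (at t))"
proof -
  \<comment> \<open>One of the two intervals is empty or a point, so this is the signed integral
    from 0.\<close>
  define F where "F x = integral {0..x} f - integral {x..0} f" for x
  have int: "f integrable_on {a..b}" for a b
    by (rule integrable_continuous_real[OF continuous_on_subset[OF f]]) simp
  have F: "F x = integral {-N..x} f - integral {-N..0} f" if "N \<ge> 0" "-N \<le> x" for x N
  proof (cases "x \<ge> 0")
    case True
    have "integral {-N..0} f + integral {0..x} f = integral {-N..x} f"
      using that True by (intro Henstock_Kurzweil_Integration.integral_combine int) auto
    then show ?thesis using True by (cases "x = 0") (auto simp: F_def)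
  next
    case False
    have "integral {-N..x} f + integral {x..0} f = integral {-N..0} f"
      using that False by (intro Henstock_Kurzweil_Integration.integral_combine int) auto
    then show ?thesis using False by (auto simp: F_def)
  qed
  have "(F has_real_derivative f t) (at t)" for t
  proof -
    define N where "N = \<bar>t\<bar> + 1"
    have t: "t \<in> {-N<..<N}" "N \<ge> 0" by (auto simp: N_def)
    have "((\<lambda>x. integral {-N..x} f) has_real_derivative f t) (at t within {-N..N})"
      by (rule integral_has_real_derivative) (use t f in \<open>auto intro: continuous_on_subset\<close>)
    then have "((\<lambda>x. integral {-N..x} f) has_real_derivative f t) (at t)"
      using t(1) by (simp add: at_within_Icc_at)
    then have "((\<lambda>x. integral {-N..x} f - integral {-N..0} f) has_real_derivative f t - 0) (at t)"
      by (intro DERIV_diff DERIV_const)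
    moreover have "\<forall>\<^sub>F x in nhds t. integral {-N..x} f - integral {-N..0} f = F x"
      using eventually_nhds_in_open[of "{-N<..<N}" t] t
      by (auto elim!: eventually_mono simp: F[of N])
    ultimately show ?thesis
      by (subst DERIV_cong_ev[OF refl _ refl, of F "\<lambda>x. integral {-N..x} f - integral {-N..0} f"])
        (auto elim: eventually_mono)
  qed
  moreover have "F 0 = 0" by (simp add: F_def)
  ultimately show ?thesis by blast
qed

text \<open>A probability density on the unit interval, with antiderivative
  \<open>3 * y^2 - 2 * y^3\<close> there. Its continuity makes the profiles built from it
  continuously differentiable.\<close>

definition kern :: "real \<Rightarrow> real" where
  "kern y = (if 0 \<le> y \<and> y \<le> 1 then 6 * y * (1 - y) else 0)"

lemma kern_eq: "kern y = max 0 (6 * y * (1 - y))"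
  by (auto simp: kern_def max_def zero_le_mult_iff mult_le_0_iff not_le)

lemma kern_continuous: "continuous_on UNIV kern"
  unfolding kern_eq[abs_def] by (intro continuous_intros)

lemma kern_nonneg: "kern y \<ge> 0"
  by (simp add: kern_eq)

lemma kern_le: "kern y \<le> 2"
proof -
  have "6 * y * (1 - y) \<le> 2" using zero_le_power2[of "y - 1 / 2"] by (simp add: power2_eq_square algebra_simps)
  then show ?thesis by (simp add: kern_eq)
qed

lemma kern_zero: "y \<le> 0 \<or> 1 \<le> y \<Longrightarrow> kern y = 0"
  by (auto simp: kern_def)

text \<open>The cubic step from 0 to 1, introduced as an antiderivative so that differentiability at
  0 and 1 takes no case distinction.\<close>

definition step :: "real \<Rightarrow> real" where
  "step = (SOME F. F 0 = 0 \<and> (\<forall>t. (F has_real_derivative kern t) (at t)))"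

lemma step_0: "step 0 = 0" and step_deriv: "(step has_real_derivative kern t) (at t)"
  using someI_ex[OF antiderivative_exists[OF kern_continuous]] unfolding step_def by blast+

lemma step_left: "y \<le> 0 \<Longrightarrow> step y = 0"
proof (cases "y = 0")
  case False
  assume "y \<le> 0"
  with False have "y < 0" by simp
  from MVT2[OF this step_deriv] obtain z where "y < z" "z < 0" "step 0 - step y = (0 - y) * kern z"
    by blast
  then show ?thesis by (simp add: step_0 kern_zero)
qed (simp add: step_0)

lemma step_1: "step 1 = 1"
proof -
  have "((\<lambda>y. step y - (3 * y^2 - 2 * y^3)) has_real_derivative kern y - 6 * y * (1 - y)) (at y)" for y
    by (auto intro!: derivative_eq_intros step_deriv simp: power2_eq_square algebra_simps)
  from MVT2[OF zero_less_one this] obtain z where "0 < z" "z < 1"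
    "step 1 - (3 * 1^2 - 2 * 1^3) - (step 0 - (3 * 0^2 - 2 * 0^3)) = (1 - 0) * (kern z - 6 * z * (1 - z))"
    by blast
  then show ?thesis by (simp add: step_0 kern_def)
qed

lemma step_right: "y \<ge> 1 \<Longrightarrow> step y = 1"
proof (cases "y = 1")
  case False
  assume "y \<ge> 1"
  with False have "1 < y" by simp
  from MVT2[OF this step_deriv] obtain z where "1 < z" "z < y" "step y - step 1 = (y - 1) * kern z"
    by blast
  then show ?thesis by (simp add: step_1 kern_zero)
qed (simp add: step_1)

lemma step_mono: "x \<le> y \<Longrightarrow> step x \<le> step y"
  by (rule DERIV_nonneg_imp_nondecreasing) (auto intro!: step_deriv kern_nonneg)

lemma step_bounds: "0 \<le> step y" "step y \<le> 1"
  using step_mono[of "min y 0" y] step_left[of "min y 0"] step_mono[of y "max y 1"] step_right[of "max y 1"]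
  by auto

definition dl :: "nat \<Rightarrow> real" where "dl n = inverse (real (Suc n))"

lemma dl_pos: "dl n > 0" and dl_tendsto: "dl \<longlonglongrightarrow> 0"
  unfolding dl_def using LIMSEQ_inverse_real_of_nat by auto

lemma eventually_dl_less: "e > 0 \<Longrightarrow> \<forall>\<^sub>F n in sequentially. dl n < e"
  using order_tendstoD(2)[OF dl_tendsto] by blast

text \<open>A chart of a level set over the slab \<open>0 \<le> x \<bullet> e < 1\<close>: on the convex open set \<open>B\<close> the
  function \<open>u\<close> is strictly increasing in direction \<open>e\<close>.\<close>

locale level_chart =
  fixes u :: "'a::euclidean_space \<Rightarrow> real" and g :: "'a \<Rightarrow> 'a" and e :: 'a and B :: "'a set"
    and c h :: real
  assumes du: "\<And>x. (u has_derivative (\<lambda>v. g x \<bullet> v)) (at x)"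
    and cg: "continuous_on UNIV g"
    and e: "norm e = 1"
    and B: "convex B" "open B" "bounded B"
    and c: "c > 0" "\<And>x. x \<in> B \<Longrightarrow> g x \<bullet> e \<ge> c"
begin

definition hit :: "'a \<Rightarrow> real \<Rightarrow> bool" where "hit x t \<longleftrightarrow> x + t *\<^sub>R e \<in> B \<and> u (x + t *\<^sub>R e) = h"
definition W where "W = {x. \<exists>t. hit x t}"
definition T where "T x = (THE t. hit x t)"
text \<open>Projection along \<open>e\<close> onto the level set; the value 0 off \<open>W\<close>
  is a dummy.\<close>

definition P where "P x = (if x \<in> W then x + T x *\<^sub>R e else 0)"
definition slab where "slab = {x. 0 \<le> x \<bullet> e \<and> x \<bullet> e < 1}"

lemma cu: "continuous_on S u"
  by (rule continuous_at_imp_continuous_on[OF ballI]) (rule has_derivative_continuous[OF du])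

lemma seg: "x + s *\<^sub>R e \<in> B" if "x + a *\<^sub>R e \<in> B" "x + b *\<^sub>R e \<in> B" "a \<le> s" "s \<le> b"
proof (cases "a = b")
  case False
  define l where "l = (s - a) / (b - a)"
  have l: "0 \<le> l" "l \<le> 1" using that False by (auto simp: l_def divide_simps)
  have "(1 - l) *\<^sub>R (x + a *\<^sub>R e) + l *\<^sub>R (x + b *\<^sub>R e) \<in> B"
    by (rule convexD[OF B(1)]) (use l that in auto)
  also have "(1 - l) *\<^sub>R (x + a *\<^sub>R e) + l *\<^sub>R (x + b *\<^sub>R e) = x + (a + l * (b - a)) *\<^sub>R e"
    by (simp add: algebra_simps)
  also have "a + l * (b - a) = s" using False by (simp add: l_def)
  finally show ?thesis .
qed (use that in auto)

lemma growth: "c * (b - a) \<le> u (x + b *\<^sub>R e) - u (x + a *\<^sub>R e)"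
  if "x + a *\<^sub>R e \<in> B" "x + b *\<^sub>R e \<in> B" "a \<le> b"
proof (cases "a = b")
  case False
  then have ab: "a < b" using that by simp
  have "((\<lambda>t. u (x + t *\<^sub>R e)) has_real_derivative g (x + t *\<^sub>R e) \<bullet> e) (at t)" for t
    by (rule has_real_derivative_line[OF du])
  from MVT2[OF ab this] obtain z where z: "a < z" "z < b"
    "u (x + b *\<^sub>R e) - u (x + a *\<^sub>R e) = (b - a) * (g (x + z *\<^sub>R e) \<bullet> e)" by blast
  have "c \<le> g (x + z *\<^sub>R e) \<bullet> e" using seg[OF that(1,2), of z] z c(2) by simp
  then have "c * (b - a) \<le> (g (x + z *\<^sub>R e) \<bullet> e) * (b - a)" using ab by (intro mult_right_mono) auto
  then show ?thesis using z(3) by (simp add: mult.commute)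
qed simp

lemma hit_unique: "hit x s \<Longrightarrow> hit x t \<Longrightarrow> s = t"
  using growth[of x s t] growth[of x t s] c(1)
  by (cases "s \<le> t") (auto simp: hit_def mult_le_0_iff not_le)

lemma hit_T: "x \<in> W \<Longrightarrow> hit x (T x)"
  unfolding W_def T_def using hit_unique by (auto intro: theI2)

lemma T_eqI: "hit x t \<Longrightarrow> T x = t"
  using hit_T hit_unique by (auto simp: W_def)

text \<open>An implicit function theorem by monotonicity: slightly before and beyond
  \<open>T x\<close> the values of \<open>u\<close> lie strictly on either side of \<open>h\<close>,
  this persists on neighbouring lines, and the intermediate value theorem gives a hit in
  between.\<close>

lemma near:
  assumes x: "x \<in> W" and \<epsilon>: "\<epsilon> > 0"
  shows "\<forall>\<^sub>F y in nhds x. y \<in> W \<and> \<bar>T y - T x\<bar> < \<epsilon>"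
proof -
  define t where "t = T x"
  have ht: "x + t *\<^sub>R e \<in> B" "u (x + t *\<^sub>R e) = h" using hit_T[OF x] by (auto simp: hit_def t_def)
  have "((\<lambda>s. x + s *\<^sub>R e) \<longlongrightarrow> x + t *\<^sub>R e) (nhds t)"
    by (intro tendsto_intros filterlim_ident)
  from topological_tendstoD[OF this B(2) ht(1)] have "\<forall>\<^sub>F s in nhds t. x + s *\<^sub>R e \<in> B" .
  then obtain d where d: "d > 0" "\<And>s. \<bar>s - t\<bar> < d \<Longrightarrow> x + s *\<^sub>R e \<in> B"
    by (auto simp: eventually_nhds_metric dist_real_def)
  define r where "r = min d \<epsilon> / 2"
  have r: "r > 0" "r < d" "r < \<epsilon>" using d \<epsilon> by (auto simp: r_def)
  have inB: "x + (t + r) *\<^sub>R e \<in> B" "x + (t - r) *\<^sub>R e \<in> B" using d r by auto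
  have up: "u (x + (t + r) *\<^sub>R e) > h" "u (x + (t - r) *\<^sub>R e) < h"
  proof -
    have "c * r > 0" using c(1) r(1) by simp
    moreover have "c * r \<le> u (x + (t + r) *\<^sub>R e) - h" using growth[OF ht(1) inB(1)] r ht(2) by simp
    moreover have "c * r \<le> h - u (x + (t - r) *\<^sub>R e)" using growth[OF inB(2) ht(1)] r ht(2) by simp
    ultimately show "u (x + (t + r) *\<^sub>R e) > h" "u (x + (t - r) *\<^sub>R e) < h" by linarith+
  qed
  have lim: "((\<lambda>y. y + s *\<^sub>R e) \<longlongrightarrow> x + s *\<^sub>R e) (nhds x)" for s
    by (intro tendsto_intros filterlim_ident)
  have limu: "((\<lambda>y. u (y + s *\<^sub>R e)) \<longlongrightarrow> u (x + s *\<^sub>R e)) (nhds x)" for s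
    by (rule isCont_tendsto_compose[OF has_derivative_continuous[OF du] lim])
  have "\<forall>\<^sub>F y in nhds x. y + (t + r) *\<^sub>R e \<in> B \<and> y + (t - r) *\<^sub>R e \<in> B
      \<and> u (y + (t + r) *\<^sub>R e) > h \<and> u (y + (t - r) *\<^sub>R e) < h"
    by (intro eventually_conj topological_tendstoD[OF lim B(2)] inB order_tendstoD[OF limu] up)
  then show ?thesis
  proof eventually_elim
    case (elim y)
    have "continuous_on {t - r..t + r} (\<lambda>s. u (y + s *\<^sub>R e))"
      by (intro continuous_on_compose2[OF cu[of UNIV]] continuous_intros) auto
    then obtain s where s: "t - r \<le> s" "s \<le> t + r" "u (y + s *\<^sub>R e) = h"
      using IVT'[of "\<lambda>s. u (y + s *\<^sub>R e)" "t - r" h "t + r"] elim r by auto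
    then have "hit y s" using seg[of y "t - r" "t + r" s] elim by (auto simp: hit_def)
    then show ?case using T_eqI[of y s] s r by (auto simp: W_def t_def)
  qed
qed

lemma open_W: "open W"
proof (subst open_subopen, intro ballI)
  fix x assume "x \<in> W"
  from near[OF this zero_less_one] obtain S where "open S" "x \<in> S" "\<And>y. y \<in> S \<Longrightarrow> y \<in> W"
    by (auto simp: eventually_nhds)
  then show "\<exists>S. open S \<and> x \<in> S \<and> S \<subseteq> W" by blast
qed

lemma P_continuous: "continuous_on W P"
proof -
  have "isCont T x" if "x \<in> W" for x
    unfolding continuous_at_eps_delta
  proof (intro allI impI)
    fix \<epsilon> :: real assume "0 < \<epsilon>"
    from near[OF that this] show "\<exists>d>0. \<forall>x'. dist x' x < d \<longrightarrow> dist (T x') (T x) < \<epsilon>"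
      by (auto simp: eventually_nhds_metric dist_real_def)
  qed
  then have "continuous_on W T" by (rule continuous_at_imp_continuous_on[OF ballI])
  then have "continuous_on W (\<lambda>x. x + T x *\<^sub>R e)" by (intro continuous_intros)
  then show ?thesis by (rule continuous_on_eq) (simp add: P_def)
qed

lemma P_measurable: "P \<in> borel_measurable borel"
proof -
  have "continuous_on W (\<lambda>x. x + T x *\<^sub>R e)"
    using P_continuous by (rule continuous_on_eq) (simp add: P_def)
  then show ?thesis unfolding P_def[abs_def]
    by (intro borel_measurable_continuous_on_if) (use open_W in auto)
qed

lemma P_level: "x \<in> W \<Longrightarrow> P x \<in> B \<and> u (P x) = h"
  using hit_T by (simp add: P_def hit_def)

lemma slab_measurable: "slab \<in> sets borel"
  unfolding slab_def by measurable

text \<open>Confining the redundant coordinate to the slab makes the set of relevant parameters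
  bounded, hence of finite measure, as dominated convergence in \<open>chart_limit\<close>
  requires.\<close>

lemma bounded_line: "\<exists>R. \<forall>x t. x \<in> slab \<longrightarrow> x + t *\<^sub>R e \<in> B \<longrightarrow> norm x \<le> R"
proof -
  obtain R where R: "\<And>x. x \<in> B \<Longrightarrow> norm x \<le> R" using B(3) by (auto simp: bounded_iff)
  have "norm x \<le> R + (R + 1)" if x: "x \<in> slab" "x + t *\<^sub>R e \<in> B" for x t
  proof -
    have "t = (x + t *\<^sub>R e) \<bullet> e - x \<bullet> e" using e by (simp add: inner_add_left dot_square_norm)
    moreover have "\<bar>(x + t *\<^sub>R e) \<bullet> e\<bar> \<le> R"
      using Cauchy_Schwarz_ineq2[of "x + t *\<^sub>R e" e] e R[OF x(2)] by simp
    ultimately have "norm (t *\<^sub>R e) \<le> R + 1" using x(1) e by (auto simp: slab_def abs_le_iff)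
    then show ?thesis using norm_triangle_ineq4[of "x + t *\<^sub>R e" "t *\<^sub>R e"] R[OF x(2)] by simp
  qed
  then show ?thesis by blast
qed

definition line_avg :: "('a \<Rightarrow> real) \<Rightarrow> nat \<Rightarrow> 'a \<Rightarrow> real" where
  "line_avg F n x = (\<integral>t. kern ((h - u (x + t *\<^sub>R e)) / dl n) * F (x + t *\<^sub>R e) \<partial>lborel) / dl n"

text \<open>On a line that misses the level set inside \<open>B\<close>,
  \<open>\<bar>h - u\<bar>\<close> has a positive minimum over the compact set \<open>K\<close>, so
  thin layers avoid the support of \<open>F\<close>.\<close>

lemma line_avg_off:
  assumes F: "continuous_on UNIV F" "compact K" "K \<subseteq> B" "\<And>x. x \<notin> K \<Longrightarrow> F x = 0" and x: "x \<notin> W"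
  shows "(\<lambda>n. line_avg F n x) \<longlonglongrightarrow> 0"
proof -
  have "\<exists>d>0. \<forall>y\<in>K. y \<in> range (\<lambda>t. x + t *\<^sub>R e) \<longrightarrow> d \<le> \<bar>h - u y\<bar>"
  proof (cases "K \<inter> range (\<lambda>t. x + t *\<^sub>R e) = {}")
    case False
    have "closed {y. y - ((y - x) \<bullet> e) *\<^sub>R e = x}"
      by (intro closed_Collect_eq continuous_intros)
    moreover have "range (\<lambda>t. x + t *\<^sub>R e) \<subseteq> {y. y - ((y - x) \<bullet> e) *\<^sub>R e = x}"
      using e by (auto simp: dot_square_norm)
    moreover have "{y. y - ((y - x) \<bullet> e) *\<^sub>R e = x} \<subseteq> range (\<lambda>t. x + t *\<^sub>R e)"
      by (auto simp: image_iff) (metis add.commute diff_add_cancel)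
    ultimately have "closed (range (\<lambda>t. x + t *\<^sub>R e))" by auto
    then have "compact (K \<inter> range (\<lambda>t. x + t *\<^sub>R e))" using F(2) by (rule compact_Int_closed[rotated])
    moreover have "continuous_on (K \<inter> range (\<lambda>t. x + t *\<^sub>R e)) (\<lambda>y. \<bar>h - u y\<bar>)"
      by (intro continuous_intros cu)
    ultimately obtain z where
      z: "z \<in> K \<inter> range (\<lambda>t. x + t *\<^sub>R e)" "\<forall>y\<in>K \<inter> range (\<lambda>t. x + t *\<^sub>R e). \<bar>h - u z\<bar> \<le> \<bar>h - u y\<bar>"
      using continuous_attains_inf[OF _ False, of "\<lambda>y. \<bar>h - u y\<bar>"] by blast
    have "u z \<noteq> h" using z(1) x F(3) by (auto simp: W_def hit_def)
    then show ?thesis using z(2) by (intro exI[of _ "\<bar>h - u z\<bar>"]) auto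
  next
    case True
    then show ?thesis by (intro exI[of _ 1]) auto
  qed
  then obtain d where d: "d > 0" "\<And>t. x + t *\<^sub>R e \<in> K \<Longrightarrow> d \<le> \<bar>h - u (x + t *\<^sub>R e)\<bar>" by blast
  show ?thesis
  proof (rule tendsto_eventually, use eventually_dl_less[OF d(1)] in eventually_elim)
    fix n assume n: "dl n < d"
    have k0: "kern ((h - u (x + t *\<^sub>R e)) / dl n) * F (x + t *\<^sub>R e) = 0" for t
    proof (cases "x + t *\<^sub>R e \<in> K")
      case True
      from d(2)[OF this] have "(h - u (x + t *\<^sub>R e)) / dl n \<le> 0 \<or> 1 \<le> (h - u (x + t *\<^sub>R e)) / dl n"
        using n dl_pos[of n] by (auto simp: divide_simps abs_if split: if_splits)
      then show ?thesis by (simp add: kern_zero)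
    qed (use F(4) in simp)
    show "line_avg F n x = 0" unfolding line_avg_def k0 by simp
  qed
qed

text \<open>Along the line \<open>u\<close> is a strictly increasing coordinate. In it the kernel is
  a probability density that concentrates at the hitting point, and
  \<open>1 / (g (P x) \<bullet> e)\<close> is the Jacobian of the change of variable.\<close>

lemma line_avg_on:
  assumes F: "continuous_on UNIV F" "K \<subseteq> B" "\<And>x. x \<notin> K \<Longrightarrow> F x = 0" and x: "x \<in> W"
  shows "(\<lambda>n. line_avg F n x) \<longlonglongrightarrow> F (P x) / (g (P x) \<bullet> e)"
proof (rule LIMSEQ_I)
  define t0 where "t0 = T x"
  define G where "G t = F (x + t *\<^sub>R e) / (g (x + t *\<^sub>R e) \<bullet> e)" for t
  have ht: "x + t0 *\<^sub>R e \<in> B" "u (x + t0 *\<^sub>R e) = h" using hit_T[OF x] by (auto simp: hit_def t0_def)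
  have P: "P x = x + t0 *\<^sub>R e" using x by (simp add: P_def t0_def)
  fix \<epsilon> :: real assume \<epsilon>: "\<epsilon> > 0"
  have lim: "((\<lambda>s. x + s *\<^sub>R e) \<longlongrightarrow> x + t0 *\<^sub>R e) (nhds t0)" by (intro tendsto_intros filterlim_ident)
  have g0: "g (x + t0 *\<^sub>R e) \<bullet> e \<noteq> 0" using c ht by force
  have "(G \<longlongrightarrow> G t0) (nhds t0)" unfolding G_def
    by (intro tendsto_intros g0 continuous_on_tendsto_compose[OF F(1) lim] continuous_on_tendsto_compose[OF cg lim]) auto
  from tendstoD[OF this, of "\<epsilon> / 2"] have "\<forall>\<^sub>F s in nhds t0. dist (G s) (G t0) < \<epsilon> / 2" using \<epsilon> by simp
  with topological_tendstoD[OF lim B(2) ht(1)]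
  have "\<forall>\<^sub>F s in nhds t0. x + s *\<^sub>R e \<in> B \<and> dist (G s) (G t0) < \<epsilon> / 2" by eventually_elim simp
  then obtain d where d: "d > 0" "\<And>s. \<bar>s - t0\<bar> < d \<Longrightarrow> x + s *\<^sub>R e \<in> B \<and> \<bar>G s - G t0\<bar> < \<epsilon> / 2"
    by (auto simp: eventually_nhds_metric dist_real_def)
  define r where "r = d / 2"
  have r: "r > 0" "r < d" using d by (auto simp: r_def)
  \<comment> \<open>The derivative of \<open>- step ((h - u) / dl n)\<close> along the line; for
    thin layers its integral over the window is 1 (\<open>w1\<close>).\<close>
  define w where "w n t = kern ((h - u (x + t *\<^sub>R e)) / dl n) * (g (x + t *\<^sub>R e) \<bullet> e) / dl n" for n t
  have inB: "x + t *\<^sub>R e \<in> B" "\<bar>G t - G t0\<bar> < \<epsilon> / 2" if "t \<in> {t0 - r..t0}" for t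
    using d(2)[of t] that r by auto
  have wpos: "w n t \<ge> 0" if "t \<in> {t0 - r..t0}" for n t
    using inB[OF that] c(1) c(2)[of "x + t *\<^sub>R e"] dl_pos[of n] by (auto simp: w_def kern_nonneg intro!: divide_nonneg_pos mult_nonneg_nonneg)
  have cline: "continuous_on S (\<lambda>t. u (x + t *\<^sub>R e))" "continuous_on S (\<lambda>t. F (x + t *\<^sub>R e))" "continuous_on S (\<lambda>t. g (x + t *\<^sub>R e))" for S
    by (intro continuous_on_compose2[OF cu[of UNIV]] continuous_on_compose2[OF F(1)] continuous_on_compose2[OF cg] continuous_intros; simp)+
  have ckern: "continuous_on S (\<lambda>t. kern ((h - u (x + t *\<^sub>R e)) / dl n))" for S n
    using dl_pos[of n] by (intro continuous_on_compose2[OF kern_continuous] continuous_intros cline) auto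
  have cw: "continuous_on S (w n)" for n S
    unfolding w_def[abs_def] using dl_pos[of n] by (intro continuous_intros ckern cline) auto
  have cG: "continuous_on {t0 - r..t0} G"
    unfolding G_def[abs_def] using inB(1) c by (intro continuous_intros cline) force
  have intI: "integrable lborel (\<lambda>t. indicator {t0 - r..t0} t *\<^sub>R f t)" if "continuous_on {t0 - r..t0} f" for f :: "real \<Rightarrow> real"
    by (rule borel_integrable_compact[OF _ that]) simp
  show "\<exists>N. \<forall>n\<ge>N. norm (line_avg F n x - F (P x) / (g (P x) \<bullet> e)) < \<epsilon>"
  proof -
    \<comment> \<open>By \<open>growth\<close>, \<open>u\<close> rises by at least
      \<open>c * r\<close> across the window, so a layer thinner than that lies inside it.\<close>
    obtain N where N: "\<And>n. n \<ge> N \<Longrightarrow> dl n < c * r"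
      using eventually_dl_less[of "c * r"] c(1) r(1) by (auto simp: eventually_sequentially)
    have "norm (line_avg F n x - F (P x) / (g (P x) \<bullet> e)) < \<epsilon>" if n: "n \<ge> N" for n
    proof -
      have u_low: "u (x + (t0 - r) *\<^sub>R e) \<le> h - dl n"
        using growth[of x "t0 - r" t0] inB(1)[of "t0 - r"] ht r N[OF n] by auto
      have w1: "(\<integral>t. indicator {t0 - r..t0} t *\<^sub>R w n t \<partial>lborel) = 1"
      proof -
        have "(\<integral>t. indicator {t0 - r..t0} t *\<^sub>R w n t \<partial>lborel)
          = - step ((h - u (x + t0 *\<^sub>R e)) / dl n) - (- step ((h - u (x + (t0 - r) *\<^sub>R e)) / dl n))"
        proof (rule integral_FTC_atLeastAtMost)
          fix t
          have "((\<lambda>t. - step ((h - u (x + t *\<^sub>R e)) / dl n)) has_real_derivative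
            - (kern ((h - u (x + t *\<^sub>R e)) / dl n) * ((0 - g (x + t *\<^sub>R e) \<bullet> e) / dl n))) (at t)"
            by (intro DERIV_minus DERIV_chain2[OF step_deriv] DERIV_cdivide DERIV_diff DERIV_const has_real_derivative_line[OF du])
          moreover have "- (kern ((h - u (x + t *\<^sub>R e)) / dl n) * ((0 - g (x + t *\<^sub>R e) \<bullet> e) / dl n)) = w n t"
            by (simp add: w_def)
          ultimately have "((\<lambda>t. - step ((h - u (x + t *\<^sub>R e)) / dl n)) has_real_derivative w n t) (at t within {t0 - r..t0})"
            using has_field_derivative_at_within by metis
          then show "((\<lambda>t. - step ((h - u (x + t *\<^sub>R e)) / dl n)) has_vector_derivative w n t) (at t within {t0 - r..t0})"
            by (simp add: has_real_derivative_iff_has_vector_derivative)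
        qed (use r cw in auto)
        moreover have "1 \<le> (h - u (x + (t0 - r) *\<^sub>R e)) / dl n" using u_low dl_pos[of n] by (simp add: field_simps)
        ultimately show ?thesis using ht by (simp add: step_right step_0)
      qed
      have eq: "kern ((h - u (x + t *\<^sub>R e)) / dl n) * F (x + t *\<^sub>R e) / dl n = indicator {t0 - r..t0} t *\<^sub>R (G t * w n t)" for t
      proof (cases "t \<in> {t0 - r..t0}")
        case True
        then show ?thesis using inB(1)[OF True] c(1) c(2)[of "x + t *\<^sub>R e"] by (simp add: G_def w_def)
      next
        case False
        have "kern ((h - u (x + t *\<^sub>R e)) / dl n) = 0" if "x + t *\<^sub>R e \<in> B"
        proof (cases "t > t0")
          case True
          then have "u (x + t *\<^sub>R e) \<ge> h" using growth[OF ht(1) that] ht(2) c(1) by (smt (verit) mult_nonneg_nonneg)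
          then show ?thesis using dl_pos[of n] by (intro kern_zero) (auto simp: divide_simps)
        next
          case False
          then have "t \<le> t0 - r" using \<open>t \<notin> {t0 - r..t0}\<close> by auto
          then have "u (x + t *\<^sub>R e) \<le> u (x + (t0 - r) *\<^sub>R e)"
            using growth[OF that inB(1)[of "t0 - r"]] r c(1) by (smt (verit) mult_nonneg_nonneg atLeastAtMost_iff)
          then show ?thesis using dl_pos[of n] u_low by (intro kern_zero disjI2) (auto simp: divide_simps)
        qed
        moreover have "F (x + t *\<^sub>R e) = 0" if "x + t *\<^sub>R e \<notin> B" using F(2,3) that by blast
        ultimately show ?thesis using False by auto
      qed
      have "line_avg F n x = (\<integral>t. kern ((h - u (x + t *\<^sub>R e)) / dl n) * F (x + t *\<^sub>R e) / dl n \<partial>lborel)"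
        by (simp add: line_avg_def)
      also have "\<dots> = (\<integral>t. indicator {t0 - r..t0} t *\<^sub>R (G t * w n t) \<partial>lborel)"
        unfolding eq ..
      finally have L: "line_avg F n x = (\<integral>t. indicator {t0 - r..t0} t *\<^sub>R (G t * w n t) \<partial>lborel)" .
      have "line_avg F n x - G t0 = (\<integral>t. indicator {t0 - r..t0} t *\<^sub>R (G t * w n t) \<partial>lborel) - G t0 * (\<integral>t. indicator {t0 - r..t0} t *\<^sub>R w n t \<partial>lborel)"
        unfolding L w1 by simp
      also have "\<dots> = (\<integral>t. indicator {t0 - r..t0} t *\<^sub>R (G t * w n t) - G t0 * (indicator {t0 - r..t0} t *\<^sub>R w n t) \<partial>lborel)"
        unfolding integral_mult_right_zero[symmetric]
        by (intro Bochner_Integration.integral_diff[symmetric] integrable_mult_right intI continuous_intros cG cw)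
      also have "\<dots> = (\<integral>t. indicator {t0 - r..t0} t *\<^sub>R ((G t - G t0) * w n t) \<partial>lborel)"
        by (simp add: algebra_simps)
      finally have "\<bar>line_avg F n x - G t0\<bar> \<le> (\<integral>t. \<bar>indicator {t0 - r..t0} t *\<^sub>R ((G t - G t0) * w n t)\<bar> \<partial>lborel)"
        using integral_norm_bound[of lborel "\<lambda>t. indicator {t0 - r..t0} t *\<^sub>R ((G t - G t0) * w n t)"] by simp
      also have "\<dots> \<le> (\<integral>t. indicator {t0 - r..t0} t *\<^sub>R (\<epsilon> / 2 * w n t) \<partial>lborel)"
      proof (rule integral_mono)
        show "integrable lborel (\<lambda>t. \<bar>indicator {t0 - r..t0} t *\<^sub>R ((G t - G t0) * w n t)\<bar>)"
          by (intro integrable_abs intI continuous_intros cG cw)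
        show "integrable lborel (\<lambda>t. indicator {t0 - r..t0} t *\<^sub>R (\<epsilon> / 2 * w n t))"
          by (intro intI continuous_intros cw)
        fix t
        show "\<bar>indicator {t0 - r..t0} t *\<^sub>R ((G t - G t0) * w n t)\<bar> \<le> indicator {t0 - r..t0} t *\<^sub>R (\<epsilon> / 2 * w n t)"
        proof (cases "t \<in> {t0 - r..t0}")
          case True
          have "\<bar>G t - G t0\<bar> * w n t \<le> \<epsilon> / 2 * w n t"
            using inB(2)[OF True] wpos[OF True, of n] by (intro mult_right_mono) auto
          with True wpos[OF True, of n] show ?thesis by (simp add: abs_mult)
        qed simp
      qed
      also have "\<dots> = (\<integral>t. \<epsilon> / 2 * (indicator {t0 - r..t0} t *\<^sub>R w n t) \<partial>lborel)"
        by (simp add: algebra_simps)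
      also have "\<dots> = \<epsilon> / 2" using w1 by simp
      finally show ?thesis using \<epsilon> by (simp add: P G_def)
    qed
    then show ?thesis by blast
  qed
qed

text \<open>By \<open>growth\<close>, the layer meets the line within distance
  \<open>dl n / c\<close> of any one of its points, and \<open>kern\<close> is at most 2: an
  interval of length \<open>2 * dl n / c\<close> times \<open>2 * M\<close>, divided by
  \<open>dl n\<close>. The bound is uniform in \<open>n\<close> and \<open>x\<close>.\<close>

lemma line_avg_bound:
  assumes F: "continuous_on UNIV F" "K \<subseteq> B" "\<And>x. x \<notin> K \<Longrightarrow> F x = 0" "\<And>x. \<bar>F x\<bar> \<le> M"
  shows "\<bar>line_avg F n x\<bar> \<le> 4 * M / c"
proof (cases "\<exists>t. x + t *\<^sub>R e \<in> B \<and> h - dl n \<le> u (x + t *\<^sub>R e) \<and> u (x + t *\<^sub>R e) \<le> h")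
  case False
  have k0: "kern ((h - u (x + t *\<^sub>R e)) / dl n) * F (x + t *\<^sub>R e) = 0" for t
  proof (cases "x + t *\<^sub>R e \<in> B")
    case True
    then have "(h - u (x + t *\<^sub>R e)) / dl n \<le> 0 \<or> 1 \<le> (h - u (x + t *\<^sub>R e)) / dl n"
      using False dl_pos[of n] by (auto simp: divide_simps not_le)
    then show ?thesis by (simp add: kern_zero)
  qed (use F in auto)
  moreover have "M \<ge> 0" using F(4)[of x] by (meson abs_ge_zero order_trans)
  ultimately show ?thesis unfolding line_avg_def k0 using c(1) by simp
next
  case True
  then obtain t0 where t0: "x + t0 *\<^sub>R e \<in> B" "h - dl n \<le> u (x + t0 *\<^sub>R e)" "u (x + t0 *\<^sub>R e) \<le> h" by blast
  have M: "M \<ge> 0" using F(4)[of x] by (meson abs_ge_zero order_trans)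
  define l where "l = dl n / c"
  have l: "l > 0" using dl_pos c(1) by (simp add: l_def)
  have bd: "\<bar>kern ((h - u (x + t *\<^sub>R e)) / dl n) * F (x + t *\<^sub>R e)\<bar> \<le> indicator {t0 - l..t0 + l} t * (2 * M)" for t
  proof (cases "t \<in> {t0 - l..t0 + l}")
    case True
    then show ?thesis using kern_le[of "(h - u (x + t *\<^sub>R e)) / dl n"] kern_nonneg F(4)[of "x + t *\<^sub>R e"]
      by (auto simp: abs_mult intro!: mult_mono)
  next
    case out: False
    have "kern ((h - u (x + t *\<^sub>R e)) / dl n) = 0" if tB: "x + t *\<^sub>R e \<in> B"
    proof (cases "t > t0")
      case True
      then have "t - t0 \<ge> l" using out by auto
      then have "c * (t - t0) \<ge> dl n" using c(1) by (simp add: l_def field_simps)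
      then have "u (x + t *\<^sub>R e) \<ge> h" using growth[OF t0(1) tB] True t0 by auto
      then show ?thesis using dl_pos[of n] by (intro kern_zero) (auto simp: divide_simps)
    next
      case False
      then have "t0 - t \<ge> l" using out l by auto
      then have "c * (t0 - t) \<ge> dl n" using c(1) by (simp add: l_def field_simps)
      then have "u (x + t *\<^sub>R e) \<le> h - dl n" using growth[OF tB t0(1)] False t0 by auto
      then show ?thesis using dl_pos[of n] by (intro kern_zero disjI2) (auto simp: divide_simps)
    qed
    moreover have "F (x + t *\<^sub>R e) = 0" if "x + t *\<^sub>R e \<notin> B" using F(2,3) that by blast
    ultimately show ?thesis using out by auto
  qed
  have ii: "integrable lborel (\<lambda>t. indicator {t0 - l..t0 + l} t * (2 * M))"
    by (intro integrable_mult_left integrable_real_indicator) (auto simp: emeasure_lborel_Icc_eq)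
  have "\<bar>\<integral>t. kern ((h - u (x + t *\<^sub>R e)) / dl n) * F (x + t *\<^sub>R e) \<partial>lborel\<bar>
     \<le> (\<integral>t. indicator {t0 - l..t0 + l} t * (2 * M) \<partial>lborel)"
    using integral_abs_bound_integral[OF _ ii, of "\<lambda>t. kern ((h - u (x + t *\<^sub>R e)) / dl n) * F (x + t *\<^sub>R e)"] bd
    by (cases "integrable lborel (\<lambda>t. kern ((h - u (x + t *\<^sub>R e)) / dl n) * F (x + t *\<^sub>R e))")
      (auto simp: not_integrable_integral_eq M l intro!: integral_nonneg_AE mult_nonneg_nonneg less_imp_le)
  also have "\<dots> = 4 * l * M" using l by simp
  finally show ?thesis using dl_pos[of n] c(1) by (simp add: line_avg_def l_def field_simps)
qed

text \<open>Fubini over the lines and dominated convergence. The area element of the level set over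
  its shadow is \<open>norm g / (g \<bullet> e)\<close>, so the limit is surface measure divided by
  the gradient norm.\<close>

lemma chart_limit:
  assumes F: "continuous_on UNIV F" "compact K" "K \<subseteq> B" "\<And>x. x \<notin> K \<Longrightarrow> F x = 0"
  shows "(\<lambda>n. (\<integral>x. kern ((h - u x) / dl n) * F x \<partial>lborel) / dl n)
    \<longlonglongrightarrow> (\<integral>x. indicator (slab \<inter> W) x * (F (P x) / (g (P x) \<bullet> e)) \<partial>lborel)" (is ?lim)
  and "integrable lborel (\<lambda>x. indicator (slab \<inter> W) x * (F (P x) / (g (P x) \<bullet> e)))" (is ?int)
proof -
  obtain M where M: "\<And>x. \<bar>F x\<bar> \<le> M"
  proof -
    have "bounded (F ` K)"
      by (intro compact_imp_bounded compact_continuous_image continuous_on_subset[OF F(1)] F(2)) simp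
    then obtain M where M: "\<And>x. x \<in> K \<Longrightarrow> \<bar>F x\<bar> \<le> M" by (auto simp: bounded_iff)
    have "\<bar>F x\<bar> \<le> \<bar>M\<bar>" for x
      using M[of x] F(4)[of x] by (cases "x \<in> K") auto
    then show ?thesis by (rule that)
  qed
  obtain R where R: "\<And>x t. x \<in> slab \<Longrightarrow> x + t *\<^sub>R e \<in> B \<Longrightarrow> norm x \<le> R" using bounded_line by blast
  have ckF: "continuous_on S (\<lambda>x. kern ((h - u x) / dl n) * F x)" for n S
    using dl_pos[of n] F(1)
    by (intro continuous_intros continuous_on_compose2[OF kern_continuous] cu) (auto intro: continuous_on_subset)
  have kF: "integrable lborel (\<lambda>x. kern ((h - u x) / dl n) * F x)" for n
  proof -
    have "(\<lambda>x. kern ((h - u x) / dl n) * F x) = (\<lambda>x. indicator K x *\<^sub>R (kern ((h - u x) / dl n) * F x))"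
    proof
      fix x show "kern ((h - u x) / dl n) * F x = indicator K x *\<^sub>R (kern ((h - u x) / dl n) * F x)"
        using F(4)[of x] by (cases "x \<in> K") auto
    qed
    then show ?thesis using borel_integrable_compact[OF F(2) ckF, of n] by simp
  qed
  have avg: "(\<integral>x. kern ((h - u x) / dl n) * F x \<partial>lborel) / dl n = (\<integral>x. indicator slab x * line_avg F n x \<partial>lborel)" for n
    unfolding line_avg_def slab_def integral_slab[OF e kF, symmetric] by simp
  have [measurable]: "slab \<in> sets borel" "W \<in> sets borel" "P \<in> borel_measurable borel"
    using slab_measurable open_W P_measurable by auto
  have [measurable]: "F \<in> borel_measurable borel" "g \<in> borel_measurable borel" "u \<in> borel_measurable borel" "kern \<in> borel_measurable borel"
    using F(1) cg cu kern_continuous by (auto intro: borel_measurable_continuous_onI)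
  have level_measure: "line_avg F n \<in> borel_measurable lborel" for n
  proof -
    have "(\<lambda>x. \<integral>t. kern ((h - u (x + t *\<^sub>R e)) / dl n) * F (x + t *\<^sub>R e) \<partial>lborel) \<in> borel_measurable lborel"
      by (rule lborel.borel_measurable_lebesgue_integral) measurable
    then show ?thesis unfolding line_avg_def[abs_def] by measurable
  qed
  have w: "integrable lborel (\<lambda>x. indicator (cball 0 R) x * (4 * M / c))"
    using emeasure_lborel_cball_finite[of 0 R]
    by (intro integrable_mult_left integrable_real_indicator) (auto simp: infinity_ennreal_def)
  have lim: "AE x in lborel. (\<lambda>n. indicator slab x * line_avg F n x) \<longlonglongrightarrow> indicator (slab \<inter> W) x * (F (P x) / (g (P x) \<bullet> e))"
  proof (intro AE_I2)
    fix x
    show "(\<lambda>n. indicator slab x * line_avg F n x) \<longlonglongrightarrow> indicator (slab \<inter> W) x * (F (P x) / (g (P x) \<bullet> e))"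
    proof (cases "x \<in> W")
      case True
      from tendsto_mult_left[OF line_avg_on[OF F(1,3,4) True], of "indicator slab x"] True show ?thesis
        by (simp add: indicator_inter_arith)
    next
      case False
      from tendsto_mult_left[OF line_avg_off[OF F False], of "indicator slab x"] False show ?thesis by simp
    qed
  qed
  have bound: "AE x in lborel. norm (indicator slab x * line_avg F n x) \<le> indicator (cball 0 R) x * (4 * M / c)" for n
  proof (intro AE_I2)
    fix x
    show "norm (indicator slab x * line_avg F n x) \<le> indicator (cball 0 R) x * (4 * M / c)"
    proof (cases "x \<in> slab \<and> (\<exists>t. x + t *\<^sub>R e \<in> B)")
      case True
      then have "x \<in> cball 0 R" using R by auto
      then show ?thesis using True line_avg_bound[OF F(1,3,4) M, of n x] by simp
    next
      case False
      have "line_avg F n x = 0" if "x \<in> slab"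
      proof -
        have "F (x + t *\<^sub>R e) = 0" for t using False that F(3,4) by blast
        then show ?thesis by (simp add: line_avg_def)
      qed
      moreover have "0 \<le> 4 * M / c" using M[of x] c(1) abs_ge_zero[of "F x"] by (simp add: divide_nonneg_pos)
      ultimately show ?thesis by (auto simp: indicator_def)
    qed
  qed
  have m1: "(\<lambda>x. indicator (slab \<inter> W) x * (F (P x) / (g (P x) \<bullet> e))) \<in> borel_measurable lborel" by measurable
  have m2: "(\<lambda>x. indicator slab x * line_avg F n x) \<in> borel_measurable lborel" for n using level_measure by measurable
  show ?lim unfolding avg by (rule integral_dominated_convergence[OF m1 m2 w lim bound])
  show ?int by (rule integrable_dominated_convergence[OF m1 m2 w lim bound])
qed

end

section \<open>Gluing the chart measures\<close>

lemma sum_of_two_measures: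
  assumes 1: "sets M1 = sets (borel :: 'a::topological_space measure)" "sets M2 = sets (borel :: 'a measure)"
  shows "\<exists>M :: 'a measure. sets M = sets borel \<and> (\<forall>A\<in>sets borel. emeasure M A = emeasure M1 A + emeasure M2 A)
    \<and> (\<forall>f\<in>borel_measurable borel. (\<integral>\<^sup>+x. f x \<partial>M) = (\<integral>\<^sup>+x. f x \<partial>M1) + (\<integral>\<^sup>+x. f x \<partial>M2))"
proof -
  define m where "m A = emeasure M1 A + emeasure M2 A" for A :: "'a set"
  define M where "M = measure_of UNIV (sets (borel :: 'a measure)) m"
  have sM: "sets M = sets borel" unfolding M_def by (metis sets.sets_measure_of_eq space_borel)
  have sp: "space M = UNIV" using sets_eq_imp_space_eq[OF sM] by simp
  have em: "emeasure M A = m A" if A: "A \<in> sets borel" for A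
    unfolding M_def
  proof (rule emeasure_measure_of_sigma)
    show "sigma_algebra UNIV (sets (borel :: 'a measure))" using sets.sigma_algebra_axioms[of "borel :: 'a measure"] by simp
    show "positive (sets borel) m" by (simp add: positive_def m_def)
    show "countably_additive (sets borel) m"
      unfolding countably_additive_def m_def
    proof (intro allI impI)
      fix A :: "nat \<Rightarrow> 'a set" assume A: "range A \<subseteq> sets borel" "disjoint_family A" "\<Union>(range A) \<in> sets borel"
      have "(\<Sum>i. emeasure M1 (A i) + emeasure M2 (A i)) = (\<Sum>i. emeasure M1 (A i)) + (\<Sum>i. emeasure M2 (A i))"
        by (rule suminf_add[symmetric]) auto
      also have "\<dots> = emeasure M1 (\<Union>(range A)) + emeasure M2 (\<Union>(range A))"
        using A 1 by (simp add: suminf_emeasure)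
      finally show "(\<Sum>i. emeasure M1 (A i) + emeasure M2 (A i)) = emeasure M1 (\<Union>(range A)) + emeasure M2 (\<Union>(range A))" .
    qed
    show "A \<in> sets borel" by (rule A)
  qed
  have mm: "borel_measurable M = (borel_measurable borel :: ('a \<Rightarrow> ennreal) set)"
    "borel_measurable M1 = (borel_measurable borel :: ('a \<Rightarrow> ennreal) set)"
    "borel_measurable M2 = (borel_measurable borel :: ('a \<Rightarrow> ennreal) set)"
    using sM 1 by (auto intro!: measurable_cong_sets)
  have "(\<integral>\<^sup>+x. f x \<partial>M) = (\<integral>\<^sup>+x. f x \<partial>M1) + (\<integral>\<^sup>+x. f x \<partial>M2)" if "f \<in> borel_measurable borel" for f :: "'a \<Rightarrow> ennreal"
    using that
  proof (induction f rule: borel_measurable_induct)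
    case (cong f g)
    then have "f = g" by auto
    with cong show ?case by simp
  next
    case (set A)
    then show ?case using em[OF set] sM 1 by (simp add: m_def)
  next
    case (mult f c)
    then show ?case using mm by (simp add: nn_integral_cmult distrib_left)
  next
    case (add f g)
    then show ?case using mm by (simp add: nn_integral_add add_ac)
  next
    case (seq U)
    have "(\<integral>\<^sup>+x. (SUP i. U i) x \<partial>N) = (SUP i. \<integral>\<^sup>+x. U i x \<partial>N)" if "borel_measurable N = (borel_measurable borel :: ('a \<Rightarrow> ennreal) set)" for N
      unfolding SUP_apply by (rule nn_integral_monotone_convergence_SUP) (use seq that in auto)
    moreover have "(SUP i. (\<integral>\<^sup>+x. U i x \<partial>M1) + (\<integral>\<^sup>+x. U i x \<partial>M2)) = (SUP i. \<integral>\<^sup>+x. U i x \<partial>M1) + (SUP i. \<integral>\<^sup>+x. U i x \<partial>M2)"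
      using seq by (intro ennreal_SUP_add) (auto simp: incseq_def le_fun_def intro!: nn_integral_mono)
    ultimately show ?case using mm seq by simp
  qed
  then show ?thesis using sM em by (intro exI[of _ M]) (auto simp: m_def)
qed

text \<open>\<open>represents u h S \<xi> M\<close>: the measures with density \<open>kern ((h - u) / \<delta>) \<xi> / \<delta>\<close>, concentrated in
  the layer \<open>h - \<delta> < u < h\<close>, converge weakly to \<open>M\<close>, and \<open>M\<close> lives on \<open>S\<close>.\<close>

definition represents ::
  "('a::euclidean_space \<Rightarrow> real) \<Rightarrow> real \<Rightarrow> 'a set \<Rightarrow> ('a \<Rightarrow> real) \<Rightarrow> 'a measure \<Rightarrow> bool" where
  "represents u h S \<xi> M \<longleftrightarrow> sets M = sets borel \<and> finite_measure M \<and> (AE x in M. x \<in> S)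
     \<and> (\<forall>F. continuous_on UNIV F \<longrightarrow> integrable M F
          \<and> (\<lambda>n. (\<integral>x. kern ((h - u x) / dl n) * (\<xi> x * F x) \<partial>lborel) / dl n) \<longlonglongrightarrow> integral\<^sup>L M F)"

lemma integrable_kern:
  fixes u :: "'a::euclidean_space \<Rightarrow> real"
  assumes "continuous_on UNIV u" "continuous_on UNIV \<xi>" "continuous_on UNIV F" "compact K" "\<And>x. x \<notin> K \<Longrightarrow> \<xi> x = 0"
  shows "integrable lborel (\<lambda>x. kern ((h - u x) / dl n) * (\<xi> x * F x))"
proof -
  have "continuous_on UNIV (\<lambda>x. kern ((h - u x) / dl n) * (\<xi> x * F x))"
    using dl_pos[of n] assms by (intro continuous_intros continuous_on_compose2[OF kern_continuous]) auto
  then have "continuous_on K (\<lambda>x. kern ((h - u x) / dl n) * (\<xi> x * F x))" by (rule continuous_on_subset) simp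
  moreover have "(\<lambda>x. kern ((h - u x) / dl n) * (\<xi> x * F x)) = (\<lambda>x. indicator K x *\<^sub>R (kern ((h - u x) / dl n) * (\<xi> x * F x)))"
  proof
    fix x show "kern ((h - u x) / dl n) * (\<xi> x * F x) = indicator K x *\<^sub>R (kern ((h - u x) / dl n) * (\<xi> x * F x))"
      using assms(5)[of x] by (cases "x \<in> K") auto
  qed
  ultimately show ?thesis
    by (subst \<open>(\<lambda>x. kern ((h - u x) / dl n) * (\<xi> x * F x)) = _\<close>) (rule borel_integrable_compact[OF assms(4)])
qed

lemma represents_add:
  fixes u :: "'a::euclidean_space \<Rightarrow> real"
  assumes u: "continuous_on UNIV u" and \<xi>: "continuous_on UNIV \<xi>" "continuous_on UNIV \<zeta>"
    and K: "compact K" "\<And>x. x \<notin> K \<Longrightarrow> \<xi> x = 0" "compact L" "\<And>x. x \<notin> L \<Longrightarrow> \<zeta> x = 0"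
    and r: "represents u h S \<xi> M1" "represents u h S \<zeta> M2" and S: "S \<in> sets borel"
  shows "\<exists>M. represents u h S (\<lambda>x. \<xi> x + \<zeta> x) M"
proof -
  have s: "sets M1 = sets borel" "sets M2 = sets borel" using r by (auto simp: represents_def)
  obtain M where M: "sets M = sets borel" "\<And>A. A \<in> sets borel \<Longrightarrow> emeasure M A = emeasure M1 A + emeasure M2 A"
    "\<And>f. f \<in> borel_measurable borel \<Longrightarrow> (\<integral>\<^sup>+x. f x \<partial>M) = (\<integral>\<^sup>+x. f x \<partial>M1) + (\<integral>\<^sup>+x. f x \<partial>M2)"
    using sum_of_two_measures[OF s] by blast
  have sp: "space M = UNIV" "space M1 = UNIV" "space M2 = UNIV"
    using sets_eq_imp_space_eq[OF M(1)] sets_eq_imp_space_eq[OF s(1)] sets_eq_imp_space_eq[OF s(2)] by auto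
  have fin: "finite_measure M1" "finite_measure M2" using r by (auto simp: represents_def)
  have "represents u h S (\<lambda>x. \<xi> x + \<zeta> x) M"
    unfolding represents_def
  proof (intro conjI allI impI)
    show "sets M = sets borel" by (rule M(1))
    show "finite_measure M"
      using finite_measure.emeasure_finite[OF fin(1), of UNIV] finite_measure.emeasure_finite[OF fin(2), of UNIV]
      by (intro finite_measureI) (simp add: sp M(2))
    have "emeasure M1 (- S) = 0" "emeasure M2 (- S) = 0"
      using r S s sp unfolding represents_def
      by (auto simp: AE_iff_measurable[of "- S"] Compl_eq)
    then have "emeasure M (- S) = 0" using M(2)[of "- S"] S by (simp add: borel_comp)
    then show "AE x in M. x \<in> S"
      using S M(1) sp by (subst AE_iff_measurable[of "- S"]) (auto simp: Compl_eq)
    fix F :: "'a \<Rightarrow> real" assume F: "continuous_on UNIV F"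
    have Fm: "F \<in> borel_measurable borel" using F by (rule borel_measurable_continuous_onI)
    have mm: "borel_measurable M = (borel_measurable borel :: ('a \<Rightarrow> real) set)"
      using M(1) by (auto intro!: measurable_cong_sets)
    have i: "integrable M1 F" "integrable M2 F" using r F by (auto simp: represents_def)
    have n: "(\<integral>\<^sup>+x. ennreal (norm (F x)) \<partial>M1) < \<infinity>" "(\<integral>\<^sup>+x. ennreal (norm (F x)) \<partial>M2) < \<infinity>"
      using i by (auto simp: integrable_iff_bounded)
    show iM: "integrable M F"
      using n Fm mm by (auto simp: integrable_iff_bounded M(3))
    have le: "(\<integral>\<^sup>+x. ennreal (F x) \<partial>N) < top" "(\<integral>\<^sup>+x. ennreal (- F x) \<partial>N) < top"
      if "(\<integral>\<^sup>+x. ennreal (norm (F x)) \<partial>N) < \<infinity>" for N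
      using that by (auto intro!: le_less_trans[OF nn_integral_mono that[unfolded infinity_ennreal_def]] ennreal_leI)
    have "integral\<^sup>L M F = integral\<^sup>L M1 F + integral\<^sup>L M2 F"
      unfolding real_lebesgue_integral_def[OF iM] real_lebesgue_integral_def[OF i(1)] real_lebesgue_integral_def[OF i(2)]
      using le[OF n(1)] le[OF n(2)] Fm by (simp add: M(3) enn2real_plus)
    moreover have "(\<lambda>n. (\<integral>x. kern ((h - u x) / dl n) * (\<xi> x * F x) \<partial>lborel) / dl n
        + (\<integral>x. kern ((h - u x) / dl n) * (\<zeta> x * F x) \<partial>lborel) / dl n) \<longlonglongrightarrow> integral\<^sup>L M1 F + integral\<^sup>L M2 F"
      using r F by (intro tendsto_add) (auto simp: represents_def)
    moreover have "(\<integral>x. kern ((h - u x) / dl n) * ((\<xi> x + \<zeta> x) * F x) \<partial>lborel) / dl n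
      = (\<integral>x. kern ((h - u x) / dl n) * (\<xi> x * F x) \<partial>lborel) / dl n
        + (\<integral>x. kern ((h - u x) / dl n) * (\<zeta> x * F x) \<partial>lborel) / dl n" for n
    proof -
      have "(\<integral>x. kern ((h - u x) / dl n) * (\<xi> x * F x) + kern ((h - u x) / dl n) * (\<zeta> x * F x) \<partial>lborel)
        = (\<integral>x. kern ((h - u x) / dl n) * (\<xi> x * F x) \<partial>lborel) + (\<integral>x. kern ((h - u x) / dl n) * (\<zeta> x * F x) \<partial>lborel)"
        by (rule Bochner_Integration.integral_add[OF integrable_kern[OF u \<xi>(1) F K(1,2)] integrable_kern[OF u \<xi>(2) F K(3,4)]])
      then show ?thesis by (simp add: distrib_left distrib_right add_divide_distrib)
    qed
    ultimately show "(\<lambda>n. (\<integral>x. kern ((h - u x) / dl n) * ((\<xi> x + \<zeta> x) * F x) \<partial>lborel) / dl n) \<longlonglongrightarrow> integral\<^sup>L M F"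
      by simp
  qed
  then show ?thesis by blast
qed

text \<open>The image under \<open>P\<close> of the limit density on the shadow; it is carried by
  the level set because \<open>P\<close> takes its values there on \<open>W\<close>.\<close>

lemma (in level_chart) chart_measure:
  assumes \<xi>: "continuous_on UNIV \<xi>" "\<And>x. \<xi> x \<ge> 0" "compact K" "K \<subseteq> B" "\<And>x. x \<notin> K \<Longrightarrow> \<xi> x = 0"
  shows "\<exists>M. represents u h {x \<in> B. u x = h} \<xi> M"
proof -
  define w where "w x = indicator (slab \<inter> W) x * (\<xi> (P x) / (g (P x) \<bullet> e))" for x
  define M where "M = distr (density lborel (\<lambda>x. ennreal (w x))) borel P"
  have [measurable]: "slab \<in> sets borel" "W \<in> sets borel" "P \<in> borel_measurable borel"
    using slab_measurable open_W P_measurable by auto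
  have [measurable]: "\<xi> \<in> borel_measurable borel" "g \<in> borel_measurable borel" "u \<in> borel_measurable borel" "B \<in> sets borel"
    using \<xi>(1) cg cu B by (auto intro: borel_measurable_continuous_onI)
  have wm[measurable]: "w \<in> borel_measurable borel" unfolding w_def[abs_def] by measurable
  have w0: "w x \<ge> 0" for x
  proof (cases "x \<in> W")
    case True
    then show ?thesis using P_level[OF True] c(1) c(2)[of "P x"] \<xi>(2) by (auto simp: w_def intro!: mult_nonneg_nonneg divide_nonneg_nonneg)
  qed (simp add: w_def)
  have int: "integrable lborel (\<lambda>x. w x * F (P x))"
    and lim: "(\<lambda>n. (\<integral>x. kern ((h - u x) / dl n) * (\<xi> x * F x) \<partial>lborel) / dl n) \<longlonglongrightarrow> (\<integral>x. w x * F (P x) \<partial>lborel)"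
    if F: "continuous_on UNIV F" for F
    using chart_limit[of "\<lambda>x. \<xi> x * F x" K] \<xi> F by (simp_all add: w_def continuous_intros mult_ac)
  have iM: "integrable M F" "integral\<^sup>L M F = (\<integral>x. w x * F (P x) \<partial>lborel)" if F: "continuous_on UNIV F" for F
  proof -
    have Fm[measurable]: "F \<in> borel_measurable borel" using F by (rule borel_measurable_continuous_onI)
    show "integrable M F"
      unfolding M_def using int[OF F] w0
      by (subst integrable_distr_eq) (auto simp: integrable_density)
    show "integral\<^sup>L M F = (\<integral>x. w x * F (P x) \<partial>lborel)"
      unfolding M_def using w0
      by (subst integral_distr) (auto simp: integral_density)
  qed
  have sets: "sets M = sets borel" by (simp add: M_def)
  have fm: "finite_measure M"
  proof (rule finite_measureI)
    have "integrable M (\<lambda>x. 1 :: real)" by (rule iM) simp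
    then show "emeasure M (space M) \<noteq> \<infinity>" by (simp add: integrable_iff_bounded)
  qed
  have "AE x in M. x \<in> {x \<in> B. u x = h}"
    unfolding M_def
  proof (subst AE_distr_iff)
    have "AE x in lborel. 0 < ennreal (w x) \<longrightarrow> P x \<in> {x \<in> B. u x = h}"
      using P_level by (intro AE_I2) (auto simp: w_def indicator_def split: if_splits)
    then show "AE x in density lborel (\<lambda>x. ennreal (w x)). P x \<in> {x \<in> B. u x = h}"
      by (subst AE_density) auto
  qed auto
  then show ?thesis
    unfolding represents_def using sets fm iM lim by (intro exI[of _ M]) auto
qed

text \<open>By continuity \<open>g\<close> varies little near \<open>y\<close>. The ratio
  \<open>(1 + \<eta>) / (1 - \<eta>)\<close> of the upper bound of \<open>norm (g x)\<close> to the
  lower bound of the component along \<open>e\<close> controls how much the projection along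
  \<open>e\<close> shrinks areas; it is close to 1 for small \<open>\<eta>\<close>.\<close>

lemma level_chart_at:
  fixes u :: "'a::euclidean_space \<Rightarrow> real"
  assumes du: "\<And>x. (u has_derivative (\<lambda>v. g x \<bullet> v)) (at x)" and cg: "continuous_on UNIV g"
    and y: "g y \<noteq> 0" "y \<in> U" "open U" and \<eta>: "0 < \<eta>" "\<eta> < 1"
  obtains r where "r > 0" "ball y r \<subseteq> U" "level_chart u g (sgn (g y)) (ball y r) ((1 - \<eta>) * norm (g y))"
    "\<And>x. x \<in> ball y r \<Longrightarrow> norm (g x) \<le> (1 + \<eta>) * norm (g y)"
proof -
  have s: "norm (g y) > 0" using y(1) by simp
  obtain d1 where d1: "d1 > 0" "\<And>x. dist x y < d1 \<Longrightarrow> dist (g x) (g y) < \<eta> * norm (g y)"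
    using cg \<eta>(1) s unfolding continuous_on_iff by (metis UNIV_I mult_pos_pos)
  obtain d2 where d2: "d2 > 0" "ball y d2 \<subseteq> U" using y(2,3) open_contains_ball by blast
  define r where "r = min d1 d2"
  have near: "norm (g x - g y) \<le> \<eta> * norm (g y)" if "x \<in> ball y r" for x
    using d1(2)[of x] that by (simp add: r_def dist_norm norm_minus_commute less_imp_le)
  show thesis
  proof
    show "r > 0" "ball y r \<subseteq> U" using d1 d2 by (auto simp: r_def)
    show "norm (g x) \<le> (1 + \<eta>) * norm (g y)" if "x \<in> ball y r" for x
      using near[OF that] norm_triangle_sub[of "g x" "g y"] by (simp add: algebra_simps)
    show "level_chart u g (sgn (g y)) (ball y r) ((1 - \<eta>) * norm (g y))"
    proof
      show "norm (sgn (g y)) = 1" using y(1) by (simp add: norm_sgn)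
      show "0 < (1 - \<eta>) * norm (g y)" using \<eta> s by simp
      fix x assume x: "x \<in> ball y r"
      have "g y \<bullet> sgn (g y) = norm (g y)"
        using s by (simp add: sgn_div_norm dot_square_norm power2_eq_square)
      moreover have "\<bar>(g x - g y) \<bullet> sgn (g y)\<bar> \<le> \<eta> * norm (g y)"
        using Cauchy_Schwarz_ineq2[of "g x - g y" "sgn (g y)"] near[OF x] y(1) by (simp add: norm_sgn)
      ultimately show "(1 - \<eta>) * norm (g y) \<le> g x \<bullet> sgn (g y)"
        by (simp add: inner_diff_left algebra_simps abs_le_iff)
    qed (use du cg in auto)
  qed
qed

text \<open>A finite cover of the compact level set by charts and subordinate weights
  \<open>\<xi> y\<close> reduce the claim to single charts, whose measures are added.\<close>

theorem level_measure_exists: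
  fixes u :: "'a::euclidean_space \<Rightarrow> real"
  assumes du: "\<And>x. (u has_derivative (\<lambda>v. g x \<bullet> v)) (at x)" and cg: "continuous_on UNIV g"
    and D: "compact D" and S: "S = {x \<in> D. u x = h}" "S \<subseteq> interior D" and g0: "\<And>x. x \<in> S \<Longrightarrow> g x \<noteq> 0"
  shows "\<exists>M. sets M = sets borel \<and> finite_measure M \<and> (AE x in M. x \<in> S)
     \<and> (\<forall>F. continuous_on UNIV F \<longrightarrow> integrable M F
          \<and> (\<lambda>n. (LINT x:D|lebesgue. kern ((h - u x) / dl n) * F x) / dl n) \<longlonglongrightarrow> integral\<^sup>L M F)"
proof -
  have cu: "continuous_on A u" for A
    by (rule continuous_at_imp_continuous_on[OF ballI]) (rule has_derivative_continuous[OF du])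
  have "closed {x. u x = h}" by (intro closed_Collect_eq cu continuous_intros)
  then have compS: "compact S" using D compact_Int_closed[of D "{x. u x = h}"] by (simp add: S Collect_conj_eq)
  have Sb: "S \<in> sets borel" using compS by (simp add: borel_compact)
  have "\<exists>r>0. ball y r \<subseteq> interior D \<and> level_chart u g (sgn (g y)) (ball y r) ((1 - 1/2) * norm (g y))" if "y \<in> S" for y
    by (rule level_chart_at[OF du cg g0[OF that], of "interior D" "1/2"]) (use that S in auto)
  then obtain r where r: "\<And>y. y \<in> S \<Longrightarrow> r y > 0 \<and> ball y (r y) \<subseteq> interior D \<and> level_chart u g (sgn (g y)) (ball y (r y)) ((1 - 1/2) * norm (g y))"
    by metis
  have "S \<subseteq> (\<Union>y\<in>S. ball y (r y / 2))" using r by force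
  then obtain I where I: "I \<subseteq> S" "finite I" "S \<subseteq> (\<Union>y\<in>I. ball y (r y / 2))"
    using compactE_image[OF compS, of S "\<lambda>y. ball y (r y / 2)"] by auto
  define ch where "ch y x = max 0 (r y / 2 - dist x y)" for y x
  define Q where "Q x = (\<Sum>y\<in>I. ch y x)" for x
  have cch: "continuous_on UNIV (ch y)" for y unfolding ch_def[abs_def] by (intro continuous_intros)
  have cQ: "continuous_on A Q" for A unfolding Q_def[abs_def]
    by (intro continuous_intros continuous_on_subset[OF cch]) auto
  have ch0: "ch y x \<ge> 0" for x y by (simp add: ch_def)
  have Qpos: "Q x > 0" if xS: "x \<in> S" for x
  proof -
    obtain y where y: "y \<in> I" "x \<in> ball y (r y / 2)" using subsetD[OF I(3) xS] by blast
    then have "ch y x > 0" by (simp add: ch_def dist_commute)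
    then show ?thesis unfolding Q_def using y I(2) ch0 by (intro sum_pos2) auto
  qed
  obtain c where c: "c > 0" "\<And>x. x \<in> S \<Longrightarrow> c < Q x"
  proof (cases "S = {}")
    case True
    then show ?thesis using that[of 1] by auto
  next
    case False
    from continuous_attains_inf[OF compS False cQ] obtain z where "z \<in> S" "\<And>x. x \<in> S \<Longrightarrow> Q z \<le> Q x" by blast
    then show ?thesis using that[of "Q z / 2"] Qpos[of z] Qpos by (metis half_gt_zero field_sum_of_halves less_add_same_cancel1 less_le_trans)
  qed
  \<comment> \<open>Division by \<open>max (Q x) c\<close> instead of \<open>Q x\<close> keeps the
    weights continuous where \<open>Q\<close> vanishes. They sum to 1 only where
    \<open>Q x \<ge> c\<close>, which holds in a neighbourhood of \<open>S\<close>.\<close>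
  define \<xi> where "\<xi> y x = ch y x / max (Q x) c" for y x
  have mx: "max (Q x) c > 0" for x using c(1) by auto
  have c\<xi>: "continuous_on UNIV (\<xi> y)" for y unfolding \<xi>_def[abs_def]
    using mx by (intro continuous_intros cQ continuous_on_subset[OF cch]) (auto simp: less_imp_neq[symmetric])
  have supp: "\<xi> y x = 0" if "x \<notin> cball y (r y / 2)" for x y using that by (auto simp: \<xi>_def ch_def dist_commute)
  have sub: "cball y (r y / 2) \<subseteq> ball y (r y)" if "y \<in> I" for y using r[of y] that I(1) by auto
  have ex: "\<exists>M. represents u h S (\<xi> y) M" if y: "y \<in> I" for y
  proof -
    interpret level_chart u g "sgn (g y)" "ball y (r y)" "(1 - 1/2) * norm (g y)" h using r y I(1) by blast
    have "\<xi> y x \<ge> 0" for x using ch0[of y x] mx[of x] by (simp add: \<xi>_def)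
    then obtain M where M: "represents u h {x \<in> ball y (r y). u x = h} (\<xi> y) M"
      using chart_measure[OF c\<xi> _ compact_cball sub[OF y] supp] by blast
    moreover have "ball y (r y) \<subseteq> D" using r[of y] y I(1) interior_subset[of D] by blast
    then have sub: "{x \<in> ball y (r y). u x = h} \<subseteq> S" unfolding S by blast
    have "AE x in M. x \<in> {x \<in> ball y (r y). u x = h}" using M unfolding represents_def by blast
    then have "AE x in M. x \<in> S" by (rule eventually_mono) (rule subsetD[OF sub])
    ultimately show ?thesis using M unfolding represents_def by blast
  qed
  have "\<exists>M. represents u h S (\<lambda>x. \<Sum>y\<in>J. \<xi> y x) M" if "J \<subseteq> I" for J
    using finite_subset[OF that I(2)] that
  proof (induction J rule: finite_induct)
    case empty
    define N where "N = density (lborel :: 'a measure) (\<lambda>x. ennreal 0)"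
    have "represents u h S (\<lambda>x. 0) N"
      unfolding represents_def
    proof (intro conjI allI impI)
      show "sets N = sets borel" by (simp add: N_def)
      show "finite_measure N" by (rule finite_measureI) (simp add: N_def emeasure_density)
      show "AE x in N. x \<in> S" unfolding N_def by (subst AE_density) auto
      fix F :: "'a \<Rightarrow> real" assume "continuous_on UNIV F"
      then have Fm: "F \<in> borel_measurable lborel" by (simp add: borel_measurable_continuous_onI)
      then show "integrable N F" unfolding N_def by (subst integrable_density) auto
      have "integral\<^sup>L N F = 0" unfolding N_def using Fm by (subst integral_density) auto
      then show "(\<lambda>n. (\<integral>x. kern ((h - u x) / dl n) * (0 * F x) \<partial>lborel) / dl n) \<longlonglongrightarrow> integral\<^sup>L N F"
        by simp
    qed
    then show ?case by auto
  next
    case (insert y J)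
    obtain M1 where M1: "represents u h S (\<xi> y) M1" using ex insert by blast
    obtain M2 where M2: "represents u h S (\<lambda>x. \<Sum>y\<in>J. \<xi> y x) M2" using insert by auto
    have comp: "compact (\<Union>y\<in>J. cball y (r y / 2))" using insert by (intro compact_UN) auto
    have cont: "continuous_on UNIV (\<lambda>x. \<Sum>y\<in>J. \<xi> y x)" by (intro continuous_intros c\<xi>)
    have zero: "(\<Sum>y\<in>J. \<xi> y x) = 0" if "x \<notin> (\<Union>y\<in>J. cball y (r y / 2))" for x
      using that supp by (intro sum.neutral) auto
    have "\<exists>M. represents u h S (\<lambda>x. \<xi> y x + (\<Sum>y\<in>J. \<xi> y x)) M"
      by (rule represents_add[OF cu c\<xi> cont compact_cball supp comp zero M1 M2 Sb])
    then show ?case using insert by simp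
  qed
  then obtain M where M: "represents u h S (\<lambda>x. \<Sum>y\<in>I. \<xi> y x) M" by blast
  have one: "(\<Sum>y\<in>I. \<xi> y x) = Q x / max (Q x) c" for x
    by (simp add: \<xi>_def Q_def sum_divide_distrib)
  have off: "(\<Sum>y\<in>I. \<xi> y x) = 0" if "x \<notin> D" for x
  proof (intro sum.neutral ballI)
    fix y assume "y \<in> I"
    then have "x \<notin> cball y (r y / 2)" using that sub[of y] r[of y] I(1) interior_subset[of D] by blast
    then show "\<xi> y x = 0" by (rule supp)
  qed
  \<comment> \<open>Where \<open>Q x \<le> c\<close>, the height stays away from \<open>h\<close>,
    so thin layers consist of points at which the weights sum to 1.\<close>
  have ev: "\<forall>\<^sub>F n in sequentially. \<forall>x\<in>D. Q x \<le> c \<longrightarrow> kern ((h - u x) / dl n) = 0"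
  proof -
    have cl: "closed {x. Q x \<le> c}" by (intro closed_Collect_le cQ continuous_intros)
    have comp: "compact (D \<inter> {x. Q x \<le> c})" using compact_Int_closed[OF D cl] .
    obtain d where d: "d > 0" "\<And>x. x \<in> D \<inter> {x. Q x \<le> c} \<Longrightarrow> d \<le> \<bar>h - u x\<bar>"
    proof (cases "D \<inter> {x. Q x \<le> c} = {}")
      case True
      then show ?thesis using that[of 1] by auto
    next
      case False
      have "continuous_on (D \<inter> {x. Q x \<le> c}) (\<lambda>x. \<bar>h - u x\<bar>)" by (intro continuous_intros cu)
      from continuous_attains_inf[OF comp False this] obtain z where z: "z \<in> D \<inter> {x. Q x \<le> c}"
        "\<And>x. x \<in> D \<inter> {x. Q x \<le> c} \<Longrightarrow> \<bar>h - u z\<bar> \<le> \<bar>h - u x\<bar>" by blast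
      have "u z \<noteq> h" using z(1) c(2)[of z] by (auto simp: S)
      then show ?thesis using that[of "\<bar>h - u z\<bar>"] z(2) by auto
    qed
    show ?thesis
      using eventually_dl_less[OF d(1)]
    proof eventually_elim
      case (elim n)
      show ?case
      proof (intro ballI impI)
        fix x assume "x \<in> D" "Q x \<le> c"
        then have "d \<le> \<bar>h - u x\<bar>" using d(2) by blast
        then have "(h - u x) / dl n \<le> 0 \<or> 1 \<le> (h - u x) / dl n"
          using elim dl_pos[of n] by (auto simp: divide_simps abs_if split: if_splits)
        then show "kern ((h - u x) / dl n) = 0" by (rule kern_zero)
      qed
    qed
  qed
  have "(\<lambda>n. (LINT x:D|lebesgue. kern ((h - u x) / dl n) * F x) / dl n) \<longlonglongrightarrow> integral\<^sup>L M F" if F: "continuous_on UNIV F" for F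
  proof (rule Lim_transform_eventually)
    show "(\<lambda>n. (\<integral>x. kern ((h - u x) / dl n) * ((\<Sum>y\<in>I. \<xi> y x) * F x) \<partial>lborel) / dl n) \<longlonglongrightarrow> integral\<^sup>L M F"
      using M F by (simp add: represents_def)
    show "\<forall>\<^sub>F n in sequentially. (\<integral>x. kern ((h - u x) / dl n) * ((\<Sum>y\<in>I. \<xi> y x) * F x) \<partial>lborel) / dl n
        = (LINT x:D|lebesgue. kern ((h - u x) / dl n) * F x) / dl n"
      using ev
    proof eventually_elim
      case (elim n)
      have eq: "kern ((h - u x) / dl n) * ((\<Sum>y\<in>I. \<xi> y x) * F x) = indicator D x *\<^sub>R (kern ((h - u x) / dl n) * F x)" for x
      proof (cases "x \<in> D")
        case True
        then show ?thesis using elim one[of x] c(1) by (cases "Q x \<le> c") auto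
      next
        case False
        then show ?thesis using off by simp
      qed
      have "continuous_on D (\<lambda>x. kern ((h - u x) / dl n) * F x)"
        using dl_pos[of n] F by (intro continuous_intros continuous_on_compose2[OF kern_continuous] cu) (auto intro: continuous_on_subset)
      from LINT_lebesgue_lborel[OF D this] show ?case unfolding eq by (simp add: set_lebesgue_integral_def)
    qed
  qed
  then show ?thesis using M unfolding represents_def by (intro exI[of _ M]) blast
qed

section \<open>Shadows of small sets\<close>

lemma emeasure_lborel_eq_measure:
  fixes S :: "'a::euclidean_space set"
  assumes "S \<in> sets borel" "bounded S"
  shows "S \<in> lmeasurable" "emeasure lborel S = ennreal (measure lebesgue S)"
proof -
  show l: "S \<in> lmeasurable" using assms by (intro bounded_set_imp_lmeasurable) auto
  have "emeasure lborel S = emeasure lebesgue S" using assms by simp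
  also have "\<dots> = ennreal (measure lebesgue S)"
    using l by (intro emeasure_eq_measure2) auto
  finally show "emeasure lborel S = ennreal (measure lebesgue S)" .
qed

lemma emeasure_orthogonal_image:
  fixes f :: "real^3 \<Rightarrow> real^3"
  assumes f: "orthogonal_transformation f" and S: "S \<in> sets borel" "bounded S"
  shows "emeasure lborel (f ` S) = emeasure lborel S"
proof -
  have inv: "orthogonal_transformation (inv f)" "bij f"
    using f orthogonal_transformation_inv orthogonal_transformation_bij by blast+
  have "inv f \<in> borel_measurable borel"
    using orthogonal_transformation_linear[OF inv(1)]
    by (intro borel_measurable_continuous_onI linear_continuous_on) (simp add: linear_conv_bounded_linear)
  moreover have "f ` S = inv f -` S"
    using bij_vimage_eq_inv_image[OF bij_imp_bij_inv[OF inv(2)], of S] inv_inv_eq[OF inv(2)] by simp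
  ultimately have "f ` S \<in> sets borel" using measurable_sets[of "inv f" borel borel S] S(1) by simp
  moreover have "bounded (f ` S)"
    using S(2) orthogonal_transformation_linear[OF f] bounded_linear_image linear_conv_bounded_linear by blast
  ultimately show ?thesis
    using emeasure_lborel_eq_measure[OF S] emeasure_lborel_eq_measure[of "f ` S"]
      measure_orthogonal_image[OF f emeasure_lborel_eq_measure(1)[OF S]] by simp
qed

text \<open>Identifies the product of a plane and a line with 3-space; this makes the planar
  isodiametric inequality applicable to shadows.\<close>

definition join3 :: "(real^2) \<times> real \<Rightarrow> real^3" where
  "join3 z = (\<chi> i. if i = 1 then fst z $ 1 else if i = 2 then fst z $ 2 else snd z)"

lemma join3_nth: "join3 z $ 1 = fst z $ 1" "join3 z $ 2 = fst z $ 2" "join3 z $ 3 = snd z"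
  by (simp_all add: join3_def UNIV_3_distinct)

lemma join3_measurable: "join3 \<in> borel_measurable borel"
proof (rule borel_measurable_continuous_onI)
  have "continuous_on UNIV (\<lambda>z. join3 z $ i)" for i
    using exhaust_3[of i] by (elim disjE) (auto simp: join3_nth intro!: continuous_intros)
  then show "continuous_on UNIV join3"
    by (simp add: continuous_on_vec_lambda[of UNIV "\<lambda>i z. join3 z $ i", simplified])
qed

lemma distr_join3: "distr lborel borel join3 = lborel"
proof (rule lborel_eqI[symmetric])
  fix l u :: "real^3"
  assume lu: "\<And>b. b \<in> Basis \<Longrightarrow> l \<bullet> b \<le> u \<bullet> b"
  then have le: "l $ i \<le> u $ i" for i
    using lu[of "axis i 1"] by (simp add: inner_axis axis_in_Basis_iff)
  have prod3: "(\<Prod>b\<in>Basis. (u - l) \<bullet> b) = (\<Prod>i\<in>UNIV. u $ i - l $ i)"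
    by (simp add: Basis_vec_def UNION_singleton_eq_range prod.reindex inj_on_def axis_eq_axis inner_axis)
  have prod2: "(\<Prod>b\<in>Basis. (b' - a') \<bullet> b) = (\<Prod>i\<in>UNIV. b' $ i - a' $ i)" for a' b' :: "real^2"
    by (simp add: Basis_vec_def UNION_singleton_eq_range prod.reindex inj_on_def axis_eq_axis inner_axis)
  let ?a = "vector [l $ 1, l $ 2] :: real^2" and ?b = "vector [u $ 1, u $ 2] :: real^2"
  have le2: "?a \<bullet> i \<le> ?b \<bullet> i" if i: "i \<in> Basis" for i
  proof -
    obtain k where k: "i = axis k 1" using i by (auto simp: Basis_vec_def)
    show ?thesis using exhaust_2[of k] le[of 1] le[of 2] unfolding k
      by (elim disjE) (simp_all add: inner_axis vector_2)
  qed
  have pre: "join3 -` box l u = box ?a ?b \<times> {l $ 3<..<u $ 3}"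
    by (auto simp: mem_box_cart join3_nth forall_3 forall_2 vector_2)
  have "emeasure (distr lborel borel join3) (box l u) = emeasure (lborel \<Otimes>\<^sub>M lborel) (box ?a ?b \<times> {l $ 3<..<u $ 3})"
    by (subst emeasure_distr) (auto simp: pre lborel_prod join3_measurable)
  also have "\<dots> = emeasure lborel (box ?a ?b) * emeasure lborel {l $ 3<..<u $ 3}"
    by (rule lborel.emeasure_pair_measure_Times) auto
  also have "\<dots> = ennreal ((\<Prod>i\<in>UNIV. ?b $ i - ?a $ i) * (u $ 3 - l $ 3))"
    using le le2 by (simp add: emeasure_lborel_box prod2 ennreal_mult' [symmetric] ennreal_mult''[symmetric] prod_nonneg)
  also have "(\<Prod>i\<in>UNIV. ?b $ i - ?a $ i) * (u $ 3 - l $ 3) = (\<Prod>b\<in>Basis. (u - l) \<bullet> b)"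
    unfolding prod3 UNIV_3 UNIV_2 by (simp add: UNIV_3_distinct vector_2)
  finally show "emeasure (distr lborel borel join3) (box l u) = ennreal (\<Prod>b\<in>Basis. (u - l) \<bullet> b)" .
qed simp

lemma cylinder_measurable:
  fixes C :: "'a::euclidean_space set"
  assumes C: "compact C" and e: "norm e = 1"
  shows "{x. 0 \<le> x \<bullet> e \<and> x \<bullet> e < 1 \<and> (\<exists>t. x + t *\<^sub>R e \<in> C)} \<in> sets borel"
    "bounded {x. 0 \<le> x \<bullet> e \<and> x \<bullet> e < 1 \<and> (\<exists>t. x + t *\<^sub>R e \<in> C)}"
proof -
  have ee: "e \<bullet> e = 1" using e by (simp add: dot_square_norm)
  let ?L = "(\<lambda>z. fst z + snd z *\<^sub>R e) ` (C \<times> UNIV)"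
  \<comment> \<open>A line in direction \<open>e\<close> meets \<open>C\<close> iff its point on the
    orthogonal hyperplane lies in the projection of \<open>C\<close>, a compact set.\<close>
  have L: "{x. \<exists>t. x + t *\<^sub>R e \<in> C} = {x. x - (x \<bullet> e) *\<^sub>R e \<in> (\<lambda>y. y - (y \<bullet> e) *\<^sub>R e) ` C}"
  proof (intro set_eqI iffI; clarsimp)
    fix x t assume "x + t *\<^sub>R e \<in> C"
    moreover have "x - (x \<bullet> e) *\<^sub>R e = (x + t *\<^sub>R e) - ((x + t *\<^sub>R e) \<bullet> e) *\<^sub>R e"
      by (simp add: inner_add_left ee algebra_simps)
    ultimately show "x - (x \<bullet> e) *\<^sub>R e \<in> (\<lambda>y. y - (y \<bullet> e) *\<^sub>R e) ` C" by blast
  next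
    fix x y assume y: "x - (x \<bullet> e) *\<^sub>R e = y - (y \<bullet> e) *\<^sub>R e" "y \<in> C"
    then have "x + (y \<bullet> e - x \<bullet> e) *\<^sub>R e = y" by (simp add: algebra_simps)
    then show "\<exists>t. x + t *\<^sub>R e \<in> C" using y(2) by metis
  qed
  have "compact ((\<lambda>y. y - (y \<bullet> e) *\<^sub>R e) ` C)"
    by (intro compact_continuous_image continuous_intros C)
  then have "closed ((\<lambda>x. x - (x \<bullet> e) *\<^sub>R e) -` ((\<lambda>y. y - (y \<bullet> e) *\<^sub>R e) ` C))"
    by (intro continuous_closed_vimage compact_imp_closed) (auto intro!: continuous_intros)
  then have "closed {x. x - (x \<bullet> e) *\<^sub>R e \<in> (\<lambda>y. y - (y \<bullet> e) *\<^sub>R e) ` C}"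
    by (simp add: vimage_def)
  then have "{x. \<exists>t. x + t *\<^sub>R e \<in> C} \<in> sets borel" unfolding L by simp
  moreover have "{x. 0 \<le> x \<bullet> e \<and> x \<bullet> e < 1} \<in> sets borel" by measurable
  ultimately have "{x. \<exists>t. x + t *\<^sub>R e \<in> C} \<inter> {x. 0 \<le> x \<bullet> e \<and> x \<bullet> e < 1} \<in> sets borel" by (rule sets.Int)
  then show "{x. 0 \<le> x \<bullet> e \<and> x \<bullet> e < 1 \<and> (\<exists>t. x + t *\<^sub>R e \<in> C)} \<in> sets borel"
    by (rule back_subst[of "\<lambda>S. S \<in> sets borel"]) auto
  obtain R where R: "\<And>x. x \<in> C \<Longrightarrow> norm x \<le> R" using compact_imp_bounded[OF C] by (auto simp: bounded_iff)
  have "norm x \<le> R + (R + 1)" if x: "0 \<le> x \<bullet> e" "x \<bullet> e < 1" "x + t *\<^sub>R e \<in> C" for x t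
  proof -
    have "t = (x + t *\<^sub>R e) \<bullet> e - x \<bullet> e" using ee by (simp add: inner_add_left)
    moreover have "\<bar>(x + t *\<^sub>R e) \<bullet> e\<bar> \<le> R"
      using Cauchy_Schwarz_ineq2[of "x + t *\<^sub>R e" e] e R[OF x(3)] by simp
    ultimately have "norm (t *\<^sub>R e) \<le> R + 1" using x e by (auto simp: abs_le_iff)
    then show ?thesis using norm_triangle_ineq4[of "x + t *\<^sub>R e" "t *\<^sub>R e"] R[OF x(3)] by simp
  qed
  then show "bounded {x. 0 \<le> x \<bullet> e \<and> x \<bullet> e < 1 \<and> (\<exists>t. x + t *\<^sub>R e \<in> C)}"
    by (intro boundedI[of _ "R + (R + 1)"]) auto
qed

text \<open>The set is a cylinder of height 1 over the projection of \<open>C\<close> to the plane.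
  Projection does not increase distances, so the planar isodiametric inequality applies.\<close>

lemma isodiametric_cylinder_axis3:
  fixes C :: "(real^3) set"
  assumes C: "compact C" and d: "\<And>x y. x \<in> C \<Longrightarrow> y \<in> C \<Longrightarrow> dist x y \<le> d" and "d \<ge> 0"
  shows "emeasure lborel {x. 0 \<le> x \<bullet> axis 3 1 \<and> x \<bullet> axis 3 1 < 1 \<and> (\<exists>t. x + t *\<^sub>R axis 3 1 \<in> C)}
    \<le> ennreal (pi * (d / 2)\<^sup>2)" (is "emeasure lborel ?Z \<le> _")
proof -
  define p where "p x = (vector [x $ 1, x $ 2] :: real^2)" for x :: "real^3"
  have p: "p x $ 1 = x $ 1" "p x $ 2 = x $ 2" for x by (simp_all add: p_def vector_2)
  define A where "A = p ` C"
  have "continuous_on C p"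
  proof -
    have "continuous_on C (\<lambda>x. p x $ i)" for i
      using exhaust_2[of i] by (elim disjE) (auto simp: p intro!: continuous_intros)
    then show ?thesis by (simp add: continuous_on_vec_lambda[of C "\<lambda>i x. p x $ i", simplified])
  qed
  then have A: "compact A" unfolding A_def using C by (rule compact_continuous_image)
  have dA: "dist x y \<le> d" if xy: "x \<in> A" "y \<in> A" for x y
  proof -
    obtain a b where ab: "a \<in> C" "b \<in> C" "x = p a" "y = p b" using xy by (auto simp: A_def)
    have "(dist (p a) (p b))\<^sup>2 \<le> (dist a b)\<^sup>2"
      unfolding dist_norm power2_norm_eq_inner
      by (simp add: inner_vec_def sum_3 sum_2 p)
    then have "dist (p a) (p b) \<le> dist a b" by (rule power2_le_imp_le) simp
    then show ?thesis using d[OF ab(1,2)] ab by simp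
  qed
  have "emeasure lborel A \<le> ennreal (unit_ball_vol (real DIM(real^2)) * (d / 2) ^ DIM(real^2))"
    by (rule isodiametric_inequality) (use A dA \<open>d \<ge> 0\<close> in \<open>auto simp: compact_imp_bounded borel_compact\<close>)
  then have eA: "emeasure lborel A \<le> ennreal (pi * (d / 2)\<^sup>2)" by (simp add: unit_ball_vol_2)
  have sub: "join3 -` ?Z \<inter> space lborel \<subseteq> A \<times> {0..<1}"
  proof (clarsimp simp: inner_axis join3_nth)
    fix y s t assume "join3 (y, s) + t *\<^sub>R axis 3 1 \<in> C"
    moreover have "p (join3 (y, s) + t *\<^sub>R axis 3 1) = y"
      by (simp add: vec_eq_iff forall_2 p join3_nth axis_def UNIV_3_distinct)
    ultimately show "y \<in> A" unfolding A_def by (metis imageI)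
  qed
  have "emeasure lborel ?Z = emeasure (distr lborel borel join3) ?Z" by (simp add: distr_join3)
  also have "\<dots> = emeasure lborel (join3 -` ?Z \<inter> space lborel)"
    using cylinder_measurable(1)[OF C, of "axis 3 1"] join3_measurable by (intro emeasure_distr) auto
  also have "\<dots> \<le> emeasure lborel (A \<times> {0..<1::real})"
    using A by (intro emeasure_mono[OF sub]) (auto simp: borel_compact intro!: borel_Times)
  also have "\<dots> = emeasure (lborel \<Otimes>\<^sub>M lborel) (A \<times> {0..<1::real})" by (simp add: lborel_prod)
  also have "\<dots> = emeasure lborel A * emeasure lborel {0..<1::real}"
    using A by (intro lborel.emeasure_pair_measure_Times) (auto simp: borel_compact)
  also have "\<dots> = emeasure lborel A" by simp
  finally show ?thesis using eA by simp
qed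

text \<open>Rotation to the third axis. The bound is the two-dimensional Hausdorff weight of a set
  of diameter \<open>d\<close>; this is what ties shadow areas to Hausdorff measure.\<close>

theorem isodiametric_cylinder:
  fixes C :: "(real^3) set"
  assumes C: "compact C" and d: "\<And>x y. x \<in> C \<Longrightarrow> y \<in> C \<Longrightarrow> dist x y \<le> d" and "d \<ge> 0" and e: "norm e = 1"
  shows "emeasure lborel {x. 0 \<le> x \<bullet> e \<and> x \<bullet> e < 1 \<and> (\<exists>t. x + t *\<^sub>R e \<in> C)} \<le> ennreal (pi * (d / 2)\<^sup>2)"
proof -
  let ?a = "axis 3 1 :: real^3"
  obtain f where f: "orthogonal_transformation f" "f ?a = e"
    using orthogonal_transformation_exists_1[of ?a e] e by auto
  have lin: "linear f" using orthogonal_transformation_linear[OF f(1)] .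
  have bij: "bij f" using orthogonal_transformation_bij[OF f(1)] .
  define C' where "C' = f -` C"
  have C'im: "C' = inv f ` C" unfolding C'_def using bij by (simp add: bij_vimage_eq_inv_image)
  have inv: "orthogonal_transformation (inv f)" using f(1) by (rule orthogonal_transformation_inv)
  have C': "compact C'" unfolding C'im
    using orthogonal_transformation_linear[OF inv] C
    by (intro compact_continuous_image linear_continuous_on) (simp_all add: linear_conv_bounded_linear)
  have dC': "dist x y \<le> d" if "x \<in> C'" "y \<in> C'" for x y
  proof -
    have "dist (f x) (f y) = dist x y"
      unfolding dist_norm using orthogonal_transformation_norm[OF f(1), of "x - y"] by (simp add: linear_diff[OF lin])
    then show ?thesis using d[of "f x" "f y"] that by (simp add: C'_def)
  qed
  let ?Z' = "{x. 0 \<le> x \<bullet> ?a \<and> x \<bullet> ?a < 1 \<and> (\<exists>t. x + t *\<^sub>R ?a \<in> C')}"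
  let ?Z = "{x. 0 \<le> x \<bullet> e \<and> x \<bullet> e < 1 \<and> (\<exists>t. x + t *\<^sub>R e \<in> C)}"
  have iff: "f x \<in> ?Z \<longleftrightarrow> x \<in> ?Z'" for x
  proof -
    have "f x \<bullet> e = x \<bullet> ?a" using f by (auto simp: orthogonal_transformation_def)
    moreover have "f x + t *\<^sub>R e = f (x + t *\<^sub>R ?a)" for t
      by (simp add: linear_add[OF lin] linear_cmul[OF lin] f(2))
    ultimately show ?thesis by (simp add: C'_def)
  qed
  have "?Z = f ` ?Z'"
  proof (intro set_eqI iffI)
    fix z assume z: "z \<in> ?Z"
    obtain x where x: "z = f x" using bij by (metis bij_pointE)
    then show "z \<in> f ` ?Z'" using iff[of x] z by blast
  next
    fix z assume "z \<in> f ` ?Z'"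
    then show "z \<in> ?Z" using iff by blast
  qed
  then have "emeasure lborel ?Z = emeasure lborel ?Z'"
    using emeasure_orthogonal_image[OF f(1) cylinder_measurable[OF C', of ?a]] by simp
  also have "\<dots> \<le> ennreal (pi * (d / 2)\<^sup>2)"
    by (rule isodiametric_cylinder_axis3[OF C' dC' \<open>d \<ge> 0\<close>])
  finally show ?thesis .
qed

section \<open>Gauss--Green formula for sublevel sets\<close>

lemma (in C4_function) grad_cont: "continuous_on S (grad u)"
  by (rule Ck1_continuous[OF C1_grad])

locale well = C4_function u for u +
  fixes D :: "(real^3) set"
  assumes D: "compact D" "convex D"
    and u_le: "\<And>x. x \<in> D \<Longrightarrow> u x \<le> 0" and u_frontier: "\<And>x. x \<in> frontier D \<Longrightarrow> u x = 0"
begin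

definition level where "level h = {x \<in> D. u x = h}"
definition sublevel where "sublevel h = {x \<in> D. u x < h}"
definition regular where "regular h \<longleftrightarrow> h < 0 \<and> (\<forall>x\<in>level h. grad u x \<noteq> 0)"

lemma u_cont: "continuous_on S u"
  by (rule Ck1_continuous[OF C1_u])

lemma interior_if_neg: "x \<in> D \<Longrightarrow> u x < 0 \<Longrightarrow> x \<in> interior D"
  using u_frontier[of x] closure_subset[of D] by (auto simp: frontier_def)

lemma level_interior: "h < 0 \<Longrightarrow> level h \<subseteq> interior D"
  using interior_if_neg by (auto simp: level_def)

text \<open>Negative heights occur only in the interior, because \<open>u\<close> vanishes on the
  frontier; this makes the sublevel sets open.\<close>

lemma sublevel_eq: "h \<le> 0 \<Longrightarrow> sublevel h = interior D \<inter> {x. u x < h}"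
  using interior_if_neg interior_subset by (auto simp: sublevel_def)

lemma open_sublevel: "h \<le> 0 \<Longrightarrow> open (sublevel h)"
  unfolding sublevel_eq by (intro open_Int open_interior open_Collect_less u_cont continuous_intros)

text \<open>Surface measure on the level set, weighted by \<open>1 / |Du|\<close>. The choice is only meaningful for regular \<open>h\<close>.\<close>

definition level_measure where
  "level_measure h = (SOME M. sets M = sets borel \<and> finite_measure M \<and> (AE x in M. x \<in> level h)
     \<and> (\<forall>F. continuous_on UNIV F \<longrightarrow> integrable M F
          \<and> (\<lambda>n. (LINT x:D|lebesgue. kern ((h - u x) / dl n) * F x) / dl n) \<longlonglongrightarrow> integral\<^sup>L M F))"

lemma level_measure:
  fixes F :: "real^3 \<Rightarrow> real"
  assumes "regular h"
  shows "sets (level_measure h) = sets borel" "finite_measure (level_measure h)" "AE x in level_measure h. x \<in> level h"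
    "continuous_on UNIV F \<Longrightarrow> integrable (level_measure h) F"
    "continuous_on UNIV F \<Longrightarrow> (\<lambda>n. (LINT x:D|lebesgue. kern ((h - u x) / dl n) * F x) / dl n) \<longlonglongrightarrow> integral\<^sup>L (level_measure h) F"
proof -
  have "\<exists>M. sets M = sets borel \<and> finite_measure M \<and> (AE x in M. x \<in> level h)
     \<and> (\<forall>F. continuous_on UNIV F \<longrightarrow> integrable M F
          \<and> (\<lambda>n. (LINT x:D|lebesgue. kern ((h - u x) / dl n) * F x) / dl n) \<longlonglongrightarrow> integral\<^sup>L M F)"
    by (rule level_measure_exists[OF u_has_derivative grad_cont D(1) level_def level_interior])
      (use assms in \<open>auto simp: regular_def\<close>)
  then have ex: "sets (level_measure h) = sets borel \<and> finite_measure (level_measure h) \<and> (AE x in level_measure h. x \<in> level h)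
     \<and> (\<forall>F. continuous_on UNIV F \<longrightarrow> integrable (level_measure h) F
          \<and> (\<lambda>n. (LINT x:D|lebesgue. kern ((h - u x) / dl n) * F x) / dl n) \<longlonglongrightarrow> integral\<^sup>L (level_measure h) F)"
    unfolding level_measure_def by (rule someI_ex)
  then show "sets (level_measure h) = sets borel" "finite_measure (level_measure h)" "AE x in level_measure h. x \<in> level h" by blast+
  assume "continuous_on UNIV F"
  note * = ex[THEN conjunct2, THEN conjunct2, THEN conjunct2, rule_format, OF this]
  show "integrable (level_measure h) F" using * by (rule conjunct1)
  show "(\<lambda>n. (LINT x:D|lebesgue. kern ((h - u x) / dl n) * F x) / dl n) \<longlonglongrightarrow> integral\<^sup>L (level_measure h) F"
    using * by (rule conjunct2)
qed

lemma level_measure_space: "regular h \<Longrightarrow> space (level_measure h) = UNIV"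
  using sets_eq_imp_space_eq[OF level_measure(1)] by simp

lemma level_measure_measurable: "regular h \<Longrightarrow> f \<in> borel_measurable borel \<Longrightarrow> f \<in> borel_measurable (level_measure h)"
  using measurable_cong_sets[OF level_measure(1) refl] by blast

lemma continuous_on_D_integrable:
  fixes g :: "real^3 \<Rightarrow> real"
  shows "continuous_on D g \<Longrightarrow> set_integrable lebesgue D g"
  by (rule continuous_on_compact_integrable[OF D(1)])

text \<open>Since the profile vanishes at height 0, the field
  \<open>\<phi> (u x) *\<^sub>R X x\<close> vanishes on the frontier, and its divergence integrates
  to 0.\<close>

lemma integral_profile_divergence:
  assumes \<phi>: "\<And>t. (\<phi> has_real_derivative \<phi>' t) (at t)" "continuous_on UNIV \<phi>'" "\<phi> 0 = 0" and X: "Ck 1 X"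
  shows "(LINT x:D|lebesgue. \<phi> (u x) * divergence X x) = - (LINT x:D|lebesgue. \<phi>' (u x) * (grad u x \<bullet> X x))"
proof -
  have c\<phi>: "continuous_on UNIV \<phi>" using DERIV_continuous[OF \<phi>(1)] by (intro continuous_at_imp_continuous_on) auto
  have C: "Ck 1 (\<lambda>x. \<phi> (u x) *\<^sub>R X x)" by (intro Ck1_scaleR Ck1_comp_real[OF \<phi>(1,2)] C1_u X)
  have div: "divergence (\<lambda>x. \<phi> (u x) *\<^sub>R X x) x = \<phi>' (u x) * (grad u x \<bullet> X x) + \<phi> (u x) * divergence X x" for x
    using divergence_scaleR[OF has_derivative_compose[OF u_has_derivative \<phi>(1)[of "u x", unfolded has_field_derivative_def]] Ck1_has_derivative[OF X]] .
  have "0 = (LINT x:D|lebesgue. divergence (\<lambda>x. \<phi> (u x) *\<^sub>R X x) x)"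
    by (rule divergence_theorem_zero[OF C D, symmetric]) (simp add: u_frontier \<phi>(3))
  also have "\<dots> = (LINT x:D|lebesgue. \<phi>' (u x) * (grad u x \<bullet> X x)) + (LINT x:D|lebesgue. \<phi> (u x) * divergence X x)"
    unfolding div
    by (intro set_integral_add continuous_on_D_integrable continuous_intros grad_cont continuous_divergence X
        continuous_on_compose2[OF \<phi>(2)] continuous_on_compose2[OF c\<phi>] u_cont Ck1_continuous[OF X]) auto
  finally show ?thesis by linarith
qed

text \<open>The profile \<open>step ((h - u) / dl n)\<close> tends to the indicator of the sublevel
  set, while its derivative is the layer kernel whose weak limit is
  \<open>level_measure h\<close>.\<close>

lemma sublevel_gauss_green:
  assumes h: "regular h" and X: "Ck 1 X"
  shows "(LINT x:sublevel h|lebesgue. divergence X x) = (\<integral>x. grad u x \<bullet> X x \<partial>level_measure h)"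
proof -
  define \<phi> where "\<phi> n t = step ((h - t) / dl n)" for n t
  have h0: "h < 0" using h by (simp add: regular_def)
  have d\<phi>: "(\<phi> n has_real_derivative - (kern ((h - t) / dl n) / dl n)) (at t)" for n t
  proof -
    have "((\<lambda>t. step ((h - t) / dl n)) has_real_derivative kern ((h - t) / dl n) * ((0 - 1) / dl n)) (at t)"
      by (intro DERIV_chain2[OF step_deriv] DERIV_cdivide DERIV_diff DERIV_const DERIV_ident)
    then show ?thesis by (simp add: \<phi>_def[abs_def])
  qed
  have c\<phi>': "continuous_on UNIV (\<lambda>t. - (kern ((h - t) / dl n) / dl n))" for n
    using dl_pos[of n] by (intro continuous_intros continuous_on_compose2[OF kern_continuous]) auto
  have \<phi>0: "\<phi> n 0 = 0" for n
    unfolding \<phi>_def using h0 dl_pos[of n] by (intro step_left) (simp add: divide_nonpos_pos)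
  have eq: "(LINT x:D|lebesgue. \<phi> n (u x) * divergence X x)
      = (LINT x:D|lebesgue. kern ((h - u x) / dl n) * (grad u x \<bullet> X x)) / dl n" for n
    unfolding integral_profile_divergence[OF d\<phi> c\<phi>' \<phi>0 X]
    by (simp add: set_lebesgue_integral_def)
  have "continuous_on UNIV (\<lambda>x. grad u x \<bullet> X x)"
    by (intro continuous_intros grad_cont Ck1_continuous X)
  from level_measure(5)[OF h this] have "(\<lambda>n. LINT x:D|lebesgue. \<phi> n (u x) * divergence X x) \<longlonglongrightarrow> (\<integral>x. grad u x \<bullet> X x \<partial>level_measure h)"
    unfolding eq .
  moreover have "(\<lambda>n. LINT x:D|lebesgue. \<phi> n (u x) * divergence X x) \<longlonglongrightarrow> (LINT x:sublevel h|lebesgue. divergence X x)"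
    unfolding set_lebesgue_integral_def
  proof (rule integral_dominated_convergence[where w="\<lambda>x. norm (indicator D x *\<^sub>R divergence X x)"])
    have i: "set_integrable lebesgue D (divergence X)" by (intro continuous_on_D_integrable continuous_divergence X)
    then show "integrable lebesgue (\<lambda>x. norm (indicator D x *\<^sub>R divergence X x))"
      unfolding set_integrable_def by (rule integrable_norm)
    have c\<phi>: "continuous_on UNIV (\<phi> n)" for n using DERIV_continuous[OF d\<phi>] by (intro continuous_at_imp_continuous_on) auto
    show "(\<lambda>x. indicator D x *\<^sub>R (\<phi> n (u x) * divergence X x)) \<in> borel_measurable lebesgue" for n
    proof -
      have "set_integrable lebesgue D (\<lambda>x. \<phi> n (u x) * divergence X x)"
        by (intro continuous_on_D_integrable continuous_intros continuous_on_compose2[OF c\<phi>] u_cont continuous_divergence X) auto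
      then show ?thesis unfolding set_integrable_def by (rule borel_measurable_integrable)
    qed
    have "open (sublevel h)" using h0 by (intro open_sublevel) simp
    then have sb: "sublevel h \<in> sets borel" by simp
    have "divergence X \<in> borel_measurable borel"
      using continuous_divergence[OF X] by (rule borel_measurable_continuous_onI)
    then have "(\<lambda>x. indicator (sublevel h) x *\<^sub>R divergence X x) \<in> borel_measurable borel"
      using sb by measurable
    then show "(\<lambda>x. indicator (sublevel h) x *\<^sub>R divergence X x) \<in> borel_measurable lebesgue"
      by (rule borel_measurable_if_lebesgue_on measurable_completion[of _ lborel borel, simplified])
    show "AE x in lebesgue. norm (indicator D x *\<^sub>R (\<phi> n (u x) * divergence X x)) \<le> norm (indicator D x *\<^sub>R divergence X x)" for n
      using step_bounds by (intro AE_I2) (auto simp: \<phi>_def abs_mult indicator_def mult_left_le_one_le)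
    show "AE x in lebesgue. (\<lambda>n. indicator D x *\<^sub>R (\<phi> n (u x) * divergence X x)) \<longlonglongrightarrow> indicator (sublevel h) x *\<^sub>R divergence X x"
    proof (intro AE_I2)
      fix x
      show "(\<lambda>n. indicator D x *\<^sub>R (\<phi> n (u x) * divergence X x)) \<longlonglongrightarrow> indicator (sublevel h) x *\<^sub>R divergence X x"
      proof (cases "x \<in> D \<and> u x < h")
        case True
        have "\<forall>\<^sub>F n in sequentially. dl n < h - u x" using eventually_dl_less[of "h - u x"] True by simp
        then have "\<forall>\<^sub>F n in sequentially. indicator D x *\<^sub>R (\<phi> n (u x) * divergence X x) = indicator (sublevel h) x *\<^sub>R divergence X x"
        proof eventually_elim
          case (elim n)
          then have "\<phi> n (u x) = 1" unfolding \<phi>_def using dl_pos[of n] by (intro step_right) (simp add: field_simps)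
          then show ?case using True by (simp add: sublevel_def)
        qed
        then show ?thesis by (rule tendsto_eventually)
      next
        case False
        have z: "indicator D x *\<^sub>R (\<phi> n (u x) * divergence X x) = 0" for n
        proof (cases "x \<in> D")
          case True
          with False have "\<phi> n (u x) = 0" unfolding \<phi>_def using dl_pos[of n] by (intro step_left) (simp add: divide_nonpos_pos)
          then show ?thesis by simp
        qed simp
        show ?thesis unfolding z using False by (simp add: sublevel_def)
      qed
    qed
  qed
  ultimately show ?thesis by (rule LIMSEQ_unique[OF _ , symmetric])
qed

text \<open>As \<open>level_measure\<close> is surface measure divided by the gradient norm, this is
  the surface area of the level set when \<open>h\<close> is regular.\<close>

definition area where "area h = (\<integral>x. norm (grad u x) \<partial>level_measure h)"

lemma sublevel_flux_le_area:
  assumes h: "regular h" and X: "Ck 1 X" "\<And>x. norm (X x) \<le> 1"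
  shows "(LINT x:sublevel h|lebesgue. divergence X x) \<le> area h"
  unfolding sublevel_gauss_green[OF h X(1)] area_def
proof (rule integral_mono)
  show "integrable (level_measure h) (\<lambda>x. grad u x \<bullet> X x)" "integrable (level_measure h) (\<lambda>x. norm (grad u x))"
    by (intro level_measure(4)[OF h] continuous_intros grad_cont Ck1_continuous X)+
  show "grad u x \<bullet> X x \<le> norm (grad u x)" for x
    using norm_cauchy_schwarz[of "grad u x" "X x"] X(2)[of x] mult_left_le[of "norm (X x)" "norm (grad u x)"] by simp
qed

lemma sublevel_flux_eq_area:
  assumes h: "regular h" and X: "Ck 1 X" "\<And>x. x \<in> level h \<Longrightarrow> grad u x \<bullet> X x = norm (grad u x)"
  shows "(LINT x:sublevel h|lebesgue. divergence X x) = area h"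
  unfolding sublevel_gauss_green[OF h X(1)] area_def
proof (rule integral_cong_AE)
  show "AE x in level_measure h. grad u x \<bullet> X x = norm (grad u x)"
    using level_measure(3)[OF h] by eventually_elim (rule X(2))
  show "(\<lambda>x. grad u x \<bullet> X x) \<in> borel_measurable (level_measure h)" "(\<lambda>x. norm (grad u x)) \<in> borel_measurable (level_measure h)"
    by (intro level_measure_measurable[OF h] borel_measurable_continuous_onI continuous_intros grad_cont Ck1_continuous X)+
qed

text \<open>The value \<open>axis 1 1\<close> at critical points makes the field of unit length
  everywhere, as \<open>gauss_green_pair\<close> demands.\<close>

definition normal where "normal x = (if grad u x = 0 then axis 1 1 else sgn (grad u x))"
definition surf where "surf h = density (level_measure h) (\<lambda>x. ennreal (norm (grad u x)))"

lemma norm_normal: "norm (normal x) = 1"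
  by (simp add: normal_def norm_sgn)

lemma normal_measurable: "normal \<in> borel_measurable borel"
proof -
  have [measurable]: "grad u \<in> borel_measurable borel" by (intro borel_measurable_continuous_onI grad_cont)
  have "sgn \<in> borel_measurable (borel :: (real^3) measure)" unfolding sgn_div_norm[abs_def] by measurable
  then have "(\<lambda>x. sgn (grad u x)) \<in> borel_measurable borel" by measurable
  then show ?thesis unfolding normal_def[abs_def] by measurable
qed

lemma surf_sets: "regular h \<Longrightarrow> sets (surf h) = sets borel"
  by (simp add: surf_def level_measure)

lemma norm_grad_measurable: "(\<lambda>x. ennreal (norm (grad u x))) \<in> borel_measurable borel"
proof -
  have [measurable]: "grad u \<in> borel_measurable borel" by (intro borel_measurable_continuous_onI grad_cont)
  show ?thesis by measurable
qed

lemma surf_finite: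
  assumes h: "regular h" shows "finite_measure (surf h)" "emeasure (surf h) UNIV = ennreal (area h)"
proof -
  have "emeasure (surf h) UNIV = (\<integral>\<^sup>+x. ennreal (norm (grad u x)) \<partial>level_measure h)"
    unfolding surf_def using level_measure_measurable[OF h norm_grad_measurable] level_measure(1)[OF h]
    by (subst emeasure_density) (auto simp: level_measure_space[OF h])
  also have "\<dots> = ennreal (area h)"
    unfolding area_def by (rule nn_integral_eq_integral) (auto intro!: level_measure(4)[OF h] continuous_intros grad_cont)
  finally show e: "emeasure (surf h) UNIV = ennreal (area h)" .
  show "finite_measure (surf h)"
  proof (rule finite_measureI)
    have "space (surf h) = UNIV" by (simp add: surf_def level_measure_space[OF h])
    then show "emeasure (surf h) (space (surf h)) \<noteq> \<infinity>" by (simp add: e)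
  qed
qed

lemma surf_gauss_green:
  assumes h: "regular h" shows "gauss_green_pair (sublevel h) (surf h) normal"
  unfolding gauss_green_pair_def
proof (intro conjI ballI allI impI)
  show "sets (surf h) = sets borel" by (rule surf_sets[OF h])
  show "emeasure (surf h) K < \<infinity>" for K
    using finite_measure.emeasure_finite[OF surf_finite(1)[OF h], of K] by (simp add: less_top)
  show "normal \<in> borel_measurable borel" by (rule normal_measurable)
  show "norm (normal x) = 1" for x by (rule norm_normal)
  fix X assume "X \<in> C1c_fields"
  then have X: "Ck 1 X" by (simp add: C1c_fields_def)
  have [measurable]: "X \<in> borel_measurable borel" by (intro borel_measurable_continuous_onI Ck1_continuous X)
  have [measurable]: "grad u \<in> borel_measurable borel" by (intro borel_measurable_continuous_onI grad_cont)
  have m: "(\<lambda>x. X x \<bullet> normal x) \<in> borel_measurable borel" using normal_measurable by measurable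
  have "(LINT x|surf h. X x \<bullet> normal x) = (\<integral>x. norm (grad u x) *\<^sub>R (X x \<bullet> normal x) \<partial>level_measure h)"
    unfolding surf_def by (rule integral_density) (auto intro!: level_measure_measurable[OF h] m)
  also have "\<dots> = (\<integral>x. grad u x \<bullet> X x \<partial>level_measure h)"
    by (rule Bochner_Integration.integral_cong) (auto simp: normal_def sgn_div_norm inner_commute)
  finally show "(LINT x:sublevel h|lebesgue. divergence X x) = (LINT x|surf h. X x \<bullet> normal x)"
    using sublevel_gauss_green[OF h X] by simp
qed

text \<open>\<open>level_measure h\<close> is a chosen weak limit. Both sides are limits of the same
  layer integrals, which identifies the chosen measure inside a chart.\<close>

lemma level_measure_chart:
  assumes h: "regular h" and chart: "level_chart u (grad u) e B c" and BD: "B \<subseteq> D"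
    and F: "continuous_on UNIV F" "compact K" "K \<subseteq> B" "\<And>x. x \<notin> K \<Longrightarrow> F x = 0"
  shows "integral\<^sup>L (level_measure h) F = (\<integral>x. indicator (level_chart.slab e \<inter> level_chart.W u e B h) x
      * (F (level_chart.P u e B h x) / (grad u (level_chart.P u e B h x) \<bullet> e)) \<partial>lborel)"
proof -
  interpret level_chart u "grad u" e B c h by (rule chart)
  have eq: "(\<lambda>n. (LINT x:D|lebesgue. kern ((h - u x) / dl n) * F x) / dl n)
      = (\<lambda>n. (\<integral>x. kern ((h - u x) / dl n) * F x \<partial>lborel) / dl n)"
  proof
    fix n
    have "continuous_on D (\<lambda>x. kern ((h - u x) / dl n) * F x)"
      using dl_pos[of n] F(1) by (intro continuous_intros continuous_on_compose2[OF kern_continuous] u_cont) (auto intro: continuous_on_subset)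
    note LL = LINT_lebesgue_lborel[OF D(1) this]
    have eqx: "indicator D x *\<^sub>R (kern ((h - u x) / dl n) * F x) = kern ((h - u x) / dl n) * F x" for x
    proof (cases "x \<in> D")
      case False
      then have "x \<notin> K" using F(3) BD by blast
      then have "F x = 0" by (rule F(4))
      then show ?thesis by simp
    next
      case True
      then show ?thesis by simp
    qed
    from LL have "(LINT x:D|lebesgue. kern ((h - u x) / dl n) * F x) = (\<integral>x. indicator D x *\<^sub>R (kern ((h - u x) / dl n) * F x) \<partial>lborel)"
      by (simp add: set_lebesgue_integral_def)
    also have "\<dots> = (\<integral>x. kern ((h - u x) / dl n) * F x \<partial>lborel)"
      unfolding eqx ..
    finally show "(LINT x:D|lebesgue. kern ((h - u x) / dl n) * F x) / dl n
      = (\<integral>x. kern ((h - u x) / dl n) * F x \<partial>lborel) / dl n" by simp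
  qed
  show ?thesis
    by (rule LIMSEQ_unique[OF level_measure(5)[OF h F(1), unfolded eq] chart_limit(1)[OF F]])
qed

lemma grad_chart:
  assumes y: "y \<in> level h" "regular h" and \<eta>: "0 < \<eta>" "\<eta> < 1"
  obtains r where "r > 0" "ball y r \<subseteq> interior D"
    "level_chart u (grad u) (sgn (grad u y)) (ball y r) ((1 - \<eta>) * norm (grad u y))"
    "\<And>x. x \<in> ball y r \<Longrightarrow> norm (grad u x) \<le> (1 + \<eta>) * norm (grad u y)"
  by (rule level_chart_at[OF u_has_derivative grad_cont _ _ open_interior \<eta>, of y D])
    (use y level_interior[of h] in \<open>auto simp: regular_def\<close>)

text \<open>Points of the reduced boundary must have positive mass in every ball. A hat function
  \<open>F\<close> around \<open>x\<close> has positive integral, since in the chart formula the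
  integrand is positive on a nonempty open set of parameters.\<close>

lemma surf_ball_pos:
  assumes h: "regular h" and x: "x \<in> level h" and r: "r > 0"
  shows "measure (surf h) (ball x r) > 0"
proof -
  obtain r0 where r0: "r0 > 0" "ball x r0 \<subseteq> interior D"
    "level_chart u (grad u) (sgn (grad u x)) (ball x r0) ((1 - 1/2) * norm (grad u x))"
    by (rule grad_chart[OF x h, of "1/2"]) auto
  define e where "e = sgn (grad u x)"
  interpret level_chart u "grad u" e "ball x r0" "(1 - 1/2) * norm (grad u x)" h
    using r0(3) by (simp add: e_def)
  define \<rho> where "\<rho> = min r r0 / 2"
  have \<rho>: "\<rho> > 0" "\<rho> < r" "\<rho> < r0" using r r0 by (auto simp: \<rho>_def)
  define F where "F y = max 0 (\<rho> - dist y x)" for y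
  have cF: "continuous_on UNIV F" unfolding F_def[abs_def] by (intro continuous_intros)
  have F0: "F y \<ge> 0" for y by (simp add: F_def)
  have supp: "F y = 0" if "y \<notin> cball x \<rho>" for y using that by (simp add: F_def dist_commute)
  have sub: "cball x \<rho> \<subseteq> ball x r0" using \<rho> by auto
  define G where "G z = indicator (slab \<inter> W) z * (F (P z) / (grad u (P z) \<bullet> e))" for z
  have I: "integral\<^sup>L (level_measure h) F = (\<integral>z. G z \<partial>lborel)"
    unfolding G_def using level_measure_chart[OF h level_chart_axioms _ cF compact_cball sub supp] r0(2) interior_subset by blast
  have iG: "integrable lborel G"
    unfolding G_def[abs_def] by (rule chart_limit(2)[OF cF compact_cball sub supp])
  have G0: "G z \<ge> 0" for z
  proof (cases "z \<in> W")
    case True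
    then have "grad u (P z) \<bullet> e > 0" using less_le_trans[OF c(1) c(2)[of "P z"]] P_level[OF True] by blast
    then show ?thesis using F0[of "P z"] by (simp add: G_def)
  qed (simp add: G_def)
  \<comment> \<open>The point on the line through \<open>x\<close> whose coordinate along
    \<open>e\<close> is \<open>1 / 2\<close>, in the interior of the slab.\<close>
  define z0 where "z0 = x + (1 / 2 - x \<bullet> e) *\<^sub>R e"
  have ee: "e \<bullet> e = 1" using e by (simp add: dot_square_norm)
  have hit0: "hit z0 (x \<bullet> e - 1 / 2)"
    using x r0(1) by (simp add: hit_def z0_def level_def algebra_simps)
  have z0W: "z0 \<in> W" using hit0 by (auto simp: W_def)
  have "P z0 = z0 + (x \<bullet> e - 1 / 2) *\<^sub>R e" using z0W T_eqI[OF hit0] by (simp add: P_def)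
  then have Pz0: "P z0 = x" by (simp add: z0_def algebra_simps)
  define Ob where "Ob = {z \<in> W. dist (P z) x < \<rho>} \<inter> {z. 0 < z \<bullet> e \<and> z \<bullet> e < 1}"
  have "open {z \<in> W. dist (P z) x < \<rho>}"
  proof -
    have "{z \<in> W. dist (P z) x < \<rho>} = P -` ball x \<rho> \<inter> W" by (auto simp: dist_commute)
    then show ?thesis using continuous_open_preimage[OF P_continuous open_W open_ball, of x \<rho>] by (simp add: Int_commute)
  qed
  moreover have "open {z. 0 < z \<bullet> e \<and> z \<bullet> e < 1}"
    by (intro open_Collect_conj open_Collect_less continuous_intros)
  ultimately have "open Ob" unfolding Ob_def by (rule open_Int)
  moreover have "z0 \<in> Ob" using z0W Pz0 \<rho>(1) ee by (simp add: Ob_def z0_def inner_add_left)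
  ultimately have nn: "\<not> negligible Ob" using open_not_negligible by blast
  have Gpos: "G z > 0" if "z \<in> Ob" for z
  proof -
    have zW: "z \<in> W" "z \<in> slab" "F (P z) > 0" using that by (auto simp: Ob_def slab_def F_def)
    moreover have "grad u (P z) \<bullet> e > 0" using less_le_trans[OF c(1) c(2)[of "P z"]] P_level[OF zW(1)] by blast
    ultimately show ?thesis by (simp add: G_def)
  qed
  have "integral\<^sup>L (level_measure h) F \<noteq> 0"
  proof
    assume "integral\<^sup>L (level_measure h) F = 0"
    then have "AE z in lborel. G z = 0"
      using I integral_nonneg_eq_0_iff_AE[OF iG] G0 by auto
    then have "AE z in lborel. z \<notin> Ob" by eventually_elim (use Gpos in force)
    then have "AE z in lebesgue. z \<notin> Ob" by (rule AE_completion)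
    then have "negligible Ob" using \<open>open Ob\<close>
      by (simp add: negligible_iff_null_sets AE_iff_null_sets)
    then show False using nn by blast
  qed
  show ?thesis
  proof (rule ccontr)
    assume "\<not> measure (surf h) (ball x r) > 0"
    then have "measure (surf h) (ball x r) = 0" using measure_nonneg[of "surf h" "ball x r"] by linarith
    then have "emeasure (surf h) (ball x r) = 0"
      using finite_measure.emeasure_eq_measure[OF surf_finite(1)[OF h]] by simp
    then have "AE y in surf h. y \<notin> ball x r"
      by (intro AE_not_in) (auto simp: null_sets_def surf_sets[OF h])
    then have "AE y in level_measure h. 0 < ennreal (norm (grad u y)) \<longrightarrow> y \<notin> ball x r"
      unfolding surf_def AE_density[OF level_measure_measurable[OF h norm_grad_measurable]] .
    then have "AE y in level_measure h. F y = 0"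
      using level_measure(3)[OF h]
    proof eventually_elim
      case (elim y)
      then have "grad u y \<noteq> 0" using h by (auto simp: regular_def)
      with elim have "y \<notin> ball x r" by simp
      then show ?case using supp[of y] \<rho>(2) by (auto simp: dist_commute)
    qed
    then have "integral\<^sup>L (level_measure h) F = 0" by (simp add: integral_eq_zero_AE)
    with \<open>integral\<^sup>L (level_measure h) F \<noteq> 0\<close> show False by blast
  qed
qed

text \<open>The gradient does not vanish at \<open>x\<close>, so \<open>normal\<close> is continuous
  there and its averages over shrinking balls tend to the unit vector
  \<open>normal x\<close>.\<close>

lemma level_subset_reduced_boundary:
  assumes h: "regular h" shows "level h \<subseteq> reduced_boundary (sublevel h)"
proof
  fix x assume x: "x \<in> level h"
  have gx: "grad u x \<noteq> 0" using x h by (auto simp: regular_def)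
  have "((\<lambda>r. (1 / measure (surf h) (ball x r)) *\<^sub>R (LINT y:ball x r|surf h. normal y)) \<longlongrightarrow> normal x) (at_right 0)"
  proof (rule tendstoI)
    fix \<epsilon> :: real assume \<epsilon>: "\<epsilon> > 0"
    have "isCont (\<lambda>y. sgn (grad u y)) x"
      using grad_cont[of UNIV] gx by (intro isCont_sgn) (auto simp: continuous_on_eq_continuous_at)
    moreover have ev0: "\<forall>\<^sub>F y in nhds x. grad u y \<noteq> 0"
      using tendsto_imp_eventually_ne[of "grad u" "grad u x" "nhds x" 0] gx grad_cont[of UNIV]
      by (auto simp: continuous_on_eq_continuous_at isCont_def tendsto_at_iff_tendsto_nhds)
    ultimately have "\<forall>\<^sub>F y in nhds x. dist (sgn (grad u y)) (sgn (grad u x)) < \<epsilon> / 2"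
      using \<epsilon> tendstoD[of "\<lambda>y. sgn (grad u y)" "sgn (grad u x)" "nhds x" "\<epsilon> / 2"]
        tendsto_at_iff_tendsto_nhds[of "\<lambda>y. sgn (grad u y)" x]
      by (auto simp: isCont_def)
    then have "\<forall>\<^sub>F y in nhds x. dist (normal y) (normal x) < \<epsilon> / 2"
      using ev0 by eventually_elim (simp add: normal_def gx)
    then obtain d where d: "d > 0" "\<And>y. dist y x < d \<Longrightarrow> dist (normal y) (normal x) < \<epsilon> / 2"
      by (auto simp: eventually_nhds_metric)
    have "dist ((1 / measure (surf h) (ball x r)) *\<^sub>R (LINT y:ball x r|surf h. normal y)) (normal x) < \<epsilon>"
      if r: "0 < r" "r < d" for r
    proof -
      interpret finite_measure "surf h" by (rule surf_finite(1)[OF h])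
      let ?m = "measure (surf h) (ball x r)"
      have m: "?m > 0" by (rule surf_ball_pos[OF h x r(1)])
      have bS: "ball x r \<in> sets (surf h)" by (simp add: surf_sets[OF h])
      have nm: "normal \<in> borel_measurable (surf h)"
        using normal_measurable measurable_cong_sets[OF surf_sets[OF h] refl] by blast
      have i0: "integrable (surf h) (\<lambda>y. indicator (ball x r) y *\<^sub>R normal y)"
      proof (rule integrable_const_bound[where B=1])
        show "AE y in surf h. norm (indicator (ball x r) y *\<^sub>R normal y) \<le> 1"
          by (intro AE_I2) (auto simp: indicator_def norm_normal)
        show "(\<lambda>y. indicator (ball x r) y *\<^sub>R normal y) \<in> borel_measurable (surf h)"
          by (intro borel_measurable_scaleR borel_measurable_indicator bS nm)
      qed
      have i1: "integrable (surf h) (\<lambda>y. indicator (ball x r) y *\<^sub>R normal x)"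
      proof (rule integrable_const_bound[where B=1])
        show "AE y in surf h. norm (indicator (ball x r) y *\<^sub>R normal x) \<le> 1"
          by (intro AE_I2) (auto simp: indicator_def norm_normal)
        show "(\<lambda>y. indicator (ball x r) y *\<^sub>R normal x) \<in> borel_measurable (surf h)"
          by (intro borel_measurable_scaleR borel_measurable_indicator bS borel_measurable_const)
      qed
      have "(LINT y:ball x r|surf h. normal y) - ?m *\<^sub>R normal x
        = (LINT y|surf h. indicator (ball x r) y *\<^sub>R normal y) - (LINT y|surf h. indicator (ball x r) y *\<^sub>R normal x)"
        using bS by (simp add: set_lebesgue_integral_def emeasure_eq_measure)
      also have "\<dots> = (LINT y|surf h. indicator (ball x r) y *\<^sub>R (normal y - normal x))"
        by (subst Bochner_Integration.integral_diff[OF i0 i1, symmetric]) (simp add: scaleR_diff_right)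
      finally have "norm ((LINT y:ball x r|surf h. normal y) - ?m *\<^sub>R normal x)
        \<le> (LINT y|surf h. norm (indicator (ball x r) y *\<^sub>R (normal y - normal x)))"
        using integral_norm_bound[of "surf h" "\<lambda>y. indicator (ball x r) y *\<^sub>R (normal y - normal x)"] by simp
      also have "\<dots> \<le> (LINT y|surf h. indicator (ball x r) y * (\<epsilon> / 2))"
      proof (rule integral_mono)
        show "integrable (surf h) (\<lambda>y. norm (indicator (ball x r) y *\<^sub>R (normal y - normal x)))"
          using Bochner_Integration.integrable_diff[OF i0 i1] by (intro integrable_norm) (simp add: scaleR_diff_right)
        show "integrable (surf h) (\<lambda>y. indicator (ball x r) y * (\<epsilon> / 2))"
          using bS by (intro integrable_mult_left integrable_real_indicator) (simp_all add: emeasure_eq_measure)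
        show "norm (indicator (ball x r) y *\<^sub>R (normal y - normal x)) \<le> indicator (ball x r) y * (\<epsilon> / 2)" for y
          using d(2)[of y] r by (cases "y \<in> ball x r") (auto simp: dist_norm dist_commute less_imp_le norm_minus_commute)
      qed
      also have "\<dots> = ?m * (\<epsilon> / 2)" using bS by (simp add: emeasure_eq_measure)
      finally have "norm ((LINT y:ball x r|surf h. normal y) - ?m *\<^sub>R normal x) \<le> ?m * (\<epsilon> / 2)" .
      then have "norm ((1 / ?m) *\<^sub>R ((LINT y:ball x r|surf h. normal y) - ?m *\<^sub>R normal x)) \<le> (1 / ?m) * (?m * (\<epsilon> / 2))"
        unfolding norm_scaleR using m by (simp add: pos_divide_le_eq mult_ac)
      moreover have "(1 / ?m) *\<^sub>R (LINT y:ball x r|surf h. normal y) - normal x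
          = (1 / ?m) *\<^sub>R ((LINT y:ball x r|surf h. normal y) - ?m *\<^sub>R normal x)"
        using m by (simp add: scaleR_diff_right)
      ultimately have "dist ((1 / ?m) *\<^sub>R (LINT y:ball x r|surf h. normal y)) (normal x) \<le> \<epsilon> / 2"
        using m by (simp add: dist_norm)
      then show ?thesis using \<epsilon> by simp
    qed
    then show "\<forall>\<^sub>F r in at_right 0. dist ((1 / measure (surf h) (ball x r)) *\<^sub>R (LINT y:ball x r|surf h. normal y)) (normal x) < \<epsilon>"
      using d(1) by (auto simp: eventually_at_right_field)
  qed
  then show "x \<in> reduced_boundary (sublevel h)"
    unfolding reduced_boundary_def
    using surf_gauss_green[OF h] surf_ball_pos[OF h x] norm_normal by blast
qed

end

section \<open>Monotonicity of the area of level sets\<close>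

lemma compact_convex_line:
  fixes D :: "'a::euclidean_space set"
  assumes D: "compact D" "convex D" and e: "norm e = 1" and ne: "\<exists>t. x + t *\<^sub>R e \<in> D"
  obtains a b where "a \<le> b" "{t. x + t *\<^sub>R e \<in> D} = {a..b}"
proof -
  let ?I = "{t. x + t *\<^sub>R e \<in> D}"
  have "closed ((\<lambda>t. x + t *\<^sub>R e) -` D)"
    using D(1) by (intro continuous_closed_vimage compact_imp_closed) (auto intro!: continuous_intros)
  then have cl: "closed ?I" by (simp add: vimage_def)
  obtain R where R: "\<And>y. y \<in> D \<Longrightarrow> norm y \<le> R" using compact_imp_bounded[OF D(1)] by (auto simp: bounded_iff)
  have "\<bar>t\<bar> \<le> R + norm x" if "x + t *\<^sub>R e \<in> D" for t
    using R[OF that] norm_triangle_ineq4[of "x + t *\<^sub>R e" x] e by simp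
  then have "bounded ?I" by (intro boundedI[of _ "R + norm x"]) auto
  with cl have "compact ?I" by (simp add: compact_eq_bounded_closed)
  moreover have "convex ?I"
  proof (rule convexI)
    fix s t p q :: real assume st: "s \<in> ?I" "t \<in> ?I" and pq: "0 \<le> p" "0 \<le> q" "p + q = 1"
    have "p *\<^sub>R (x + s *\<^sub>R e) + q *\<^sub>R (x + t *\<^sub>R e) \<in> D"
      using convexD[OF D(2), of "x + s *\<^sub>R e" "x + t *\<^sub>R e" p q] st pq by simp
    moreover have "p *\<^sub>R (x + s *\<^sub>R e) + q *\<^sub>R (x + t *\<^sub>R e) = (p + q) *\<^sub>R x + (p * s + q * t) *\<^sub>R e"
      by (simp add: algebra_simps)
    ultimately show "p *\<^sub>R s + q *\<^sub>R t \<in> ?I" using pq by simp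
  qed
  ultimately obtain a b where ab: "?I = {a..b}"
    using connected_compact_interval_1[of ?I] convex_connected by (auto simp: box_real)
  obtain t where "x + t *\<^sub>R e \<in> D" using ne by blast
  then have "t \<in> {a..b}" using ab by blast
  then have "a \<le> b" by simp
  then show ?thesis using ab that by blast
qed

text \<open>The integral along a chord is a difference of two values of \<open>f\<close>, hence at
  most 2, and the shadow measures the lines that meet \<open>D\<close>.\<close>

lemma convex_dir_deriv_integral_bound:
  fixes f :: "'a::euclidean_space \<Rightarrow> real"
  assumes D: "compact D" "convex D" and e: "norm e = 1" and f: "Ck 1 f" "\<And>x. \<bar>f x\<bar> \<le> 1"
  shows "(LINT x:D|lebesgue. dir_deriv f e x)
    \<le> 2 * measure lborel {x. 0 \<le> x \<bullet> e \<and> x \<bullet> e < 1 \<and> (\<exists>t. x + t *\<^sub>R e \<in> D)}" (is "_ \<le> 2 * measure lborel ?Z")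
proof -
  define k where "k x = indicator D x *\<^sub>R dir_deriv f e x" for x
  have ik: "integrable lborel k"
    unfolding k_def[abs_def] by (rule borel_integrable_compact[OF D(1) Ck1_continuous_dir_deriv[OF f(1)]])
  have Z: "?Z \<in> sets borel" "bounded ?Z" by (rule cylinder_measurable[OF D(1) e])+
  have Zfin: "emeasure lborel ?Z < \<infinity>" using Z emeasure_bounded_finite by blast
  have line: "\<bar>\<integral>t. k (x + t *\<^sub>R e) \<partial>lborel\<bar> \<le> indicator {x. \<exists>t. x + t *\<^sub>R e \<in> D} x * 2" for x
  proof (cases "\<exists>t. x + t *\<^sub>R e \<in> D")
    case True
    then obtain a b where ab: "a \<le> b" "{t. x + t *\<^sub>R e \<in> D} = {a..b}"
      using compact_convex_line[OF D e] by blast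
    have eq: "k (x + t *\<^sub>R e) = indicator {a..b} t *\<^sub>R dir_deriv f e (x + t *\<^sub>R e)" for t
    proof -
      have "x + t *\<^sub>R e \<in> D \<longleftrightarrow> t \<in> {a..b}" using ab(2) by blast
      then show ?thesis by (simp add: k_def indicator_def)
    qed
    have "(\<integral>t. k (x + t *\<^sub>R e) \<partial>lborel) = f (x + b *\<^sub>R e) - f (x + a *\<^sub>R e)"
      unfolding eq
    proof (rule integral_FTC_atLeastAtMost[OF ab(1)])
      show "((\<lambda>t. f (x + t *\<^sub>R e)) has_vector_derivative dir_deriv f e (x + t *\<^sub>R e)) (at t within {a..b})" for t
        by (rule has_vector_derivative_at_within, rule has_derivative_line, rule Ck1_has_derivative[OF f(1)])
      show "continuous_on {a..b} (\<lambda>t. dir_deriv f e (x + t *\<^sub>R e))"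
        by (intro continuous_on_compose2[OF Ck1_continuous_dir_deriv[OF f(1), of UNIV]] continuous_intros) auto
    qed
    then show ?thesis using True f(2)[of "x + b *\<^sub>R e"] f(2)[of "x + a *\<^sub>R e"] by (auto simp: abs_le_iff)
  next
    case False
    then have eq: "k (x + t *\<^sub>R e) = 0" for t by (simp add: k_def)
    show ?thesis unfolding eq using False by simp
  qed
  have "(LINT x:D|lebesgue. dir_deriv f e x) = (\<integral>x. k x \<partial>lborel)"
    using LINT_lebesgue_lborel[OF D(1) Ck1_continuous_dir_deriv[OF f(1)]] by (simp add: set_lebesgue_integral_def k_def)
  also have "\<dots> = (\<integral>x. indicator {x. 0 \<le> x \<bullet> e \<and> x \<bullet> e < 1} x * (\<integral>t. k (x + t *\<^sub>R e) \<partial>lborel) \<partial>lborel)"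
    by (rule integral_slab[OF e ik, symmetric])
  also have "\<dots> \<le> (\<integral>x. indicator ?Z x * 2 \<partial>lborel)"
  proof (rule integral_mono_AE')
    show "integrable lborel (\<lambda>x. indicator ?Z x * (2::real))"
      using Z(1) Zfin by (intro integrable_mult_left integrable_real_indicator) auto
    show "AE x in lborel. indicator {x. 0 \<le> x \<bullet> e \<and> x \<bullet> e < 1} x * (\<integral>t. k (x + t *\<^sub>R e) \<partial>lborel) \<le> indicator ?Z x * 2"
    proof (intro AE_I2)
      fix x
      show "indicator {x. 0 \<le> x \<bullet> e \<and> x \<bullet> e < 1} x * (\<integral>t. k (x + t *\<^sub>R e) \<partial>lborel) \<le> indicator ?Z x * 2"
        using line[of x] by (cases "\<exists>t. x + t *\<^sub>R e \<in> D") (auto simp: abs_le_iff indicator_def)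
    qed
  qed (auto simp: indicator_def)
  also have "\<dots> = 2 * measure lborel ?Z" by simp
  finally show ?thesis .
qed

text \<open>One shadow bound for each coordinate direction. The constant depends on \<open>D\<close>
  alone and becomes the uniform bound \<open>C0\<close> on the areas of level sets.\<close>

lemma perimeter_convex_finite:
  assumes D: "compact D" "convex D"
  obtains C where "C \<ge> 0" "perimeter D \<le> ennreal C"
proof -
  define V where "V i = 2 * measure lborel {x :: real^3. 0 \<le> x \<bullet> axis i 1 \<and> x \<bullet> axis i 1 < 1 \<and> (\<exists>t. x + t *\<^sub>R axis i 1 \<in> D)}" for i
  have "perimeter D \<le> ennreal (\<Sum>i\<in>UNIV. V i)"
    unfolding perimeter_def
  proof (rule SUP_least, clarify)
    fix X assume X: "X \<in> C1c_fields" "\<forall>x. norm (X x) \<le> 1"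
    then have X1: "Ck 1 X" by (simp add: C1c_fields_def)
    have "(LINT x:D|lebesgue. divergence X x) = (\<Sum>i\<in>UNIV. LINT x:D|lebesgue. dir_deriv (\<lambda>x. X x $ i) (axis i 1) x)"
      unfolding divergence_def set_lebesgue_integral_def dir_deriv_vec_nth[OF X1] scaleR_sum_right
      by (rule Bochner_Integration.integral_sum)
        (use continuous_on_compact_integrable[OF D(1) continuous_on_component[OF Ck1_continuous_dir_deriv[OF X1]]]
          in \<open>auto simp: set_integrable_def\<close>)
    also have "\<dots> \<le> (\<Sum>i\<in>UNIV. V i)"
      unfolding V_def
    proof (intro sum_mono convex_dir_deriv_integral_bound[OF D] Ck1_vec_nth X1)
      show "norm (axis i 1 :: real^3) = 1" for i by simp
      show "\<bar>X x $ i\<bar> \<le> 1" for x i using X(2) component_le_norm_cart[of "X x" i] order_trans by blast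
    qed
    finally show "ennreal (LINT x:D|lebesgue. divergence X x) \<le> ennreal (\<Sum>i\<in>UNIV. V i)" by (rule ennreal_leI)
  qed
  moreover have "(\<Sum>i\<in>UNIV. V i) \<ge> 0" by (simp add: V_def sum_nonneg)
  ultimately show ?thesis using that by blast
qed

text \<open>Below \<open>c\<close> the derivative is frozen at its value in \<open>c\<close>, and
  the function is recovered as an antiderivative. Applied to the squared gradient norm, it gives
  normalized gradient fields that remain differentiable across critical points.\<close>

lemma inverse_sqrt_extension:
  fixes c :: real
  assumes "c > 0"
  obtains \<theta> \<theta>' where "\<And>t. (\<theta> has_real_derivative \<theta>' t) (at t)" "continuous_on UNIV \<theta>'"
    "\<And>t. t \<ge> c \<Longrightarrow> \<theta> t = 1 / sqrt t" "\<And>t. t \<ge> c \<Longrightarrow> \<theta>' t = - 1 / (2 * t * sqrt t)"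
proof -
  define \<theta>' where "\<theta>' t = - 1 / (2 * max t c * sqrt (max t c))" for t
  have pos: "max t c > 0" for t using assms by auto
  have c': "continuous_on UNIV \<theta>'"
    unfolding \<theta>'_def[abs_def] using pos by (intro continuous_intros) (auto simp: less_imp_neq[symmetric])
  obtain F where F: "\<And>t. (F has_real_derivative \<theta>' t) (at t)"
    using antiderivative_exists[OF c'] by blast
  define \<theta> where "\<theta> t = F t - F c + 1 / sqrt c" for t
  have "\<theta> t = 1 / sqrt t" if "t \<ge> c" for t
  proof (cases "t = c")
    case False
    then have ct: "c < t" using that by simp
    have "((\<lambda>s. F s - 1 / sqrt s) has_real_derivative 0) (at s)" if "c \<le> s" for s
    proof -
      have s: "s > 0" "\<theta>' s = - 1 / (2 * s * sqrt s)" using that assms by (auto simp: \<theta>'_def max_absorb1)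
      show ?thesis
        using s(1) by (auto intro!: derivative_eq_intros F simp: s(2) field_simps power2_eq_square)
    qed
    from MVT2[OF ct, of "\<lambda>s. F s - 1 / sqrt s" "\<lambda>_. 0"] this have "F t - 1 / sqrt t = F c - 1 / sqrt c" by auto
    then show ?thesis by (simp add: \<theta>_def)
  qed (simp add: \<theta>_def)
  moreover have "(\<theta> has_real_derivative \<theta>' t) (at t)" for t
    unfolding \<theta>_def[abs_def] by (auto intro!: derivative_eq_intros F)
  moreover have "\<theta>' t = - 1 / (2 * t * sqrt t)" if "t \<ge> c" for t using that by (simp add: \<theta>'_def max_absorb1)
  ultimately show ?thesis using c' that by blast
qed

section \<open>Area of a regular level set and Hausdorff measure\<close>

context well begin

lemma compact_level: "compact (level h)"
proof -
  have "closed {x. u x = h}" by (intro closed_Collect_eq u_cont continuous_intros)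
  then show ?thesis using compact_Int_closed[OF D(1), of "{x. u x = h}"] by (simp add: level_def Collect_conj_eq)
qed

text \<open>In the chart the area element over the shadow is at most
  \<open>(1 + \<eta>) / (1 - \<eta>)\<close>, and \<open>isodiametric_cylinder\<close> bounds the
  shadow of \<open>C\<close>.\<close>

lemma surf_chart_bound:
  assumes h: "regular h" and y: "y \<in> level h" and \<eta>: "0 < \<eta>" "\<eta> < 1"
    and chart: "level_chart u (grad u) (sgn (grad u y)) (ball y r) ((1 - \<eta>) * norm (grad u y))"
      "\<And>x. x \<in> ball y r \<Longrightarrow> norm (grad u x) \<le> (1 + \<eta>) * norm (grad u y)" and sub: "ball y r \<subseteq> D"
    and C: "compact C" "C \<noteq> {}" "C \<subseteq> ball y r" and d: "\<And>x z. x \<in> C \<Longrightarrow> z \<in> C \<Longrightarrow> dist x z \<le> d" "d \<ge> 0"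
  shows "measure (surf h) C \<le> (1 + \<eta>) / (1 - \<eta>) * (pi * (d / 2)\<^sup>2)"
proof -
  define e where "e = sgn (grad u y)"
  define k where "k = (1 + \<eta>) / (1 - \<eta>)"
  interpret ch: level_chart u "grad u" e "ball y r" "(1 - \<eta>) * norm (grad u y)" h
    using chart(1) by (simp add: e_def)
  interpret fm: finite_measure "surf h" by (rule surf_finite(1)[OF h])
  obtain \<delta> where \<delta>: "\<delta> > 0" "{x. infdist x C \<le> \<delta>} \<subseteq> ball y r"
    using compact_in_open_separated[OF C(2,1) open_ball C(3)] by blast
  define K where "K = {x. infdist x C \<le> \<delta>}"
  have K: "compact K" "K \<subseteq> ball y r"
    unfolding K_def using compact_infdist_le[OF C(2,1) \<delta>(1)] \<delta>(2) by auto
  \<comment> \<open>Continuous functions that decrease to the indicator of \<open>C\<close> and are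
    supported in the chart; the chart formula is stated for continuous integrands.\<close>
  define F where "F n x = max 0 (1 - (real (Suc n) / \<delta>) * infdist x C)" for n x
  have cF: "continuous_on S (F n)" for n S unfolding F_def[abs_def] by (intro continuous_intros)
  have F0: "F n x \<ge> 0" "F n x \<le> 1" for n x using \<delta>(1) infdist_nonneg[of x C] by (auto simp: F_def)
  have supp: "F n x = 0" if "x \<notin> K" for n x
  proof -
    have "infdist x C > \<delta>" using that by (simp add: K_def)
    then have "1 \<le> infdist x C / \<delta>" using \<delta>(1) by simp
    moreover have "1 * (infdist x C / \<delta>) \<le> real (Suc n) * (infdist x C / \<delta>)"
      using \<delta>(1) infdist_nonneg[of x C] by (intro mult_right_mono divide_nonneg_pos) auto
    ultimately have "1 \<le> (real (Suc n) / \<delta>) * infdist x C" by simp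
    then show ?thesis by (simp add: F_def)
  qed
  have FC: "F n x = 1" if "x \<in> C" for n x using that by (simp add: F_def)
  define A where "A n = (\<integral>x. indicator (ch.slab \<inter> ch.W) x * F n (ch.P x) \<partial>lborel)" for n
  have gpos: "(1 - \<eta>) * norm (grad u y) \<le> grad u (ch.P x) \<bullet> e" "grad u (ch.P x) \<bullet> e > 0" "ch.P x \<in> ball y r" if "x \<in> ch.W" for x
    using ch.P_level[OF that] ch.c less_le_trans[OF ch.c(1) ch.c(2)] by blast+
  have iA: "integrable lborel (\<lambda>x. indicator (ch.slab \<inter> ch.W) x * F n (ch.P x))" for n
  proof -
    have "integrable lborel (\<lambda>x. indicator (ch.slab \<inter> ch.W) x * ((F n (ch.P x) * (grad u (ch.P x) \<bullet> e)) / (grad u (ch.P x) \<bullet> e)))"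
      by (rule ch.chart_limit(2)[of "\<lambda>x. F n x * (grad u x \<bullet> e)" K])
        (use K supp in \<open>auto intro!: continuous_intros cF grad_cont\<close>)
    moreover have "(\<lambda>x. indicator (ch.slab \<inter> ch.W) x * ((F n (ch.P x) * (grad u (ch.P x) \<bullet> e)) / (grad u (ch.P x) \<bullet> e)))
       = (\<lambda>x. indicator (ch.slab \<inter> ch.W) x * F n (ch.P x))"
    proof
      fix x show "indicator (ch.slab \<inter> ch.W) x * ((F n (ch.P x) * (grad u (ch.P x) \<bullet> e)) / (grad u (ch.P x) \<bullet> e))
       = indicator (ch.slab \<inter> ch.W) x * F n (ch.P x)"
        using gpos(2)[of x] by (cases "x \<in> ch.W") auto
    qed
    ultimately show ?thesis by (simp only:)
  qed
  have cFs: "continuous_on UNIV (\<lambda>x. F n x * norm (grad u x))" for n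
    by (intro continuous_intros cF grad_cont)
  have Cb: "C \<in> sets (surf h)" using C(1) by (simp add: surf_sets[OF h] borel_compact)
  have "measure (surf h) C \<le> k * A n" for n
  proof -
    have Fm: "F n \<in> borel_measurable borel" by (intro borel_measurable_continuous_onI cF)
    have Fs: "F n \<in> borel_measurable (surf h)" using Fm measurable_cong_sets[OF surf_sets[OF h] refl] by blast
    have "measure (surf h) C = (\<integral>x. indicator C x \<partial>surf h)" using Cb by simp
    also have "\<dots> \<le> (\<integral>x. F n x \<partial>surf h)"
    proof (rule integral_mono)
      show "integrable (surf h) (indicator C :: _ \<Rightarrow> real)" using Cb by (intro integrable_real_indicator) (simp_all add: fm.emeasure_eq_measure)
      show "integrable (surf h) (F n)" by (rule fm.integrable_const_bound[where B=1]) (use F0 Fs in auto)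
      show "indicator C x \<le> F n x" for x using FC F0 by (auto simp: indicator_def)
    qed
    also have "\<dots> = (\<integral>x. norm (grad u x) *\<^sub>R F n x \<partial>level_measure h)"
      unfolding surf_def
      by (rule integral_density)
        (auto intro!: level_measure_measurable[OF h] Fm borel_measurable_continuous_onI continuous_intros grad_cont)
    also have "\<dots> = (\<integral>x. F n x * norm (grad u x) \<partial>level_measure h)" by (simp add: mult.commute)
    also have "\<dots> = (\<integral>x. indicator (ch.slab \<inter> ch.W) x * (F n (ch.P x) * norm (grad u (ch.P x)) / (grad u (ch.P x) \<bullet> e)) \<partial>lborel)"
      by (rule level_measure_chart[OF h ch.level_chart_axioms sub cFs K]) (simp add: supp)
    also have "\<dots> \<le> (\<integral>x. k * (indicator (ch.slab \<inter> ch.W) x * F n (ch.P x)) \<partial>lborel)"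
    proof (rule integral_mono)
      show "integrable lborel (\<lambda>x. indicator (ch.slab \<inter> ch.W) x * (F n (ch.P x) * norm (grad u (ch.P x)) / (grad u (ch.P x) \<bullet> e)))"
        by (rule ch.chart_limit(2)[OF cFs K]) (simp add: supp)
      show "integrable lborel (\<lambda>x. k * (indicator (ch.slab \<inter> ch.W) x * F n (ch.P x)))"
        by (intro integrable_mult_right iA)
      fix x
      show "indicator (ch.slab \<inter> ch.W) x * (F n (ch.P x) * norm (grad u (ch.P x)) / (grad u (ch.P x) \<bullet> e))
          \<le> k * (indicator (ch.slab \<inter> ch.W) x * F n (ch.P x))"
      proof (cases "x \<in> ch.W")
        case True
        note g = gpos[OF True]
        have "norm (grad u (ch.P x)) \<le> (1 + \<eta>) * norm (grad u y)" by (rule chart(2)[OF g(3)])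
        also have "\<dots> = k * ((1 - \<eta>) * norm (grad u y))" using \<eta> by (simp add: k_def)
        also have "\<dots> \<le> k * (grad u (ch.P x) \<bullet> e)"
          using g(1) \<eta> by (intro mult_left_mono) (auto simp: k_def)
        finally have "norm (grad u (ch.P x)) / (grad u (ch.P x) \<bullet> e) \<le> k" using g(2) by (simp add: pos_divide_le_eq)
        from mult_left_mono[OF this F0(1)[of n "ch.P x"]] show ?thesis
          by (auto simp: indicator_def mult.commute)
      qed simp
    qed
    finally show ?thesis by (simp add: A_def)
  qed
  moreover have "A \<longlonglongrightarrow> (\<integral>x. indicator (ch.slab \<inter> ch.W) x * indicator C (ch.P x) \<partial>lborel)"
    unfolding A_def[abs_def]
  proof (rule integral_dominated_convergence[OF _ _ iA[of 0]])
    have [measurable]: "ch.slab \<in> sets borel" "ch.W \<in> sets borel" "ch.P \<in> borel_measurable borel" "C \<in> sets borel"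
      using ch.slab_measurable ch.open_W ch.P_measurable C(1) by (auto simp: borel_compact)
    have [measurable]: "F n \<in> borel_measurable borel" for n by (intro borel_measurable_continuous_onI cF)
    show "(\<lambda>x. indicator (ch.slab \<inter> ch.W) x * indicator C (ch.P x) :: real) \<in> borel_measurable lborel" by measurable
    show "(\<lambda>x. indicator (ch.slab \<inter> ch.W) x * F n (ch.P x)) \<in> borel_measurable lborel" for n by measurable
    have "F n x \<le> F 0 x" for n x
    proof -
      have "1 * (infdist x C / \<delta>) \<le> real (Suc n) * (infdist x C / \<delta>)"
        using \<delta>(1) infdist_nonneg[of x C] by (intro mult_right_mono divide_nonneg_pos) auto
      then show ?thesis by (simp add: F_def)
    qed
    then show "AE x in lborel. norm (indicator (ch.slab \<inter> ch.W) x * F n (ch.P x)) \<le> indicator (ch.slab \<inter> ch.W) x * F 0 (ch.P x)" for n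
      using F0 by (intro AE_I2) (auto simp: indicator_def)
    have "(\<lambda>n. F n x) \<longlonglongrightarrow> indicator C x" for x
    proof (cases "x \<in> C")
      case False
      then have "infdist x C > 0" using C(1,2) by (simp add: infdist_pos_not_in_closed compact_imp_closed)
      then have "\<forall>\<^sub>F n in sequentially. dl n < infdist x C / \<delta>" using \<delta>(1) by (intro eventually_dl_less) simp
      then have "\<forall>\<^sub>F n in sequentially. F n x = indicator C x"
      proof eventually_elim
        case (elim n)
        then have "1 \<le> real (Suc n) / \<delta> * infdist x C" using \<delta>(1) by (simp add: dl_def field_simps)
        then show ?case using False by (simp add: F_def)
      qed
      then show ?thesis by (rule tendsto_eventually)
    qed (simp add: FC)
    then show "AE x in lborel. (\<lambda>n. indicator (ch.slab \<inter> ch.W) x * F n (ch.P x)) \<longlonglongrightarrow> indicator (ch.slab \<inter> ch.W) x * indicator C (ch.P x)"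
      by (intro AE_I2 tendsto_mult_left)
  qed
  ultimately have "measure (surf h) C \<le> k * (\<integral>x. indicator (ch.slab \<inter> ch.W) x * indicator C (ch.P x) \<partial>lborel)"
    by (intro LIMSEQ_le_const[OF tendsto_mult_left]) auto
  also have "\<dots> \<le> k * (pi * (d / 2)\<^sup>2)"
  proof (rule mult_left_mono)
    let ?Z = "{x. 0 \<le> x \<bullet> e \<and> x \<bullet> e < 1 \<and> (\<exists>t. x + t *\<^sub>R e \<in> C)}"
    have Z: "?Z \<in> sets borel" "bounded ?Z" by (rule cylinder_measurable[OF C(1) ch.e])+
    have eZ: "emeasure lborel ?Z \<le> ennreal (pi * (d / 2)\<^sup>2)" by (rule isodiametric_cylinder[OF C(1) d ch.e])
    have "(\<integral>x. indicator (ch.slab \<inter> ch.W) x * indicator C (ch.P x) \<partial>lborel) \<le> (\<integral>x. indicator ?Z x \<partial>lborel :: real)"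
    proof (rule integral_mono_AE')
      show "integrable lborel (indicator ?Z :: _ \<Rightarrow> real)"
        using Z emeasure_bounded_finite[OF Z(2)] by (intro integrable_real_indicator) auto
      show "AE x in lborel. indicator (ch.slab \<inter> ch.W) x * indicator C (ch.P x) \<le> (indicator ?Z x :: real)"
        by (intro AE_I2) (auto simp: indicator_def ch.P_def ch.slab_def)
    qed simp
    also have "\<dots> = measure lborel ?Z" using Z by simp
    also have "\<dots> \<le> pi * (d / 2)\<^sup>2"
      unfolding measure_def using eZ by (intro enn2real_leI) auto
    finally show "(\<integral>x. indicator (ch.slab \<inter> ch.W) x * indicator C (ch.P x) \<partial>lborel) \<le> pi * (d / 2)\<^sup>2" .
    show "0 \<le> k" using \<eta> by (simp add: k_def)
  qed
  finally show ?thesis by (simp add: k_def)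
qed

text \<open>The Lebesgue number of the cover by charts makes the scale \<open>\<delta>\<close>
  uniform over the level set.\<close>

lemma surf_small_sets:
  assumes h: "regular h" and \<epsilon>: "\<epsilon> > 0"
  obtains \<delta> where "\<delta> > 0" "\<And>C d. compact C \<Longrightarrow> C \<subseteq> level h \<Longrightarrow> (\<And>x z. x \<in> C \<Longrightarrow> z \<in> C \<Longrightarrow> dist x z \<le> d) \<Longrightarrow> 0 \<le> d \<Longrightarrow> d < \<delta>
     \<Longrightarrow> measure (surf h) C \<le> (1 + \<epsilon>) * (pi * (d / 2)\<^sup>2)"
proof (cases "level h = {}")
  case True
  then show ?thesis using that[of 1] \<epsilon> by auto
next
  case False
  \<comment> \<open>Solves \<open>(1 + \<eta>) / (1 - \<eta>) = 1 + \<epsilon>\<close>.\<close>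
  define \<eta> where "\<eta> = \<epsilon> / (\<epsilon> + 2)"
  have \<eta>: "0 < \<eta>" "\<eta> < 1" "(1 + \<eta>) / (1 - \<eta>) = 1 + \<epsilon>" using \<epsilon> by (auto simp: \<eta>_def field_simps)
  have "\<exists>r. r > 0 \<and> ball y r \<subseteq> interior D \<and>
     level_chart u (grad u) (sgn (grad u y)) (ball y r) ((1 - \<eta>) * norm (grad u y)) \<and>
     (\<forall>x\<in>ball y r. norm (grad u x) \<le> (1 + \<eta>) * norm (grad u y))" if "y \<in> level h" for y
    by (rule grad_chart[OF that h \<eta>(1,2)]) blast
  then obtain r where r: "\<And>y. y \<in> level h \<Longrightarrow> r y > 0 \<and> ball y (r y) \<subseteq> interior D \<and>
     level_chart u (grad u) (sgn (grad u y)) (ball y (r y)) ((1 - \<eta>) * norm (grad u y)) \<and>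
     (\<forall>x\<in>ball y (r y). norm (grad u x) \<le> (1 + \<eta>) * norm (grad u y))" by metis
  let ?C = "(\<lambda>y. ball y (r y)) ` level h"
  have cov: "level h \<subseteq> \<Union>?C" using r by force
  obtain \<delta> where \<delta>: "\<delta> > 0" "\<And>T. T \<subseteq> level h \<Longrightarrow> diameter T < \<delta> \<Longrightarrow> \<exists>B\<in>?C. T \<subseteq> B"
    by (rule Lebesgue_number_lemma[OF compact_level[of h], of ?C]) (use False cov in auto)
  show ?thesis
  proof (rule that[OF \<delta>(1)])
    fix C d assume C: "compact C" "C \<subseteq> level h" "\<And>x z. x \<in> C \<Longrightarrow> z \<in> C \<Longrightarrow> dist x z \<le> d" "0 \<le> d" "d < \<delta>"
    show "measure (surf h) C \<le> (1 + \<epsilon>) * (pi * (d / 2)\<^sup>2)"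
    proof (cases "C = {}")
      case True
      then show ?thesis using \<epsilon> by simp
    next
      case False
      have "diameter C \<le> d" using C(3,4) by (intro diameter_le) (auto simp: dist_norm)
      then obtain y where y: "y \<in> level h" "C \<subseteq> ball y (r y)" using \<delta>(2)[OF C(2)] C(5) by auto
      have "measure (surf h) C \<le> (1 + \<eta>) / (1 - \<eta>) * (pi * (d / 2)\<^sup>2)"
        by (rule surf_chart_bound[OF h y(1) \<eta>(1,2), of "r y"])
          (use r[OF y(1)] y C False interior_subset[of D] in auto)
      then show ?thesis by (simp add: \<eta>(3))
    qed
  qed
qed

text \<open>In a cover by small sets, each piece of the level set has area at most
  \<open>1 + \<epsilon>\<close> times its Hausdorff weight. The pieces are summed, and
  \<open>\<epsilon>\<close> tends to 0.\<close>

lemma area_le_hausdorff: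
  assumes h: "regular h" shows "ennreal (area h) \<le> hausdorff_outer 2 (level h)"
proof -
  interpret fm: finite_measure "surf h" by (rule surf_finite(1)[OF h])
  have lb: "level h \<in> sets borel" using compact_level by (simp add: borel_compact)
  have lev: "ennreal (area h) = emeasure (surf h) (level h)"
  proof -
    have "AE x in surf h. x \<in> level h"
      unfolding surf_def AE_density[OF level_measure_measurable[OF h norm_grad_measurable]]
      using level_measure(3)[OF h] by eventually_elim simp
    then have "emeasure (surf h) (level h) = emeasure (surf h) UNIV"
      using lb by (intro emeasure_eq_AE) (auto simp: surf_sets[OF h])
    then show ?thesis using surf_finite(2)[OF h] by simp
  qed
  have main: "ennreal (area h) \<le> ennreal (1 + \<epsilon>) * hausdorff_outer 2 (level h)" if \<epsilon>: "\<epsilon> > 0" for \<epsilon>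
  proof -
    obtain \<delta> where \<delta>: "\<delta> > 0" "\<And>C d. compact C \<Longrightarrow> C \<subseteq> level h \<Longrightarrow> (\<And>x z. x \<in> C \<Longrightarrow> z \<in> C \<Longrightarrow> dist x z \<le> d) \<Longrightarrow> 0 \<le> d \<Longrightarrow> d < \<delta>
     \<Longrightarrow> measure (surf h) C \<le> (1 + \<epsilon>) * (pi * (d / 2)\<^sup>2)" using surf_small_sets[OF h \<epsilon>] by blast
    have cover: "ennreal (area h) \<le> ennreal (1 + \<epsilon>) * (\<Sum>j. hausdorff_weight 2 (C j))"
      if C: "level h \<subseteq> (\<Union>j. C j)" "\<And>j. bounded (C j) \<and> diameter (C j) \<le> \<delta> / 2" for C :: "nat \<Rightarrow> (real^3) set"
    proof -
      have small: "emeasure (surf h) (closure (C j) \<inter> level h) \<le> ennreal (1 + \<epsilon>) * hausdorff_weight 2 (C j)" for j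
      proof (cases "C j = {}")
        case False
        have bd: "bounded (C j)" "diameter (C j) \<le> \<delta> / 2" using C(2) by auto
        have "measure (surf h) (closure (C j) \<inter> level h) \<le> (1 + \<epsilon>) * (pi * (diameter (C j) / 2)\<^sup>2)"
        proof (rule \<delta>(2))
          show "compact (closure (C j) \<inter> level h)" using compact_level by (simp add: closed_Int_compact)
          show "dist x z \<le> diameter (C j)" if "x \<in> closure (C j) \<inter> level h" "z \<in> closure (C j) \<inter> level h" for x z
            using diameter_bounded_bound[OF bounded_closure[OF bd(1)]] that bd(1) by (simp add: diameter_closure)
          show "0 \<le> diameter (C j)" by (rule diameter_ge_0[OF bd(1)])
          show "diameter (C j) < \<delta>" using bd(2) \<delta>(1) by simp
        qed auto
        then have "emeasure (surf h) (closure (C j) \<inter> level h) \<le> ennreal ((1 + \<epsilon>) * (pi * (diameter (C j) / 2)\<^sup>2))"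
          unfolding fm.emeasure_eq_measure by (rule ennreal_leI)
        also have "\<dots> = ennreal (1 + \<epsilon>) * hausdorff_weight 2 (C j)"
          using False \<epsilon> by (simp add: hausdorff_weight_def unit_ball_vol_2 ennreal_mult')
        finally show ?thesis .
      qed simp
      have "ennreal (area h) = emeasure (surf h) (\<Union>j. closure (C j) \<inter> level h)"
      proof -
        have "level h \<subseteq> (\<Union>j. closure (C j))"
          by (rule subset_trans[OF C(1)], rule UN_mono[OF subset_refl closure_subset])
        then have "level h = (\<Union>j. closure (C j) \<inter> level h)" by blast
        then show ?thesis using lev by simp
      qed
      also have "\<dots> \<le> (\<Sum>j. emeasure (surf h) (closure (C j) \<inter> level h))"
        using lb by (intro emeasure_subadditive_countably) (auto simp: surf_sets[OF h])
      also have "\<dots> \<le> (\<Sum>j. ennreal (1 + \<epsilon>) * hausdorff_weight 2 (C j))"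
        by (intro suminf_le small) auto
      also have "\<dots> = ennreal (1 + \<epsilon>) * (\<Sum>j. hausdorff_weight 2 (C j))"
        by (rule ennreal_suminf_cmult)
      finally show ?thesis .
    qed
    have k: "ennreal (1 + \<epsilon>) \<noteq> 0" "ennreal (1 + \<epsilon>) \<noteq> top" using \<epsilon> by auto
    have "ennreal (area h) / ennreal (1 + \<epsilon>) \<le> hausdorff_pre 2 (\<delta> / 2) (level h)"
      unfolding hausdorff_pre_eq
    proof (rule INF_greatest, clarify)
      fix C :: "nat \<Rightarrow> (real^3) set" assume "level h \<subseteq> \<Union> (range C)" "\<forall>j. bounded (C j) \<and> diameter (C j) \<le> \<delta> / 2"
      from cover[OF this(1)] this(2) have "ennreal (area h) \<le> (\<Sum>j. hausdorff_weight 2 (C j)) * ennreal (1 + \<epsilon>)"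
        by (simp add: mult.commute)
      then show "ennreal (area h) / ennreal (1 + \<epsilon>) \<le> (\<Sum>j. hausdorff_weight 2 (C j))"
        using k by (intro divide_le_posI_ennreal) (auto simp: zero_less_iff_neq_zero mult.commute)
    qed
    also have "\<dots> \<le> hausdorff_outer 2 (level h)" by (rule hausdorff_pre_le_outer) (use \<delta>(1) in simp)
    finally have "ennreal (area h) / ennreal (1 + \<epsilon>) * ennreal (1 + \<epsilon>) \<le> hausdorff_outer 2 (level h) * ennreal (1 + \<epsilon>)"
      by (rule mult_right_mono) simp
    moreover have "ennreal (area h) / ennreal (1 + \<epsilon>) * ennreal (1 + \<epsilon>) = ennreal (area h)"
      unfolding ennreal_divide_times by (subst ennreal_divide_self[OF k(1)]) (use k(2) in \<open>simp_all add: less_top\<close>)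
    ultimately show ?thesis by (simp add: mult.commute)
  qed
  show ?thesis
  proof (cases "hausdorff_outer 2 (level h)")
    case (real b)
    have eps: "area h \<le> (1 + \<epsilon>) * b" if "\<epsilon> > 0" for \<epsilon>
    proof -
      have "ennreal (area h) \<le> ennreal (1 + \<epsilon>) * ennreal b" using main[OF that] by (simp only: real(2))
      also have "\<dots> = ennreal ((1 + \<epsilon>) * b)" by (rule ennreal_mult[symmetric]) (use that real in auto)
      finally show ?thesis by (rule ennreal_le_iff[THEN iffD1, rotated]) (use that real in simp)
    qed
    have le: "area h \<le> b + e" if "e > 0" for e
    proof -
      have b1: "b + 1 > 0" using real(1) by simp
      have "area h \<le> (1 + e / (b + 1)) * b" using eps[of "e / (b + 1)"] that b1 by simp
      also have "\<dots> = b + e * (b / (b + 1))" by (simp add: distrib_right)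
      also have "\<dots> \<le> b + e * 1" using that b1 by (intro add_left_mono mult_left_mono) auto
      finally show ?thesis by simp
    qed
    have "area h \<le> b" by (rule field_le_epsilon) (rule le)
    then show ?thesis using real by (simp add: ennreal_leI)
  qed simp
qed

section \<open>Monotone areas at good heights\<close>

definition good where "good h \<longleftrightarrow> regular h \<and> outer_minimizing (sublevel h)"

lemma area_nonneg: "area h \<ge> 0"
  by (simp add: area_def)

text \<open>The level set lies in the reduced boundary, and outer minimality compares the Hausdorff
  measure of the latter with the perimeter of \<open>F\<close>.\<close>

lemma area_le_perimeter:
  assumes "good h" "bounded F" "F \<in> sets lebesgue" "sublevel h \<subseteq> F"
  shows "ennreal (area h) \<le> perimeter F"
proof -
  have h: "regular h" using assms by (simp add: good_def)
  have "ennreal (area h) \<le> hausdorff_outer 2 (level h)" by (rule area_le_hausdorff[OF h])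
  also have "\<dots> \<le> hausdorff_outer 2 (reduced_boundary (sublevel h))"
    by (rule hausdorff_outer_mono[OF level_subset_reduced_boundary[OF h]])
  also have "\<dots> \<le> perimeter F" using assms by (auto simp: good_def outer_minimizing_def)
  finally show ?thesis .
qed

text \<open>The larger sublevel set is a competitor for the smaller one, and Gauss-Green bounds its
  perimeter by the area of its level set.\<close>

lemma area_mono:
  assumes "good \<alpha>" "good \<beta>" "\<alpha> \<le> \<beta>"
  shows "area \<alpha> \<le> area \<beta>"
proof -
  have \<beta>: "regular \<beta>" "\<beta> < 0" using assms by (auto simp: good_def regular_def)
  have "ennreal (area \<alpha>) \<le> perimeter (sublevel \<beta>)"
  proof (rule area_le_perimeter[OF assms(1)])
    show "bounded (sublevel \<beta>)"
      using compact_imp_bounded[OF D(1)] by (rule bounded_subset) (auto simp: sublevel_def)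
    show "sublevel \<beta> \<in> sets lebesgue" using open_sublevel[of \<beta>] \<beta>(2) by (simp add: borel_open)
    show "sublevel \<alpha> \<subseteq> sublevel \<beta>" using assms(3) by (auto simp: sublevel_def)
  qed
  also have "\<dots> \<le> ennreal (area \<beta>)"
    unfolding perimeter_def
    by (rule SUP_least, clarify, rule ennreal_leI, rule sublevel_flux_le_area[OF \<beta>(1)]) (auto simp: C1c_fields_def)
  finally show ?thesis by (simp add: area_nonneg)
qed

lemma area_le:
  assumes "good h" "perimeter D \<le> ennreal C0" "C0 \<ge> 0"
  shows "area h \<le> C0"
proof -
  have "ennreal (area h) \<le> perimeter D"
    by (rule area_le_perimeter[OF assms(1)])
      (use compact_imp_bounded[OF D(1)] D(1) in \<open>auto simp: sublevel_def borel_compact\<close>)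
  also note assms(2)
  finally show ?thesis using assms(3) by simp
qed

text \<open>The mean curvature of the level sets, the divergence of the normalized gradient; at
  critical points it is 0 by the convention for division by zero.\<close>

definition mc where "mc x = mcnum x / (norm (grad u x)) ^ 3"

lemma slope2_has_derivative: "(slope2 has_derivative (\<lambda>v. 2 * (hess x v \<bullet> grad u x))) (at x)"
proof -
  have "((\<lambda>x. grad u x \<bullet> grad u x) has_derivative (\<lambda>v. grad u x \<bullet> hess x v + hess x v \<bullet> grad u x)) (at x)"
    by (rule has_derivative_inner[OF grad_has_derivative grad_has_derivative])
  then show ?thesis
    by (simp add: slope2_eq[abs_def] power2_norm_eq_inner inner_commute)
qed

lemma divergence_grad: "divergence (grad u) x = lap x"
  by (simp add: divergence_eqI[OF grad_has_derivative] lap_def hess_def axis_def if_distrib[where f="\<lambda>t. t * _"] cong: if_cong)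

text \<open>The derivative claims hold up to the boundary \<open>slope2 x = c\<close> of the region
  because \<open>\<theta>\<close> has the derivative of \<open>1 / sqrt t\<close> at
  \<open>c\<close> itself. The last of them is the derivative of the gradient norm.\<close>

lemma normal_extension:
  assumes c: "c > 0"
  obtains N where "Ck 1 N" "\<And>x. slope2 x \<ge> c \<Longrightarrow> N x = (1 / norm (grad u x)) *\<^sub>R grad u x"
    "\<And>x. slope2 x \<ge> c \<Longrightarrow> divergence N x = mc x"
    "\<And>x. slope2 x \<ge> c \<Longrightarrow> ((\<lambda>y. N y \<bullet> grad u y) has_derivative (\<lambda>v. (hess x v \<bullet> grad u x) / norm (grad u x))) (at x)"
proof -
  obtain \<theta> \<theta>' where \<theta>: "\<And>t. (\<theta> has_real_derivative \<theta>' t) (at t)" "continuous_on UNIV \<theta>'"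
    "\<And>t. t \<ge> c \<Longrightarrow> \<theta> t = 1 / sqrt t" "\<And>t. t \<ge> c \<Longrightarrow> \<theta>' t = - 1 / (2 * t * sqrt t)"
    using inverse_sqrt_extension[OF c] by blast
  define N where "N x = \<theta> (slope2 x) *\<^sub>R grad u x" for x
  have d\<theta>: "((\<lambda>x. \<theta> (slope2 x)) has_derivative (\<lambda>v. \<theta>' (slope2 x) * (2 * (hess x v \<bullet> grad u x)))) (at x)" for x
    using has_derivative_compose[OF slope2_has_derivative \<theta>(1)[of "slope2 x", unfolded has_field_derivative_def]] .
  have sq: "sqrt (slope2 x) = norm (grad u x)" for x by (simp add: slope2_eq)
  show ?thesis
  proof
    show "Ck 1 N" unfolding N_def[abs_def]
      by (intro Ck1_scaleR Ck1_comp_real[OF \<theta>(1,2)] C1_slope2 C1_grad)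
    fix x assume x: "slope2 x \<ge> c"
    then have s: "norm (grad u x) > 0" "slope2 x > 0" using c by (auto simp: slope2_eq)
    have t: "\<theta> (slope2 x) = 1 / norm (grad u x)" "\<theta>' (slope2 x) = - 1 / (2 * slope2 x * norm (grad u x))"
      using \<theta>(3,4)[OF x] by (simp_all add: sq)
    show "N x = (1 / norm (grad u x)) *\<^sub>R grad u x" by (simp add: N_def t)
    have "divergence N x = \<theta>' (slope2 x) * (2 * (hess x (grad u x) \<bullet> grad u x)) + \<theta> (slope2 x) * divergence (grad u) x"
      unfolding N_def[abs_def] by (rule divergence_scaleR[OF d\<theta> grad_has_derivative])
    also have "\<dots> = mc x"
      unfolding t hess_inner_grad divergence_grad mc_def mcnum_def unfolding slope2_eq
      using s(1) by (simp add: field_simps power2_eq_square power3_eq_cube)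
    finally show "divergence N x = mc x" .
    have "((\<lambda>y. \<theta> (slope2 y) * slope2 y) has_derivative
      (\<lambda>v. \<theta> (slope2 x) * (2 * (hess x v \<bullet> grad u x)) + \<theta>' (slope2 x) * (2 * (hess x v \<bullet> grad u x)) * slope2 x)) (at x)"
      by (rule has_derivative_mult[OF d\<theta> slope2_has_derivative])
    moreover have "(\<lambda>y. \<theta> (slope2 y) * slope2 y) = (\<lambda>y. N y \<bullet> grad u y)"
      by (simp add: N_def slope2_eq power2_norm_eq_inner)
    moreover have "(\<lambda>v. \<theta> (slope2 x) * (2 * (hess x v \<bullet> grad u x)) + \<theta>' (slope2 x) * (2 * (hess x v \<bullet> grad u x)) * slope2 x)
       = (\<lambda>v. (hess x v \<bullet> grad u x) / norm (grad u x))"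
      using s by (intro ext) (simp add: t field_simps)
    ultimately show "((\<lambda>y. N y \<bullet> grad u y) has_derivative (\<lambda>v. (hess x v \<bullet> grad u x) / norm (grad u x))) (at x)" by simp
  qed
qed

lemma slope2_lower_bound:
  assumes "compact A" "A \<subseteq> D" "\<And>x. x \<in> A \<Longrightarrow> grad u x \<noteq> 0"
  obtains c where "c > 0" "\<And>x. x \<in> A \<Longrightarrow> slope2 x \<ge> c"
proof (cases "A = {}")
  case False
  from continuous_attains_inf[OF assms(1) False Ck1_continuous[OF C1_slope2]]
  obtain z where z: "z \<in> A" "\<And>x. x \<in> A \<Longrightarrow> slope2 z \<le> slope2 x" by blast
  then have "slope2 z > 0" using assms(3) by (simp add: slope2_eq)
  then show ?thesis using z that by blast
qed (use that[of 1] in auto)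

text \<open>Half-open in height, so that consecutive cells tile and a cell is a difference of two
  sublevel sets.\<close>

definition cell where "cell \<alpha> \<beta> = {x \<in> D. \<alpha> \<le> u x \<and> u x < \<beta>}"

text \<open>Gauss-Green on both sublevel sets for an extension \<open>N\<close> of the unit normal:
  on the cell its divergence is the mean curvature, and its flux through either level set is the
  area.\<close>

lemma cell_mean_curvature:
  assumes reg: "regular \<alpha>" "regular \<beta>" and ab: "\<alpha> \<le> \<beta>" and ne: "\<And>x. x \<in> D \<Longrightarrow> \<alpha> \<le> u x \<Longrightarrow> u x \<le> \<beta> \<Longrightarrow> grad u x \<noteq> 0"
  shows "set_integrable lebesgue (cell \<alpha> \<beta>) mc" "(LINT x:cell \<alpha> \<beta>|lebesgue. mc x) = area \<beta> - area \<alpha>"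
proof -
  let ?A = "{x \<in> D. \<alpha> \<le> u x \<and> u x \<le> \<beta>}"
  have "closed {x. \<alpha> \<le> u x \<and> u x \<le> \<beta>}"
    by (intro closed_Collect_conj closed_Collect_le u_cont continuous_intros)
  then have "compact ?A" using compact_Int_closed[OF D(1), of "{x. \<alpha> \<le> u x \<and> u x \<le> \<beta>}"] by (simp add: Collect_conj_eq)
  then obtain c where c: "c > 0" "\<And>x. x \<in> ?A \<Longrightarrow> slope2 x \<ge> c"
    by (rule slope2_lower_bound) (use ne in auto)
  obtain N where N: "Ck 1 N" "\<And>x. slope2 x \<ge> c \<Longrightarrow> N x = (1 / norm (grad u x)) *\<^sub>R grad u x"
    "\<And>x. slope2 x \<ge> c \<Longrightarrow> divergence N x = mc x"
    by (rule normal_extension[OF c(1)]) blast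
  have flux: "grad u x \<bullet> N x = norm (grad u x)" if "x \<in> ?A" for x
    using N(2)[OF c(2)[OF that]] by (simp add: dot_square_norm power2_eq_square)
  have f: "(LINT x:sublevel h|lebesgue. divergence N x) = area h" if "h = \<alpha> \<or> h = \<beta>" for h
    by (rule sublevel_flux_eq_area[OF _ N(1)]) (use that reg flux ab in \<open>auto simp: level_def\<close>)
  have sb: "sublevel \<alpha> \<in> sets borel" "sublevel \<beta> \<in> sets borel"
    using open_sublevel reg by (auto simp: regular_def intro!: borel_open)
  have iD: "set_integrable lebesgue D (divergence N)"
    by (intro continuous_on_D_integrable continuous_divergence N)
  have cell: "cell \<alpha> \<beta> = sublevel \<beta> - sublevel \<alpha>" by (auto simp: cell_def sublevel_def)
  have i: "set_integrable lebesgue (sublevel \<alpha>) (divergence N)" "set_integrable lebesgue (cell \<alpha> \<beta>) (divergence N)"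
    by (rule set_integrable_subset[OF iD]; use sb in \<open>auto simp: sublevel_def cell\<close>)+
  have eq: "indicator (cell \<alpha> \<beta>) x *\<^sub>R divergence N x = indicator (cell \<alpha> \<beta>) x *\<^sub>R mc x" for x
    using N(3)[OF c(2)[of x]] by (cases "x \<in> cell \<alpha> \<beta>") (auto simp: cell_def)
  show "set_integrable lebesgue (cell \<alpha> \<beta>) mc"
    using i(2) unfolding set_integrable_def eq .
  have "sublevel \<beta> = sublevel \<alpha> \<union> cell \<alpha> \<beta>" "sublevel \<alpha> \<inter> cell \<alpha> \<beta> = {}"
    using ab by (auto simp: cell_def sublevel_def)
  then have "(LINT x:sublevel \<beta>|lebesgue. divergence N x) = (LINT x:sublevel \<alpha>|lebesgue. divergence N x) + (LINT x:cell \<alpha> \<beta>|lebesgue. divergence N x)"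
    using set_integral_Un[OF _ i] by simp
  then show "(LINT x:cell \<alpha> \<beta>|lebesgue. mc x) = area \<beta> - area \<alpha>"
    using f[of \<alpha>] f[of \<beta>] unfolding set_lebesgue_integral_def eq by simp
qed

end

section \<open>The gradient estimate\<close>

lemma AE_lborel_exists_between:
  fixes a b :: real
  assumes "AE h in lborel. P h" "a < b"
  obtains h where "a < h" "h < b" "P h"
proof (rule ccontr)
  assume n: "\<not> thesis"
  have "AE h in lborel. \<not> (a < h \<and> h < b)"
    using assms(1) by eventually_elim (use n that in blast)
  then have "emeasure lborel {h \<in> space lborel. a < h \<and> h < b} = 0" by (rule emeasure_eq_0_AE)
  moreover have "{h \<in> space lborel. a < h \<and> h < b} = {a<..<b}" by auto
  ultimately show False using assms(2) by simp
qed

text \<open>A ramp in the distance from \<open>K\<close>, rising between \<open>2 * \<delta>\<close>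
  and \<open>3 * \<delta>\<close>, is averaged over intervals of length \<open>\<delta>\<close> to
  become continuously differentiable. The averaging costs one \<open>\<delta>\<close> at either
  end.\<close>

lemma cutoff_profile:
  fixes K :: "real set"
  assumes K: "K \<noteq> {}" and \<delta>: "\<delta> > 0"
  obtains \<psi> \<psi>' where "\<And>t. (\<psi> has_real_derivative \<psi>' t) (at t)" "continuous_on UNIV \<psi>'"
    "\<And>t. 0 \<le> \<psi> t" "\<And>t. \<psi> t \<le> 1" "\<And>t. infdist t K \<le> \<delta> \<Longrightarrow> \<psi> t = 0" "\<And>t. infdist t K \<ge> 4 * \<delta> \<Longrightarrow> \<psi> t = 1"
proof -
  define g where "g s = min 1 (max 0 (infdist s K / \<delta> - 2))" for s
  have cg: "continuous_on UNIV g" unfolding g_def[abs_def] using \<delta> by (intro continuous_intros) auto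
  obtain G where G: "\<And>t. (G has_real_derivative g t) (at t)" using antiderivative_exists[OF cg] by blast
  define \<psi> where "\<psi> t = (G (t + \<delta>) - G t) / \<delta>" for t
  have mv: "\<exists>z. t < z \<and> z < t + \<delta> \<and> \<psi> t = g z" for t
    using MVT2[of t "t + \<delta>" G g] G \<delta> by (auto simp: \<psi>_def)
  have near: "\<bar>infdist z K - infdist t K\<bar> \<le> \<delta>" if "t < z" "z < t + \<delta>" for t z
    using infdist_triangle_abs[of z K t] that by (simp add: dist_real_def)
  show ?thesis
  proof
    show "(\<psi> has_real_derivative (g (t + \<delta>) - g t) / \<delta>) (at t)" for t
    proof -
      have "((\<lambda>t. G (t + \<delta>)) has_real_derivative g (t + \<delta>)) (at t)"
        using DERIV_shift[of G "g (t + \<delta>)" t \<delta>] G by simp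
      then show ?thesis unfolding \<psi>_def[abs_def] by (intro DERIV_cdivide DERIV_diff G)
    qed
    show "continuous_on UNIV (\<lambda>t. (g (t + \<delta>) - g t) / \<delta>)"
      using \<delta> by (intro continuous_intros continuous_on_compose2[OF cg]) auto
    show "0 \<le> \<psi> t" "\<psi> t \<le> 1" for t using mv[of t] by (auto simp: g_def)
    show "\<psi> t = 0" if "infdist t K \<le> \<delta>" for t
    proof -
      obtain z where z: "t < z" "z < t + \<delta>" "\<psi> t = g z" using mv by blast
      have "infdist z K \<le> 2 * \<delta>" using near[OF z(1,2)] that by linarith
      then have "infdist z K / \<delta> \<le> 2" using \<delta> by (simp add: pos_divide_le_eq)
      then show ?thesis by (simp add: z(3) g_def)
    qed
    show "\<psi> t = 1" if "infdist t K \<ge> 4 * \<delta>" for t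
    proof -
      obtain z where z: "t < z" "z < t + \<delta>" "\<psi> t = g z" using mv by blast
      have "infdist z K \<ge> 3 * \<delta>" using near[OF z(1,2)] that by linarith
      then have "infdist z K / \<delta> \<ge> 3" using \<delta> by (simp add: pos_le_divide_eq)
      then show ?thesis by (simp add: z(3) g_def)
    qed
  qed
qed

context well begin

lemma mcnum_critical: "grad u x = 0 \<Longrightarrow> mcnum x = 0"
  by (simp add: mcnum_def slope2_eq flip: hess_inner_grad)

lemma mcnum_continuous: "continuous_on S mcnum"
proof -
  have "continuous_on S hessgrad2"
    unfolding hessgrad2_def[abs_def]
    by (intro continuous_on_sum continuous_on_mult Ck1_continuous[OF C1_hessgrad] Ck1_continuous[OF C1_d1])
  then show ?thesis unfolding mcnum_def[abs_def] by (intro continuous_intros Ck1_continuous[OF C1_lap] Ck1_continuous[OF C1_slope2])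
qed

text \<open>The hypothesis covers only almost every height. Where \<open>mcnum\<close> is negative
  the gradient does not vanish, so moving along it sweeps a whole interval of heights within a
  neighbourhood in which \<open>mcnum\<close> is negative, and one of these heights contradicts the
  hypothesis.\<close>

lemma mcnum_nonneg_dense:
  assumes ae: "AE h in lborel. h \<in> u ` D \<longrightarrow> h < 0 \<longrightarrow> (\<forall>x\<in>D. u x = h \<longrightarrow> mcnum x > 0)"
    and x: "x \<in> D" "u x < 0"
  shows "mcnum x \<ge> 0"
proof (rule ccontr)
  assume "\<not> mcnum x \<ge> 0"
  then have neg: "mcnum x < 0" by simp
  define V where "V = interior D \<inter> {y. mcnum y < 0 \<and> u y < 0}"
  have oV: "open V"
    unfolding V_def
    by (intro open_Int open_interior open_Collect_conj open_Collect_less mcnum_continuous u_cont continuous_intros)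
  have xV: "x \<in> V" using interior_if_neg x neg by (auto simp: V_def)
  obtain r where r: "r > 0" "ball x r \<subseteq> V" using oV xV open_contains_ball by blast
  have g: "grad u x \<noteq> 0" using mcnum_critical[of x] neg by auto
  define f where "f t = u (x + t *\<^sub>R grad u x)" for t
  have "(f has_real_derivative grad u x \<bullet> grad u x) (at 0)"
    unfolding f_def[abs_def] by (rule has_real_derivative_line) (simp add: u_has_derivative)
  then obtain d where d: "d > 0" "\<And>h. 0 < h \<Longrightarrow> h < d \<Longrightarrow> f 0 < f (0 + h)"
    using DERIV_pos_inc_right[of f "grad u x \<bullet> grad u x" 0] g by auto
  define t where "t = min (d / 2) (r / (2 * norm (grad u x)))"
  have t: "0 < t" "t < d" "t * norm (grad u x) < r"
  proof -
    show "0 < t" "t < d" using d r g by (auto simp: t_def)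
    have "t * norm (grad u x) \<le> r / (2 * norm (grad u x)) * norm (grad u x)"
      by (intro mult_right_mono) (auto simp: t_def)
    then show "t * norm (grad u x) < r" using g r by simp
  qed
  have lt: "f 0 < f t" using d(2)[OF t(1,2)] by simp
  have cf: "continuous_on S f" for S
    unfolding f_def[abs_def] by (intro continuous_on_compose2[OF u_cont[of UNIV]] continuous_intros) auto
  obtain h where h: "f 0 < h" "h < f t" "h \<in> u ` D \<longrightarrow> h < 0 \<longrightarrow> (\<forall>x\<in>D. u x = h \<longrightarrow> mcnum x > 0)"
    using AE_lborel_exists_between[OF ae lt] by blast
  obtain s where s: "0 \<le> s" "s \<le> t" "f s = h"
    using IVT'[of f 0 h t] h t cf by auto
  have "s * norm (grad u x) \<le> t * norm (grad u x)" using s by (intro mult_right_mono) auto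
  then have "x + s *\<^sub>R grad u x \<in> ball x r" using t s by (simp add: dist_norm)
  then have y: "x + s *\<^sub>R grad u x \<in> V" using r by blast
  then have "x + s *\<^sub>R grad u x \<in> D" "u (x + s *\<^sub>R grad u x) = h" "h < 0" "mcnum (x + s *\<^sub>R grad u x) < 0"
    using s interior_subset by (auto simp: V_def f_def)
  then show False using h(3) by force
qed

end

section \<open>Total mean curvature and gradient integral of the well\<close>

locale mean_convex_well = well +
  fixes \<epsilon> \<rho> C0 :: real
  assumes ne: "D \<noteq> {}"
    and mcnum_nonneg: "\<And>x. x \<in> D \<Longrightarrow> u x < 0 \<Longrightarrow> mcnum x \<ge> 0"
    and AE_good: "AE h in lborel. h \<in> u ` D \<longrightarrow> h < 0 \<longrightarrow> good h"
    and scal_le: "\<And>x. x \<in> D \<Longrightarrow> \<bar>scal x\<bar> \<le> \<epsilon>"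
    and norm_le: "\<And>x. x \<in> D \<Longrightarrow> norm x \<le> \<rho>"
    and perimeter_le: "perimeter D \<le> ennreal C0" and C0: "C0 \<ge> 0"
begin

text \<open>The heights that the profiles avoid: the critical values and the boundary value
  0.\<close>

definition K where "K = insert 0 (u ` {x \<in> D. grad u x = 0})"
definition m where "m = (SOME m. m \<in> u ` D \<and> (\<forall>x\<in>D. m \<le> u x))"

lemma m: "m \<in> u ` D" "x \<in> D \<Longrightarrow> m \<le> u x"
proof -
  obtain x0 where "x0 \<in> D" "\<And>x. x \<in> D \<Longrightarrow> u x0 \<le> u x"
    using continuous_attains_inf[OF D(1) ne u_cont] by blast
  then have "\<exists>m. m \<in> u ` D \<and> (\<forall>x\<in>D. m \<le> u x)" by blast
  then have "m \<in> u ` D \<and> (\<forall>x\<in>D. m \<le> u x)" unfolding m_def by (rule someI_ex)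
  then show "m \<in> u ` D" "x \<in> D \<Longrightarrow> m \<le> u x" by auto
qed

lemma m_le: "m \<le> 0"
  using m(1) u_le by auto

text \<open>A negative minimum is attained at an interior point, which is critical; so the profiles
  vanish near the bottom of the well too.\<close>

lemma m_K: "m \<in> K"
proof -
  obtain x0 where x0: "x0 \<in> D" "m = u x0" using m(1) by blast
  show ?thesis
  proof (cases "m = 0")
    case False
    then have "x0 \<in> interior D" using interior_if_neg x0 m_le by simp
    then have "\<forall>\<^sub>F y in at x0. y \<in> interior D" by (intro eventually_at_topological[THEN iffD2] exI[of _ "interior D"]) auto
    then have "\<forall>\<^sub>F y in at x0. u x0 \<le> u y"
    proof eventually_elim
      case (elim y)
      then have "y \<in> D" using interior_subset by blast
      then show ?case using m(2) x0(2) by simp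
    qed
    from fun_cong[OF has_derivative_local_min[OF u_has_derivative this], of "grad u x0"]
    have "grad u x0 \<bullet> grad u x0 = 0" .
    then show ?thesis using x0 by (auto simp: K_def)
  qed (simp add: K_def)
qed

text \<open>The frontier of the bounded nonempty set \<open>D\<close> is nonempty, so 0 is attained,
  and the image of the convex set is connected.\<close>

lemma range_u: "m \<le> h \<Longrightarrow> h \<le> 0 \<Longrightarrow> h \<in> u ` D"
proof -
  assume h: "m \<le> h" "h \<le> 0"
  have "D \<noteq> UNIV" using compact_imp_bounded[OF D(1)] not_bounded_UNIV by auto
  then obtain z where "z \<in> frontier D" using ne frontier_eq_empty by blast
  then have "0 \<in> u ` D" using u_frontier frontier_subset_closed[OF compact_imp_closed[OF D(1)]] by force
  moreover have "connected (u ` D)" by (intro connected_continuous_image u_cont convex_connected D)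
  ultimately show ?thesis using connected_contains_Icc[OF _ m(1), of 0] h by auto
qed

lemma good_between:
  assumes "m \<le> a" "a < b" "b \<le> 0"
  obtains h where "a < h" "h < b" "good h"
proof -
  obtain h where "a < h" "h < b" "h \<in> u ` D \<longrightarrow> h < 0 \<longrightarrow> good h"
    using AE_lborel_exists_between[OF AE_good assms(2)] by blast
  then show ?thesis using range_u[of h] assms that by auto
qed

lemma AE_good_interval: "AE h in lborel. h \<in> {m..0} \<longrightarrow> good h"
  using AE_good AE_lborel_singleton[of "0::real"] by eventually_elim (use range_u in auto)

lemma good_notin_K: "good h \<Longrightarrow> h \<notin> K"
  by (auto simp: K_def good_def regular_def level_def)

lemma K_ne: "K \<noteq> {}"
  by (simp add: K_def)

lemma K_closed: "closed K"
proof -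
  have "closed {x. grad u x = 0}" by (intro closed_Collect_eq grad_cont continuous_intros)
  then have "compact {x \<in> D. grad u x = 0}"
    using compact_Int_closed[OF D(1), of "{x. grad u x = 0}"] by (simp add: Collect_conj_eq)
  then have "compact (u ` {x \<in> D. grad u x = 0})" by (intro compact_continuous_image u_cont)
  then show ?thesis unfolding K_def by (intro compact_imp_closed compact_insert)
qed

text \<open>A thin cell that meets a critical level lies in the zero set of the profile; any other cell contains no
  critical point.\<close>

lemma good_cell_bound:
  assumes \<psi>: "continuous_on UNIV \<psi>" "\<And>t. 0 \<le> \<psi> t" "\<And>t. \<psi> t \<le> 1" "\<And>t. infdist t K \<le> \<delta> \<Longrightarrow> \<psi> t = 0"
    and \<delta>: "\<delta> > 0" and ab: "good \<alpha>" "good \<beta>" "\<alpha> \<le> \<beta>" "\<beta> - \<alpha> < \<delta>"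
    and i: "set_integrable lebesgue D (\<lambda>x. \<psi> (u x) * mc x)"
  shows "(LINT x:cell \<alpha> \<beta>|lebesgue. \<psi> (u x) * mc x) \<le> area \<beta> - area \<alpha>"
proof (cases "\<exists>t\<in>K. \<alpha> \<le> t \<and> t \<le> \<beta>")
  case True
  then obtain t where t: "t \<in> K" "\<alpha> \<le> t" "t \<le> \<beta>" by blast
  have "\<psi> (u x) = 0" if "x \<in> cell \<alpha> \<beta>" for x
  proof (rule \<psi>(4))
    have "infdist (u x) K \<le> dist (u x) t" by (rule infdist_le[OF t(1)])
    also have "\<dots> \<le> \<delta>" using that t ab by (auto simp: cell_def dist_real_def)
    finally show "infdist (u x) K \<le> \<delta>" .
  qed
  then have "(LINT x:cell \<alpha> \<beta>|lebesgue. \<psi> (u x) * mc x) = (LINT x:cell \<alpha> \<beta>|lebesgue. 0)"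
    unfolding set_lebesgue_integral_def
    by (intro Bochner_Integration.integral_cong refl) (simp add: indicator_def)
  \<comment> \<open>The left side is 0, and monotonicity of the area makes the right side
    nonnegative even across critical heights.\<close>
  then show ?thesis using area_mono[OF ab(1-3)] by (simp add: set_lebesgue_integral_def)
next
  case False
  have g: "grad u x \<noteq> 0" if "x \<in> D" "\<alpha> \<le> u x" "u x \<le> \<beta>" for x using False that by (auto simp: K_def)
  have reg: "regular \<alpha>" "regular \<beta>" using ab by (auto simp: good_def)
  note c = cell_mean_curvature[OF reg ab(3) g]
  have b0: "\<beta> < 0" using reg by (simp add: regular_def)
  have cb: "cell \<alpha> \<beta> \<in> sets borel"
  proof -
    have "cell \<alpha> \<beta> = sublevel \<beta> - sublevel \<alpha>" by (auto simp: cell_def sublevel_def)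
    then show ?thesis using open_sublevel[of \<alpha>] open_sublevel[of \<beta>] b0 ab(3) by (simp add: borel_open sets.Diff)
  qed
  have "(LINT x:cell \<alpha> \<beta>|lebesgue. \<psi> (u x) * mc x) \<le> (LINT x:cell \<alpha> \<beta>|lebesgue. mc x)"
  proof (rule set_integral_mono)
    show "set_integrable lebesgue (cell \<alpha> \<beta>) (\<lambda>x. \<psi> (u x) * mc x)"
      by (rule set_integrable_subset[OF i]) (use cb in \<open>auto simp: cell_def\<close>)
    show "set_integrable lebesgue (cell \<alpha> \<beta>) mc" by (rule c(1))
    show "\<psi> (u x) * mc x \<le> mc x" if "x \<in> cell \<alpha> \<beta>" for x
    proof -
      have "mcnum x \<ge> 0" using that b0 by (intro mcnum_nonneg) (auto simp: cell_def)
      then have "mc x \<ge> 0" by (simp add: mc_def)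
      then show ?thesis using \<psi> by (intro mult_left_le_one_le) auto
    qed
  qed
  then show ?thesis using c(2) by simp
qed

text \<open>The bound of \<open>good_cell_bound\<close> telescopes. Each step splits off a top cell
  of height between \<open>\<delta> / 2\<close> and \<open>\<delta>\<close> at a good height, so
  \<open>k\<close> falls by one.\<close>

lemma good_interval_bound:
  assumes \<psi>: "continuous_on UNIV \<psi>" "\<And>t. 0 \<le> \<psi> t" "\<And>t. \<psi> t \<le> 1" "\<And>t. infdist t K \<le> \<delta> \<Longrightarrow> \<psi> t = 0"
    and \<delta>: "\<delta> > 0" and i: "set_integrable lebesgue D (\<lambda>x. \<psi> (u x) * mc x)" and a: "good \<alpha>" "m \<le> \<alpha>"
  shows "good \<beta> \<Longrightarrow> \<alpha> \<le> \<beta> \<Longrightarrow> \<beta> - \<alpha> < real (Suc k) * (\<delta> / 2)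
    \<Longrightarrow> (LINT x:cell \<alpha> \<beta>|lebesgue. \<psi> (u x) * mc x) \<le> area \<beta> - area \<alpha>"
proof (induction k arbitrary: \<beta>)
  case 0
  then show ?case using \<delta> by (intro good_cell_bound[OF \<psi> \<delta> a(1) _ _ _ i]) auto
next
  case (Suc k)
  show ?case
  proof (cases "\<beta> - \<alpha> < \<delta>")
    case True
    then show ?thesis using Suc.prems by (intro good_cell_bound[OF \<psi> \<delta> a(1) _ _ _ i]) auto
  next
    case False
    have b0: "\<beta> < 0" using Suc.prems by (simp add: good_def regular_def)
    obtain \<gamma> where \<gamma>: "\<beta> - \<delta> < \<gamma>" "\<gamma> < \<beta> - \<delta> / 2" "good \<gamma>"
      by (rule good_between[of "\<beta> - \<delta>" "\<beta> - \<delta> / 2"]) (use False a \<delta> b0 in auto)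
    have "(LINT x:cell \<alpha> \<gamma>|lebesgue. \<psi> (u x) * mc x) \<le> area \<gamma> - area \<alpha>"
    proof (rule Suc.IH[OF \<gamma>(3)])
      show "\<alpha> \<le> \<gamma>" using False \<gamma> by simp
      show "\<gamma> - \<alpha> < real (Suc k) * (\<delta> / 2)" using Suc.prems(3) \<gamma>(2) by (simp add: algebra_simps)
    qed
    moreover have "(LINT x:cell \<gamma> \<beta>|lebesgue. \<psi> (u x) * mc x) \<le> area \<beta> - area \<gamma>"
      by (rule good_cell_bound[OF \<psi> \<delta> \<gamma>(3) Suc.prems(1) _ _ i]) (use \<gamma> \<delta> in auto)
    moreover have "(LINT x:cell \<alpha> \<beta>|lebesgue. \<psi> (u x) * mc x)
      = (LINT x:cell \<alpha> \<gamma>|lebesgue. \<psi> (u x) * mc x) + (LINT x:cell \<gamma> \<beta>|lebesgue. \<psi> (u x) * mc x)"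
    proof -
      have e: "cell \<alpha> \<beta> = cell \<alpha> \<gamma> \<union> cell \<gamma> \<beta>" using False \<gamma> \<delta> by (auto simp: cell_def)
      have cb: "cell s t \<in> sets borel" if "s < 0" "t < 0" for s t
      proof -
        have "cell s t = sublevel t - sublevel s" by (auto simp: cell_def sublevel_def)
        then show ?thesis using open_sublevel[of s] open_sublevel[of t] that by (simp add: borel_open sets.Diff)
      qed
      have n: "\<alpha> < 0" "\<gamma> < 0" using a(1) \<gamma>(3) by (auto simp: good_def regular_def)
      have i1: "set_integrable lebesgue (cell \<alpha> \<gamma>) (\<lambda>x. \<psi> (u x) * mc x)"
        by (rule set_integrable_subset[OF i]) (use cb n in auto, auto simp: cell_def)
      have i2: "set_integrable lebesgue (cell \<gamma> \<beta>) (\<lambda>x. \<psi> (u x) * mc x)"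
        by (rule set_integrable_subset[OF i]) (use cb n b0 in auto, auto simp: cell_def)
      show ?thesis unfolding e by (rule set_integral_Un[OF _ i1 i2]) (auto simp: cell_def)
    qed
    ultimately show ?thesis by linarith
  qed
qed

text \<open>The profile vanishes within \<open>\<delta>\<close> of the minimum and of 0, so
  \<open>D\<close> may be replaced by a cell between two good heights close to these. The difference
  of the two areas is at most the upper one, hence at most \<open>C0\<close>.\<close>

lemma total_mean_curvature_bound:
  assumes \<psi>: "continuous_on UNIV \<psi>" "\<And>t. 0 \<le> \<psi> t" "\<And>t. \<psi> t \<le> 1" "\<And>t. infdist t K \<le> \<delta> \<Longrightarrow> \<psi> t = 0"
    and \<delta>: "\<delta> > 0" and i: "set_integrable lebesgue D (\<lambda>x. \<psi> (u x) * mc x)"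
  shows "(LINT x:D|lebesgue. \<psi> (u x) * mc x) \<le> C0"
proof -
  have near: "\<psi> t = 0" if "s \<in> K" "\<bar>t - s\<bar> \<le> \<delta>" for s t
    using infdist_le[OF that(1), of t] that(2) by (intro \<psi>(4)) (simp add: dist_real_def)
  show ?thesis
  proof (cases "m = 0")
    case True
    then have "\<psi> (u x) = 0" if "x \<in> D" for x
      using near[of 0 "u x"] m(2)[OF that] u_le[OF that] \<delta> by (simp add: K_def)
    then have "(LINT x:D|lebesgue. \<psi> (u x) * mc x) = (LINT x:D|lebesgue. 0)"
      unfolding set_lebesgue_integral_def
      by (intro Bochner_Integration.integral_cong refl) (simp add: indicator_def)
    then show ?thesis using C0 by (simp add: set_lebesgue_integral_def)
  next
    case False
    then have m0: "m < 0" using m_le by simp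
    \<comment> \<open>Together with the choice of \<open>\<beta>\<close> above \<open>m / 2\<close>,
      the bound \<open>m / 2\<close> ensures \<open>\<alpha> < \<beta>\<close>.\<close>
    obtain \<alpha> where \<alpha>: "m < \<alpha>" "\<alpha> < min (m + \<delta>) (m / 2)" "good \<alpha>"
      by (rule good_between[of m "min (m + \<delta>) (m / 2)"]) (use m0 \<delta> in auto)
    obtain \<beta> where \<beta>: "max (- \<delta>) (m / 2) < \<beta>" "\<beta> < 0" "good \<beta>"
      by (rule good_between[of "max (- \<delta>) (m / 2)" 0]) (use m0 \<delta> in auto)
    obtain k where k: "\<beta> - \<alpha> < real k * (\<delta> / 2)" using reals_Archimedean3[of "\<delta> / 2"] \<delta> by (metis half_gt_zero)
    then have k': "\<beta> - \<alpha> < real (Suc k) * (\<delta> / 2)" using \<delta> by (simp add: algebra_simps)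
    have "\<psi> (u x) = 0" if "x \<in> D" "x \<notin> cell \<alpha> \<beta>" for x
    proof (cases "u x < \<alpha>")
      case True
      then show ?thesis using near[OF m_K, of "u x"] m(2)[OF that(1)] \<alpha> by simp
    next
      case False
      then have "u x \<ge> \<beta>" using that by (simp add: cell_def)
      then show ?thesis using near[of 0 "u x"] u_le[OF that(1)] \<beta> by (simp add: K_def)
    qed
    then have "(LINT x:D|lebesgue. \<psi> (u x) * mc x) = (LINT x:cell \<alpha> \<beta>|lebesgue. \<psi> (u x) * mc x)"
      unfolding set_lebesgue_integral_def
      by (intro Bochner_Integration.integral_cong refl) (auto simp: indicator_def cell_def)
    also have "\<dots> \<le> area \<beta> - area \<alpha>"
      by (rule good_interval_bound[OF \<psi> \<delta> i \<alpha>(3) _ \<beta>(3) _ k']) (use \<alpha> \<beta> in auto)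
    also have "\<dots> \<le> C0" using area_le[OF \<beta>(3) perimeter_le C0] area_nonneg[of \<alpha>] by linarith
    finally show ?thesis .
  qed
qed

text \<open>The field \<open>\<psi>(u) ((N \<bullet> Du) x - (x \<bullet> Du) N)\<close> is tangent to the level sets, so the derivative of \<open>\<psi>\<close> does
  not contribute to its divergence.\<close>

lemma rellich_identity:
  assumes \<psi>: "\<And>t. (\<psi> has_real_derivative \<psi>' t) (at t)" "continuous_on UNIV \<psi>'" "\<psi> 0 = 0"
    and N: "Ck 1 N" "\<And>x. x \<in> D \<Longrightarrow> \<psi> (u x) \<noteq> 0 \<Longrightarrow> N x = (1 / norm (grad u x)) *\<^sub>R grad u x \<and> divergence N x = mc x \<and> grad u x \<noteq> 0
      \<and> ((\<lambda>y. N y \<bullet> grad u y) has_derivative (\<lambda>v. (hess x v \<bullet> grad u x) / norm (grad u x))) (at x)"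
  shows "2 * (LINT x:D|lebesgue. \<psi> (u x) * norm (grad u x)) = (LINT x:D|lebesgue. \<psi> (u x) * divergence N x * (x \<bullet> grad u x))"
proof -
  define p where "p x = N x \<bullet> grad u x" for x
  define r where "r x = x \<bullet> grad u x" for x
  define Y where "Y x = p x *\<^sub>R x - r x *\<^sub>R N x" for x
  have C: "Ck 1 p" "Ck 1 r" unfolding p_def[abs_def] r_def[abs_def] by (intro Ck1_inner N C1_grad Ck1_ident)+
  have CY: "Ck 1 Y" unfolding Y_def[abs_def] by (intro Ck1_diff Ck1_scaleR C N Ck1_ident)
  have c\<psi>: "continuous_on UNIV \<psi>" using DERIV_continuous[OF \<psi>(1)] by (intro continuous_at_imp_continuous_on) auto
  have c\<psi>u: "continuous_on S (\<lambda>x. \<psi> (u x))" for S by (rule continuous_on_compose2[OF c\<psi> u_cont]) auto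
  have dr: "(r has_derivative (\<lambda>v. x \<bullet> hess x v + v \<bullet> grad u x)) (at x)" for x
    unfolding r_def[abs_def] by (rule has_derivative_inner[OF has_derivative_ident grad_has_derivative])
  have divY: "divergence Y x = (dir_deriv p x x + p x * 3) - ((x \<bullet> hess x (N x) + N x \<bullet> grad u x) + r x * divergence N x)" for x
  proof -
    have "divergence Y x = divergence (\<lambda>x. p x *\<^sub>R x) x - divergence (\<lambda>x. r x *\<^sub>R N x) x"
      unfolding Y_def[abs_def]
      by (rule divergence_diff[OF Ck1_has_derivative Ck1_has_derivative]; intro Ck1_scaleR C N Ck1_ident)
    then show ?thesis
      by (simp add: divergence_scaleR[OF Ck1_has_derivative[OF C(1)] has_derivative_ident]
          divergence_scaleR[OF dr Ck1_has_derivative[OF N(1)]] divergence_ident)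
  qed
  have eq: "\<psi> (u x) * divergence Y x = \<psi> (u x) * (2 * norm (grad u x)) - \<psi> (u x) * divergence N x * r x" if x: "x \<in> D" for x
  proof (cases "\<psi> (u x) = 0")
    case False
    note n = N(2)[OF x False]
    let ?s = "norm (grad u x)"
    have s: "?s > 0" "N x = (1 / ?s) *\<^sub>R grad u x" using n by auto
    have "dir_deriv p x x = (hess x x \<bullet> grad u x) / ?s"
      unfolding p_def[abs_def] by (rule dir_deriv_eqI) (use n in blast)
    moreover have "p x = ?s" using s by (simp add: p_def dot_square_norm power2_eq_square)
    \<comment> \<open>By symmetry of the Hessian this equals \<open>dir_deriv p x x\<close>, with
      which it cancels; second derivatives survive only in \<open>divergence N x\<close>.\<close>
    moreover have "x \<bullet> hess x (N x) = (hess x x \<bullet> grad u x) / ?s"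
      using hess_sym[of x "N x" x] by (simp add: s(2) inner_commute)
    moreover have "N x \<bullet> grad u x = ?s" using s by (simp add: dot_square_norm power2_eq_square)
    ultimately have dY: "divergence Y x = 2 * ?s - divergence N x * r x" unfolding divY by simp
    show ?thesis unfolding dY by (simp add: algebra_simps)
  qed simp
  have "0 = (LINT x:D|lebesgue. divergence (\<lambda>x. \<psi> (u x) *\<^sub>R Y x) x)"
    by (rule divergence_theorem_zero[OF _ D, symmetric])
      (auto intro!: Ck1_scaleR Ck1_comp_real[OF \<psi>(1,2)] C1_u CY simp: u_frontier \<psi>(3))
  also have "\<dots> = (LINT x:D|lebesgue. \<psi> (u x) * divergence Y x)"
  proof -
    have "divergence (\<lambda>x. \<psi> (u x) *\<^sub>R Y x) x = \<psi> (u x) * divergence Y x" for x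
    proof -
      have "divergence (\<lambda>x. \<psi> (u x) *\<^sub>R Y x) x = \<psi>' (u x) * (grad u x \<bullet> Y x) + \<psi> (u x) * divergence Y x"
        using divergence_scaleR[OF has_derivative_compose[OF u_has_derivative \<psi>(1)[of "u x", unfolded has_field_derivative_def]] Ck1_has_derivative[OF CY]] .
      moreover have "grad u x \<bullet> Y x = 0"
        by (simp add: Y_def p_def r_def inner_diff_right inner_commute)
      ultimately show ?thesis by simp
    qed
    then show ?thesis by simp
  qed
  also have "\<dots> = (LINT x:D|lebesgue. \<psi> (u x) * (2 * norm (grad u x)) - \<psi> (u x) * divergence N x * r x)"
    unfolding set_lebesgue_integral_def
    by (intro Bochner_Integration.integral_cong refl) (simp add: indicator_def eq)
  also have "\<dots> = (LINT x:D|lebesgue. \<psi> (u x) * (2 * norm (grad u x))) - (LINT x:D|lebesgue. \<psi> (u x) * divergence N x * r x)"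
    unfolding r_def
    by (intro set_integral_diff continuous_on_D_integrable continuous_intros c\<psi>u grad_cont continuous_divergence N)
  also have "(LINT x:D|lebesgue. \<psi> (u x) * (2 * norm (grad u x))) = 2 * (LINT x:D|lebesgue. \<psi> (u x) * norm (grad u x))"
    unfolding set_integral_mult_right[symmetric] by (simp add: mult.left_commute)
  finally show ?thesis by (simp add: r_def)
qed

text \<open>Three integrals bound one another in a cycle: \<open>2 * J\<close> by a small term and a
  multiple of \<open>L\<close>, \<open>L\<close> by \<open>\<epsilon> * M\<close>, and
  \<open>3 * M\<close> by \<open>\<rho> * J\<close>. The condition on \<open>\<tau>\<close> makes
  the multiple of \<open>J\<close> that returns at most \<open>J\<close>.\<close>

lemma cutoff_gradient_bound:
  assumes \<psi>: "\<And>t. (\<psi> has_real_derivative \<psi>' t) (at t)" "continuous_on UNIV \<psi>'"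
    "\<And>t. 0 \<le> \<psi> t" "\<And>t. \<psi> t \<le> 1" "\<And>t. infdist t K \<le> \<delta> \<Longrightarrow> \<psi> t = 0" and \<delta>: "\<delta> > 0"
    and \<tau>: "\<tau> > 0" "\<rho>\<^sup>2 * (1 + 1 / \<tau>\<^sup>2) * \<epsilon> \<le> 3"
  shows "(LINT x:D|lebesgue. \<psi> (u x) * norm (grad u x)) \<le> \<rho> * \<tau> * C0"
proof -
  have c\<psi>: "continuous_on UNIV \<psi>" using DERIV_continuous[OF \<psi>(1)] by (intro continuous_at_imp_continuous_on) auto
  have c\<psi>u: "continuous_on S (\<lambda>x. \<psi> (u x))" for S by (rule continuous_on_compose2[OF c\<psi> u_cont]) auto
  have \<psi>0: "\<psi> 0 = 0" using \<delta> by (intro \<psi>(5)) (simp add: K_def)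
  have \<rho>: "\<rho> \<ge> 0" using ne norm_le norm_ge_zero order_trans by blast
  have \<epsilon>: "\<epsilon> \<ge> 0" using ne scal_le abs_ge_zero order_trans by blast
  \<comment> \<open>Where the profile does not vanish, the height keeps its distance from the
    critical values; compactness bounds the gradient from below there, and a globally defined normal
    field becomes available.\<close>
  let ?A = "D \<inter> {x. \<delta> \<le> infdist (u x) K}"
  have "compact ?A"
    by (intro compact_Int_closed D closed_Collect_le continuous_intros u_cont)
  then obtain c where c: "c > 0" "\<And>x. x \<in> ?A \<Longrightarrow> slope2 x \<ge> c"
    by (rule slope2_lower_bound) (use \<delta> in \<open>auto simp: K_def\<close>)
  obtain N where N: "Ck 1 N" "\<And>x. slope2 x \<ge> c \<Longrightarrow> N x = (1 / norm (grad u x)) *\<^sub>R grad u x"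
    "\<And>x. slope2 x \<ge> c \<Longrightarrow> divergence N x = mc x"
    "\<And>x. slope2 x \<ge> c \<Longrightarrow> ((\<lambda>y. N y \<bullet> grad u y) has_derivative (\<lambda>v. (hess x v \<bullet> grad u x) / norm (grad u x))) (at x)"
    by (rule normal_extension[OF c(1)]) blast
  have big: "slope2 x \<ge> c" if "x \<in> D" "\<psi> (u x) \<noteq> 0" for x
    using c(2)[of x] \<psi>(5)[of "u x"] that by force
  have neg: "u x < 0" if "x \<in> D" "\<psi> (u x) \<noteq> 0" for x
    using u_le[OF that(1)] \<psi>0 that(2) by (cases "u x = 0") auto
  define \<kappa> where "\<kappa> x = \<psi> (u x) * divergence N x" for x
  have \<kappa>: "\<kappa> x = \<psi> (u x) * mc x" if "x \<in> D" for x
    using N(3)[OF big[OF that]] by (cases "\<psi> (u x) = 0") (auto simp: \<kappa>_def)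
  have c\<kappa>: "continuous_on S \<kappa>" for S
    unfolding \<kappa>_def[abs_def] by (intro continuous_intros c\<psi>u continuous_divergence N)
  have mc0: "mc x \<ge> 0" if "x \<in> D" "\<psi> (u x) \<noteq> 0" for x
    using mcnum_nonneg[OF that(1) neg[OF that]] by (simp add: mc_def)
  define J where "J = (LINT x:D|lebesgue. \<psi> (u x) * norm (grad u x))"
  define L where "L = (LINT x:D|lebesgue. \<psi> (u x) * (q x * mcnum x))"
  have cq: "continuous_on S q" for S by (rule Ck1_continuous[OF C1_q])
  have total: "(LINT x:D|lebesgue. \<kappa> x) \<le> C0"
  proof -
    have e: "(\<lambda>x. indicator D x *\<^sub>R \<kappa> x) = (\<lambda>x. indicator D x *\<^sub>R (\<psi> (u x) * mc x))"
      by (auto simp: indicator_def \<kappa>)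
    have "set_integrable lebesgue D (\<lambda>x. \<psi> (u x) * mc x)"
      using continuous_on_D_integrable[OF c\<kappa>] unfolding set_integrable_def e .
    from total_mean_curvature_bound[OF c\<psi> \<psi>(3-5) \<delta> this] show ?thesis
      unfolding set_lebesgue_integral_def e .
  qed
  have pt: "\<kappa> x * (x \<bullet> grad u x) \<le> \<rho> * \<tau> * \<kappa> x + \<rho> * (1 + 1 / \<tau>\<^sup>2) * (\<psi> (u x) * (q x * mcnum x))" if x: "x \<in> D" for x
  proof (cases "\<psi> (u x) = 0")
    case False
    let ?s = "norm (grad u x)"
    have s: "?s > 0" using big[OF x False] c(1) by (auto simp: slope2_eq)
    have mm: "mcnum x \<ge> 0" by (rule mcnum_nonneg[OF x neg[OF x False]])
    have "x \<bullet> grad u x \<le> norm x * ?s" by (rule norm_cauchy_schwarz)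
    also have "\<dots> \<le> \<rho> * ?s" by (intro mult_right_mono norm_le x) auto
    finally have "mc x * (x \<bullet> grad u x) \<le> mc x * (\<rho> * ?s)"
      by (rule mult_left_mono) (rule mc0[OF x False])
    also have "\<dots> = \<rho> * (mc x * ?s)" by simp
    \<comment> \<open>Up to slope \<open>\<tau>\<close> the first term suffices. Beyond it, a slope
      \<open>s\<close> is \<open>s^3 / (1 + s^2)\<close> times \<open>1 + 1 / s^2\<close>, and
      \<open>q * mcnum\<close> is the mean curvature times \<open>s^3 / (1 + s^2)\<close>.\<close>
    also have "mc x * ?s \<le> \<tau> * mc x + (1 + 1 / \<tau>\<^sup>2) * (q x * mcnum x)"
    proof (cases "?s \<le> \<tau>")
      case True
      have "mc x * ?s \<le> mc x * \<tau>" by (rule mult_left_mono[OF True mc0[OF x False]])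
      moreover have "(1 + 1 / \<tau>\<^sup>2) * (q x * mcnum x) \<ge> 0" using mm q_pos[of x] by (intro mult_nonneg_nonneg add_nonneg_nonneg) auto
      ultimately show ?thesis by (simp add: mult.commute)
    next
      case False
      have "q x * (1 + ?s\<^sup>2) = 1" using q_W[of x] by (simp add: slope2_eq)
      then have "mc x * ?s = (mcnum x / ?s ^ 2) * (q x * (1 + ?s\<^sup>2))"
        using s by (simp add: mc_def power3_eq_cube power2_eq_square)
      also have "\<dots> = (1 + 1 / ?s\<^sup>2) * (q x * mcnum x)" using s by (simp add: field_simps)
      also have "\<dots> \<le> (1 + 1 / \<tau>\<^sup>2) * (q x * mcnum x)"
        using False \<tau>(1) s mm q_pos[of x] by (intro mult_right_mono add_left_mono divide_left_mono power_mono) auto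
      moreover have "\<tau> * mc x \<ge> 0" using mc0[OF x \<open>\<psi> (u x) \<noteq> 0\<close>] \<tau> by simp
      ultimately show ?thesis by simp
    qed
    finally have "mc x * (x \<bullet> grad u x) \<le> \<rho> * (\<tau> * mc x + (1 + 1 / \<tau>\<^sup>2) * (q x * mcnum x))"
      using \<rho> by (simp add: mult_left_mono)
    from mult_left_mono[OF this \<psi>(3)[of "u x"]] show ?thesis
      by (simp add: \<kappa>[OF x] algebra_simps)
  qed (simp add: \<kappa>[OF x])
  have "2 * J = (LINT x:D|lebesgue. \<kappa> x * (x \<bullet> grad u x))"
    unfolding J_def \<kappa>_def
  proof (rule rellich_identity[OF \<psi>(1,2) \<psi>0 N(1)])
    fix x assume x: "x \<in> D" "\<psi> (u x) \<noteq> 0"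
    from big[OF this] c(1) have "grad u x \<noteq> 0" by (auto simp: slope2_eq)
    then show "N x = (1 / norm (grad u x)) *\<^sub>R grad u x \<and> divergence N x = mc x \<and> grad u x \<noteq> 0
      \<and> ((\<lambda>y. N y \<bullet> grad u y) has_derivative (\<lambda>v. (hess x v \<bullet> grad u x) / norm (grad u x))) (at x)"
      using N(2-4)[OF big[OF x]] by blast
  qed
  also have "\<dots> \<le> (LINT x:D|lebesgue. \<rho> * \<tau> * \<kappa> x + \<rho> * (1 + 1 / \<tau>\<^sup>2) * (\<psi> (u x) * (q x * mcnum x)))"
    by (rule set_integral_mono[OF _ _ pt])
      (intro continuous_on_D_integrable continuous_intros c\<kappa> c\<psi>u grad_cont cq mcnum_continuous)+
  also have "\<dots> = \<rho> * \<tau> * (LINT x:D|lebesgue. \<kappa> x) + \<rho> * (1 + 1 / \<tau>\<^sup>2) * L"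
  proof -
    have "(LINT x:D|lebesgue. \<rho> * \<tau> * \<kappa> x + \<rho> * (1 + 1 / \<tau>\<^sup>2) * (\<psi> (u x) * (q x * mcnum x)))
      = (LINT x:D|lebesgue. \<rho> * \<tau> * \<kappa> x) + (LINT x:D|lebesgue. \<rho> * (1 + 1 / \<tau>\<^sup>2) * (\<psi> (u x) * (q x * mcnum x)))"
      by (intro set_integral_add continuous_on_D_integrable continuous_intros c\<kappa> c\<psi>u cq mcnum_continuous)
    then show ?thesis by (simp only: L_def set_integral_mult_right)
  qed
  finally have J1: "2 * J \<le> \<rho> * \<tau> * C0 + \<rho> * (1 + 1 / \<tau>\<^sup>2) * L"
    using mult_left_mono[OF total, of "\<rho> * \<tau>"] \<rho> \<tau>(1) by simp
  obtain F where F: "F 0 = 0" "\<And>t. (F has_real_derivative \<psi> t) (at t)" using antiderivative_exists[OF c\<psi>] by blast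
  \<comment> \<open>Takes the place of \<open>- u\<close>: it is nonnegative for heights at most 0,
    and its derivative \<open>- \<psi>\<close> makes integration by parts produce the cut-off
    integrands.\<close>
  define \<Psi> where "\<Psi> t = - F t" for t
  have d\<Psi>: "(\<Psi> has_real_derivative - \<psi> t) (at t)" for t unfolding \<Psi>_def[abs_def] by (intro DERIV_minus F)
  have c\<Psi>': "continuous_on UNIV (\<lambda>t. - \<psi> t)" by (intro continuous_intros c\<psi>)
  have \<Psi>0: "\<Psi> 0 = 0" by (simp add: \<Psi>_def F)
  have c\<Psi>: "continuous_on UNIV \<Psi>" using DERIV_continuous[OF d\<Psi>] by (intro continuous_at_imp_continuous_on) auto
  have c\<Psi>u: "continuous_on S (\<lambda>x. \<Psi> (u x))" for S by (rule continuous_on_compose2[OF c\<Psi> u_cont]) auto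
  have \<Psi>pos: "\<Psi> t \<ge> 0" if "t \<le> 0" for t
    using DERIV_nonpos_imp_nonincreasing[OF that, of \<Psi>] d\<Psi> \<psi>(3) \<Psi>0 by (metis neg_le_0_iff_le)
  have by_parts: "(LINT x:D|lebesgue. \<Psi> (u x) * divergence X x) = (LINT x:D|lebesgue. \<psi> (u x) * (grad u x \<bullet> X x))" if "Ck 1 X" for X
    unfolding integral_profile_divergence[OF d\<Psi> c\<Psi>' \<Psi>0 that] by (simp add: set_lebesgue_integral_def)
  define M where "M = (LINT x:D|lebesgue. \<Psi> (u x))"
  have cs: "continuous_on S scal" for S
    using continuous_divergence[OF C1_flux] by (simp add: divergence_flux[abs_def])
  have "L = (LINT x:D|lebesgue. \<Psi> (u x) * scal x)"
    using by_parts[OF C1_flux] flux_inner_grad by (simp add: L_def divergence_flux inner_commute)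
  also have "\<dots> \<le> (LINT x:D|lebesgue. \<epsilon> * \<Psi> (u x))"
  proof (rule set_integral_mono)
    show "\<Psi> (u x) * scal x \<le> \<epsilon> * \<Psi> (u x)" if "x \<in> D" for x
      using mult_left_mono[OF abs_le_D1[OF scal_le[OF that]] \<Psi>pos[OF u_le[OF that]]] by (simp add: mult.commute)
  qed (intro continuous_on_D_integrable continuous_intros c\<Psi>u cs)+
  also have "\<dots> = \<epsilon> * M" by (simp add: M_def)
  finally have LM: "L \<le> \<epsilon> * M" .
  have "3 * M = (LINT x:D|lebesgue. \<psi> (u x) * (grad u x \<bullet> x))"
    using by_parts[OF Ck1_ident] by (simp add: divergence_ident M_def mult.commute)
  also have "\<dots> \<le> (LINT x:D|lebesgue. \<rho> * (\<psi> (u x) * norm (grad u x)))"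
  proof (rule set_integral_mono)
    fix x assume x: "x \<in> D"
    have "grad u x \<bullet> x \<le> norm (grad u x) * norm x" by (rule norm_cauchy_schwarz)
    also have "\<dots> \<le> norm (grad u x) * \<rho>" by (intro mult_left_mono norm_le x) auto
    finally have "\<psi> (u x) * (grad u x \<bullet> x) \<le> \<psi> (u x) * (norm (grad u x) * \<rho>)"
      by (rule mult_left_mono) (rule \<psi>(3))
    then show "\<psi> (u x) * (grad u x \<bullet> x) \<le> \<rho> * (\<psi> (u x) * norm (grad u x))"
      by (simp add: mult.left_commute mult.commute)
  qed (intro continuous_on_D_integrable continuous_intros c\<psi>u grad_cont)+
  also have "\<dots> = \<rho> * J" by (simp add: J_def)
  finally have MJ: "3 * M \<le> \<rho> * J" .
  have J0: "J \<ge> 0"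
  proof -
    have "(LINT x:D|lebesgue. 0) \<le> J" unfolding J_def
    proof (rule set_integral_mono)
      show "0 \<le> \<psi> (u x) * norm (grad u x)" for x using \<psi>(3) by (intro mult_nonneg_nonneg) auto
    qed (intro continuous_on_D_integrable continuous_intros c\<psi>u grad_cont)+
    then show ?thesis by (simp add: set_lebesgue_integral_def)
  qed
  have k: "\<rho> * (1 + 1 / \<tau>\<^sup>2) \<ge> 0" using \<rho> by (intro mult_nonneg_nonneg add_nonneg_nonneg) auto
  \<comment> \<open>The 3 is the divergence of the position field. Of \<open>2 * J\<close>, one
    \<open>J\<close> absorbs the curvature term.\<close>
  have "\<rho> * (1 + 1 / \<tau>\<^sup>2) * L \<le> \<rho> * (1 + 1 / \<tau>\<^sup>2) * (\<epsilon> * (\<rho> * J / 3))"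
    by (rule mult_left_mono[OF order_trans[OF LM mult_left_mono[OF _ \<epsilon>]] k]) (use MJ in simp)
  also have "\<dots> = (\<rho>\<^sup>2 * (1 + 1 / \<tau>\<^sup>2) * \<epsilon>) * (J / 3)" by (simp add: power2_eq_square)
  also have "\<dots> \<le> 3 * (J / 3)" by (rule mult_right_mono[OF \<tau>(2)]) (use J0 in simp)
  finally show ?thesis using J1 by (simp add: J_def)
qed

text \<open>Testing with \<open>Du / \<surd>(\<sigma>\<^sup>2 + |Du|\<^sup>2)\<close> and slicing by heights replaces the coarea formula.\<close>

lemma profile_gradient_bound:
  assumes w: "continuous_on UNIV w" "\<And>t. 0 \<le> w t" "\<And>t. w t \<le> 1" and \<sigma>: "\<sigma> > 0"
  shows "(LINT x:D|lebesgue. w (u x) * norm (grad u x)) \<le> C0 * (LINT h:{m..0}|lborel. w h) + \<sigma> * measure lebesgue D"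
proof -
  have s2: "\<sigma>\<^sup>2 > 0" using \<sigma> by simp
  obtain \<theta> \<theta>' where \<theta>: "\<And>t. (\<theta> has_real_derivative \<theta>' t) (at t)" "continuous_on UNIV \<theta>'"
    "\<And>t. t \<ge> \<sigma>\<^sup>2 \<Longrightarrow> \<theta> t = 1 / sqrt t"
    by (rule inverse_sqrt_extension[OF s2]) blast
  \<comment> \<open>The regularized normal, defined at critical points too: its length is at most 1,
    and its product with the gradient falls short of the gradient norm by at most
    \<open>\<sigma>\<close>.\<close>
  define X where "X x = \<theta> (\<sigma>\<^sup>2 + slope2 x) *\<^sub>R grad u x" for x
  define R where "R x = sqrt (\<sigma>\<^sup>2 + slope2 x)" for x
  have R: "R x > 0" "R x \<ge> norm (grad u x)" "R x \<ge> \<sigma>" "(R x)\<^sup>2 = \<sigma>\<^sup>2 + (norm (grad u x))\<^sup>2" for x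
  proof -
    show "(R x)\<^sup>2 = \<sigma>\<^sup>2 + (norm (grad u x))\<^sup>2" by (simp add: R_def slope2_eq)
    show "R x > 0" using s2 slope2_nonneg[of x] by (simp add: R_def add_pos_nonneg)
    show "R x \<ge> norm (grad u x)" "R x \<ge> \<sigma>" unfolding R_def slope2_eq by (rule real_le_rsqrt, simp)+
  qed
  have XR: "X x = (1 / R x) *\<^sub>R grad u x" for x
    using \<theta>(3)[of "\<sigma>\<^sup>2 + slope2 x"] slope2_nonneg[of x] by (simp add: X_def R_def)
  have X1: "Ck 1 X"
    unfolding X_def[abs_def] by (intro Ck1_scaleR Ck1_comp_real[OF \<theta>(1,2)] Ck1_add Ck1_const C1_slope2 C1_grad)
  have Xle: "norm (X x) \<le> 1" for x using R(1,2)[of x] by (simp add: XR)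
  have gX: "grad u x \<bullet> X x \<ge> norm (grad u x) - \<sigma>" for x
  proof -
    have "grad u x \<bullet> X x = (norm (grad u x))\<^sup>2 / R x" by (simp add: XR dot_square_norm)
    also have "\<dots> = R x - \<sigma>\<^sup>2 / R x" using R(1)[of x] R(4)[of x] by (simp add: field_simps power2_eq_square)
    also have "\<sigma>\<^sup>2 / R x \<le> \<sigma>" using R(1,3)[of x] \<sigma> by (simp add: pos_divide_le_eq power2_eq_square)
    then have "R x - \<sigma>\<^sup>2 / R x \<ge> norm (grad u x) - \<sigma>" using R(2)[of x] by linarith
    finally show ?thesis .
  qed
  have cwu: "continuous_on S (\<lambda>x. w (u x))" for S by (rule continuous_on_compose2[OF w(1) u_cont]) auto
  have cX: "continuous_on S X" for S by (rule Ck1_continuous[OF X1])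
  obtain F where F: "F 0 = 0" "\<And>t. (F has_real_derivative w t) (at t)" using antiderivative_exists[OF w(1)] by blast
  define W where "W t = - F t" for t
  have dW: "(W has_real_derivative - w t) (at t)" for t unfolding W_def[abs_def] by (intro DERIV_minus F)
  have cW': "continuous_on UNIV (\<lambda>t. - w t)" by (intro continuous_intros w)
  have W0: "W 0 = 0" by (simp add: W_def F)
  have W_int: "W t = (\<integral>h. indicator {t..0} h * w h \<partial>lborel)" if "t \<le> 0" for t
  proof -
    have "(\<integral>h. indicator {t..0} h *\<^sub>R w h \<partial>lborel) = F 0 - F t"
    proof (rule integral_FTC_atLeastAtMost[OF that])
      show "(F has_vector_derivative w s) (at s within {t..0})" for s
        using F(2)[of s] by (simp add: has_real_derivative_iff_has_vector_derivative has_vector_derivative_at_within)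
      show "continuous_on {t..0} w" using w(1) by (rule continuous_on_subset) simp
    qed
    then show ?thesis by (simp add: W_def F(1))
  qed
  have cd: "continuous_on S (divergence X)" for S by (rule continuous_divergence[OF X1])
  have cW: "continuous_on UNIV W" using DERIV_continuous[OF dW] by (intro continuous_at_imp_continuous_on) auto
  have cWu: "continuous_on S (\<lambda>x. W (u x))" for S by (rule continuous_on_compose2[OF cW u_cont]) auto
  have [measurable]: "u \<in> borel_measurable borel" "w \<in> borel_measurable borel" "divergence X \<in> borel_measurable borel"
    "D \<in> sets borel"
    using D(1) by (auto intro!: borel_measurable_continuous_onI u_cont w cd borel_compact)
  \<comment> \<open>Layer cake: \<open>W (u x)\<close> is the integral of \<open>w\<close> over the
    heights between \<open>u x\<close> and 0, so Fubini yields fluxes out of sublevel sets, which at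
    good heights are at most \<open>C0\<close>.\<close>
  define f where "f x h = indicator D x * (indicator {m..0} h * (if u x < h then w h * divergence X x else 0))" for x h
  obtain B where B: "\<And>x. x \<in> D \<Longrightarrow> \<bar>divergence X x\<bar> \<le> B"
    using compact_imp_bounded[OF compact_continuous_image[OF cd D(1)]] by (auto simp: bounded_iff)
  have intf: "integrable (lborel \<Otimes>\<^sub>M lborel) (case_prod f)"
  proof (rule integrableI_bounded_set[where A="D \<times> {m..0}" and B=B])
    show "D \<times> {m..0} \<in> sets (lborel \<Otimes>\<^sub>M lborel)" by (intro pair_measureI) auto
    show "case_prod f \<in> borel_measurable (lborel \<Otimes>\<^sub>M lborel)"
      unfolding f_def[abs_def] by measurable
    have "emeasure (lborel \<Otimes>\<^sub>M lborel) (D \<times> {m..0}) = emeasure lborel D * emeasure lborel {m..0}"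
      by (rule lborel.emeasure_pair_measure_Times) auto
    also have "\<dots> < \<infinity>"
      using emeasure_bounded_finite[OF compact_imp_bounded[OF D(1)]] m_le by (simp add: ennreal_mult_less_top)
    finally show "emeasure (lborel \<Otimes>\<^sub>M lborel) (D \<times> {m..0}) < \<infinity>" .
    show "AE z in lborel \<Otimes>\<^sub>M lborel. z \<in> D \<times> {m..0} \<longrightarrow> norm (case_prod f z) \<le> B"
    proof (intro AE_I2 impI)
      fix z assume "z \<in> D \<times> {m..0}"
      then obtain x h where z: "z = (x, h)" "x \<in> D" by auto
      have B0: "B \<ge> 0" using B[OF z(2)] by simp
      have "\<bar>f x h\<bar> \<le> \<bar>w h * divergence X x\<bar>" by (simp add: f_def indicator_def)
      also have "\<dots> \<le> 1 * B"
        unfolding abs_mult using w(2,3)[of h] B[OF z(2)] by (intro mult_mono) auto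
      finally show "norm (case_prod f z) \<le> B" by (simp add: z)
    qed
    show "AE z in lborel \<Otimes>\<^sub>M lborel. z \<notin> D \<times> {m..0} \<longrightarrow> case_prod f z = 0"
      by (intro AE_I2) (auto simp: f_def indicator_def)
  qed
  have fx: "(\<integral>h. f x h \<partial>lborel) = indicator D x * (W (u x) * divergence X x)" for x
  proof (cases "x \<in> D")
    case True
    have "(\<integral>h. f x h \<partial>lborel) = (\<integral>h. (indicator {u x..0} h * w h) * divergence X x \<partial>lborel)"
    proof (rule integral_cong_AE)
      show "(\<lambda>h. f x h) \<in> borel_measurable lborel" unfolding f_def by measurable
      show "(\<lambda>h. (indicator {u x..0} h * w h) * divergence X x) \<in> borel_measurable lborel" by measurable
      show "AE h in lborel. f x h = (indicator {u x..0} h * w h) * divergence X x"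
        using AE_lborel_singleton[of "u x"]
        by eventually_elim (use m(2)[OF True] True in \<open>auto simp: f_def indicator_def\<close>)
    qed
    then show ?thesis using W_int[OF u_le[OF True]] True by simp
  qed (simp add: f_def)
  have fh: "(\<integral>x. f x h \<partial>lborel) \<le> indicator {m..0} h * (w h * C0)" if "h \<in> {m..0} \<longrightarrow> good h" for h
  proof (cases "h \<in> {m..0}")
    case True
    then have g: "good h" "regular h" using that by (auto simp: good_def)
    have [measurable]: "sublevel h \<in> sets borel" using open_sublevel[of h] g by (simp add: regular_def borel_open)
    have "(\<integral>x. f x h \<partial>lborel) = (\<integral>x. w h * (indicator (sublevel h) x * divergence X x) \<partial>lborel)"
      using True by (intro Bochner_Integration.integral_cong refl) (auto simp: f_def sublevel_def indicator_def)
    also have "\<dots> = w h * (\<integral>x. indicator (sublevel h) x * divergence X x \<partial>lborel)" by simp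
    also have "(\<integral>x. indicator (sublevel h) x * divergence X x \<partial>lborel) = (LINT x:sublevel h|lebesgue. divergence X x)"
      unfolding set_lebesgue_integral_def by (subst integral_completion) (auto simp: mult.commute)
    also have "\<dots> \<le> area h" by (rule sublevel_flux_le_area[OF g(2) X1 Xle])
    also have "\<dots> \<le> C0" by (rule area_le[OF g(1) perimeter_le C0])
    finally show ?thesis using True w(2)[of h] by (simp add: mult_left_mono)
  qed (simp add: f_def)
  have iw: "integrable lborel (\<lambda>h. indicator {m..0} h *\<^sub>R w h)"
    by (rule borel_integrable_compact[OF _ continuous_on_subset[OF w(1)]]) auto
  have "(LINT x:D|lebesgue. w (u x) * (grad u x \<bullet> X x)) = (LINT x:D|lebesgue. W (u x) * divergence X x)"
    unfolding integral_profile_divergence[OF dW cW' W0 X1] by (simp add: set_lebesgue_integral_def)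
  also have "\<dots> = (\<integral>x. (\<integral>h. f x h \<partial>lborel) \<partial>lborel)"
    unfolding fx
    by (subst LINT_lebesgue_lborel[OF D(1)]) (auto intro!: continuous_intros cWu cd simp: set_lebesgue_integral_def)
  also have "\<dots> = (\<integral>h. (\<integral>x. f x h \<partial>lborel) \<partial>lborel)"
    by (rule lborel_pair.Fubini_integral[OF intf, symmetric])
  also have "\<dots> \<le> (\<integral>h. indicator {m..0} h * (w h * C0) \<partial>lborel)"
  proof (rule integral_mono_AE')
    show "integrable lborel (\<lambda>h. indicator {m..0} h * (w h * C0))"
      using integrable_mult_left[OF iw, of C0] by (simp add: mult.assoc)
    show "AE h in lborel. (\<integral>x. f x h \<partial>lborel) \<le> indicator {m..0} h * (w h * C0)"
      using AE_good_interval by eventually_elim (rule fh)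
  qed (use w C0 in \<open>simp add: indicator_def\<close>)
  also have "\<dots> = C0 * (LINT h:{m..0}|lborel. w h)"
    unfolding set_lebesgue_integral_def integral_mult_right_zero[symmetric]
    by (intro Bochner_Integration.integral_cong refl) simp
  finally have main: "(LINT x:D|lebesgue. w (u x) * (grad u x \<bullet> X x)) \<le> C0 * (LINT h:{m..0}|lborel. w h)" .
  have iD: "set_integrable lebesgue D (\<lambda>x. \<sigma>)" by (intro continuous_on_D_integrable continuous_intros)
  have "(LINT x:D|lebesgue. w (u x) * norm (grad u x)) \<le> (LINT x:D|lebesgue. w (u x) * (grad u x \<bullet> X x) + \<sigma>)"
  proof (rule set_integral_mono)
    show "w (u x) * norm (grad u x) \<le> w (u x) * (grad u x \<bullet> X x) + \<sigma>" for x
    proof -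
      have "w (u x) * norm (grad u x) \<le> w (u x) * (grad u x \<bullet> X x + \<sigma>)"
        using gX[of x] w by (intro mult_left_mono) auto
      also have "\<dots> = w (u x) * (grad u x \<bullet> X x) + w (u x) * \<sigma>" by (rule distrib_left)
      also have "w (u x) * \<sigma> \<le> 1 * \<sigma>" using w \<sigma> by (intro mult_right_mono) auto
      finally show ?thesis by simp
    qed
  qed (intro continuous_on_D_integrable continuous_intros cwu grad_cont cX)+
  also have "\<dots> = (LINT x:D|lebesgue. w (u x) * (grad u x \<bullet> X x)) + (LINT x:D|lebesgue. \<sigma>)"
    by (intro set_integral_add(2) iD continuous_on_D_integrable continuous_intros cwu grad_cont cX)
  also have "(LINT x:D|lebesgue. \<sigma>) = \<sigma> * measure lebesgue D"
    using emeasure_bounded_finite[OF compact_imp_bounded[OF D(1)]]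
    by (simp add: set_lebesgue_integral_def lmeasurable_iff_integrable)
  finally show ?thesis using main by linarith
qed

text \<open>Almost every height between \<open>m\<close> and 0 is good, hence outside the closed set
  \<open>K\<close>, so the profiles tend to 1 at almost every height. By
  \<open>profile_gradient_bound\<close> the part they remove tends to 0, up to a term with
  \<open>\<sigma>\<close> that is arbitrarily small.\<close>

theorem gradient_integral_bound:
  assumes \<tau>: "\<tau> > 0" "\<rho>\<^sup>2 * (1 + 1 / \<tau>\<^sup>2) * \<epsilon> \<le> 3"
  shows "(LINT x:D|lebesgue. norm (grad u x)) \<le> \<rho> * \<tau> * C0"
proof -
  define P where "P \<delta> \<psi> \<longleftrightarrow> (\<exists>\<psi>'. (\<forall>t. (\<psi> has_real_derivative \<psi>' t) (at t)) \<and> continuous_on UNIV \<psi>')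
    \<and> (\<forall>t. 0 \<le> \<psi> t \<and> \<psi> t \<le> 1 \<and> (infdist t K \<le> \<delta> \<longrightarrow> \<psi> t = 0) \<and> (4 * \<delta> \<le> infdist t K \<longrightarrow> \<psi> t = 1))"
    for \<delta> :: real and \<psi> :: "real \<Rightarrow> real"
  have "\<exists>\<psi>. P (dl n) \<psi>" for n
    by (rule cutoff_profile[OF K_ne dl_pos[of n]]) (unfold P_def, blast)
  then obtain \<psi> where \<psi>: "\<And>n. P (dl n) (\<psi> n)" by metis
  have b: "0 \<le> \<psi> n t" "\<psi> n t \<le> 1" "4 * dl n \<le> infdist t K \<Longrightarrow> \<psi> n t = 1" for n t
    using \<psi>[of n] unfolding P_def by blast+
  have c\<psi>: "continuous_on UNIV (\<psi> n)" for n
  proof -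
    obtain \<psi>' where "\<forall>t. (\<psi> n has_real_derivative \<psi>' t) (at t)" using \<psi>[of n] unfolding P_def by blast
    then show ?thesis using DERIV_continuous by (intro continuous_at_imp_continuous_on) blast
  qed
  have c\<psi>u: "continuous_on S (\<lambda>x. \<psi> n (u x))" for S n by (rule continuous_on_compose2[OF c\<psi> u_cont]) auto
  have c1: "continuous_on UNIV (\<lambda>t. 1 - \<psi> n t)" for n by (intro continuous_intros c\<psi>)
  define I where "I = (LINT x:D|lebesgue. norm (grad u x))"
  define E where "E n = (LINT h:{m..0}|lborel. 1 - \<psi> n h)" for n
  have bound: "I \<le> \<rho> * \<tau> * C0 + (C0 * E n + \<sigma> * measure lebesgue D)" if "\<sigma> > 0" for n \<sigma>
  proof -
    obtain \<psi>' where \<psi>': "\<And>t. (\<psi> n has_real_derivative \<psi>' t) (at t)" "continuous_on UNIV \<psi>'"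
      "\<And>t. infdist t K \<le> dl n \<Longrightarrow> \<psi> n t = 0" using \<psi>[of n] unfolding P_def by blast
    have "I = (LINT x:D|lebesgue. \<psi> n (u x) * norm (grad u x) + (1 - \<psi> n (u x)) * norm (grad u x))"
      unfolding I_def by (simp add: algebra_simps)
    also have "\<dots> = (LINT x:D|lebesgue. \<psi> n (u x) * norm (grad u x)) + (LINT x:D|lebesgue. (1 - \<psi> n (u x)) * norm (grad u x))"
      by (intro set_integral_add(2) continuous_on_D_integrable continuous_intros c\<psi>u grad_cont)
    also have "\<dots> \<le> \<rho> * \<tau> * C0 + (C0 * E n + \<sigma> * measure lebesgue D)"
      unfolding E_def
      by (rule add_mono[OF cutoff_gradient_bound[OF \<psi>'(1,2) b(1,2) \<psi>'(3) dl_pos \<tau>] profile_gradient_bound[OF c1 _ _ that]])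
        (use b in auto)
    finally show ?thesis .
  qed
  have "E \<longlonglongrightarrow> (LINT h:{m..0}|lborel. 0)"
    unfolding E_def[abs_def] set_lebesgue_integral_def
  proof (rule integral_dominated_convergence[where w="indicator {m..0}"])
    have [measurable]: "\<psi> n \<in> borel_measurable borel" for n by (intro borel_measurable_continuous_onI c\<psi>)
    show "(\<lambda>h. indicator {m..0} h *\<^sub>R (1 - \<psi> n h)) \<in> borel_measurable lborel" for n by measurable
    show "integrable lborel (indicator {m..0} :: real \<Rightarrow> real)" by (intro integrable_real_indicator) (simp_all add: m_le)
    show "AE h in lborel. norm (indicator {m..0} h *\<^sub>R (1 - \<psi> n h)) \<le> indicator {m..0} h" for n
      using b by (intro AE_I2) (auto simp: indicator_def)
    show "AE h in lborel. (\<lambda>n. indicator {m..0} h *\<^sub>R (1 - \<psi> n h)) \<longlonglongrightarrow> indicator {m..0} h *\<^sub>R 0"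
      using AE_good_interval
    proof eventually_elim
      case (elim h)
      show ?case
      proof (cases "h \<in> {m..0}")
        case True
        then have "h \<notin> K" using elim good_notin_K by blast
        then have "infdist h K > 0" using K_closed K_ne by (intro infdist_pos_not_in_closed) auto
        then have "\<forall>\<^sub>F n in sequentially. dl n < infdist h K / 4" by (intro eventually_dl_less) simp
        then have "\<forall>\<^sub>F n in sequentially. indicator {m..0} h *\<^sub>R (1 - \<psi> n h) = indicator {m..0} h *\<^sub>R 0"
          by eventually_elim (simp add: b(3))
        then show ?thesis by (rule tendsto_eventually)
      qed simp
    qed
  qed simp
  then have E: "E \<longlonglongrightarrow> 0" by (simp add: set_lebesgue_integral_def)
  have le: "I \<le> \<rho> * \<tau> * C0 + \<sigma> * measure lebesgue D" if "\<sigma> > 0" for \<sigma>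
  proof -
    have "(\<lambda>n. \<rho> * \<tau> * C0 + (C0 * E n + \<sigma> * measure lebesgue D)) \<longlonglongrightarrow> \<rho> * \<tau> * C0 + (C0 * 0 + \<sigma> * measure lebesgue D)"
      by (intro tendsto_intros E)
    then have "I \<le> \<rho> * \<tau> * C0 + (C0 * 0 + \<sigma> * measure lebesgue D)"
      by (rule LIMSEQ_le_const) (use bound[OF that] in blast)
    then show ?thesis by simp
  qed
  have "I \<le> \<rho> * \<tau> * C0 + e" if e: "e > 0" for e
  proof -
    have p: "measure lebesgue D + 1 > 0" by (simp add: add_nonneg_pos)
    have "e / (measure lebesgue D + 1) * measure lebesgue D = e * (measure lebesgue D / (measure lebesgue D + 1))" by simp
    also have "\<dots> \<le> e * 1" using e p by (intro mult_left_mono) auto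
    finally show ?thesis using le[of "e / (measure lebesgue D + 1)"] e p by simp
  qed
  then have "I \<le> \<rho> * \<tau> * C0" by (rule field_le_epsilon)
  then show ?thesis by (simp add: I_def)
qed

end

section \<open>Flat tori and the region between two graphs\<close>

text \<open>The linear map that takes the integer lattice to \<open>lattice a\<close> and the unit
  cube to the fundamental domain.\<close>

definition lat :: "real^3^3 \<Rightarrow> real^3 \<Rightarrow> real^3" where
  "lat a y = (\<Sum>i\<in>UNIV. (y $ i) *\<^sub>R (a $ i))"

lemma lat_matrix: "lat a y = transpose a *v y"
  by (simp add: lat_def matrix_mult_sum column_transpose row_def scalar_mult_eq_scaleR vec_lambda_eta)

lemma lat_linear: "linear (lat a)"
  unfolding lat_matrix[abs_def] by (rule matrix_vector_mul_linear)

lemma lat_bij: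
  assumes "det a \<noteq> 0" shows "inj (lat a)" "surj (lat a)"
proof -
  have "invertible (transpose a)" using assms by (simp add: invertible_det_nz det_transpose)
  then show "inj (lat a)" unfolding lat_matrix[abs_def] by (rule inj_matrix_vector_mult)
  then show "surj (lat a)" by (rule linear_injective_imp_surjective[OF lat_linear _ refl])
qed

lemma lat_diff: "lat a (x - y) = lat a x - lat a y"
  by (rule linear_diff[OF lat_linear])

lemma lattice_eq: "lattice a = {lat a y | y. \<forall>i. y $ i \<in> \<int>}"
proof (intro set_eqI iffI)
  fix x assume "x \<in> lattice a"
  then obtain n :: "3 \<Rightarrow> int" where "x = (\<Sum>i\<in>UNIV. of_int (n i) *\<^sub>R (a $ i))" by (auto simp: lattice_def)
  then have "x = lat a (\<chi> i. of_int (n i))" by (simp add: lat_def)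
  then show "x \<in> {lat a y | y. \<forall>i. y $ i \<in> \<int>}" by fastforce
next
  fix x assume "x \<in> {lat a y | y. \<forall>i. y $ i \<in> \<int>}"
  then obtain y where y: "x = lat a y" "\<And>i. y $ i \<in> \<int>" by blast
  then have "x = (\<Sum>i\<in>UNIV. of_int \<lfloor>y $ i\<rfloor> *\<^sub>R (a $ i))" by (simp add: lat_def)
  then show "x \<in> lattice a" unfolding lattice_def by (intro CollectI exI conjI TrueI)
qed

lemma fund_domain_eq: "fund_domain a = lat a ` cbox 0 (vec 1)"
proof (intro set_eqI iffI)
  fix x assume "x \<in> fund_domain a"
  then obtain l :: "3 \<Rightarrow> real" where l: "x = (\<Sum>i\<in>UNIV. l i *\<^sub>R (a $ i))" "\<And>i. 0 \<le> l i \<and> l i \<le> 1"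
    by (auto simp: fund_domain_def)
  then have "x = lat a (\<chi> i. l i)" "(\<chi> i. l i) \<in> cbox 0 (vec 1)" by (simp_all add: lat_def mem_box_cart)
  then show "x \<in> lat a ` cbox 0 (vec 1)" by blast
next
  fix x assume "x \<in> lat a ` cbox 0 (vec 1)"
  then obtain y where y: "x = lat a y" "\<And>i. 0 \<le> y $ i \<and> y $ i \<le> 1" by (auto simp: mem_box_cart)
  then have "x = (\<Sum>i\<in>UNIV. (y $ i) *\<^sub>R (a $ i))" "\<forall>i. 0 \<le> y $ i \<and> y $ i \<le> 1" by (simp_all add: lat_def)
  then show "x \<in> fund_domain a" unfolding fund_domain_def by blast
qed

lemma fund_domain_compact: "compact (fund_domain a)"
  unfolding fund_domain_eq
  by (rule compact_continuous_image[OF linear_continuous_on compact_cbox])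
    (simp add: lat_linear linear_conv_bounded_linear[symmetric])

lemma fund_domain_convex: "convex (fund_domain a)"
  unfolding fund_domain_eq by (rule convex_linear_image[OF lat_linear convex_box(1)])

lemma fund_domain_ne: "fund_domain a \<noteq> {}"
  unfolding fund_domain_eq by (simp add: interval_ne_empty_cart)

lemma fund_domain_interior:
  assumes "det a \<noteq> 0" shows "interior (fund_domain a) = lat a ` box 0 (vec 1)"
  unfolding fund_domain_eq
  by (simp add: interior_injective_linear_image[OF lat_linear lat_bij(1)[OF assms]] interior_cbox)

lemma lattice_diff: "v \<in> lattice a \<Longrightarrow> w \<in> lattice a \<Longrightarrow> v - w \<in> lattice a"
proof -
  assume "v \<in> lattice a" "w \<in> lattice a"
  then obtain x y where "v = lat a x" "w = lat a y" "\<And>i. x $ i \<in> \<int>" "\<And>i. y $ i \<in> \<int>" by (auto simp: lattice_eq)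
  then have "v - w = lat a (x - y)" "\<forall>i. (x - y) $ i \<in> \<int>" by (simp_all add: lat_diff)
  then show "v - w \<in> lattice a" unfolding lattice_eq by blast
qed

lemma zero_lattice: "0 \<in> lattice a"
  unfolding lattice_eq using linear_0[OF lat_linear, of a] by (auto intro!: exI[of _ 0])

lemma lattice_minus: "v \<in> lattice a \<Longrightarrow> - v \<in> lattice a"
  using lattice_diff[OF zero_lattice, of v a] by simp

lemma proj_eq_iff: "proj a x = proj a y \<longleftrightarrow> x - y \<in> lattice a"
proof
  assume "proj a x = proj a y"
  moreover have "x \<in> proj a x" using zero_lattice by (force simp: proj_def)
  ultimately show "x - y \<in> lattice a" by (auto simp: proj_def)
next
  have sub: "proj a x \<subseteq> proj a y" if xy: "x - y \<in> lattice a" for x y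
  proof
    fix z assume "z \<in> proj a x"
    then obtain v where v: "z = x + v" "v \<in> lattice a" by (auto simp: proj_def)
    have "v - (- (x - y)) \<in> lattice a" using lattice_diff[OF v(2) lattice_minus[OF xy]] .
    moreover have "z = y + (v - (- (x - y)))" by (simp add: v)
    ultimately show "z \<in> proj a y" unfolding proj_def by blast
  qed
  assume "x - y \<in> lattice a"
  then show "proj a x = proj a y" using sub[of x y] sub[of y x] lattice_minus[of "x - y" a] by auto
qed

lemma fund_domain_covers:
  assumes "det a \<noteq> 0" obtains y where "y \<in> fund_domain a" "proj a y = proj a x"
proof -
  obtain z where z: "x = lat a z" using lat_bij(2)[OF assms] by (metis surjD)
  define w where "w = (\<chi> i. frac (z $ i))"
  have "lat a w \<in> fund_domain a"
    unfolding fund_domain_eq by (intro imageI) (simp add: w_def mem_box_cart less_imp_le[OF frac_lt_1])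
  moreover have "lat a w - x \<in> lattice a"
  proof -
    have "lat a w - x = lat a (w - z)" "\<forall>i. (w - z) $ i \<in> \<int>" by (simp_all add: z lat_diff w_def frac_def)
    then show ?thesis unfolding lattice_eq by blast
  qed
  ultimately show ?thesis using that proj_eq_iff by blast
qed

text \<open>The lattice coordinates of two interior points differ by less than 1, so an integral
  difference is 0.\<close>

lemma proj_inj_interior:
  assumes "det a \<noteq> 0" shows "inj_on (proj a) (interior (fund_domain a))"
proof (rule inj_onI)
  fix x y assume xy: "x \<in> interior (fund_domain a)" "y \<in> interior (fund_domain a)" "proj a x = proj a y"
  obtain s t where st: "x = lat a s" "y = lat a t" "s \<in> box 0 (vec 1)" "t \<in> box 0 (vec 1)"
    using xy(1,2) unfolding fund_domain_interior[OF assms] by blast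
  obtain n where n: "x - y = lat a n" "\<And>i. n $ i \<in> \<int>" using xy(3) unfolding proj_eq_iff lattice_eq by blast
  have "s - t = n" using n(1) injD[OF lat_bij(1)[OF assms]] by (simp add: st flip: lat_diff)
  have "s $ i = t $ i" for i
  proof -
    have "\<bar>n $ i\<bar> < 1" using st(3,4) by (auto simp: mem_box_cart abs_less_iff simp flip: \<open>s - t = n\<close>) (smt (verit))+
    then have "n $ i = 0" using n(2)[of i] Ints_nonzero_abs_less1 by blast
    then show ?thesis by (simp flip: \<open>s - t = n\<close>)
  qed
  then have "s = t" by (simp add: vec_eq_iff)
  then show "x = y" by (simp add: st)
qed

lemma cover_eq_iff: "cover a z = cover a z' \<longleftrightarrow> fst z - fst z' \<in> lattice a \<and> snd z = snd z'"
  by (simp add: cover_def proj_eq_iff)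

lemma dir_deriv_shift:
  assumes "\<And>z. g (z + w) = g z" and d: "\<And>z. g differentiable (at z)"
  shows "dir_deriv g v (z + w) = dir_deriv g v z"
proof -
  have "((\<lambda>z. g (z + w)) has_derivative frechet_derivative g (at (z + w))) (at z)"
  proof -
    have "((\<lambda>z. z + w) has_derivative (\<lambda>h. h)) (at z)" by (auto intro!: derivative_eq_intros)
    moreover have "(g has_derivative frechet_derivative g (at (z + w))) (at (z + w))"
      using d[of "z + w"] by (simp only: frechet_derivative_works)
    ultimately show ?thesis by (rule has_derivative_compose)
  qed
  then have "(g has_derivative frechet_derivative g (at (z + w))) (at z)" by (simp add: assms(1))
  then show ?thesis by (simp add: frechet_derivative_at[symmetric])
qed

text \<open>\<open>ext_deriv\<close> differentiates at an arbitrary preimage under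
  \<open>cover a\<close>. Two preimages differ by a lattice vector, which is a period of the
  function.\<close>

lemma dir_deriv_cover:
  assumes "\<And>z. (\<lambda>z. g (cover a z)) differentiable (at z)"
  shows "dir_deriv (\<lambda>z. g (cover a z)) v (inv (cover a) (cover a z)) = dir_deriv (\<lambda>z. g (cover a z)) v z"
proof -
  define z' where "z' = inv (cover a) (cover a z)"
  have c: "cover a z' = cover a z" unfolding z'_def by (rule f_inv_into_f) simp
  define w where "w = z' - z"
  have w: "fst w \<in> lattice a" "snd w = 0" using c by (auto simp: cover_eq_iff w_def)
  have "cover a (y + w) = cover a y" for y using w by (simp add: cover_eq_iff)
  then have "dir_deriv (\<lambda>z. g (cover a z)) v (z + w) = dir_deriv (\<lambda>z. g (cover a z)) v z"
    by (intro dir_deriv_shift assms) simp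
  then show ?thesis by (simp add: w_def z'_def)
qed

text \<open>Each \<open>(e, s)\<close> is \<open>(e, 0) - s *\<^sub>R X\<close> with
  \<open>X = (0, -1)\<close>. Terms with more than one \<open>X\<close> vanish, and moving
  \<open>X\<close> to the front yields the signs.\<close>

lemma alternating_graph_expansion:
  assumes "alternating 3 \<alpha>"
  shows "\<alpha> [(e1, s1), (e2, s2), (e3, s3)] = \<alpha> [(e1, 0), (e2, 0), (e3, 0)] - s1 * \<alpha> [(0, -1), (e2, 0), (e3, 0)]
    + s2 * \<alpha> [(0, -1), (e1, 0), (e3, 0)] - s3 * \<alpha> [(0, -1), (e1, 0), (e2, 0)]"
proof -
  define A where "A x y z = \<alpha> [x, y, z]" for x y z
  have lin: "linear (\<lambda>v. \<alpha> (vs[i := v]))" if "length vs = 3" "i < 3" for vs i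
    using assms that unfolding alternating_def by blast
  have alt: "\<alpha> vs = 0" if "length vs = 3" "i < j" "j < 3" "vs ! i = vs ! j" for vs i j
    using assms that unfolding alternating_def by blast
  have l: "linear (\<lambda>v. A v y z)" "linear (\<lambda>v. A x v z)" "linear (\<lambda>v. A x y v)" for x y z
    using lin[of "[x, y, z]" 0] lin[of "[x, y, z]" 1] lin[of "[x, y, z]" 2]
    by (simp_all add: A_def numeral_2_eq_2 One_nat_def)
  have z: "A x x y = 0" "A x y x = 0" "A y x x = 0" for x y
    using alt[of "[x, x, y]" 0 1] alt[of "[x, y, x]" 0 2] alt[of "[y, x, x]" 1 2]
    by (simp_all add: A_def numeral_2_eq_2 One_nat_def)
  have diff: "A (x - x') y w = A x y w - A x' y w" "A y (x - x') w = A y x w - A y x' w" "A y w (x - x') = A y w x - A y w x'" for x x' y w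
    using linear_diff[OF l(1)] linear_diff[OF l(2)] linear_diff[OF l(3)] by simp_all
  have plus: "A (x + x') y w = A x y w + A x' y w" "A y (x + x') w = A y x w + A y x' w" "A y w (x + x') = A y w x + A y w x'" for x x' y w
    using linear_add[OF l(1)] linear_add[OF l(2)] linear_add[OF l(3)] by simp_all
  have scale: "A (c *\<^sub>R x) y w = c * A x y w" "A y (c *\<^sub>R x) w = c * A y x w" "A y w (c *\<^sub>R x) = c * A y w x" for c x y w
    using linear_scale[OF l(1)] linear_scale[OF l(2)] linear_scale[OF l(3)] by simp_all
  have sw1: "A x y w = - A y x w" for x y w
    using z(1)[of "x + y" w] unfolding plus by (simp add: z eq_neg_iff_add_eq_0 add.commute)
  have sw2: "A w x y = - A w y x" for x y w
    using z(3)[of w "x + y"] unfolding plus by (simp add: z eq_neg_iff_add_eq_0 add.commute)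
  let ?X = "(0, -1) :: vec4"
  have e: "(e, s) = (e, 0) - s *\<^sub>R ?X" for e s by simp
  have "A (e1, s1) (e2, s2) (e3, s3) = A ((e1, 0) - s1 *\<^sub>R ?X) ((e2, 0) - s2 *\<^sub>R ?X) ((e3, 0) - s3 *\<^sub>R ?X)"
    using e[of e1 s1] e[of e2 s2] e[of e3 s3] by simp
  also have "\<dots> = A (e1, 0) (e2, 0) (e3, 0) - s1 * A ?X (e2, 0) (e3, 0) - s2 * A (e1, 0) ?X (e3, 0) - s3 * A (e1, 0) (e2, 0) ?X"
    by (simp only: diff scale z) (simp add: algebra_simps)
  also have "A (e1, 0) ?X (e3, 0) = - A ?X (e1, 0) (e3, 0)" by (rule sw1)
  also have "A (e1, 0) (e2, 0) ?X = A ?X (e1, 0) (e2, 0)" using sw2[of "(e1, 0)" "(e2, 0)" ?X] sw1[of "(e1, 0)" ?X "(e2, 0)"] by simp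
  finally show ?thesis by (simp add: A_def)
qed

section \<open>The zero current and currents of full dimension\<close>

lemma hausdorff_outer_empty: "hausdorff_outer k {} = 0"
proof -
  have "hausdorff_pre k \<delta> {} \<le> 0" if "\<delta> > 0" for \<delta>
    unfolding hausdorff_pre_def by (rule INF_lower2[of "\<lambda>_. {}"]) (use that in auto)
  then show ?thesis unfolding hausdorff_outer_def by (intro antisym SUP_least) auto
qed

text \<open>Provides the part \<open>A\<close> in the flat distance. Rectifiability asks for a
  \<open>k\<close>-dimensional subspace of the ambient space, whence
  \<open>k \<le> 4\<close>.\<close>

lemma zero_integral_current:
  assumes "k \<le> 4" shows "integral_current a W k (\<lambda>_. 0)" "mass a W k (\<lambda>_. 0) = 0"
proof -
  show m: "mass a W k (\<lambda>_. 0) = 0" for k unfolding mass_def by (intro antisym SUP_least) auto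
  obtain V :: "vec4 set" where V: "subspace V" "dim V = k"
    using choose_subspace_of_subspace[of k "UNIV :: vec4 set"] assms by (auto simp: dim_UNIV)
  have "countably_rectifiable k {}"
    unfolding countably_rectifiable_def
    by (rule exI[of _ V], rule exI[of _ "{}"], rule exI[of _ "\<lambda>_ z. z"])
      (use V in \<open>auto simp: hausdorff_outer_empty intro!: exI[of _ 1] lipschitz_intros\<close>)
  then have "rectifiable_current a W k (\<lambda>_. 0)"
    unfolding rectifiable_current_def
    by (intro exI[of _ "{}"] exI[of _ "\<lambda>_. 1"] exI[of _ "\<lambda>_ _. 0"])
      (simp add: set_integrable_def set_lebesgue_integral_def)
  then show "integral_current a W k (\<lambda>_. 0)"
    by (simp add: integral_current_def m boundary_def)
qed

lemma lborel_integral_affine: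
  fixes g :: "'a::euclidean_space \<Rightarrow> real"
  assumes [measurable]: "g \<in> borel_measurable borel" and r: "r > 0"
  shows "(\<integral>y. g y \<partial>lborel) = r ^ DIM('a) * (\<integral>y. g (x + r *\<^sub>R y) \<partial>lborel)"
proof -
  have "(\<integral>y. g y \<partial>lborel) = (\<integral>y. g y \<partial>density (distr lborel borel (\<lambda>y. x + r *\<^sub>R y)) (\<lambda>_. ennreal (\<bar>r\<bar> ^ DIM('a))))"
    using lborel_affine[of r x] r by simp
  also have "\<dots> = (\<integral>y. (r ^ DIM('a)) *\<^sub>R g y \<partial>distr lborel borel (\<lambda>y. x + r *\<^sub>R y))"
    using r by (subst integral_density) auto
  also have "\<dots> = (\<integral>y. (r ^ DIM('a)) *\<^sub>R g (x + r *\<^sub>R y) \<partial>lborel)"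
    by (rule integral_distr) auto
  finally show ?thesis by simp
qed

lemma hausdorff_measure_vec4: "(hausdorff_measure 4 :: vec4 measure) = lborel"
  using hausdorff_measure_eq_lborel[where 'a=vec4] by simp

text \<open>Rescaled about an interior point, \<open>M\<close> eventually contains the support of
  \<open>\<phi>\<close>, so the rescaled integrals are eventually constant.\<close>

lemma approx_tangent_open:
  assumes M: "open M" and z: "z \<in> M"
  shows "has_approx_tangent 4 M z UNIV"
  unfolding has_approx_tangent_def hausdorff_measure_vec4
proof (intro conjI allI impI)
  show "dim (UNIV :: vec4 set) = 4" by (simp add: dim_UNIV)
  fix \<phi> :: "vec4 \<Rightarrow> real"
  assume "continuous_on UNIV \<phi> \<and> (\<exists>K. compact K \<and> (\<forall>y. y \<notin> K \<longrightarrow> \<phi> y = 0))"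
  then obtain K where c: "continuous_on UNIV \<phi>" and K: "compact K" "\<And>y. y \<notin> K \<Longrightarrow> \<phi> y = 0" by blast
  have [measurable]: "\<phi> \<in> borel_measurable borel" by (rule borel_measurable_continuous_onI[OF c])
  have [measurable]: "M \<in> sets borel" using M by simp
  obtain R where R: "R > 0" "\<And>y. y \<in> K \<Longrightarrow> norm y \<le> R"
    using compact_imp_bounded[OF K(1)] by (auto simp: bounded_pos)
  obtain \<rho> where \<rho>: "\<rho> > 0" "ball z \<rho> \<subseteq> M" using M z open_contains_ball by blast
  have "\<forall>\<^sub>F r in at_right (0::real). 0 < r \<and> r < \<rho> / (R + 1)"
    using \<rho> R by (intro eventually_conj eventually_at_right_less)
      (auto simp: eventually_at_right_field intro!: exI[of _ "\<rho> / (R + 1)"])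
  then have "\<forall>\<^sub>F r in at_right 0. (LINT y:M|lborel. \<phi> ((1 / r) *\<^sub>R (y - z))) / r ^ 4 = (LINT y:UNIV|lborel. \<phi> y)"
  proof eventually_elim
    case (elim r)
    have "(LINT y:M|lborel. \<phi> ((1 / r) *\<^sub>R (y - z))) = r ^ DIM(vec4) * (\<integral>y. indicator M (z + r *\<^sub>R y) *\<^sub>R \<phi> ((1 / r) *\<^sub>R ((z + r *\<^sub>R y) - z)) \<partial>lborel)"
      unfolding set_lebesgue_integral_def by (rule lborel_integral_affine) (use elim in auto)
    also have "(\<integral>y. indicator M (z + r *\<^sub>R y) *\<^sub>R \<phi> ((1 / r) *\<^sub>R ((z + r *\<^sub>R y) - z)) \<partial>lborel) = (\<integral>y. \<phi> y \<partial>lborel)"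
    proof (intro Bochner_Integration.integral_cong refl)
      fix y
      show "indicator M (z + r *\<^sub>R y) *\<^sub>R \<phi> ((1 / r) *\<^sub>R ((z + r *\<^sub>R y) - z)) = \<phi> y"
      proof (cases "y \<in> K")
        case True
        have "r * norm y \<le> r * R" using R(2)[OF True] elim by (intro mult_left_mono) auto
        also have "\<dots> < \<rho>" using elim R(1) by (simp add: field_simps)
        finally have "z + r *\<^sub>R y \<in> ball z \<rho>" using elim by (simp add: dist_norm)
        then show ?thesis using \<rho>(2) elim by auto
      qed (use elim K in simp)
    qed
    finally show ?case using elim by (simp add: set_lebesgue_integral_def)
  qed
  then show "((\<lambda>r. (LINT y:M|lborel. \<phi> ((1 / r) *\<^sub>R (y - z))) / r ^ 4) \<longlongrightarrow> (LINT y:UNIV|lborel. \<phi> y)) (at_right 0)"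
    by (rule tendsto_eventually)
qed simp

locale graph_torus = well u D for u D +
  fixes a :: "real^3^3" and f :: "(real^3) set \<Rightarrow> real"
  assumes det: "det a > 0" and u_def: "u = f \<circ> proj a" and D_def: "D = fund_domain a"
begin

text \<open>Restriction to the interior of \<open>D\<close> makes the region open and
  \<open>cover a\<close> injective on it. No point between the graphs is lost, since
  \<open>u\<close> is 0 on the frontier.\<close>

definition M :: "vec4 set" where "M = {z. fst z \<in> interior D \<and> u (fst z) < snd z \<and> snd z < 0}"

lemma M_mem: "(x, t) \<in> M \<longleftrightarrow> x \<in> D \<and> u x < t \<and> t < 0"
  using interior_if_neg[of x] interior_subset[of D] by (auto simp: M_def)

lemma open_M: "open M"
proof -
  have "open (interior D \<times> {..<0::real})" by (intro open_Times open_interior open_lessThan)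
  moreover have "open {z :: vec4. u (fst z) < snd z}"
    by (intro open_Collect_less continuous_on_compose2[OF u_cont[of UNIV]] continuous_intros) auto
  ultimately have "open (interior D \<times> {..<0} \<inter> {z :: vec4. u (fst z) < snd z})" by (rule open_Int)
  moreover have "M = interior D \<times> {..<0} \<inter> {z. u (fst z) < snd z}" by (auto simp: M_def)
  ultimately show ?thesis by simp
qed

lemma M_box: obtains m where "M \<subseteq> D \<times> {m..0}"
proof -
  obtain B where B: "\<And>x. x \<in> D \<Longrightarrow> \<bar>u x\<bar> \<le> B"
    using compact_imp_bounded[OF compact_continuous_image[OF u_cont D(1)]] by (auto simp: bounded_iff)
  have "M \<subseteq> D \<times> {-B..0}"
  proof
    fix z assume z: "z \<in> M"
    then have "fst z \<in> D" "u (fst z) < snd z" "snd z < 0" using M_mem[of "fst z" "snd z"] by auto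
    then show "z \<in> D \<times> {-B..0}" using B[of "fst z"] by (auto simp: mem_Times_iff)
  qed
  then show ?thesis by (rule that)
qed

section \<open>Integration over the region between the graphs\<close>

lemma M_integrable:
  fixes h :: "vec4 \<Rightarrow> real"
  assumes "continuous_on UNIV h" shows "set_integrable lborel M h"
proof -
  obtain m where m: "M \<subseteq> D \<times> {m..0}" by (rule M_box)
  have "set_integrable lborel (D \<times> {m..0}) h"
    unfolding set_integrable_def
    by (rule borel_integrable_compact[OF compact_Times[OF D(1) compact_Icc] continuous_on_subset[OF assms]]) simp
  then show ?thesis by (rule set_integrable_subset) (use m open_M in auto)
qed

text \<open>The substitution \<open>t = s * u x\<close>, with Jacobian \<open>- u x\<close>, turns
  the region into the product of \<open>D\<close> with the unit interval, up to null sets.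
  Derivatives in \<open>x\<close> can then be taken at fixed \<open>s\<close>.\<close>

lemma region_integral:
  fixes h :: "vec4 \<Rightarrow> real"
  assumes h: "continuous_on UNIV h"
  shows "(LINT z:M|lborel. h z) = (LINT x:D|lborel. LINT s:{0..1}|lborel. - u x * h (x, s * u x))"
proof -
  define F where "F z = indicator M z *\<^sub>R h z" for z
  have i: "integrable (lborel \<Otimes>\<^sub>M lborel) F"
    using M_integrable[OF h] by (simp add: set_integrable_def F_def[abs_def] lborel_prod)
  have [measurable]: "h \<in> borel_measurable borel" by (rule borel_measurable_continuous_onI[OF h])
  have "(LINT z:M|lborel. h z) = (\<integral>z. F z \<partial>(lborel \<Otimes>\<^sub>M lborel))"
    by (simp add: set_lebesgue_integral_def F_def lborel_prod)
  also have "\<dots> = (\<integral>x. (\<integral>t. F (x, t) \<partial>lborel) \<partial>lborel)"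
    by (rule lborel_pair.integral_fst'[OF i, symmetric])
  also have "\<dots> = (LINT x:D|lborel. LINT s:{0..1}|lborel. - u x * h (x, s * u x))"
    unfolding set_lebesgue_integral_def
  proof (intro Bochner_Integration.integral_cong refl)
    fix x
    show "(\<integral>t. F (x, t) \<partial>lborel) = indicator D x *\<^sub>R (\<integral>s. indicator {0..1} s *\<^sub>R (- u x * h (x, s * u x)) \<partial>lborel)"
    proof (cases "x \<in> D \<and> u x < 0")
      case True
      have "(\<integral>t. F (x, t) \<partial>lborel) = \<bar>u x\<bar> *\<^sub>R (\<integral>s. F (x, 0 + u x * s) \<partial>lborel)"
        using True by (intro lborel_integral_real_affine) simp
      also have "\<dots> = (\<integral>s. \<bar>u x\<bar> *\<^sub>R F (x, u x * s) \<partial>lborel)" by simp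
      also have "\<dots> = (\<integral>s. indicator {0..1} s *\<^sub>R (- u x * h (x, s * u x)) \<partial>lborel)"
      proof (rule integral_cong_AE)
        have [measurable]: "(\<lambda>s. (x, u x * s)) \<in> borel_measurable borel" "(\<lambda>s. (x, s * u x)) \<in> borel_measurable borel"
          by (intro borel_measurable_continuous_onI continuous_intros)+
        have [measurable]: "F \<in> borel_measurable borel"
          unfolding F_def[abs_def]
          by (intro borel_measurable_scaleR borel_measurable_indicator borel_measurable_continuous_onI[OF h])
            (simp add: open_M)
        show "(\<lambda>s. \<bar>u x\<bar> *\<^sub>R F (x, u x * s)) \<in> borel_measurable lborel" by measurable
        show "(\<lambda>s. indicator {0..1} s *\<^sub>R (- u x * h (x, s * u x))) \<in> borel_measurable lborel" by measurable
        show "AE s in lborel. \<bar>u x\<bar> *\<^sub>R F (x, u x * s) = indicator {0..1} s *\<^sub>R (- u x * h (x, s * u x))"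
          using AE_lborel_singleton[of "0::real"] AE_lborel_singleton[of "1::real"]
        proof eventually_elim
          case (elim s)
          have "(x, u x * s) \<in> M \<longleftrightarrow> 0 < s \<and> s < 1"
            using True by (auto simp: M_mem mult_less_0_iff mult_less_cancel_left1)
          then show ?case using True elim by (auto simp: F_def indicator_def mult.commute)
        qed
      qed
      finally show ?thesis using True by simp
    next
      case False
      then have "x \<notin> D \<or> u x = 0" using u_le[of x] by fastforce
      moreover have "F (x, t) = 0" for t using False by (auto simp: F_def M_mem)
      ultimately show ?thesis by auto
    qed
  qed
  finally show ?thesis .
qed

lemma swap_integral:
  fixes g :: "real^3 \<Rightarrow> real \<Rightarrow> real"
  assumes g: "continuous_on UNIV (\<lambda>z. g (fst z) (snd z))"
  shows "(LINT x:D|lborel. LINT s:{0..1}|lborel. g x s) = (LINT s:{0..1}|lborel. LINT x:D|lborel. g x s)"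
proof -
  have "integrable lborel (\<lambda>z. indicator (D \<times> {0..1}) z *\<^sub>R g (fst z) (snd z))"
    by (rule borel_integrable_compact[OF compact_Times[OF D(1) compact_Icc] continuous_on_subset[OF g]]) simp
  moreover have "(\<lambda>z. indicator (D \<times> {0..1}) z *\<^sub>R g (fst z) (snd z)) = (\<lambda>(x, s). indicator D x * (indicator {0..1} s * g x s))"
    by (auto simp: indicator_def)
  ultimately have "integrable (lborel \<Otimes>\<^sub>M lborel) (\<lambda>(x, s). indicator D x * (indicator {0..1} s * g x s))"
    by (simp add: lborel_prod)
  from lborel_pair.Fubini_integral[OF this]
  have "(\<integral>s. (\<integral>x. indicator D x * (indicator {0..1} s * g x s) \<partial>lborel) \<partial>lborel)
    = (\<integral>x. (\<integral>s. indicator D x * (indicator {0..1} s * g x s) \<partial>lborel) \<partial>lborel)" .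
  moreover have "(\<integral>x. indicator D x * (indicator {0..1} s * g x s) \<partial>lborel) = indicator {0..1} s * (\<integral>x. indicator D x * g x s \<partial>lborel)" for s
    by (simp only: mult.left_commute[of _ "indicator {0..1} s"] integral_mult_right_zero)
  ultimately show ?thesis
    unfolding set_lebesgue_integral_def by (simp only: real_scaleR_def integral_mult_right_zero)
qed

lemma line_FTC:
  assumes "\<And>s. (F has_real_derivative F' s) (at s)" "continuous_on UNIV F'"
  shows "(LINT s:{0..1}|lborel. F' s) = F 1 - F 0"
  unfolding set_lebesgue_integral_def
proof (rule integral_FTC_atLeastAtMost)
  show "(F has_vector_derivative F' s) (at s within {0..1})" for s
    using assms(1)[of s] by (simp add: has_real_derivative_iff_has_vector_derivative has_vector_derivative_at_within)
  show "continuous_on {0..1} F'" using assms(2) by (rule continuous_on_subset) simp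
qed simp

lemma cont_ufst: "continuous_on T (\<lambda>z. u (fst z))"
  by (rule continuous_on_compose2[OF u_cont[of UNIV]]) (auto intro: continuous_intros)

lemma cont_partial: "continuous_on T (partial j u)"
  using Ck1_continuous_dir_deriv[OF C1_u, of T "axis j 1"] by (simp add: partial_def[abs_def])

lemma cont_partial_fst: "continuous_on T (\<lambda>z. partial j u (fst z))"
  by (rule continuous_on_compose2[OF cont_partial[of UNIV]]) (auto intro: continuous_intros)

context
  fixes \<beta> :: "vec4 \<Rightarrow> real" assumes \<beta>: "Ck 1 \<beta>"
begin

lemma dir_deriv_decomp: "dir_deriv \<beta> (v, t) z = dir_deriv \<beta> (v, 0) z + t * dir_deriv \<beta> (0, 1) z"
proof -
  interpret b: bounded_linear "\<lambda>v. dir_deriv \<beta> v z"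
    by (rule has_derivative_bounded_linear[OF Ck1_has_derivative[OF \<beta>]])
  have "(v, t) = (v, 0) + t *\<^sub>R (0, 1)" by simp
  then show ?thesis using b.add[of "(v, 0)" "t *\<^sub>R (0, 1)"] b.scaleR[of t "(0, 1)"] by simp
qed

lemma vertical_deriv: "((\<lambda>s. \<beta> (x, s * c)) has_real_derivative c * dir_deriv \<beta> (0, 1) (x, s * c)) (at s)"
proof -
  have "((\<lambda>s. (x, s * c)) has_derivative (\<lambda>h. (0, h * c))) (at s)" by (auto intro!: derivative_eq_intros)
  from has_derivative_compose[OF this Ck1_has_derivative[OF \<beta>]]
  have d: "((\<lambda>s. \<beta> (x, s * c)) has_derivative (\<lambda>h. dir_deriv \<beta> (0, h * c) (x, s * c))) (at s)" .
  have "dir_deriv \<beta> (0, 0) z = 0" for z using dir_deriv_decomp[where v=0 and t=1 and z=z] by simp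
  then have "(\<lambda>h. dir_deriv \<beta> (0, h * c) (x, s * c)) = (*) (c * dir_deriv \<beta> (0, 1) (x, s * c))"
    by (intro ext) (subst dir_deriv_decomp, simp)
  with d show ?thesis by (simp add: has_field_derivative_def)
qed

lemma cont_comp: "continuous_on T g \<Longrightarrow> continuous_on T (\<lambda>z. dir_deriv \<beta> v (g z))"
  by (rule continuous_on_compose2[OF Ck1_continuous_dir_deriv[OF \<beta>, of UNIV]]) auto

lemma cont_comp0: "continuous_on T g \<Longrightarrow> continuous_on T (\<lambda>z. \<beta> (g z))"
  by (rule continuous_on_compose2[OF Ck1_continuous[OF \<beta>, of UNIV]]) auto

text \<open>The fundamental theorem of calculus along vertical segments.\<close>

lemma region_integral_vertical:
  "(LINT z:M|lborel. dir_deriv \<beta> (0, -1) z) = (LINT x:D|lborel. \<beta> (x, u x) - \<beta> (x, 0))"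
proof -
  have z0: "dir_deriv \<beta> (0, 0) z = 0" for z using dir_deriv_decomp[where v=0 and t=1 and z=z] by simp
  have "(LINT s:{0..1}|lborel. - u x * dir_deriv \<beta> (0, -1) (x, s * u x)) = \<beta> (x, u x) - \<beta> (x, 0)" for x
  proof -
    have "- u x * dir_deriv \<beta> (0, -1) (x, s * u x) = u x * dir_deriv \<beta> (0, 1) (x, s * u x)" for s
      by (subst dir_deriv_decomp) (simp add: z0)
    moreover have "(LINT s:{0..1}|lborel. u x * dir_deriv \<beta> (0, 1) (x, s * u x)) = \<beta> (x, 1 * u x) - \<beta> (x, 0 * u x)"
      by (rule line_FTC[OF vertical_deriv]) (intro continuous_intros cont_comp)
    ultimately show ?thesis by simp
  qed
  then show ?thesis
    by (simp add: region_integral[OF Ck1_continuous_dir_deriv[OF \<beta>]])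
qed

text \<open>For fixed \<open>s\<close> the function \<open>x \<mapsto> u x * \<beta> (x, s * u x)\<close> vanishes on the boundary of \<open>D\<close>, so its
  derivative integrates to \<open>0\<close>.\<close>

lemma region_integral_horizontal:
  "(LINT z:M|lborel. dir_deriv \<beta> (axis j 1, 0) z) = (LINT x:D|lborel. partial j u x * \<beta> (x, u x))"
proof -
  let ?bj = "\<lambda>x s. dir_deriv \<beta> (axis j 1, 0) (x, s * u x)"
  let ?bt = "\<lambda>x s. dir_deriv \<beta> (0, 1) (x, s * u x)"
  have inner: "(LINT x:D|lborel. - u x * ?bj x s) = (LINT x:D|lborel. partial j u x * (\<beta> (x, s * u x) + s * (u x * ?bt x s)))" for s
  proof -
    define g where "g x = u x * \<beta> (x, s * u x)" for x
    have dg: "(g has_derivative (\<lambda>v. u x * (dir_deriv \<beta> (v, 0) (x, s * u x) + s * (grad u x \<bullet> v) * ?bt x s) + (grad u x \<bullet> v) * \<beta> (x, s * u x))) (at x)" for x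
    proof -
      have "((\<lambda>x. (x, s * u x)) has_derivative (\<lambda>v. (v, s * (grad u x \<bullet> v)))) (at x)"
        by (intro has_derivative_Pair has_derivative_ident has_derivative_mult_right u_has_derivative)
      from has_derivative_compose[OF this Ck1_has_derivative[OF \<beta>]]
      have "((\<lambda>x. \<beta> (x, s * u x)) has_derivative (\<lambda>v. dir_deriv \<beta> (v, s * (grad u x \<bullet> v)) (x, s * u x))) (at x)" .
      from has_derivative_mult[OF u_has_derivative this] show ?thesis
        unfolding g_def[abs_def] by (subst (asm) dir_deriv_decomp)
    qed
    have cu: "continuous_on UNIV u" by (rule u_cont)
    have g1: "Ck 1 g"
      by (rule Ck1I[OF dg]) (intro continuous_intros cu cont_comp cont_comp0 grad_cont)
    have "0 = (LINT x:D|lebesgue. dir_deriv g (axis j 1) x)"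
      by (rule integral_dir_deriv_zero[OF g1 D, symmetric]) (simp add: g_def u_frontier)
    also have "\<dots> = (LINT x:D|lborel. dir_deriv g (axis j 1) x)"
      by (rule LINT_lebesgue_lborel[OF D(1) Ck1_continuous_dir_deriv[OF g1]])
    also have "\<dots> = (LINT x:D|lborel. partial j u x * (\<beta> (x, s * u x) + s * (u x * ?bt x s)) - (- u x * ?bj x s))"
      by (simp add: dir_deriv_eqI[OF dg] grad_def inner_axis algebra_simps)
    also have "\<dots> = (LINT x:D|lborel. partial j u x * (\<beta> (x, s * u x) + s * (u x * ?bt x s))) - (LINT x:D|lborel. - u x * ?bj x s)"
      by (intro set_integral_diff; unfold set_integrable_def; rule borel_integrable_compact[OF D(1)];
          intro continuous_intros cont_partial cont_comp cont_comp0 u_cont)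
    finally show ?thesis by simp
  qed
  have "(LINT z:M|lborel. dir_deriv \<beta> (axis j 1, 0) z) = (LINT x:D|lborel. LINT s:{0..1}|lborel. - u x * ?bj x s)"
    by (rule region_integral[OF Ck1_continuous_dir_deriv[OF \<beta>]])
  also have "\<dots> = (LINT s:{0..1}|lborel. LINT x:D|lborel. - u x * ?bj x s)"
    by (rule swap_integral) (intro continuous_intros cont_ufst cont_comp)
  also have "\<dots> = (LINT s:{0..1}|lborel. LINT x:D|lborel. partial j u x * (\<beta> (x, s * u x) + s * (u x * ?bt x s)))"
    unfolding inner ..
  also have "\<dots> = (LINT x:D|lborel. LINT s:{0..1}|lborel. partial j u x * (\<beta> (x, s * u x) + s * (u x * ?bt x s)))"
    by (rule swap_integral[symmetric]) (intro continuous_intros cont_ufst cont_partial_fst cont_comp cont_comp0)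
  also have "\<dots> = (LINT x:D|lborel. partial j u x * \<beta> (x, u x))"
  proof -
    \<comment> \<open>Up to the factor \<open>partial j u x\<close>, the integrand is the derivative
      of \<open>s * \<beta> (x, s * u x)\<close> in \<open>s\<close>.\<close>
    have "(LINT s:{0..1}|lborel. partial j u x * (\<beta> (x, s * u x) + s * (u x * ?bt x s))) = partial j u x * \<beta> (x, u x)" for x
    proof -
      have "((\<lambda>s. partial j u x * (s * \<beta> (x, s * u x))) has_real_derivative partial j u x * (\<beta> (x, s * u x) + s * (u x * ?bt x s))) (at s)" for s
        by (auto intro!: derivative_eq_intros vertical_deriv)
      from line_FTC[OF this] show ?thesis by (simp add: continuous_intros cont_comp cont_comp0)
    qed
    then show ?thesis by (simp only:)
  qed
  finally show ?thesis .
qed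

end

text \<open>The graph is the lower boundary of the region. The leading \<open>-1\<close> orients the
  region so that its boundary is the graph minus the zero section.\<close>

definition frame :: "vec4 list" where
  "frame = [(0, -1), (axis 1 1, 0), (axis 2 1, 0), (axis 3 1, 0)]"

lemma orthonormal_frame: "orthonormal_list frame"
  by (simp add: frame_def orthonormal_list_def All_less_Suc inner_axis_axis UNIV_3_distinct)

lemma map_frame: "map (\<lambda>i. frame ! i) [0..<4] = frame"
proof -
  have "length frame = 4" by (simp add: frame_def)
  then show ?thesis using map_nth[of frame] by simp
qed

definition fill :: current where
  "fill \<omega> = (LINT z:M|lborel. \<omega> (cover a z) frame)"

text \<open>The approximate tangent space of an open set is the whole space at every point, so a
  constant orthonormal frame orients it.\<close>

lemma fill_rectifiable: "rectifiable_current a (torus a \<times> UNIV) 4 fill"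
  unfolding rectifiable_current_def hausdorff_measure_vec4
proof (rule exI[of _ M], rule exI[of _ "\<lambda>_. 1"], rule exI[of _ "\<lambda>i _. frame ! i"], intro conjI ballI allI impI)
  show "M \<in> sets borel" using open_M by simp
  show "cover a ` M \<subseteq> torus a \<times> UNIV" by (auto simp: cover_def torus_def)
  show "inj_on (cover a) M"
  proof (rule inj_onI)
    fix z z' assume z: "z \<in> M" "z' \<in> M" "cover a z = cover a z'"
    then have m: "fst z \<in> interior D" "fst z' \<in> interior D" "proj a (fst z) = proj a (fst z')"
      unfolding M_def cover_def by auto
    have "inj_on (proj a) (interior D)" unfolding D_def by (rule proj_inj_interior) (use det in simp)
    then have "fst z = fst z'" using m(3,1,2) by (rule inj_onD)
    then show "z = z'" using z(3) by (simp add: cover_def prod_eq_iff)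
  qed
  show "countably_rectifiable 4 M"
    unfolding countably_rectifiable_def
    by (rule exI[of _ UNIV], rule exI[of _ "{}"], rule exI[of _ "\<lambda>_ z. z"])
      (auto simp: hausdorff_outer_empty dim_UNIV intro!: exI[of _ 1] lipschitz_intros)
  show "set_integrable lborel M (\<lambda>z. real 1)" by (intro M_integrable continuous_intros)
  show "AE z in lborel. z \<in> M \<longrightarrow> (\<exists>V. has_approx_tangent 4 M z V \<and> (\<forall>i<4. frame ! i \<in> V)
      \<and> orthonormal_list (map (\<lambda>i. frame ! i) [0..<4]))"
  proof (intro AE_I2 impI exI[of _ UNIV] conjI)
    show "orthonormal_list (map (\<lambda>i. frame ! i) [0..<4])"
      by (simp add: map_frame orthonormal_frame)
  qed (auto intro: approx_tangent_open[OF open_M])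
  show "fill \<omega> = (LINT z:M|lborel. real 1 * \<omega> (cover a z) (map (\<lambda>i. frame ! i) [0..<4]))" for \<omega>
    by (simp add: fill_def map_frame)
qed auto

section \<open>Stokes' formula for the filling current\<close>

lemma test_form_Ck1:
  assumes "\<omega> \<in> test_forms a W k" "length vs = k" shows "Ck 1 (\<lambda>z. \<omega> (cover a z) vs)"
  using assms by (auto simp: test_forms_def)

lemma test_form_alternating:
  assumes "\<omega> \<in> test_forms a W k" shows "alternating k (\<omega> (cover a z))"
  using assms unfolding test_forms_def by blast

lemma graph_point: "(proj a x, f (proj a x)) = cover a (x, u x)"
  by (simp add: cover_def u_def)

lemma zero_point: "(proj a x, 0) = cover a (x, 0)"
  by (simp add: cover_def)

context
  fixes \<omega> assumes \<omega>: "\<omega> \<in> test_forms a (torus a \<times> UNIV) 3"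
begin

text \<open>\<open>\<eta>0\<close> to \<open>\<eta>3\<close> are the coefficients of
  \<open>\<omega>\<close> on \<open>frame\<close> with the entry of that index deleted, which are
  the functions differentiated by \<open>ext_deriv\<close> on \<open>frame\<close>.\<close>

definition "\<eta>0 z = \<omega> (cover a z) [(axis 1 1, 0), (axis 2 1, 0), (axis 3 1, 0)]"
definition "\<eta>1 z = \<omega> (cover a z) [(0, -1), (axis 2 1, 0), (axis 3 1, 0)]"
definition "\<eta>2 z = \<omega> (cover a z) [(0, -1), (axis 1 1, 0), (axis 3 1, 0)]"
definition "\<eta>3 z = \<omega> (cover a z) [(0, -1), (axis 1 1, 0), (axis 2 1, 0)]"

lemma \<eta>_Ck1: "Ck 1 \<eta>0" "Ck 1 \<eta>1" "Ck 1 \<eta>2" "Ck 1 \<eta>3"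
  unfolding \<eta>0_def[abs_def] \<eta>1_def[abs_def] \<eta>2_def[abs_def] \<eta>3_def[abs_def]
  by (rule test_form_Ck1[OF \<omega>], simp)+

lemma graph_current_expand:
  "graph_current a f \<omega> = (LINT x:D|lborel. \<eta>0 (x, u x) - partial 1 u x * \<eta>1 (x, u x) + partial 2 u x * \<eta>2 (x, u x) - partial 3 u x * \<eta>3 (x, u x))"
proof -
  have c: "continuous_on D (\<lambda>x. \<eta>0 (x, u x) - partial 1 u x * \<eta>1 (x, u x) + partial 2 u x * \<eta>2 (x, u x) - partial 3 u x * \<eta>3 (x, u x))"
    by (intro continuous_intros cont_partial u_cont cont_comp0[OF \<eta>_Ck1(1)] cont_comp0[OF \<eta>_Ck1(2)] cont_comp0[OF \<eta>_Ck1(3)] cont_comp0[OF \<eta>_Ck1(4)])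
  have pt: "\<omega> (cover a (x, u x)) [(axis 1 1, partial 1 u x), (axis 2 1, partial 2 u x), (axis 3 1, partial 3 u x)]
    = \<eta>0 (x, u x) - partial 1 u x * \<eta>1 (x, u x) + partial 2 u x * \<eta>2 (x, u x) - partial 3 u x * \<eta>3 (x, u x)" for x
    unfolding \<eta>0_def \<eta>1_def \<eta>2_def \<eta>3_def
    by (rule alternating_graph_expansion[OF test_form_alternating[OF \<omega>]])
  have "graph_current a f \<omega> = (LINT x:D|lebesgue. \<eta>0 (x, u x) - partial 1 u x * \<eta>1 (x, u x) + partial 2 u x * \<eta>2 (x, u x) - partial 3 u x * \<eta>3 (x, u x))"
    unfolding graph_current_def D_def[symmetric] u_def[symmetric] graph_point list.map pt ..
  also have "\<dots> = (LINT x:D|lborel. \<eta>0 (x, u x) - partial 1 u x * \<eta>1 (x, u x) + partial 2 u x * \<eta>2 (x, u x) - partial 3 u x * \<eta>3 (x, u x))"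
    by (rule LINT_lebesgue_lborel[OF D(1) c])
  finally show ?thesis .
qed

lemma zero_current_expand: "graph_current a (\<lambda>_. 0) \<omega> = (LINT x:D|lborel. \<eta>0 (x, 0))"
proof -
  have z: "(\<lambda>_. 0) \<circ> proj a = (\<lambda>x. 0::real)" by (simp add: fun_eq_iff)
  have "graph_current a (\<lambda>_. 0) \<omega> = (LINT x:D|lebesgue. \<eta>0 (x, 0))"
    unfolding graph_current_def D_def[symmetric] z zero_point list.map partial_const \<eta>0_def ..
  also have "\<dots> = (LINT x:D|lborel. \<eta>0 (x, 0))"
    by (rule LINT_lebesgue_lborel[OF D(1)]) (intro cont_comp0[OF \<eta>_Ck1(1)] continuous_intros)
  finally show ?thesis .
qed

lemma ext_deriv_frame:
  "ext_deriv a \<omega> (cover a z) frame = dir_deriv \<eta>0 (0, -1) z - dir_deriv \<eta>1 (axis 1 1, 0) z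
    + dir_deriv \<eta>2 (axis 2 1, 0) z - dir_deriv \<eta>3 (axis 3 1, 0) z"
proof -
  have d: "dir_deriv (\<lambda>z. \<omega> (cover a z) vs) v (inv (cover a) (cover a z)) = dir_deriv (\<lambda>z. \<omega> (cover a z) vs) v z" if "length vs = 3" for vs v
    by (rule dir_deriv_cover) (rule differentiableI[OF Ck1_has_derivative[OF test_form_Ck1[OF \<omega> that]]])
  show ?thesis
    unfolding ext_deriv_def frame_def \<eta>0_def[abs_def] \<eta>1_def[abs_def] \<eta>2_def[abs_def] \<eta>3_def[abs_def]
    by (simp add: d lessThan_Suc)
qed

text \<open>The vertical derivative yields both graphs, and the horizontal derivatives yield exactly
  the slope terms of the graph current. The sides of the region contribute nothing because
  \<open>u\<close> vanishes on the frontier of \<open>D\<close>.\<close>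

lemma boundary_fill: "boundary a fill \<omega> = graph_current a f \<omega> - graph_current a (\<lambda>_. 0) \<omega>"
proof -
  have i: "set_integrable lborel M (dir_deriv \<beta> v)" if "Ck 1 \<beta>" for \<beta> :: "vec4 \<Rightarrow> real" and v
    by (rule M_integrable[OF Ck1_continuous_dir_deriv[OF that]])
  have j: "set_integrable lborel D g" if "continuous_on D g" for g :: "real^3 \<Rightarrow> real"
    unfolding set_integrable_def by (rule borel_integrable_compact[OF D(1) that])
  have c: "continuous_on D (\<lambda>x. \<beta> (x, u x))" "continuous_on D (\<lambda>x. \<beta> (x, 0))" if "Ck 1 \<beta>" for \<beta> :: "vec4 \<Rightarrow> real"
    by (intro cont_comp0[OF that] continuous_intros u_cont)+
  have "boundary a fill \<omega> = (LINT z:M|lborel. dir_deriv \<eta>0 (0, -1) z - dir_deriv \<eta>1 (axis 1 1, 0) z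
    + dir_deriv \<eta>2 (axis 2 1, 0) z - dir_deriv \<eta>3 (axis 3 1, 0) z)"
    by (simp add: boundary_def fill_def ext_deriv_frame)
  also have "\<dots> = (LINT z:M|lborel. dir_deriv \<eta>0 (0, -1) z) - (LINT z:M|lborel. dir_deriv \<eta>1 (axis 1 1, 0) z)
    + (LINT z:M|lborel. dir_deriv \<eta>2 (axis 2 1, 0) z) - (LINT z:M|lborel. dir_deriv \<eta>3 (axis 3 1, 0) z)"
    using i \<eta>_Ck1 by simp
  also have "\<dots> = (LINT x:D|lborel. \<eta>0 (x, u x) - \<eta>0 (x, 0)) - (LINT x:D|lborel. partial 1 u x * \<eta>1 (x, u x))
    + (LINT x:D|lborel. partial 2 u x * \<eta>2 (x, u x)) - (LINT x:D|lborel. partial 3 u x * \<eta>3 (x, u x))"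
    by (simp only: region_integral_vertical[OF \<eta>_Ck1(1)] region_integral_horizontal[OF \<eta>_Ck1(2)]
        region_integral_horizontal[OF \<eta>_Ck1(3)] region_integral_horizontal[OF \<eta>_Ck1(4)])
  also have "\<dots> = graph_current a f \<omega> - graph_current a (\<lambda>_. 0) \<omega>"
    unfolding graph_current_expand zero_current_expand
    using \<eta>_Ck1 by (simp add: j c continuous_on_mult cont_partial continuous_on_add continuous_on_diff)
  finally show ?thesis .
qed

text \<open>An integral current must have a boundary of finite mass, for which a crude bound is
  enough. The 2 counts the two occurrences of \<open>\<eta>0\<close>.\<close>

lemma boundary_fill_le:
  assumes "comass_le_1 a 3 \<omega>"
  shows "\<bar>boundary a fill \<omega>\<bar> \<le> (LINT x:D|lborel. 2 + \<bar>partial 1 u x\<bar> + \<bar>partial 2 u x\<bar> + \<bar>partial 3 u x\<bar>)"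
proof -
  have b: "\<bar>\<eta>0 z\<bar> \<le> 1" "\<bar>\<eta>1 z\<bar> \<le> 1" "\<bar>\<eta>2 z\<bar> \<le> 1" "\<bar>\<eta>3 z\<bar> \<le> 1" for z
    unfolding \<eta>0_def \<eta>1_def \<eta>2_def \<eta>3_def
    by (rule assms[unfolded comass_le_1_def, rule_format],
        simp add: orthonormal_list_def All_less_Suc inner_axis_axis UNIV_3_distinct)+
  have j: "set_integrable lborel D g" if "continuous_on D g" for g :: "real^3 \<Rightarrow> real"
    unfolding set_integrable_def by (rule borel_integrable_compact[OF D(1) that])
  define G where "G x = \<eta>0 (x, u x) - partial 1 u x * \<eta>1 (x, u x) + partial 2 u x * \<eta>2 (x, u x) - partial 3 u x * \<eta>3 (x, u x) - \<eta>0 (x, 0)" for x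
  have cG: "continuous_on D G"
    unfolding G_def[abs_def]
    by (intro continuous_intros cont_partial u_cont cont_comp0[OF \<eta>_Ck1(1)] cont_comp0[OF \<eta>_Ck1(2)] cont_comp0[OF \<eta>_Ck1(3)] cont_comp0[OF \<eta>_Ck1(4)])
  have "boundary a fill \<omega> = (LINT x:D|lborel. G x)"
    unfolding boundary_fill graph_current_expand zero_current_expand G_def
    by (rule set_integral_diff(2)[symmetric]; rule j)
      (intro continuous_intros cont_partial u_cont cont_comp0[OF \<eta>_Ck1(1)] cont_comp0[OF \<eta>_Ck1(2)] cont_comp0[OF \<eta>_Ck1(3)] cont_comp0[OF \<eta>_Ck1(4)])+
  also have "\<bar>\<dots>\<bar> \<le> (LINT x:D|lborel. \<bar>G x\<bar>)"
    unfolding set_lebesgue_integral_def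
    using integral_norm_bound[of lborel "\<lambda>x. indicator D x *\<^sub>R G x"] by (simp add: abs_mult)
  also have "\<dots> \<le> (LINT x:D|lborel. 2 + \<bar>partial 1 u x\<bar> + \<bar>partial 2 u x\<bar> + \<bar>partial 3 u x\<bar>)"
  proof (rule set_integral_mono)
    fix x
    have tri: "\<bar>a - c1 + c2 - c3 - b\<bar> \<le> 2 + d1 + d2 + d3"
      if "\<bar>a\<bar> \<le> 1" "\<bar>b\<bar> \<le> 1" "\<bar>c1\<bar> \<le> d1" "\<bar>c2\<bar> \<le> d2" "\<bar>c3\<bar> \<le> d3" for a b c1 c2 c3 d1 d2 d3 :: real
      using that unfolding abs_le_iff by linarith
    have m: "\<bar>p * e\<bar> \<le> \<bar>p\<bar>" if "\<bar>e\<bar> \<le> 1" for p e :: real using mult_left_mono[OF that, of "\<bar>p\<bar>"] by (simp add: abs_mult)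
    show "\<bar>G x\<bar> \<le> 2 + \<bar>partial 1 u x\<bar> + \<bar>partial 2 u x\<bar> + \<bar>partial 3 u x\<bar>"
      unfolding G_def by (rule tri[OF b(1) b(1) m[OF b(2)] m[OF b(3)] m[OF b(4)]])
  qed (intro j continuous_intros cG cont_partial)+
  finally show ?thesis .
qed

end

lemma fill_mass: "mass a (torus a \<times> UNIV) 4 fill \<le> ennreal (LINT x:D|lborel. - u x)"
  unfolding mass_def
proof (rule SUP_least, clarify, rule ennreal_leI)
  fix \<omega> assume \<omega>: "\<omega> \<in> test_forms a (torus a \<times> UNIV) 4" "comass_le_1 a 4 \<omega>"
  have c: "continuous_on UNIV (\<lambda>z. \<omega> (cover a z) frame)"
    by (rule Ck1_continuous[OF test_form_Ck1[OF \<omega>(1)]]) (simp add: frame_def)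
  have b: "\<bar>\<omega> (cover a z) frame\<bar> \<le> 1" for z
    by (rule \<omega>(2)[unfolded comass_le_1_def, rule_format])
      (simp add: orthonormal_frame, simp add: frame_def)
  have "\<bar>fill \<omega>\<bar> \<le> (LINT z:M|lborel. \<bar>\<omega> (cover a z) frame\<bar>)"
    unfolding fill_def set_lebesgue_integral_def
    using integral_norm_bound[of lborel "\<lambda>z. indicator M z *\<^sub>R \<omega> (cover a z) frame"] by (simp add: abs_mult)
  also have "\<dots> \<le> (LINT z:M|lborel. 1)"
    by (rule set_integral_mono) (intro M_integrable continuous_intros c b)+
  also have "\<dots> = (LINT x:D|lborel. LINT s:{0..1::real}|lborel. - u x * 1)"
    by (rule region_integral[of "\<lambda>_. 1"]) (intro continuous_intros)
  also have "\<dots> = (LINT x:D|lborel. - u x)" by (simp add: set_lebesgue_integral_def)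
  finally show "\<bar>fill \<omega>\<bar> \<le> (LINT x:D|lborel. - u x)" .
qed

text \<open>The decomposition \<open>A = 0\<close>, \<open>B = fill\<close>.\<close>

lemma flat_distance_le:
  "flat_distance a (torus a \<times> UNIV) (graph_current a f) (graph_current a (\<lambda>_. 0)) \<le> ennreal (LINT x:D|lborel. - u x)"
proof -
  let ?W = "torus a \<times> (UNIV :: real set)"
  have "mass a ?W (4 - 1) (boundary a fill) \<le> ennreal (LINT x:D|lborel. 2 + \<bar>partial 1 u x\<bar> + \<bar>partial 2 u x\<bar> + \<bar>partial 3 u x\<bar>)"
    unfolding mass_def
    by (rule SUP_least, clarify, rule ennreal_leI, rule boundary_fill_le) simp_all
  then have "mass a ?W (4 - 1) (boundary a fill) < \<infinity>" by (rule le_less_trans) simp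
  moreover have "mass a ?W 4 fill < \<infinity>" by (rule le_less_trans[OF fill_mass]) simp
  ultimately have fill: "integral_current a ?W 4 fill"
    using fill_rectifiable by (simp add: integral_current_def)
  have zero: "integral_current a ?W 3 (\<lambda>_. 0)" "mass a ?W 3 (\<lambda>_. 0) = 0"
    by (rule zero_integral_current; simp)+
  have "flat_distance a ?W (graph_current a f) (graph_current a (\<lambda>_. 0)) \<le> mass a ?W 3 (\<lambda>_. 0) + mass a ?W 4 fill"
    unfolding flat_distance_def
    by (rule INF_lower2[of "((\<lambda>_. 0), fill)"]) (use fill zero boundary_fill in auto)
  also have "\<dots> = mass a ?W 4 fill" by (simp add: zero)
  also note fill_mass
  finally show ?thesis .
qed

end

section \<open>Convergence\<close>

context well begin

text \<open>Integration by parts against the position field, whose divergence is 3.\<close>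

lemma integral_le_gradient:
  assumes \<rho>: "\<And>x. x \<in> D \<Longrightarrow> norm x \<le> \<rho>"
  shows "(LINT x:D|lborel. - u x) \<le> \<rho> / 3 * (LINT x:D|lebesgue. norm (grad u x))"
proof -
  have "(LINT x:D|lebesgue. u x * divergence (\<lambda>x. x) x) = - (LINT x:D|lebesgue. 1 * (grad u x \<bullet> x))"
    by (rule integral_profile_divergence[where \<phi>="\<lambda>t. t" and \<phi>'="\<lambda>_. 1"])
      (auto intro!: derivative_eq_intros Ck1_ident)
  then have "3 * (LINT x:D|lebesgue. - u x) = (LINT x:D|lebesgue. grad u x \<bullet> x)"
    by (simp add: divergence_ident set_lebesgue_integral_def mult.commute[of _ 3])
  also have "\<dots> \<le> (LINT x:D|lebesgue. \<rho> * norm (grad u x))"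
  proof (rule set_integral_mono)
    fix x assume x: "x \<in> D"
    have "grad u x \<bullet> x \<le> norm (grad u x) * norm x" by (rule norm_cauchy_schwarz)
    also have "\<dots> \<le> norm (grad u x) * \<rho>" by (intro mult_left_mono \<rho> x) auto
    finally show "grad u x \<bullet> x \<le> \<rho> * norm (grad u x)" by (simp add: mult.commute)
  qed (intro continuous_on_D_integrable continuous_intros grad_cont)+
  finally have "3 * (LINT x:D|lebesgue. - u x) \<le> \<rho> * (LINT x:D|lebesgue. norm (grad u x))" by simp
  moreover have "(LINT x:D|lborel. - u x) = (LINT x:D|lebesgue. - u x)"
    by (rule LINT_lebesgue_lborel[OF D(1), symmetric]) (intro continuous_intros u_cont)
  ultimately show ?thesis by simp
qed

lemma area_excess_le_gradient:
  "\<bar>(LINT x:D|lebesgue. sqrt (1 + (norm (grad u x))\<^sup>2)) - (LINT x:D|lebesgue. 1)\<bar> \<le> (LINT x:D|lebesgue. norm (grad u x))"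
proof -
  have c: "continuous_on D (\<lambda>x. sqrt (1 + (norm (grad u x))\<^sup>2))" by (intro continuous_intros grad_cont)
  have eq: "(LINT x:D|lebesgue. sqrt (1 + (norm (grad u x))\<^sup>2)) - (LINT x:D|lebesgue. 1) = (LINT x:D|lebesgue. sqrt (1 + (norm (grad u x))\<^sup>2) - 1)"
    by (rule set_integral_diff(2)[symmetric]; intro continuous_on_D_integrable c continuous_intros)
  have b: "0 \<le> sqrt (1 + s\<^sup>2) - 1" "sqrt (1 + s\<^sup>2) - 1 \<le> s" if "s \<ge> 0" for s :: real
  proof -
    show "0 \<le> sqrt (1 + s\<^sup>2) - 1" by simp
    have "sqrt (1 + s\<^sup>2) \<le> 1 + s" using that by (intro real_le_lsqrt) (auto simp: power2_eq_square algebra_simps)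
    then show "sqrt (1 + s\<^sup>2) - 1 \<le> s" by simp
  qed
  have "(LINT x:D|lebesgue. 0) \<le> (LINT x:D|lebesgue. sqrt (1 + (norm (grad u x))\<^sup>2) - 1)"
    by (rule set_integral_mono) (intro continuous_on_D_integrable continuous_intros grad_cont | rule b(1)[OF norm_ge_zero])+
  moreover have "(LINT x:D|lebesgue. sqrt (1 + (norm (grad u x))\<^sup>2) - 1) \<le> (LINT x:D|lebesgue. norm (grad u x))"
    by (rule set_integral_mono) (intro continuous_on_D_integrable continuous_intros grad_cont | rule b(2)[OF norm_ge_zero])+
  ultimately show ?thesis unfolding eq by (simp add: set_lebesgue_integral_def)
qed

end

text \<open>Periodicity is checked for \<open>flux\<close>, whose divergence is
  \<open>scal\<close>.\<close>

lemma (in C4_function) scal_periodic: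
  assumes "\<And>x. u (x + v) = u x" shows "scal (x + v) = scal x"
proof -
  have shift: "partial i g (x + v) = partial i g x" if "Ck 1 g" "\<And>x. g (x + v) = g x" for g i x
    unfolding partial_def by (rule dir_deriv_shift[OF that(2) differentiableI[OF Ck1_has_derivative[OF that(1)]]])
  have p1: "d1 i (x + v) = d1 i x" for i x unfolding d1_def by (rule shift[OF C1_u assms])
  have p2: "d2 i j (x + v) = d2 i j x" for i j x unfolding d2_def by (rule shift[OF C1_d1 p1])
  have fl: "flux (x + v) = flux x" for x
    unfolding flux_def by (simp add: q_def slope2_def lap_def hessgrad_def p1 p2)
  have "dir_deriv flux w (x + v) = dir_deriv flux w x" for w
    by (rule dir_deriv_shift[OF fl differentiableI[OF Ck1_has_derivative[OF C1_flux]]])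
  then show ?thesis by (simp add: divergence_flux[symmetric] divergence_def)
qed

text \<open>The determinant of the identity plus a rank one matrix \<open>v v^T\<close> is
  \<open>1 + |v|^2\<close>.\<close>

lemma (in C4_function) det_graph_metric:
  assumes "u = f \<circ> proj a" shows "det (graph_metric a f x) = 1 + (norm (grad u x))\<^sup>2"
proof -
  have "(norm (grad u x))\<^sup>2 = (\<Sum>i\<in>UNIV. (partial i u x)\<^sup>2)"
    using slope2_eq[of x] by (simp add: slope2_def d1_def)
  then show ?thesis
    by (simp add: det_3 graph_metric_def flat_metric_def mat_def assms[symmetric] sum_3 UNIV_3_distinct)
      (simp add: algebra_simps power2_eq_square)
qed

locale class_G_torus =
  fixes a :: "real^3^3" and f :: "(real^3) set \<Rightarrow> real"
  assumes tor: "flat_torus a" and G: "f \<in> class_G a"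
begin

definition u where "u = f \<circ> proj a"

lemma det: "det a > 0"
  using tor by (simp add: flat_torus_def)

lemma G_facts:
  "Ck 4 u" "f (proj a x) \<le> 0" "x \<in> frontier (fund_domain a) \<Longrightarrow> u x = 0"
  "AE h in lborel. h \<in> f ` torus a \<longrightarrow> (\<forall>x. u x = h \<longrightarrow> (\<exists>H. has_mean_curvature_vector {y. u y = h} x H
     \<and> H \<bullet> (- (1 / norm (grad u x)) *\<^sub>R grad u x) > 0))"
  "AE h in lborel. h \<in> f ` torus a \<longrightarrow> outer_minimizing {x \<in> fund_domain a. u x < h}"
proof -
  have *: "Ck 4 u \<and> (\<exists>q\<in>torus a. f q = 0) \<and> (\<forall>q\<in>torus a. f q \<le> 0) \<and> (\<forall>x\<in>frontier (fund_domain a). u x = 0)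
    \<and> (AE h in lborel. h \<in> f ` torus a \<longrightarrow> (\<forall>x. u x = h \<longrightarrow> (\<exists>H. has_mean_curvature_vector {y. u y = h} x H
     \<and> H \<bullet> (- (1 / norm (grad u x)) *\<^sub>R grad u x) > 0)))
    \<and> (AE h in lborel. h \<in> f ` torus a \<longrightarrow> outer_minimizing {x \<in> fund_domain a. u x < h})"
    using G unfolding class_G_def Let_def u_def[symmetric] mem_Collect_eq .
  show "Ck 4 u" using * by (rule conjunct1)
  show "f (proj a x) \<le> 0" using *[THEN conjunct2, THEN conjunct2, THEN conjunct1] by (simp add: torus_def)
  show "x \<in> frontier (fund_domain a) \<Longrightarrow> u x = 0"
    using *[THEN conjunct2, THEN conjunct2, THEN conjunct2, THEN conjunct1] by simp
  show "AE h in lborel. h \<in> f ` torus a \<longrightarrow> (\<forall>x. u x = h \<longrightarrow> (\<exists>H. has_mean_curvature_vector {y. u y = h} x H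
     \<and> H \<bullet> (- (1 / norm (grad u x)) *\<^sub>R grad u x) > 0))"
    by (rule *[THEN conjunct2, THEN conjunct2, THEN conjunct2, THEN conjunct2, THEN conjunct1])
  show "AE h in lborel. h \<in> f ` torus a \<longrightarrow> outer_minimizing {x \<in> fund_domain a. u x < h}"
    by (rule *[THEN conjunct2, THEN conjunct2, THEN conjunct2, THEN conjunct2, THEN conjunct2])
qed

sublocale graph_torus u "fund_domain a" a f
proof (intro graph_torus.intro well.intro well_axioms.intro graph_torus_axioms.intro C4_function.intro)
  show "u x \<le> 0" for x using G_facts(2)[of x] by (simp add: u_def)
qed (use G_facts det fund_domain_compact fund_domain_convex u_def in auto)

lemma u_image: "u x \<in> f ` torus a"
  by (simp add: u_def torus_def)

lemma AE_positive: "AE h in lborel. h \<in> u ` fund_domain a \<longrightarrow> h < 0 \<longrightarrow> (\<forall>x\<in>fund_domain a. u x = h \<longrightarrow> mcnum x > 0)"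
  using G_facts(4)
proof eventually_elim
  case (elim h)
  show ?case
  proof (intro impI ballI)
    fix x assume x: "u x = h"
    then have "h \<in> f ` torus a" using u_image by blast
    then obtain H where "has_mean_curvature_vector {y. u y = h} x H" "H \<bullet> (- (1 / norm (grad u x)) *\<^sub>R grad u x) > 0"
      using elim x by blast
    then show "mcnum x > 0" by (rule mean_curvature_pos(2))
  qed
qed

lemma AE_good: "AE h in lborel. h \<in> u ` fund_domain a \<longrightarrow> h < 0 \<longrightarrow> good h"
  using G_facts(4,5)
proof eventually_elim
  case (elim h)
  show ?case
  proof (intro impI)
    assume h: "h \<in> u ` fund_domain a" "h < 0"
    have hf: "h \<in> f ` torus a" using h(1) u_image by blast
    have "grad u x \<noteq> 0" if ux: "u x = h" for x
    proof -
      obtain H where "has_mean_curvature_vector {y. u y = h} x H" "H \<bullet> (- (1 / norm (grad u x)) *\<^sub>R grad u x) > 0"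
        using elim(1) hf ux by blast
      then show ?thesis by (rule mean_curvature_pos(1))
    qed
    then show "good h" using elim(2) hf h by (simp add: good_def regular_def level_def sublevel_def)
  qed
qed

lemma scalar_curvature_eq: "scalar_curvature (graph_metric a f) x = scal x"
  unfolding u_def by (rule scalar_curvature_graph_metric) (use G_facts(1) u_def in simp)

text \<open>A real supremum is known to be an upper bound only of a set that is bounded above.
  Boundedness over the whole space comes from periodicity and compactness of the fundamental
  domain.\<close>

lemma scalar_curvature_le_SUP: "\<bar>scal x\<bar> \<le> (SUP x. \<bar>scalar_curvature (graph_metric a f) x\<bar>)"
proof -
  have cs: "continuous_on (fund_domain a) scal"
    using continuous_divergence[OF C1_flux] by (simp add: divergence_flux[abs_def])
  obtain B where B: "\<And>y. y \<in> fund_domain a \<Longrightarrow> \<bar>scal y\<bar> \<le> B"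
    using compact_imp_bounded[OF compact_continuous_image[OF cs fund_domain_compact]] by (auto simp: bounded_iff)
  have "\<bar>scal y\<bar> \<le> B" for y
  proof -
    obtain z where z: "z \<in> fund_domain a" "proj a z = proj a y" using fund_domain_covers[of a y] det by auto
    then have v: "y - z \<in> lattice a" using proj_eq_iff by metis
    have "u (x + (y - z)) = u x" for x
    proof -
      have "proj a (x + (y - z)) = proj a x" using v by (simp add: proj_eq_iff)
      then show ?thesis by (simp add: u_def)
    qed
    from scal_periodic[OF this, of z] have "scal y = scal z" by simp
    then show ?thesis using B[OF z(1)] by simp
  qed
  then have "bdd_above (range (\<lambda>x. \<bar>scal x\<bar>))" by (intro bdd_aboveI2)
  then show ?thesis unfolding scalar_curvature_eq by (rule cSUP_upper[OF UNIV_I])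
qed

lemma gradient_bound:
  assumes "\<And>x. x \<in> fund_domain a \<Longrightarrow> norm x \<le> \<rho>" "perimeter (fund_domain a) \<le> ennreal C0" "C0 \<ge> 0"
    and "\<tau> > 0" "\<rho>\<^sup>2 * (1 + 1 / \<tau>\<^sup>2) * (SUP x. \<bar>scalar_curvature (graph_metric a f) x\<bar>) \<le> 3"
  shows "(LINT x:fund_domain a|lebesgue. norm (grad u x)) \<le> \<rho> * \<tau> * C0"
proof -
  interpret mean_convex_well u "fund_domain a" "SUP x. \<bar>scalar_curvature (graph_metric a f) x\<bar>" \<rho> C0
    by unfold_locales
      (use fund_domain_ne mcnum_nonneg_dense[OF AE_positive] AE_good scalar_curvature_le_SUP assms in auto)
  show ?thesis by (rule gradient_integral_bound[OF assms(4,5)])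
qed

lemma volume_le: "\<bar>riem_vol a (graph_metric a f) - riem_vol a flat_metric\<bar> \<le> (LINT x:fund_domain a|lebesgue. norm (grad u x))"
  using area_excess_le_gradient
  by (simp add: riem_vol_def det_graph_metric[OF u_def] flat_metric_def)

lemma flat_distance_le_gradient:
  assumes "\<And>x. x \<in> fund_domain a \<Longrightarrow> norm x \<le> \<rho>"
  shows "flat_distance a (torus a \<times> UNIV) (graph_current a f) (graph_current a (\<lambda>_. 0))
    \<le> ennreal (\<rho> / 3 * (LINT x:fund_domain a|lebesgue. norm (grad u x)))"
  by (rule order_trans[OF flat_distance_le ennreal_leI[OF integral_le_gradient[OF assms]]])

end

theorem theorem1p3:
  fixes a :: "real^3^3" and D0 :: real and f :: "nat \<Rightarrow> (real^3) set \<Rightarrow> real"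
  assumes "flat_torus a"
    and "D0 > 0"
    and "\<And>i. f i \<in> class_G a"
    and "\<And>i. riem_diam a (graph_metric a (f i)) \<le> D0"
    and "(\<lambda>i. SUP x. \<bar>scalar_curvature (graph_metric a (f i)) x\<bar>) \<longlonglongrightarrow> 0"
  shows "\<exists>r :: nat \<Rightarrow> nat. strict_mono r
     \<and> (\<lambda>j. flat_distance a (torus a \<times> UNIV)
              (graph_current a (f (r j))) (graph_current a (\<lambda>_. 0))) \<longlonglongrightarrow> 0
     \<and> (\<lambda>j. riem_vol a (graph_metric a (f (r j)))) \<longlonglongrightarrow> riem_vol a flat_metric"
\<comment> \<open>The bounds below tend to 0 along the whole sequence, so the identity serves as the
  subsequence.\<close>
proof (intro exI[of _ "\<lambda>i. i"] conjI)
  have cg: "class_G_torus a (f i)" for i by (intro class_G_torus.intro assms)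
  obtain \<rho> where \<rho>: "\<rho> > 0" "\<And>x. x \<in> fund_domain a \<Longrightarrow> norm x \<le> \<rho>"
    using compact_imp_bounded[OF fund_domain_compact, of a] unfolding bounded_pos by blast
  obtain C0 where C0: "C0 \<ge> 0" "perimeter (fund_domain a) \<le> ennreal C0"
    by (rule perimeter_convex_finite[OF fund_domain_compact fund_domain_convex])
  define I where "I i = (LINT x:fund_domain a|lebesgue. norm (grad (f i \<circ> proj a) x))" for i
  have bound: "I i \<le> \<rho> * \<tau> * C0"
    if "\<tau> > 0" "\<rho>\<^sup>2 * (1 + 1 / \<tau>\<^sup>2) * (SUP x. \<bar>scalar_curvature (graph_metric a (f i)) x\<bar>) \<le> 3" for i \<tau>
    using class_G_torus.gradient_bound[OF cg _ C0(2,1) that] \<rho>(2) by (simp add: I_def class_G_torus.u_def[OF cg])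
  have I0: "I i \<ge> 0" for i
    unfolding I_def set_lebesgue_integral_def by (intro integral_nonneg_AE AE_I2) simp
  have I: "I \<longlonglongrightarrow> 0"
  proof (rule LIMSEQ_I)
    fix e :: real assume e: "e > 0"
    \<comment> \<open>The \<open>+ 1\<close> keeps the denominator positive when
      \<open>C0 = 0\<close> and makes the resulting bound strictly smaller than
      \<open>e\<close>.\<close>
    define \<tau> where "\<tau> = e / (\<rho> * C0 + 1)"
    have p: "\<rho> * C0 + 1 > 0" using \<rho> C0 by (simp add: add_nonneg_pos)
    have \<tau>: "\<tau> > 0" using e p by (simp add: \<tau>_def)
    have "\<rho> * \<tau> * C0 = e * (\<rho> * C0 / (\<rho> * C0 + 1))" by (simp add: \<tau>_def)
    also have "\<dots> < e * 1" using e p by (intro mult_strict_left_mono) auto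
    finally have small: "\<rho> * \<tau> * C0 < e" by simp
    \<comment> \<open>With \<open>\<tau>\<close> fixed, the curvature condition of the gradient
      bound holds for all large \<open>i\<close>.\<close>
    have "(\<lambda>i. \<rho>\<^sup>2 * (1 + 1 / \<tau>\<^sup>2) * (SUP x. \<bar>scalar_curvature (graph_metric a (f i)) x\<bar>)) \<longlonglongrightarrow> \<rho>\<^sup>2 * (1 + 1 / \<tau>\<^sup>2) * 0"
      by (intro tendsto_intros assms(5))
    then have "\<forall>\<^sub>F i in sequentially. \<rho>\<^sup>2 * (1 + 1 / \<tau>\<^sup>2) * (SUP x. \<bar>scalar_curvature (graph_metric a (f i)) x\<bar>) < 3"
      by (rule order_tendstoD) simp
    then obtain N where N: "\<And>i. i \<ge> N \<Longrightarrow> \<rho>\<^sup>2 * (1 + 1 / \<tau>\<^sup>2) * (SUP x. \<bar>scalar_curvature (graph_metric a (f i)) x\<bar>) < 3"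
      by (auto simp: eventually_sequentially)
    have "norm (I i - 0) < e" if "i \<ge> N" for i
      using bound[OF \<tau> less_imp_le[OF N[OF that]]] I0[of i] small by simp
    then show "\<exists>N. \<forall>i\<ge>N. norm (I i - 0) < e" by blast
  qed
  show "strict_mono (\<lambda>i::nat. i)" by (simp add: strict_mono_def)
  have flat: "flat_distance a (torus a \<times> UNIV) (graph_current a (f i)) (graph_current a (\<lambda>_. 0)) \<le> ennreal (\<rho> / 3 * I i)" for i
    using class_G_torus.flat_distance_le_gradient[OF cg, of \<rho>] \<rho>(2) by (simp add: I_def class_G_torus.u_def[OF cg])
  have lim: "(\<lambda>i. ennreal (\<rho> / 3 * I i)) \<longlonglongrightarrow> 0"
    using tendsto_ennrealI[OF tendsto_mult_left[OF I, of "\<rho> / 3"]] by simp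
  show "(\<lambda>i. flat_distance a (torus a \<times> UNIV) (graph_current a (f i)) (graph_current a (\<lambda>_. 0))) \<longlonglongrightarrow> 0"
  proof (rule tendsto_sandwich[OF _ _ tendsto_const lim])
    show "\<forall>\<^sub>F i in sequentially. flat_distance a (torus a \<times> UNIV) (graph_current a (f i)) (graph_current a (\<lambda>_. 0)) \<le> ennreal (\<rho> / 3 * I i)"
      by (rule always_eventually) (use flat in blast)
  qed simp
  have vol: "\<bar>riem_vol a (graph_metric a (f i)) - riem_vol a flat_metric\<bar> \<le> I i" for i
    using class_G_torus.volume_le[OF cg] by (simp add: I_def class_G_torus.u_def[OF cg])
  have "(\<lambda>i. riem_vol a (graph_metric a (f i)) - riem_vol a flat_metric) \<longlonglongrightarrow> 0"
    by (rule Lim_null_comparison[OF _ I]) (use vol in simp)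
  then show "(\<lambda>i. riem_vol a (graph_metric a (f i))) \<longlonglongrightarrow> riem_vol a flat_metric"
    by (simp add: LIM_zero_iff)
qed

end
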